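(* Let ${}_RT_S$ be a Wakamatsu tilting bimodule, i.e. $T$ is a Wakamatsu tilting left $R$-module and $S=\operatorname{End}_R(T)$. If $T$ has finite projective dimension on both sides (as a left $R$-module and as a right $S$-module), then the adjunction $$T\otimes_S-:\mathbf{KT}(T_S)\rightleftarrows\mathbf{KE}({}_RT):\operatorname{Hom}_R(T,-)$$ is an equivalence of categories. Moreover, $\mathcal A_T(S)=\mathbf{KT}(T_S)$ and $\mathcal B_T(R)=\mathbf{KE}({}_RT)$.
   Context: All rings are associative with unit; modules are left modules unless otherwise specified, and $\operatorname{Mod}(R)$ is the category of left $R$-modules. For an $R$-module $M$, $\operatorname{add}_R(M)$ is the class of direct summands of finite direct sums of copies of $M$. An $R$-module $T$ is Wakamatsu tilting if: (1) $T$ has a projective resolution by finitely generated projective $R$-modules; (2) $\operatorname{Ext}_R^i(T,T)=0$ for all $i>0$; (3) there is an exact sequence $0\to R\to T_0\to T_1\to T_2\to\cdots$ with each $T_j\in\operatorname{add}_R(T)$ which remains exact after applying $\operatorname{Hom}_R(-,T)$. The ring $S=\operatorname{End}_R(T)$ uses the right-action convention $s_1s_2=s_2\circ s_1$, so $T$ is an $R$-$S$-bimodule via $ts=s(t)$. Define the full subcategories: $\mathbf{KT}(T_S)=\{M\in\operatorname{Mod}(S)\mid \operatorname{Tor}_i^S(T,M)=0 \text{ for all } i>0\}$; $\mathbf{KE}({}_RT)=\{N\in\operatorname{Mod}(R)\mid \operatorname{Ext}_R^i(T,N)=0\text{ for all } i>0\}$; the Auslander class $\mathcal A_T(S)$ of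 all $M\in\operatorname{Mod}(S)$ such that $\operatorname{Tor}_i^S(T,M)=0=\operatorname{Ext}_R^i(T,T\otimes_SM)$ for all $i>0$ and the canonical unit map $M\to\operatorname{Hom}_R(T,T\otimes_SM)$ is an isomorphism; the Bass class $\mathcal B_T(R)$ of all $N\in\operatorname{Mod}(R)$ such that $\operatorname{Ext}_R^i(T,N)=0=\operatorname{Tor}_i^S(T,\operatorname{Hom}_R(T,N))$ for all $i>0$ and the evaluation map $T\otimes_S\operatorname{Hom}_R(T,N)\to N$ is an isomorphism. *)

theory Defs
  imports "HOL-Algebra.Free_Abelian_Groups" "HOL-Algebra.AbelCoset" "HOL-Algebra.Module"
begin

section \<open>Modules over a (not necessarily commutative) ring\<close>

text \<open>
  The library's \<^locale>\<open>module\<close> requires a commutative ring of scalars.  The locale below has the same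
  axioms over an arbitrary unital ring and uses the library's record type; the fields
  \<^const>\<open>monoid.mult\<close> and \<^const>\<open>one\<close> of a module record carry no information.
\<close>

locale left_module = R?: ring R + M?: abelian_group M
  for R :: "('a, 'r) ring_scheme" (structure) and M :: "('a, 'b, 'm) module_scheme" (structure) +
  assumes smult_closed [simp, intro]:
      "\<lbrakk>a \<in> carrier R; x \<in> carrier M\<rbrakk> \<Longrightarrow> a \<odot>\<^bsub>M\<^esub> x \<in> carrier M"
    and smult_l_distr:
      "\<lbrakk>a \<in> carrier R; b \<in> carrier R; x \<in> carrier M\<rbrakk> \<Longrightarrow>
        (a \<oplus> b) \<odot>\<^bsub>M\<^esub> x = a \<odot>\<^bsub>M\<^esub> x \<oplus>\<^bsub>M\<^esub> b \<odot>\<^bsub>M\<^esub> x"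
    and smult_r_distr:
      "\<lbrakk>a \<in> carrier R; x \<in> carrier M; y \<in> carrier M\<rbrakk> \<Longrightarrow>
        a \<odot>\<^bsub>M\<^esub> (x \<oplus>\<^bsub>M\<^esub> y) = a \<odot>\<^bsub>M\<^esub> x \<oplus>\<^bsub>M\<^esub> a \<odot>\<^bsub>M\<^esub> y"
    and smult_assoc1:
      "\<lbrakk>a \<in> carrier R; b \<in> carrier R; x \<in> carrier M\<rbrakk> \<Longrightarrow>
        (a \<otimes> b) \<odot>\<^bsub>M\<^esub> x = a \<odot>\<^bsub>M\<^esub> (b \<odot>\<^bsub>M\<^esub> x)"
    and smult_one [simp]: "x \<in> carrier M \<Longrightarrow> \<one> \<odot>\<^bsub>M\<^esub> x = x"

text \<open>Right \<open>S\<close>-modules are treated as left modules over the opposite ring, \<open>s \<odot> x\<close> standing for \<open>x s\<close>.\<close>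

definition op_ring :: "'s ring \<Rightarrow> 's ring" where
  "op_ring S = S\<lparr>monoid.mult := (\<lambda>x y. y \<otimes>\<^bsub>S\<^esub> x)\<rparr>"

definition regular_module :: "'r ring \<Rightarrow> ('r, 'r) module" where
  "regular_module R = \<lparr>carrier = carrier R, monoid.mult = monoid.mult R, one = \<one>\<^bsub>R\<^esub>,
     ring.zero = \<zero>\<^bsub>R\<^esub>, ring.add = ring.add R, smult = monoid.mult R\<rparr>"

text \<open>Maps are extensional (\<^const>\<open>undefined\<close> off the carrier), so that equality of functions is
  equality of homomorphisms.\<close>

definition mod_hom :: "'r ring \<Rightarrow> ('r, 'm) module \<Rightarrow> ('r, 'n) module \<Rightarrow> ('m \<Rightarrow> 'n) set" where
  "mod_hom R M N = {f \<in> carrier M \<rightarrow>\<^sub>E carrier N.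
     (\<forall>x\<in>carrier M. \<forall>y\<in>carrier M. f (x \<oplus>\<^bsub>M\<^esub> y) = f x \<oplus>\<^bsub>N\<^esub> f y) \<and>
     (\<forall>r\<in>carrier R. \<forall>x\<in>carrier M. f (r \<odot>\<^bsub>M\<^esub> x) = r \<odot>\<^bsub>N\<^esub> f x)}"

definition mod_iso :: "'r ring \<Rightarrow> ('r, 'm) module \<Rightarrow> ('r, 'n) module \<Rightarrow> ('m \<Rightarrow> 'n) set" where
  "mod_iso R M N = {f \<in> mod_hom R M N. bij_betw f (carrier M) (carrier N)}"

definition id_hom :: "('r, 'm) module \<Rightarrow> 'm \<Rightarrow> 'm" where
  "id_hom M = (\<lambda>x\<in>carrier M. x)"

text \<open>\<open>Hom\<^sub>R(M,N)\<close> as an abelian group.  Like the library's free abelian groups and quotient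
  groups, it is written with the multiplicative record \<^typ>\<open>'a monoid\<close>.\<close>

definition hom_group :: "'r ring \<Rightarrow> ('r, 'm) module \<Rightarrow> ('r, 'n) module \<Rightarrow> ('m \<Rightarrow> 'n) monoid" where
  "hom_group R M N = \<lparr>carrier = mod_hom R M N,
     monoid.mult = (\<lambda>f g. \<lambda>x\<in>carrier M. f x \<oplus>\<^bsub>N\<^esub> g x), one = (\<lambda>x\<in>carrier M. \<zero>\<^bsub>N\<^esub>)\<rparr>"

text \<open>The map \<open>Hom\<^sub>R(M',N) \<rightarrow> Hom\<^sub>R(M,N)\<close> induced by \<open>d : M \<rightarrow> M'\<close>.\<close>

definition precomp :: "('r, 'm) module \<Rightarrow> ('m \<Rightarrow> 'm') \<Rightarrow> ('m' \<Rightarrow> 'n) \<Rightarrow> 'm \<Rightarrow> 'n" where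
  "precomp M d f = compose (carrier M) f d"


section \<open>Projective modules and projective resolutions\<close>

definition free_module :: "'r ring \<Rightarrow> 'x set \<Rightarrow> ('r, 'x \<Rightarrow> 'r) module" where
  "free_module R X = \<lparr>carrier = {f. (\<forall>x. f x \<in> carrier R) \<and> finite {x. f x \<noteq> \<zero>\<^bsub>R\<^esub>} \<and>
       (\<forall>x. x \<notin> X \<longrightarrow> f x = \<zero>\<^bsub>R\<^esub>)},
     monoid.mult = undefined, one = undefined,
     ring.zero = (\<lambda>x. \<zero>\<^bsub>R\<^esub>), ring.add = (\<lambda>f g x. f x \<oplus>\<^bsub>R\<^esub> g x), smult = (\<lambda>r f x. r \<otimes>\<^bsub>R\<^esub> f x)\<rparr>"

text \<open>
  The lifting property.  Modules \<open>A\<close>, \<open>B\<close> cannot be quantified over all types inside a definition;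
  the types used here include the canonical surjection from the free module on the elements of
  \<open>P\<close> onto \<open>P\<close>, so \<open>P\<close> is a direct summand of a free module and lifting holds against surjections
  in all types (see \<open>projective_lift\<close> below).
\<close>

definition projective :: "'r ring \<Rightarrow> ('r, 'p) module \<Rightarrow> bool" where
  "projective R P \<longleftrightarrow> left_module R P \<and>
     (\<forall>(A :: ('r, 'p \<Rightarrow> 'r) module) (B :: ('r, 'p) module). left_module R A \<longrightarrow> left_module R B \<longrightarrow>
        (\<forall>g\<in>mod_hom R A B. g ` carrier A = carrier B \<longrightarrow>
           (\<forall>h\<in>mod_hom R P B. \<exists>k\<in>mod_hom R P A. compose (carrier P) g k = h)))"

definition fin_gen :: "'r ring \<Rightarrow> ('r, 'm) module \<Rightarrow> bool" where
  "fin_gen R M \<longleftrightarrow> (\<exists>B. finite B \<and> B \<subseteq> carrier M \<and>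
     (\<forall>x\<in>carrier M. \<exists>c\<in>B \<rightarrow> carrier R. x = (\<Oplus>\<^bsub>M\<^esub>b\<in>B. c b \<odot>\<^bsub>M\<^esub> b)))"

text \<open>Exactness of \<open>A \<rightarrow> B \<rightarrow> C\<close> (maps \<open>f\<close>, \<open>g\<close>) at the middle term.\<close>

definition exact_at :: "('a, 'x) monoid_scheme \<Rightarrow> ('a \<Rightarrow> 'b) \<Rightarrow> ('b, 'y) monoid_scheme \<Rightarrow> ('b \<Rightarrow> 'c) \<Rightarrow>
    ('c, 'z) monoid_scheme \<Rightarrow> bool" where
  "exact_at A f B g C \<longleftrightarrow> f ` carrier A = kernel B C g"

text \<open>\<open>\<dots> \<rightarrow> P 2 \<rightarrow> P 1 \<rightarrow> P 0 \<rightarrow> M \<rightarrow> 0\<close>, where \<open>d n : P (n+1) \<rightarrow> P n\<close> and \<open>e : P 0 \<rightarrow> M\<close>.\<close>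

definition projective_resolution ::
  "'r ring \<Rightarrow> ('r, 'm) module \<Rightarrow> (nat \<Rightarrow> ('r, 'p) module) \<Rightarrow> (nat \<Rightarrow> 'p \<Rightarrow> 'p) \<Rightarrow> ('p \<Rightarrow> 'm) \<Rightarrow> bool" where
  "projective_resolution R M P d e \<longleftrightarrow>
     (\<forall>n. projective R (P n)) \<and>
     (\<forall>n. d n \<in> mod_hom R (P (Suc n)) (P n)) \<and> e \<in> mod_hom R (P 0) M \<and>
     e ` carrier (P 0) = carrier M \<and>
     exact_at (add_monoid (P 1)) (d 0) (add_monoid (P 0)) e (add_monoid M) \<and>
     (\<forall>n. exact_at (add_monoid (P (Suc (Suc n)))) (d (Suc n)) (add_monoid (P (Suc n))) (d n)
            (add_monoid (P n)))"

subsection \<open>A canonical free resolution\<close>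

text \<open>
  To have derived functors as honest functions of their arguments, without types that grow with
  the degree, all terms of one functorially chosen free resolution of \<open>M\<close> are placed in a single
  type: the degree 0 generators are the elements of \<open>M\<close>, and the generators of degree \<open>n + 1\<close> are
  the formal relations (finite lists of coefficients and generators) between the images of the
  generators of degree \<open>n\<close>.
\<close>

datatype ('r, 'm) cell = Elem 'm | Rel "('r \<times> ('r, 'm) cell) list"

definition lin_comb :: "('r, 'm) module \<Rightarrow> ('x \<Rightarrow> 'm) \<Rightarrow> ('r \<times> 'x) list \<Rightarrow> 'm" where
  "lin_comb M g l = foldr (\<lambda>(r, x) acc. r \<odot>\<^bsub>M\<^esub> g x \<oplus>\<^bsub>M\<^esub> acc) l \<zero>\<^bsub>M\<^esub>"

definition basis_elem :: "'r ring \<Rightarrow> 'x \<Rightarrow> 'x \<Rightarrow> 'r" where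
  "basis_elem R x = (\<lambda>y. if y = x then \<one>\<^bsub>R\<^esub> else \<zero>\<^bsub>R\<^esub>)"

primrec cell_elem :: "('r, 'm) cell \<Rightarrow> 'm" where
  "cell_elem (Elem m) = m"
| "cell_elem (Rel l) = undefined"

primrec cell_bd :: "'r ring \<Rightarrow> ('r, 'm) cell \<Rightarrow> ('r, 'm) cell \<Rightarrow> 'r" where
  "cell_bd R (Elem m) = (\<lambda>_. \<zero>\<^bsub>R\<^esub>)"
| "cell_bd R (Rel l) = lin_comb (free_module R UNIV) (basis_elem R) l"

fun cells :: "'r ring \<Rightarrow> ('r, 'm) module \<Rightarrow> nat \<Rightarrow> ('r, 'm) cell set" where
  "cells R M 0 = Elem ` carrier M"
| "cells R M (Suc 0) = {Rel l | l. set l \<subseteq> carrier R \<times> cells R M 0 \<and> lin_comb M cell_elem l = \<zero>\<^bsub>M\<^esub>}"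
| "cells R M (Suc (Suc n)) = {Rel l | l. set l \<subseteq> carrier R \<times> cells R M (Suc n) \<and>
     lin_comb (free_module R UNIV) (cell_bd R) l = \<zero>\<^bsub>free_module R (UNIV :: ('r, 'm) cell set)\<^esub>}"

text \<open>The homomorphism from \<open>free_module R X\<close> to \<open>M\<close> extending \<open>g : X \<rightarrow> M\<close>.\<close>

definition free_ext :: "'r ring \<Rightarrow> 'x set \<Rightarrow> ('r, 'm) module \<Rightarrow> ('x \<Rightarrow> 'm) \<Rightarrow> ('x \<Rightarrow> 'r) \<Rightarrow> 'm" where
  "free_ext R X M g = (\<lambda>f\<in>carrier (free_module R X). \<Oplus>\<^bsub>M\<^esub>x\<in>{x. f x \<noteq> \<zero>\<^bsub>R\<^esub>}. f x \<odot>\<^bsub>M\<^esub> g x)"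

definition free_res :: "'r ring \<Rightarrow> ('r, 'm) module \<Rightarrow> nat \<Rightarrow> ('r, ('r, 'm) cell \<Rightarrow> 'r) module" where
  "free_res R M n = free_module R (cells R M n)"

definition free_res_d ::
  "'r ring \<Rightarrow> ('r, 'm) module \<Rightarrow> nat \<Rightarrow> (('r, 'm) cell \<Rightarrow> 'r) \<Rightarrow> ('r, 'm) cell \<Rightarrow> 'r" where
  "free_res_d R M n = free_ext R (cells R M (Suc n)) (free_res R M n) (cell_bd R)"

definition free_res_aug :: "'r ring \<Rightarrow> ('r, 'm) module \<Rightarrow> (('r, 'm) cell \<Rightarrow> 'r) \<Rightarrow> 'm" where
  "free_res_aug R M = free_ext R (cells R M 0) M cell_elem"

subsection \<open>The canonical free resolution is a projective resolution\<close>

lemma mod_homI: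
  assumes "f \<in> carrier M \<rightarrow>\<^sub>E carrier N"
    and "\<And>x y. x \<in> carrier M \<Longrightarrow> y \<in> carrier M \<Longrightarrow> f (x \<oplus>\<^bsub>M\<^esub> y) = f x \<oplus>\<^bsub>N\<^esub> f y"
    and "\<And>r x. r \<in> carrier R \<Longrightarrow> x \<in> carrier M \<Longrightarrow> f (r \<odot>\<^bsub>M\<^esub> x) = r \<odot>\<^bsub>N\<^esub> f x"
  shows "f \<in> mod_hom R M N"
  using assms unfolding mod_hom_def by simp

lemma mod_homD:
  assumes "f \<in> mod_hom R M N"
  shows "f \<in> carrier M \<rightarrow>\<^sub>E carrier N"
    and "\<And>x. x \<in> carrier M \<Longrightarrow> f x \<in> carrier N"
    and "\<And>x y. x \<in> carrier M \<Longrightarrow> y \<in> carrier M \<Longrightarrow> f (x \<oplus>\<^bsub>M\<^esub> y) = f x \<oplus>\<^bsub>N\<^esub> f y"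
    and "\<And>r x. r \<in> carrier R \<Longrightarrow> x \<in> carrier M \<Longrightarrow> f (r \<odot>\<^bsub>M\<^esub> x) = r \<odot>\<^bsub>N\<^esub> f x"
  using assms unfolding mod_hom_def by auto

lemma mod_hom_zero:
  assumes "f \<in> mod_hom R M N" "left_module R M" "left_module R N"
  shows "f \<zero>\<^bsub>M\<^esub> = \<zero>\<^bsub>N\<^esub>"
proof -
  interpret M: left_module R M by fact
  interpret N: left_module R N by fact
  have "f \<zero>\<^bsub>M\<^esub> \<oplus>\<^bsub>N\<^esub> f \<zero>\<^bsub>M\<^esub> = f \<zero>\<^bsub>M\<^esub>"
    using mod_homD(3)[OF assms(1), of "\<zero>\<^bsub>M\<^esub>" "\<zero>\<^bsub>M\<^esub>"] by simp
  then show ?thesis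
    using mod_homD(2)[OF assms(1), of "\<zero>\<^bsub>M\<^esub>"] by (metis M.M.zero_closed N.M.add.l_cancel_one')
qed

lemma mod_hom_compose:
  assumes "f \<in> mod_hom R M N" "g \<in> mod_hom R N K" "left_module R M"
  shows "compose (carrier M) g f \<in> mod_hom R M K"
proof -
  interpret M: left_module R M by fact
  show ?thesis
    using mod_homD[OF assms(1)] mod_homD[OF assms(2)]
    by (intro mod_homI) (auto simp: compose_def)
qed

context left_module begin

lemma smult_l_zero: "x \<in> carrier M \<Longrightarrow> \<zero> \<odot>\<^bsub>M\<^esub> x = \<zero>\<^bsub>M\<^esub>"
  by (metis R.add.l_cancel_one' R.add.m_comm R.zero_closed M.add.l_cancel_one' smult_closed smult_l_distr)

lemma smult_r_zero: "a \<in> carrier R \<Longrightarrow> a \<odot>\<^bsub>M\<^esub> \<zero>\<^bsub>M\<^esub> = \<zero>\<^bsub>M\<^esub>"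
  by (metis M.add.l_cancel_one' M.zero_closed M.l_zero smult_closed smult_r_distr)

lemma smult_finsum:
  assumes "a \<in> carrier R" "finite F" "g \<in> F \<rightarrow> carrier M"
  shows "a \<odot>\<^bsub>M\<^esub> (\<Oplus>\<^bsub>M\<^esub>x\<in>F. g x) = (\<Oplus>\<^bsub>M\<^esub>x\<in>F. a \<odot>\<^bsub>M\<^esub> g x)"
  using assms(2,3)
proof (induction F)
  case (insert x F)
  then have "g \<in> F \<rightarrow> carrier M" "g x \<in> carrier M" by auto
  with insert assms(1) show ?case
    by (subst M.finsum_insert; (subst M.finsum_insert)?) (auto simp: smult_r_distr Pi_iff)
qed (simp add: smult_r_zero assms)

end

lemma free_module_sel:
  "\<zero>\<^bsub>free_module R X\<^esub> = (\<lambda>x. \<zero>\<^bsub>R\<^esub>)"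
  "f \<oplus>\<^bsub>free_module R X\<^esub> g = (\<lambda>x. f x \<oplus>\<^bsub>R\<^esub> g x)"
  "r \<odot>\<^bsub>free_module R X\<^esub> f = (\<lambda>x. r \<otimes>\<^bsub>R\<^esub> f x)"
  "f \<in> carrier (free_module R X) \<longleftrightarrow> (\<forall>x. f x \<in> carrier R) \<and> finite {x. f x \<noteq> \<zero>\<^bsub>R\<^esub>} \<and>
       (\<forall>x. x \<notin> X \<longrightarrow> f x = \<zero>\<^bsub>R\<^esub>)"
  by (auto simp: free_module_def)

lemma left_module_free:
  fixes R (structure)
  assumes "ring R"
  shows "left_module R (free_module R X)"
proof -
  interpret ring R by fact
  have ag: "abelian_group (free_module R X)"
  proof (rule abelian_groupI; (unfold free_module_sel)?)
    fix f g assume a: "(\<forall>x. f x \<in> carrier R) \<and> finite {x. f x \<noteq> \<zero>} \<and> (\<forall>x. x \<notin> X \<longrightarrow> f x = \<zero>)"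
       "(\<forall>x. g x \<in> carrier R) \<and> finite {x. g x \<noteq> \<zero>} \<and> (\<forall>x. x \<notin> X \<longrightarrow> g x = \<zero>)"
    have "finite {x. f x \<oplus> g x \<noteq> \<zero>}"
      by (rule finite_subset[of _ "{x. f x \<noteq> \<zero>} \<union> {x. g x \<noteq> \<zero>}"]) (use a in auto)
    with a show "(\<forall>x. f x \<oplus> g x \<in> carrier R) \<and> finite {x. f x \<oplus> g x \<noteq> \<zero>} \<and> (\<forall>x. x \<notin> X \<longrightarrow> f x \<oplus> g x = \<zero>)"
      by auto
  next
    fix f assume a: "(\<forall>x. f x \<in> carrier R) \<and> finite {x. f x \<noteq> \<zero>} \<and> (\<forall>x. x \<notin> X \<longrightarrow> f x = \<zero>)"
    have "finite {x. \<ominus> f x \<noteq> \<zero>}"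
      by (rule finite_subset[of _ "{x. f x \<noteq> \<zero>}"]) (use a in auto)
    with a show "\<exists>y\<in>carrier (free_module R X). (\<lambda>x. y x \<oplus> f x) = (\<lambda>x. \<zero>)"
      by (intro bexI[of _ "\<lambda>x. \<ominus> f x"]) (auto simp: free_module_sel l_neg)
  qed (auto simp: a_ac)
  interpret F: abelian_group "free_module R X" by fact
  show ?thesis
  proof (unfold_locales; (unfold free_module_sel)?)
    fix a f assume a: "a \<in> carrier R" "(\<forall>x. f x \<in> carrier R) \<and> finite {x. f x \<noteq> \<zero>} \<and> (\<forall>x. x \<notin> X \<longrightarrow> f x = \<zero>)"
    have "finite {x. a \<otimes> f x \<noteq> \<zero>}"
      by (rule finite_subset[of _ "{x. f x \<noteq> \<zero>}"]) (use a in auto)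
    with a show "(\<forall>x. a \<otimes> f x \<in> carrier R) \<and> finite {x. a \<otimes> f x \<noteq> \<zero>} \<and> (\<forall>x. x \<notin> X \<longrightarrow> a \<otimes> f x = \<zero>)"
      by auto
  qed (auto simp: l_distr r_distr m_assoc)
qed

lemma basis_elem_closed: "ring R \<Longrightarrow> x \<in> X \<Longrightarrow> basis_elem R x \<in> carrier (free_module R X)"
  unfolding free_module_sel basis_elem_def
  by (auto intro: finite_subset[of _ "{x}"] simp: ring.ring_simprules)

lemma free_ext_eq:
  assumes "left_module R M" "g \<in> X \<rightarrow> carrier M" "f \<in> carrier (free_module R X)"
    "finite F" "{x. f x \<noteq> \<zero>\<^bsub>R\<^esub>} \<subseteq> F" "F \<subseteq> X"
  shows "free_ext R X M g f = (\<Oplus>\<^bsub>M\<^esub>x\<in>F. f x \<odot>\<^bsub>M\<^esub> g x)"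
proof -
  interpret left_module R M by fact
  show ?thesis
    unfolding free_ext_def using assms
    by (simp add: free_module_sel)
       (rule M.add.finprod_mono_neutral_cong_left, auto simp: smult_l_zero Pi_iff subset_iff)
qed

lemma free_ext_hom:
  fixes R (structure)
  assumes "left_module R M" "g \<in> X \<rightarrow> carrier M"
  shows "free_ext R X M g \<in> mod_hom R (free_module R X) M"
proof (rule mod_homI)
  interpret left_module R M by fact
  interpret F: left_module R "free_module R X" by (rule left_module_free) unfold_locales
  note e = free_ext_eq[OF assms]
  have gx: "x \<in> X \<Longrightarrow> g x \<in> carrier M" for x using assms by auto
  have cl: "free_ext R X M g f \<in> carrier M" if "f \<in> carrier (free_module R X)" for f
    using that gx unfolding free_ext_def
    by (auto intro!: M.finsum_closed simp: free_module_sel Pi_iff)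
  show "free_ext R X M g \<in> carrier (free_module R X) \<rightarrow>\<^sub>E carrier M"
    using cl by (auto simp: free_ext_def)
  fix f h assume f: "f \<in> carrier (free_module R X)" and h: "h \<in> carrier (free_module R X)"
  let ?F = "{x. f x \<noteq> \<zero>\<^bsub>R\<^esub>} \<union> {x. h x \<noteq> \<zero>\<^bsub>R\<^esub>}"
  have fin: "finite ?F" "?F \<subseteq> X" using f h by (auto simp: free_module_sel)
  have c: "\<And>x. f x \<in> carrier R" "\<And>x. h x \<in> carrier R" using f h by (auto simp: free_module_sel)
  have *: "{x. (f \<oplus>\<^bsub>free_module R X\<^esub> h) x \<noteq> \<zero>\<^bsub>R\<^esub>} \<subseteq> ?F"
    by (auto simp: free_module_sel)
  have "free_ext R X M g (f \<oplus>\<^bsub>free_module R X\<^esub> h) = (\<Oplus>\<^bsub>M\<^esub>x\<in>?F. (f x \<oplus> h x) \<odot>\<^bsub>M\<^esub> g x)"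
    by (subst e[OF F.M.a_closed[OF f h] fin(1) * fin(2)]) (simp add: free_module_sel)
  also have "\<dots> = (\<Oplus>\<^bsub>M\<^esub>x\<in>?F. f x \<odot>\<^bsub>M\<^esub> g x \<oplus>\<^bsub>M\<^esub> h x \<odot>\<^bsub>M\<^esub> g x)"
    using fin c gx by (intro M.finsum_cong') (auto simp: smult_l_distr subset_iff)
  also have "\<dots> = (\<Oplus>\<^bsub>M\<^esub>x\<in>?F. f x \<odot>\<^bsub>M\<^esub> g x) \<oplus>\<^bsub>M\<^esub> (\<Oplus>\<^bsub>M\<^esub>x\<in>?F. h x \<odot>\<^bsub>M\<^esub> g x)"
    using fin c gx by (intro M.finsum_addf) (auto simp: subset_iff)
  also have "(\<Oplus>\<^bsub>M\<^esub>x\<in>?F. f x \<odot>\<^bsub>M\<^esub> g x) = free_ext R X M g f"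
    by (rule e[OF f fin(1) _ fin(2), symmetric]) auto
  also have "(\<Oplus>\<^bsub>M\<^esub>x\<in>?F. h x \<odot>\<^bsub>M\<^esub> g x) = free_ext R X M g h"
    by (rule e[OF h fin(1) _ fin(2), symmetric]) auto
  finally show "free_ext R X M g (f \<oplus>\<^bsub>free_module R X\<^esub> h) = free_ext R X M g f \<oplus>\<^bsub>M\<^esub> free_ext R X M g h" .
next
  interpret left_module R M by fact
  interpret F: left_module R "free_module R X" by (rule left_module_free) unfold_locales
  note e = free_ext_eq[OF assms]
  have gx: "x \<in> X \<Longrightarrow> g x \<in> carrier M" for x using assms by auto
  fix r f assume r: "r \<in> carrier R" and f: "f \<in> carrier (free_module R X)"
  let ?F = "{x. f x \<noteq> \<zero>\<^bsub>R\<^esub>}"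
  have fin: "finite ?F" "?F \<subseteq> X" using f by (auto simp: free_module_sel)
  have c: "\<And>x. f x \<in> carrier R" using f by (auto simp: free_module_sel)
  have *: "{x. (r \<odot>\<^bsub>free_module R X\<^esub> f) x \<noteq> \<zero>\<^bsub>R\<^esub>} \<subseteq> ?F"
    using r by (auto simp: free_module_sel)
  have "free_ext R X M g (r \<odot>\<^bsub>free_module R X\<^esub> f) = (\<Oplus>\<^bsub>M\<^esub>x\<in>?F. (r \<otimes> f x) \<odot>\<^bsub>M\<^esub> g x)"
    by (subst e[OF F.smult_closed[OF r f] fin(1) * fin(2)]) (simp add: free_module_sel)
  also have "\<dots> = (\<Oplus>\<^bsub>M\<^esub>x\<in>?F. r \<odot>\<^bsub>M\<^esub> (f x \<odot>\<^bsub>M\<^esub> g x))"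
    using fin c gx r by (intro M.finsum_cong') (auto simp: smult_assoc1 subset_iff)
  also have "\<dots> = r \<odot>\<^bsub>M\<^esub> (\<Oplus>\<^bsub>M\<^esub>x\<in>?F. f x \<odot>\<^bsub>M\<^esub> g x)"
    using fin c gx r by (intro smult_finsum[symmetric]) (auto simp: subset_iff)
  also have "(\<Oplus>\<^bsub>M\<^esub>x\<in>?F. f x \<odot>\<^bsub>M\<^esub> g x) = free_ext R X M g f"
    by (rule e[OF f fin(1) _ fin(2), symmetric]) auto
  finally show "free_ext R X M g (r \<odot>\<^bsub>free_module R X\<^esub> f) = r \<odot>\<^bsub>M\<^esub> free_ext R X M g f" .
qed

lemma free_ext_basis:
  assumes "left_module R M" "g \<in> X \<rightarrow> carrier M" "x \<in> X"
  shows "free_ext R X M g (basis_elem R x) = g x"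
proof -
  interpret left_module R M by fact
  have gx: "g x \<in> carrier M" using assms by auto
  have "free_ext R X M g (basis_elem R x) = (\<Oplus>\<^bsub>M\<^esub>y\<in>{x}. basis_elem R x y \<odot>\<^bsub>M\<^esub> g y)"
    by (rule free_ext_eq[OF assms(1,2) basis_elem_closed])
       (use assms in \<open>auto simp: basis_elem_def R.ring_axioms\<close>)
  also have "\<dots> = basis_elem R x x \<odot>\<^bsub>M\<^esub> g x"
    using gx by (subst M.finsum_insert) (auto simp: basis_elem_def)
  finally show ?thesis using gx by (simp add: basis_elem_def)
qed

lemma free_module_expand:
  assumes R: "ring R" and f: "f \<in> carrier (free_module R X)"
  shows "f = (\<Oplus>\<^bsub>free_module R X\<^esub>x\<in>{x. f x \<noteq> \<zero>\<^bsub>R\<^esub>}. f x \<odot>\<^bsub>free_module R X\<^esub> basis_elem R x)"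
proof -
  interpret F: left_module R "free_module R X" by (rule left_module_free[OF R])
  have c: "\<And>x. f x \<in> carrier R" using f by (auto simp: free_module_sel)
  have *: "(\<Oplus>\<^bsub>free_module R X\<^esub>x\<in>A. f x \<odot>\<^bsub>free_module R X\<^esub> basis_elem R x) = (\<lambda>y. if y \<in> A then f y else \<zero>\<^bsub>R\<^esub>)"
    if "finite A" "A \<subseteq> X" for A
    using that
  proof (induction A)
    case (insert x A)
    have "(\<Oplus>\<^bsub>free_module R X\<^esub>x\<in>insert x A. f x \<odot>\<^bsub>free_module R X\<^esub> basis_elem R x) =
       f x \<odot>\<^bsub>free_module R X\<^esub> basis_elem R x \<oplus>\<^bsub>free_module R X\<^esub> (\<lambda>y. if y \<in> A then f y else \<zero>\<^bsub>R\<^esub>)"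
      using insert c by (subst F.M.finsum_insert) (auto intro!: F.smult_closed basis_elem_closed[OF R])
    also have "\<dots> = (\<lambda>y. if y \<in> insert x A then f y else \<zero>\<^bsub>R\<^esub>)"
      using insert c by (auto simp: free_module_sel basis_elem_def fun_eq_iff)
    finally show ?case .
  qed (simp add: free_module_sel)
  have "finite {x. f x \<noteq> \<zero>\<^bsub>R\<^esub>}" "{x. f x \<noteq> \<zero>\<^bsub>R\<^esub>} \<subseteq> X" using f by (auto simp: free_module_sel)
  from *[OF this] show ?thesis by auto
qed

lemma mod_hom_finsum:
  assumes h: "h \<in> mod_hom R M N" and M: "left_module R M" and N: "left_module R N"
    and F: "finite F" and g: "g \<in> F \<rightarrow> carrier M"
  shows "h (\<Oplus>\<^bsub>M\<^esub>x\<in>F. g x) = (\<Oplus>\<^bsub>N\<^esub>x\<in>F. h (g x))"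
proof -
  interpret M: left_module R M by fact
  interpret N: left_module R N by fact
  show ?thesis using F g
  proof (induction F)
    case (insert x F)
    then have "g \<in> F \<rightarrow> carrier M" "g x \<in> carrier M" by auto
    with insert show ?case
      by (subst M.M.finsum_insert; (subst N.M.finsum_insert)?)
         (auto simp: mod_homD[OF h] Pi_iff)
  qed (simp add: mod_hom_zero[OF h M N])
qed

lemma hom_free_eq:
  assumes M: "left_module R M" and h: "h \<in> mod_hom R (free_module R X) M"
  shows "h = free_ext R X M (\<lambda>x. h (basis_elem R x))"
proof (rule PiE_ext[of _ "carrier (free_module R X)" "\<lambda>_. carrier M"])
  interpret left_module R M by fact
  have R: "ring R" by unfold_locales
  interpret F: left_module R "free_module R X" by (rule left_module_free[OF R])
  have hb: "(\<lambda>x. h (basis_elem R x)) \<in> X \<rightarrow> carrier M"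
    by (intro Pi_I mod_homD(2)[OF h] basis_elem_closed[OF R])
  show "h \<in> carrier (free_module R X) \<rightarrow>\<^sub>E carrier M" by (rule mod_homD[OF h])
  show "free_ext R X M (\<lambda>x. h (basis_elem R x)) \<in> carrier (free_module R X) \<rightarrow>\<^sub>E carrier M"
    by (rule mod_homD[OF free_ext_hom[OF M hb]])
  fix f assume f: "f \<in> carrier (free_module R X)"
  let ?F = "{x. f x \<noteq> \<zero>\<^bsub>R\<^esub>}"
  have fin: "finite ?F" "?F \<subseteq> X" using f by (auto simp: free_module_sel)
  have c: "\<And>x. f x \<in> carrier R" using f by (auto simp: free_module_sel)
  have b: "\<And>x. x \<in> ?F \<Longrightarrow> basis_elem R x \<in> carrier (free_module R X)" by (rule basis_elem_closed[OF R subsetD[OF fin(2)]])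
  have "h f = h (\<Oplus>\<^bsub>free_module R X\<^esub>x\<in>?F. f x \<odot>\<^bsub>free_module R X\<^esub> basis_elem R x)"
    by (rule arg_cong[where f = h, OF free_module_expand[OF R f]])
  also have "\<dots> = (\<Oplus>\<^bsub>M\<^esub>x\<in>?F. h (f x \<odot>\<^bsub>free_module R X\<^esub> basis_elem R x))"
    using b c by (intro mod_hom_finsum[OF h F.left_module_axioms M fin(1)]) auto
  also have "\<dots> = (\<Oplus>\<^bsub>M\<^esub>x\<in>?F. f x \<odot>\<^bsub>M\<^esub> h (basis_elem R x))"
    using b c mod_homD[OF h] by (intro M.finsum_cong') auto
  also have "\<dots> = free_ext R X M (\<lambda>x. h (basis_elem R x)) f"
    using f by (simp add: free_ext_def)
  finally show "h f = free_ext R X M (\<lambda>x. h (basis_elem R x)) f" .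
qed

lemma free_lift:
  assumes A: "left_module R A" and B: "left_module R B"
    and g: "g \<in> mod_hom R A B" "g ` carrier A = carrier B"
    and h: "h \<in> mod_hom R (free_module R X) B"
  shows "\<exists>k\<in>mod_hom R (free_module R X) A. compose (carrier (free_module R X)) g k = h"
proof -
  interpret A: left_module R A by fact
  have R: "ring R" by unfold_locales
  have F: "left_module R (free_module R X)" by (rule left_module_free[OF R])
  have "\<forall>x\<in>X. \<exists>a\<in>carrier A. g a = h (basis_elem R x)"
    using g(2) mod_homD(2)[OF h] basis_elem_closed[OF R] by (metis imageE)
  then obtain a where a: "\<And>x. x \<in> X \<Longrightarrow> a x \<in> carrier A" "\<And>x. x \<in> X \<Longrightarrow> g (a x) = h (basis_elem R x)"
    by metis
  have a': "a \<in> X \<rightarrow> carrier A" using a by auto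
  let ?k = "free_ext R X A a"
  have k: "?k \<in> mod_hom R (free_module R X) A" by (rule free_ext_hom[OF A a'])
  have gk: "compose (carrier (free_module R X)) g ?k \<in> mod_hom R (free_module R X) B"
    by (rule mod_hom_compose[OF k g(1) F])
  have "free_ext R X B (\<lambda>x. compose (carrier (free_module R X)) g ?k (basis_elem R x)) =
        free_ext R X B (\<lambda>x. h (basis_elem R x))"
    unfolding free_ext_def
  proof (rule restrict_ext)
    interpret B: left_module R B by fact
    fix f assume f: "f \<in> carrier (free_module R X)"
    then have x: "x \<in> X" "f x \<in> carrier R" if "f x \<noteq> \<zero>\<^bsub>R\<^esub>" for x
      using that by (auto simp: free_module_sel)
    show "(\<Oplus>\<^bsub>B\<^esub>x\<in>{x. f x \<noteq> \<zero>\<^bsub>R\<^esub>}. f x \<odot>\<^bsub>B\<^esub> compose (carrier (free_module R X)) g (\<lambda>f\<in>carrier (free_module R X). \<Oplus>\<^bsub>A\<^esub>x\<in>{x. f x \<noteq> \<zero>\<^bsub>R\<^esub>}. f x \<odot>\<^bsub>A\<^esub> a x) (basis_elem R x)) =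
         (\<Oplus>\<^bsub>B\<^esub>x\<in>{x. f x \<noteq> \<zero>\<^bsub>R\<^esub>}. f x \<odot>\<^bsub>B\<^esub> h (basis_elem R x))"
      using x mod_homD(2)[OF h basis_elem_closed[OF R]] basis_elem_closed[OF R, of _ X]
      by (intro B.M.finsum_cong')
         (auto simp: free_ext_def[symmetric] compose_eq free_ext_basis[OF A a'] a)
  qed
  with hom_free_eq[OF B gk] hom_free_eq[OF B h] have "compose (carrier (free_module R X)) g ?k = h" by simp
  with k show ?thesis by blast
qed

lemma projective_free: "ring R \<Longrightarrow> projective R (free_module R X)"
  unfolding projective_def by (simp add: left_module_free free_lift)

lemma projective_lift:
  assumes P: "projective R P" and A: "left_module R A" and B: "left_module R B"
    and g: "g \<in> mod_hom R A B" "g ` carrier A = carrier B"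
    and h: "h \<in> mod_hom R P B"
  shows "\<exists>k\<in>mod_hom R P A. compose (carrier P) g k = h"
proof -
  have PM: "left_module R P" using P by (simp add: projective_def)
  interpret P: left_module R P by fact
  let ?F = "free_module R (carrier P)"
  have F: "left_module R ?F" by (rule left_module_free) unfold_locales
  let ?\<pi> = "free_ext R (carrier P) P (\<lambda>x. x)"
  have \<pi>: "?\<pi> \<in> mod_hom R ?F P" by (rule free_ext_hom[OF PM]) auto
  have \<pi>s: "?\<pi> ` carrier ?F = carrier P"
  proof
    show "carrier P \<subseteq> ?\<pi> ` carrier ?F"
      using free_ext_basis[OF PM, of "\<lambda>x. x" "carrier P"] basis_elem_closed[OF P.R.ring_axioms, of _ "carrier P"]
      by (metis (no_types, lifting) Pi_I imageI subsetI)
  qed (use mod_homD(2)[OF \<pi>] in auto)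
  have "id_hom P \<in> mod_hom R P P" by (rule mod_homI) (auto simp: id_hom_def)
  then obtain s where s: "s \<in> mod_hom R P ?F" "compose (carrier P) ?\<pi> s = id_hom P"
    using P F \<pi> \<pi>s unfolding projective_def by metis
  obtain k where k: "k \<in> mod_hom R ?F A" "compose (carrier ?F) g k = compose (carrier ?F) h ?\<pi>"
    using free_lift[OF A B g mod_hom_compose[OF \<pi> h F]] by blast
  have "compose (carrier P) g (compose (carrier P) k s) x = h x" if x: "x \<in> carrier P" for x
  proof -
    have sx: "s x \<in> carrier ?F" using s x by (auto dest: mod_homD)
    have "?\<pi> (s x) = x" using fun_cong[OF s(2), of x] x by (simp add: compose_eq id_hom_def)
    then show ?thesis using fun_cong[OF k(2), of "s x"] sx x by (simp add: compose_eq)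
  qed
  then have "compose (carrier P) g (compose (carrier P) k s) = h"
    using mod_homD(1)[OF h] by (intro extensionalityI[of _ "carrier P"]) (auto simp: PiE_def)
  with mod_hom_compose[OF s(1) k(1) PM] show ?thesis by blast
qed

lemma lin_comb_closed:
  assumes M: "left_module R M" and l: "set l \<subseteq> carrier R \<times> X" and g: "g \<in> X \<rightarrow> carrier M"
  shows "lin_comb M g l \<in> carrier M"
proof -
  interpret left_module R M by fact
  show ?thesis using l g by (induction l) (auto simp: lin_comb_def)
qed

lemma hom_lin_comb:
  assumes h: "h \<in> mod_hom R M N" and M: "left_module R M" and N: "left_module R N"
    and l: "set l \<subseteq> carrier R \<times> X" and g: "g \<in> X \<rightarrow> carrier M"
  shows "h (lin_comb M g l) = lin_comb N (\<lambda>x. h (g x)) l"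
proof -
  interpret M: left_module R M by fact
  show ?thesis using l
  proof (induction l)
    case Nil then show ?case using mod_hom_zero[OF h M N] by (simp add: lin_comb_def)
  next
    case (Cons p l)
    obtain r x where p: "p = (r, x)" by force
    have "lin_comb M g l \<in> carrier M" using Cons.prems by (intro lin_comb_closed[OF M _ g]) auto
    moreover have "r \<in> carrier R" "g x \<in> carrier M" using Cons.prems p g by auto
    ultimately show ?case using Cons p by (simp add: lin_comb_def mod_homD[OF h])
  qed
qed

lemma lin_comb_cong:
  assumes "set l \<subseteq> A \<times> X" "\<And>x. x \<in> X \<Longrightarrow> g x = g' x"
  shows "lin_comb M g l = lin_comb M g' l"
  using assms by (induction l) (auto simp: lin_comb_def)

lemma lin_comb_free: "lin_comb (free_module R X) g l = lin_comb (free_module R Y) g l"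
  by (simp add: lin_comb_def free_module_def)

lemma relations_exact:
  assumes M: "left_module R M" and g: "g \<in> X \<rightarrow> carrier M"
    and Y: "Y = {Rel l | l. set l \<subseteq> carrier R \<times> X \<and> lin_comb M g l = \<zero>\<^bsub>M\<^esub>}"
  shows "cell_bd R \<in> Y \<rightarrow> carrier (free_module R X)"
    and "exact_at (add_monoid (free_module R Y)) (free_ext R Y (free_module R X) (cell_bd R))
      (add_monoid (free_module R X)) (free_ext R X M g) (add_monoid M)"
proof -
  interpret left_module R M by fact
  have R: "ring R" by unfold_locales
  let ?F = "free_module R X"
  have F: "left_module R ?F" by (rule left_module_free[OF R])
  interpret F: left_module R ?F by fact
  have FY: "left_module R (free_module R Y)" by (rule left_module_free[OF R])
  have b: "basis_elem R \<in> X \<rightarrow> carrier ?F" using basis_elem_closed[OF R] by auto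
  have bd: "cell_bd R (Rel l) = lin_comb ?F (basis_elem R) l" for l
    by (simp add: lin_comb_free[of R UNIV _ _ X])
  show c: "cell_bd R \<in> Y \<rightarrow> carrier ?F"
    unfolding Y using lin_comb_closed[OF F _ b] bd by (auto simp del: cell_bd.simps)
  let ?e = "free_ext R X M g" and ?d = "free_ext R Y ?F (cell_bd R)"
  have e: "?e \<in> mod_hom R ?F M" by (rule free_ext_hom[OF M g])
  have d: "?d \<in> mod_hom R (free_module R Y) ?F" by (rule free_ext_hom[OF F c])
  have el: "?e (lin_comb ?F (basis_elem R) l) = lin_comb M g l" if "set l \<subseteq> carrier R \<times> X" for l
    using hom_lin_comb[OF e F M that b] lin_comb_cong[OF that, of "\<lambda>x. ?e (basis_elem R x)" g]
      free_ext_basis[OF M g] by simp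
  have ey: "?e (cell_bd R y) = \<zero>\<^bsub>M\<^esub>" if "y \<in> Y" for y
    using that el bd unfolding Y by (auto simp del: cell_bd.simps)
  have 1: "?e (?d f) = \<zero>\<^bsub>M\<^esub>" if f: "f \<in> carrier (free_module R Y)" for f
  proof -
    have fin: "finite {y. f y \<noteq> \<zero>\<^bsub>R\<^esub>}" "{y. f y \<noteq> \<zero>\<^bsub>R\<^esub>} \<subseteq> Y" "\<And>y. f y \<in> carrier R"
      using f by (auto simp: free_module_sel)
    have df: "?d f = (\<Oplus>\<^bsub>?F\<^esub>y\<in>{y. f y \<noteq> \<zero>\<^bsub>R\<^esub>}. f y \<odot>\<^bsub>?F\<^esub> cell_bd R y)" using f by (simp add: free_ext_def)
    have "?e (?d f) = (\<Oplus>\<^bsub>M\<^esub>y\<in>{y. f y \<noteq> \<zero>\<^bsub>R\<^esub>}. ?e (f y \<odot>\<^bsub>?F\<^esub> cell_bd R y))"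
      unfolding df using fin c by (intro mod_hom_finsum[OF e F M]) auto
    also have "\<dots> = (\<Oplus>\<^bsub>M\<^esub>y\<in>{y. f y \<noteq> \<zero>\<^bsub>R\<^esub>}. \<zero>\<^bsub>M\<^esub>)"
      using fin c ey by (intro M.finsum_cong') (auto simp: mod_homD(4)[OF e] smult_r_zero subset_iff Pi_iff)
    finally show ?thesis by simp
  qed
  have 2: "\<exists>f\<in>carrier (free_module R Y). ?d f = x" if x: "x \<in> carrier ?F" and x0: "?e x = \<zero>\<^bsub>M\<^esub>" for x
  proof -
    let ?S = "{y. x y \<noteq> \<zero>\<^bsub>R\<^esub>}"
    have fin: "finite ?S" "?S \<subseteq> X" "\<And>y. x y \<in> carrier R" using x by (auto simp: free_module_sel)
    obtain xs where xs: "set xs = ?S" "distinct xs" using finite_distinct_list[OF fin(1)] by blast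
    define l where "l = map (\<lambda>y. (x y, y)) xs"
    have l: "set l \<subseteq> carrier R \<times> X" using fin xs by (auto simp: l_def)
    have "lin_comb ?F (basis_elem R) (map (\<lambda>y. (x y, y)) ys) = (\<Oplus>\<^bsub>?F\<^esub>y\<in>set ys. x y \<odot>\<^bsub>?F\<^esub> basis_elem R y)"
      if "distinct ys" "set ys \<subseteq> X" for ys
      using that
    proof (induction ys)
      case (Cons y ys)
      then show ?case
        using fin b by (simp add: lin_comb_def, subst F.M.finsum_insert) (auto intro!: F.smult_closed)
    qed (simp add: lin_comb_def)
    from this[OF xs(2)] have lx: "lin_comb ?F (basis_elem R) l = x"
      using fin xs free_module_expand[OF R x, symmetric] by (simp add: l_def)
    have "Rel l \<in> Y" unfolding Y using l el[OF l] lx x0 by auto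
    then have "?d (basis_elem R (Rel l)) = x" "basis_elem R (Rel l) \<in> carrier (free_module R Y)"
      using free_ext_basis[OF F c, of "Rel l"] bd lx basis_elem_closed[OF R] by auto
    then show ?thesis by blast
  qed
  show "exact_at (add_monoid (free_module R Y)) ?d (add_monoid ?F) ?e (add_monoid M)"
    unfolding exact_at_def kernel_def using 1 2 mod_homD(2)[OF d] by (auto simp: image_iff)
qed

lemma projective_resolution_free_res:
  assumes M: "left_module R M"
  shows "projective_resolution R M (free_res R M) (free_res_d R M) (free_res_aug R M)"
proof -
  interpret left_module R M by fact
  have R: "ring R" by unfold_locales
  have c0: "cell_elem \<in> cells R M 0 \<rightarrow> carrier M" by auto
  have e: "free_res_aug R M \<in> mod_hom R (free_res R M 0) M"
    unfolding free_res_aug_def free_res_def by (rule free_ext_hom[OF M c0])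
  have Y0: "cells R M (Suc 0) = {Rel l | l. set l \<subseteq> carrier R \<times> cells R M 0 \<and> lin_comb M cell_elem l = \<zero>\<^bsub>M\<^esub>}"
    by simp
  have YS: "cells R M (Suc (Suc n)) = {Rel l | l. set l \<subseteq> carrier R \<times> cells R M (Suc n) \<and>
       lin_comb (free_module R (cells R M n)) (cell_bd R) l = \<zero>\<^bsub>free_module R (cells R M n)\<^esub>}" for n
    by (simp add: lin_comb_free[of R UNIV _ _ "cells R M n"] free_module_sel)
  have F: "left_module R (free_module R X)" for X :: "('a, 'b) cell set" by (rule left_module_free[OF R])
  have c: "cell_bd R \<in> cells R M (Suc n) \<rightarrow> carrier (free_module R (cells R M n))" for n
  proof (induction n)
    case 0 show ?case by (rule relations_exact(1)[OF M c0 Y0])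
  next
    case (Suc n) show ?case by (rule relations_exact(1)[OF F Suc YS])
  qed
  have d: "free_res_d R M n \<in> mod_hom R (free_res R M (Suc n)) (free_res R M n)" for n
    unfolding free_res_d_def free_res_def by (rule free_ext_hom[OF F c])
  have s: "free_res_aug R M ` carrier (free_res R M 0) = carrier M"
  proof
    show "carrier M \<subseteq> free_res_aug R M ` carrier (free_res R M 0)"
    proof
      fix m assume "m \<in> carrier M"
      then have "Elem m \<in> cells R M 0" by simp
      from free_ext_basis[OF M c0 this] basis_elem_closed[OF R this]
      show "m \<in> free_res_aug R M ` carrier (free_res R M 0)"
        unfolding free_res_aug_def free_res_def by (metis cell_elem.simps imageI)
    qed
  qed (use mod_homD(2)[OF e] in auto)
  show ?thesis
    unfolding projective_resolution_def
    using e d s relations_exact(2)[OF M c0 Y0] relations_exact(2)[OF F c YS]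
    by (simp add: free_res_def projective_free[OF R] free_res_d_def free_res_aug_def)
qed


subsection \<open>Finiteness conditions\<close>

text \<open>
  In the next two definitions the type of the resolving modules is no restriction: every finitely
  generated projective module is isomorphic to a submodule of some \<open>R\<^sup>n\<close>, and if \<open>M\<close> has projective
  dimension at most \<open>n\<close>, then truncating \<^const>\<open>free_res\<close> at the \<open>n\<close>-th syzygy gives a resolution
  of the required type.
\<close>

definition has_fg_projective_resolution :: "'r ring \<Rightarrow> ('r, 'm) module \<Rightarrow> bool" where
  "has_fg_projective_resolution R M \<longleftrightarrow>
     (\<exists>(P :: nat \<Rightarrow> ('r, nat \<Rightarrow> 'r) module) d e.
        projective_resolution R M P d e \<and> (\<forall>n. fin_gen R (P n)))"

definition finite_projective_dimension :: "'r ring \<Rightarrow> ('r, 'm) module \<Rightarrow> bool" where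
  "finite_projective_dimension R M \<longleftrightarrow>
     (\<exists>(P :: nat \<Rightarrow> ('r, ('r, 'm) cell \<Rightarrow> 'r) module) d e n.
        projective_resolution R M P d e \<and> (\<forall>k>n. carrier (P k) = {\<zero>\<^bsub>P k\<^esub>}))"


section \<open>Ext\<close>

definition Ext :: "'r ring \<Rightarrow> ('r, 'm) module \<Rightarrow> ('r, 'n) module \<Rightarrow> nat \<Rightarrow>
    ((('r, 'm) cell \<Rightarrow> 'r) \<Rightarrow> 'n) set monoid" where
  "Ext R M N i =
     (let C = (\<lambda>n. hom_group R (free_res R M n) N);
          \<delta> = (\<lambda>n. precomp (free_res R M (Suc n)) (free_res_d R M n))
      in (C i)\<lparr>carrier := kernel (C i) (C (Suc i)) (\<delta> i)\<rparr> Mod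
           (case i of 0 \<Rightarrow> {\<one>\<^bsub>C 0\<^esub>} | Suc j \<Rightarrow> \<delta> j ` carrier (C j)))"


section \<open>Tensor products and Tor\<close>

text \<open>Throughout, \<open>A\<close> is a right \<open>S\<close>-module, i.e. a left module over \<^term>\<open>op_ring S\<close>.  The tensor
  product is the free abelian group on pairs modulo the usual relations; its elements are cosets.\<close>

definition tensor_relations :: "'s ring \<Rightarrow> ('s, 'a) module \<Rightarrow> ('s, 'm) module \<Rightarrow> ('a \<times> 'm \<Rightarrow>\<^sub>0 int) set" where
  "tensor_relations S A M =
     {frag_of (a \<oplus>\<^bsub>A\<^esub> b, m) - frag_of (a, m) - frag_of (b, m) | a b m.
        a \<in> carrier A \<and> b \<in> carrier A \<and> m \<in> carrier M} \<union>
     {frag_of (a, m \<oplus>\<^bsub>M\<^esub> n) - frag_of (a, m) - frag_of (a, n) | a m n.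
        a \<in> carrier A \<and> m \<in> carrier M \<and> n \<in> carrier M} \<union>
     {frag_of (s \<odot>\<^bsub>A\<^esub> a, m) - frag_of (a, s \<odot>\<^bsub>M\<^esub> m) | s a m.
        s \<in> carrier S \<and> a \<in> carrier A \<and> m \<in> carrier M}"

definition tensor_null :: "'s ring \<Rightarrow> ('s, 'a) module \<Rightarrow> ('s, 'm) module \<Rightarrow> ('a \<times> 'm \<Rightarrow>\<^sub>0 int) set" where
  "tensor_null S A M =
     generate (free_Abelian_group (carrier A \<times> carrier M)) (tensor_relations S A M)"

definition tensor_group :: "'s ring \<Rightarrow> ('s, 'a) module \<Rightarrow> ('s, 'm) module \<Rightarrow>
    ('a \<times> 'm \<Rightarrow>\<^sub>0 int) set monoid" where
  "tensor_group S A M = free_Abelian_group (carrier A \<times> carrier M) Mod tensor_null S A M"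

definition tensor_class :: "'s ring \<Rightarrow> ('s, 'a) module \<Rightarrow> ('s, 'm) module \<Rightarrow> ('a \<times> 'm \<Rightarrow>\<^sub>0 int) \<Rightarrow>
    ('a \<times> 'm \<Rightarrow>\<^sub>0 int) set" where
  "tensor_class S A M x = tensor_null S A M #>\<^bsub>free_Abelian_group (carrier A \<times> carrier M)\<^esub> x"

definition tensor_elem :: "'s ring \<Rightarrow> ('s, 'a) module \<Rightarrow> ('s, 'm) module \<Rightarrow> 'a \<Rightarrow> 'm \<Rightarrow>
    ('a \<times> 'm \<Rightarrow>\<^sub>0 int) set" where
  "tensor_elem S A M a m = tensor_class S A M (frag_of (a, m))"

text \<open>The map \<open>f \<otimes> g : A \<otimes>\<^sub>S M \<rightarrow> A' \<otimes>\<^sub>S M'\<close>.\<close>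

definition tensor_map :: "'s ring \<Rightarrow> ('s, 'a) module \<Rightarrow> ('s, 'm) module \<Rightarrow> ('s, 'b) module \<Rightarrow> ('s, 'n) module \<Rightarrow>
    ('a \<Rightarrow> 'b) \<Rightarrow> ('m \<Rightarrow> 'n) \<Rightarrow> ('a \<times> 'm \<Rightarrow>\<^sub>0 int) set \<Rightarrow> ('b \<times> 'n \<Rightarrow>\<^sub>0 int) set" where
  "tensor_map S A M A' M' f g = (\<lambda>c\<in>carrier (tensor_group S A M).
     the_elem ((\<lambda>x. tensor_class S A' M' (frag_extend (\<lambda>(a, m). frag_of (f a, g m)) x)) ` c))"

text \<open>\<open>Tor\<^sub>i\<^sup>S(A,M)\<close>, as the left derived functor of \<open>- \<otimes>\<^sub>S M\<close> evaluated at the right module \<open>A\<close>.\<close>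

definition Tor :: "'s ring \<Rightarrow> ('s, 'a) module \<Rightarrow> ('s, 'm) module \<Rightarrow> nat \<Rightarrow>
    ((('s, 'a) cell \<Rightarrow> 's) \<times> 'm \<Rightarrow>\<^sub>0 int) set set monoid" where
  "Tor S A M i =
     (let P = free_res (op_ring S) A;
          C = (\<lambda>n. tensor_group S (P n) M);
          bd = (\<lambda>n. tensor_map S (P (Suc n)) M (P n) M (free_res_d (op_ring S) A n) (id_hom M))
      in (C i)\<lparr>carrier := (case i of 0 \<Rightarrow> carrier (C 0) | Suc j \<Rightarrow> kernel (C (Suc j)) (C j) (bd j))\<rparr> Mod
           (bd i ` carrier (C (Suc i))))"


section \<open>Wakamatsu tilting modules\<close>

text \<open>\<open>End\<^sub>R(T)\<close> with \<open>s\<^sub>1 s\<^sub>2 = s\<^sub>2 \<circ> s\<^sub>1\<close>, and \<open>T\<close> as a right module over it via \<open>t s = s(t)\<close>.\<close>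

definition End_ring :: "'r ring \<Rightarrow> ('r, 't) module \<Rightarrow> ('t \<Rightarrow> 't) ring" where
  "End_ring R T = \<lparr>carrier = mod_hom R T T, monoid.mult = (\<lambda>f g. compose (carrier T) g f),
     one = id_hom T, ring.zero = \<one>\<^bsub>hom_group R T T\<^esub>, ring.add = monoid.mult (hom_group R T T)\<rparr>"

definition right_End_module :: "('r, 't) module \<Rightarrow> ('t \<Rightarrow> 't, 't) module" where
  "right_End_module T = \<lparr>carrier = carrier T, monoid.mult = undefined, one = undefined,
     ring.zero = \<zero>\<^bsub>T\<^esub>, ring.add = ring.add T, smult = (\<lambda>s t. s t)\<rparr>"

text \<open>\<open>T\<^sup>n\<close>\<close>

definition mod_power :: "('r, 't) module \<Rightarrow> nat \<Rightarrow> ('r, nat \<Rightarrow> 't) module" where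
  "mod_power T n = \<lparr>carrier = {..<n} \<rightarrow>\<^sub>E carrier T, monoid.mult = undefined, one = undefined,
     ring.zero = (\<lambda>i\<in>{..<n}. \<zero>\<^bsub>T\<^esub>), ring.add = (\<lambda>x y. \<lambda>i\<in>{..<n}. x i \<oplus>\<^bsub>T\<^esub> y i),
     smult = (\<lambda>r x. \<lambda>i\<in>{..<n}. r \<odot>\<^bsub>T\<^esub> x i)\<rparr>"

definition is_submodule :: "'r ring \<Rightarrow> 'm set \<Rightarrow> ('r, 'm) module \<Rightarrow> bool" where
  "is_submodule R U M \<longleftrightarrow> U \<subseteq> carrier M \<and> left_module R (M\<lparr>carrier := U\<rparr>)"

text \<open>\<open>X\<close> is isomorphic to a summand \<open>U\<close> in an internal decomposition \<open>M = U \<oplus> V\<close>.\<close>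

definition is_direct_summand :: "'r ring \<Rightarrow> ('r, 'x) module \<Rightarrow> ('r, 'm) module \<Rightarrow> bool" where
  "is_direct_summand R X M \<longleftrightarrow> (\<exists>U V. is_submodule R U M \<and> is_submodule R V M \<and>
     U \<inter> V = {\<zero>\<^bsub>M\<^esub>} \<and> U <+>\<^bsub>M\<^esub> V = carrier M \<and> mod_iso R X (M\<lparr>carrier := U\<rparr>) \<noteq> {})"

definition add_class :: "'r ring \<Rightarrow> ('r, 't) module \<Rightarrow> ('r, 'x) module set" where
  "add_class R T = {X. left_module R X \<and> (\<exists>n. is_direct_summand R X (mod_power T n))}"

text \<open>
  An exact sequence \<open>0 \<rightarrow> R \<rightarrow> X 0 \<rightarrow> X 1 \<rightarrow> \<dots>\<close> with terms in \<open>add(T)\<close>, maps \<open>u : R \<rightarrow> X 0\<close> and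
  \<open>d n : X n \<rightarrow> X (n+1)\<close>, which \<open>Hom\<^sub>R(-,T)\<close> turns into an exact sequence
  \<open>\<dots> \<rightarrow> Hom\<^sub>R(X 1,T) \<rightarrow> Hom\<^sub>R(X 0,T) \<rightarrow> Hom\<^sub>R(R,T) \<rightarrow> 0\<close>.  Up to isomorphism, all modules in
  \<open>add(T)\<close> are submodules of some \<open>T\<^sup>n\<close>, so their type is no restriction.
\<close>

definition has_add_coresolution :: "'r ring \<Rightarrow> ('r, 't) module \<Rightarrow> bool" where
  "has_add_coresolution R T \<longleftrightarrow>
     (\<exists>(X :: nat \<Rightarrow> ('r, nat \<Rightarrow> 't) module) d u.
        (let R0 = regular_module R; H = (\<lambda>n. hom_group R (X n) T) in
          (\<forall>n. X n \<in> add_class R T) \<and>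
          u \<in> mod_hom R R0 (X 0) \<and> (\<forall>n. d n \<in> mod_hom R (X n) (X (Suc n))) \<and>
          inj_on u (carrier R0) \<and>
          exact_at (add_monoid R0) u (add_monoid (X 0)) (d 0) (add_monoid (X 1)) \<and>
          (\<forall>n. exact_at (add_monoid (X n)) (d n) (add_monoid (X (Suc n))) (d (Suc n))
                 (add_monoid (X (Suc (Suc n))))) \<and>
          precomp R0 u ` carrier (H 0) = carrier (hom_group R R0 T) \<and>
          exact_at (H 1) (precomp (X 0) (d 0)) (H 0) (precomp R0 u) (hom_group R R0 T) \<and>
          (\<forall>n. exact_at (H (Suc (Suc n))) (precomp (X (Suc n)) (d (Suc n)))
                 (H (Suc n)) (precomp (X n) (d n)) (H n))))"

definition wakamatsu_tilting :: "'r ring \<Rightarrow> ('r, 't) module \<Rightarrow> bool" where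
  "wakamatsu_tilting R T \<longleftrightarrow> left_module R T \<and>
     has_fg_projective_resolution R T \<and>
     (\<forall>i>0. trivial_group (Ext R T T i)) \<and>
     has_add_coresolution R T"


section \<open>The adjunction \<open>T \<otimes>\<^sub>S - \<stileturn> Hom\<^sub>R(T,-)\<close> and the four subcategories\<close>

text \<open>\<open>T \<otimes>\<^sub>S M\<close> with \<open>r (t \<otimes> m) = (r t) \<otimes> m\<close>, for \<open>S = End\<^sub>R(T)\<close>.\<close>

definition tensor_obj :: "'r ring \<Rightarrow> ('r, 't) module \<Rightarrow> ('t \<Rightarrow> 't, 'm) module \<Rightarrow>
    ('r, ('t \<times> 'm \<Rightarrow>\<^sub>0 int) set) module" where
  "tensor_obj R T M =
     (let S = End_ring R T; A = right_End_module T; G = tensor_group S A M in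
       \<lparr>carrier = carrier G, monoid.mult = undefined, one = undefined,
        ring.zero = \<one>\<^bsub>G\<^esub>, ring.add = monoid.mult G,
        smult = (\<lambda>r. tensor_map S A M A M (\<lambda>t. r \<odot>\<^bsub>T\<^esub> t) (id_hom M))\<rparr>)"

definition tensor_arr :: "'r ring \<Rightarrow> ('r, 't) module \<Rightarrow> ('t \<Rightarrow> 't, 'm) module \<Rightarrow> ('t \<Rightarrow> 't, 'n) module \<Rightarrow>
    ('m \<Rightarrow> 'n) \<Rightarrow> ('t \<times> 'm \<Rightarrow>\<^sub>0 int) set \<Rightarrow> ('t \<times> 'n \<Rightarrow>\<^sub>0 int) set" where
  "tensor_arr R T M N f =
     tensor_map (End_ring R T) (right_End_module T) M (right_End_module T) N (id_hom T) f"

text \<open>\<open>Hom\<^sub>R(T,N)\<close> with \<open>(s f)(t) = f(t s)\<close>.\<close>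

definition hom_obj :: "'r ring \<Rightarrow> ('r, 't) module \<Rightarrow> ('r, 'n) module \<Rightarrow> ('t \<Rightarrow> 't, 't \<Rightarrow> 'n) module" where
  "hom_obj R T N = \<lparr>carrier = mod_hom R T N, monoid.mult = undefined, one = undefined,
     ring.zero = \<one>\<^bsub>hom_group R T N\<^esub>, ring.add = monoid.mult (hom_group R T N),
     smult = (\<lambda>s f. compose (carrier T) f s)\<rparr>"

definition hom_arr :: "'r ring \<Rightarrow> ('r, 't) module \<Rightarrow> ('r, 'm) module \<Rightarrow> ('r, 'n) module \<Rightarrow>
    ('m \<Rightarrow> 'n) \<Rightarrow> ('t \<Rightarrow> 'm) \<Rightarrow> 't \<Rightarrow> 'n" where
  "hom_arr R T M N g = (\<lambda>f\<in>mod_hom R T M. compose (carrier T) g f)"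

text \<open>\<open>m \<mapsto> (t \<mapsto> t \<otimes> m)\<close>\<close>

definition adj_unit :: "'r ring \<Rightarrow> ('r, 't) module \<Rightarrow> ('t \<Rightarrow> 't, 'm) module \<Rightarrow>
    'm \<Rightarrow> 't \<Rightarrow> ('t \<times> 'm \<Rightarrow>\<^sub>0 int) set" where
  "adj_unit R T M = (\<lambda>m\<in>carrier M. \<lambda>t\<in>carrier T.
     tensor_elem (End_ring R T) (right_End_module T) M t m)"

text \<open>\<open>t \<otimes> f \<mapsto> f(t)\<close>, extended \<open>\<int>\<close>-linearly to representatives of cosets\<close>

definition adj_counit :: "'r ring \<Rightarrow> ('r, 't) module \<Rightarrow> ('r, 'n) module \<Rightarrow>
    ('t \<times> ('t \<Rightarrow> 'n) \<Rightarrow>\<^sub>0 int) set \<Rightarrow> 'n" where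
  "adj_counit R T N = (\<lambda>c\<in>carrier (tensor_obj R T (hom_obj R T N)).
     the_elem ((\<lambda>x. \<Oplus>\<^bsub>N\<^esub>p\<in>Poly_Mapping.keys x.
                      [Poly_Mapping.lookup x p] \<cdot>\<^bsub>N\<^esub> (snd p) (fst p)) ` c))"

definition KT :: "'s ring \<Rightarrow> ('s, 'a) module \<Rightarrow> ('s, 'm) module set" where
  "KT S A = {M. left_module S M \<and> (\<forall>i>0. trivial_group (Tor S A M i))}"

definition KE :: "'r ring \<Rightarrow> ('r, 't) module \<Rightarrow> ('r, 'n) module set" where
  "KE R T = {N. left_module R N \<and> (\<forall>i>0. trivial_group (Ext R T N i))}"

definition auslander_class :: "'r ring \<Rightarrow> ('r, 't) module \<Rightarrow> ('t \<Rightarrow> 't, 'm) module set" where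
  "auslander_class R T = {M. left_module (End_ring R T) M \<and>
     (\<forall>i>0. trivial_group (Tor (End_ring R T) (right_End_module T) M i)) \<and>
     (\<forall>i>0. trivial_group (Ext R T (tensor_obj R T M) i)) \<and>
     adj_unit R T M \<in> mod_iso (End_ring R T) M (hom_obj R T (tensor_obj R T M))}"

definition bass_class :: "'r ring \<Rightarrow> ('r, 't) module \<Rightarrow> ('r, 'n) module set" where
  "bass_class R T = {N. left_module R N \<and>
     (\<forall>i>0. trivial_group (Ext R T N i)) \<and>
     (\<forall>i>0. trivial_group (Tor (End_ring R T) (right_End_module T) (hom_obj R T N) i)) \<and>
     adj_counit R T N \<in> mod_iso R (tensor_obj R T (hom_obj R T N)) N}"


section \<open>Functors and natural isomorphisms between full subcategories of module categories\<close>

text \<open>A set \<open>C\<close> of \<open>A\<close>-modules stands for the full subcategory of \<open>Mod(A)\<close> it spans.  The arrow map of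
  a functor takes the source and the target of an arrow as additional arguments.\<close>

definition module_functor :: "'a ring \<Rightarrow> ('a, 'm) module set \<Rightarrow> 'b ring \<Rightarrow> ('b, 'n) module set \<Rightarrow>
    (('a, 'm) module \<Rightarrow> ('b, 'n) module) \<Rightarrow>
    (('a, 'm) module \<Rightarrow> ('a, 'm) module \<Rightarrow> ('m \<Rightarrow> 'm) \<Rightarrow> 'n \<Rightarrow> 'n) \<Rightarrow> bool" where
  "module_functor A C B D Fo Fa \<longleftrightarrow>
     (\<forall>X\<in>C. Fo X \<in> D) \<and>
     (\<forall>X\<in>C. \<forall>Y\<in>C. \<forall>f\<in>mod_hom A X Y. Fa X Y f \<in> mod_hom B (Fo X) (Fo Y)) \<and>
     (\<forall>X\<in>C. Fa X X (id_hom X) = id_hom (Fo X)) \<and>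
     (\<forall>X\<in>C. \<forall>Y\<in>C. \<forall>Z\<in>C. \<forall>f\<in>mod_hom A X Y. \<forall>g\<in>mod_hom A Y Z.
        Fa X Z (compose (carrier X) g f) = compose (carrier (Fo X)) (Fa Y Z g) (Fa X Y f))"

text \<open>A natural isomorphism from \<open>(Fo, Fa)\<close> to \<open>(Go, Ga)\<close>, both defined on the full subcategory \<open>C\<close> of
  \<open>Mod(A)\<close> with values in \<open>Mod(B)\<close>.\<close>

definition natural_isomorphism :: "'a ring \<Rightarrow> ('a, 'm) module set \<Rightarrow> 'b ring \<Rightarrow>
    (('a, 'm) module \<Rightarrow> ('b, 'n) module) \<Rightarrow>
    (('a, 'm) module \<Rightarrow> ('a, 'm) module \<Rightarrow> ('m \<Rightarrow> 'm) \<Rightarrow> 'n \<Rightarrow> 'n) \<Rightarrow>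
    (('a, 'm) module \<Rightarrow> ('b, 'k) module) \<Rightarrow>
    (('a, 'm) module \<Rightarrow> ('a, 'm) module \<Rightarrow> ('m \<Rightarrow> 'm) \<Rightarrow> 'k \<Rightarrow> 'k) \<Rightarrow>
    (('a, 'm) module \<Rightarrow> 'n \<Rightarrow> 'k) \<Rightarrow> bool" where
  "natural_isomorphism A C B Fo Fa Go Ga \<eta> \<longleftrightarrow>
     (\<forall>X\<in>C. \<eta> X \<in> mod_iso B (Fo X) (Go X)) \<and>
     (\<forall>X\<in>C. \<forall>Y\<in>C. \<forall>f\<in>mod_hom A X Y.
        compose (carrier (Fo X)) (\<eta> Y) (Fa X Y f) = compose (carrier (Fo X)) (Ga X Y f) (\<eta> X))"

text \<open>
  \<open>T \<otimes>\<^sub>S -\<close> and \<open>Hom\<^sub>R(T,-)\<close> restrict to an adjoint equivalence between \<open>KT(T\<^sub>S)\<close> and \<open>KE(\<^sub>RT)\<close>.  A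
  module category contains modules carried by all types, and both functors change the type of the
  carrier; the two type arguments name the types \<open>'m\<close> and \<open>'n\<close> carrying the objects on which the
  two composites are evaluated, and the predicate is meant to be asserted for all \<open>'m\<close>, \<open>'n\<close>.
\<close>

definition tensor_hom_equivalence ::
  "'m itself \<Rightarrow> 'n itself \<Rightarrow> 'r ring \<Rightarrow> ('r, 't) module \<Rightarrow> bool" where
  "tensor_hom_equivalence TYPE('m) TYPE('n) R T \<longleftrightarrow>
     (let S = End_ring R T;
          T\<^sub>S = right_End_module T;
          C = (KT S T\<^sub>S :: ('t \<Rightarrow> 't, 'm) module set);
          D = (KE R T :: ('r, 'n) module set)
      in
       module_functor S C R (KE R T) (tensor_obj R T) (tensor_arr R T) \<and>
       module_functor R D S (KT S T\<^sub>S) (hom_obj R T) (hom_arr R T) \<and>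
       natural_isomorphism S C S (\<lambda>X. X) (\<lambda>X Y f. f)
         (\<lambda>X. hom_obj R T (tensor_obj R T X))
         (\<lambda>X Y f. hom_arr R T (tensor_obj R T X) (tensor_obj R T Y) (tensor_arr R T X Y f))
         (adj_unit R T) \<and>
       natural_isomorphism R D R
         (\<lambda>X. tensor_obj R T (hom_obj R T X))
         (\<lambda>X Y f. tensor_arr R T (hom_obj R T X) (hom_obj R T Y) (hom_arr R T X Y f))
         (\<lambda>X. X) (\<lambda>X Y f. f)
         (adj_counit R T) \<and>
       (\<forall>X\<in>C. compose (carrier (tensor_obj R T X)) (adj_counit R T (tensor_obj R T X))
            (tensor_arr R T X (hom_obj R T (tensor_obj R T X)) (adj_unit R T X))
          = id_hom (tensor_obj R T X)) \<and>
       (\<forall>X\<in>D. compose (carrier (hom_obj R T X))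
            (hom_arr R T (tensor_obj R T (hom_obj R T X)) X (adj_counit R T X))
            (adj_unit R T (hom_obj R T X))
          = id_hom (hom_obj R T X)))"

end

theory Submission
  imports Defs
begin

text \<open>
  Write \<open>X\<^sup>* = Hom\<^sub>R(X,T)\<close>, a right \<open>S\<close>-module.  A bilinear map \<open>T \<otimes>\<^sub>S U \<rightarrow> N\<close> induces maps
  \<open>\<theta> : X\<^sup>* \<otimes>\<^sub>S U \<rightarrow> Hom\<^sub>R(X,N)\<close>, natural in \<open>X\<close>.

  Let \<open>M\<close> be in \<open>KT(T\<^sub>S)\<close> and take \<open>U = M\<close>, \<open>N = T \<otimes> M\<close>.  Then \<open>\<theta>\<close> is bijective for \<open>X = R\<close>,
  hence for all \<open>X\<close> in \<open>add(R)\<close>; for \<open>X = T\<close> it is the unit.  As the projective dimension of \<open>T\<close> over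
  \<open>R\<close> is finite, the high syzygies of \<open>T\<close> are in \<open>add(R)\<close>, and one descends along
  \<open>0 \<rightarrow> \<Omega>' \<rightarrow> P \<rightarrow> \<Omega> \<rightarrow> 0\<close>, whose duals are exact because \<open>Ext(T,T) = 0\<close>: if \<open>\<theta>\<close> is bijective at \<open>\<Omega>'\<close>
  and \<open>Tor(\<Omega>'\<^sup>*,M) = 0\<close>, then both hold at \<open>\<Omega>\<close>, and \<open>Hom(P,N) \<rightarrow> Hom(\<Omega>',N)\<close> is onto, which says that
  \<open>Ext(T,N) = 0\<close>.

  Dually, let \<open>N\<close> be in \<open>KE(\<^sub>RT)\<close> and \<open>U = Hom\<^sub>R(T,N)\<close>.  Now \<open>\<theta>\<close> is bijective on \<open>add(T)\<close>; for
  \<open>X = R\<close> it is the counit.  The dual of the coresolution of \<open>R\<close> is a projective resolution of \<open>T\<^sub>S\<close>, so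
  finiteness of the projective dimension puts the high cosyzygies of \<open>R\<close> into \<open>add(T)\<close>, and one
  descends along the coresolution, using \<open>Ext(-,N)\<close> in place of \<open>Tor(-,M)\<close>.
\<close>

section \<open>Linear maps\<close>

text \<open>\<open>Ext\<close> and \<open>Tor\<close> are defined by canonical free resolutions,
  whereas the descents run along a resolution with finitely generated terms and along the dual of
  the coresolution. Vanishing therefore has to be independent of the resolution, and it has to pass
  along short exact sequences. Both are obtained directly from chain maps, homotopies and mapping
  cones, without long exact sequences. Vanishing is expressed by \<open>hom_acyclic\<close> and
  \<open>tensor_acyclic\<close>, which speak of elements; quotient groups disappear behind
  \<open>trivial_Ext_iff\<close> and \<open>trivial_Tor_iff\<close>. Ext(-,N) and Tor(-,M) are both
  resolved in the first variable with the second one fixed, so the same chain maps, homotopies and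
  cones serve both, and M itself is never resolved. Tensor products are handled on representatives,
  that is, formal integer combinations of pairs, modulo the subgroup \<open>tensor_null\<close>.
  Membership in add(Y) is replaced by \<open>retr\<close>, which consists of maps only, so that
  additive functors can be applied to it at once.\<close>

text \<open>In contrast to \<^const>\<open>mod_hom\<close>, nothing is required off the carrier, so that maps can be
  composed and added without restricting them.\<close>

definition lin :: "'r ring \<Rightarrow> ('r, 'm) module \<Rightarrow> ('r, 'n) module \<Rightarrow> ('m \<Rightarrow> 'n) \<Rightarrow> bool" where
  "lin R M N f \<longleftrightarrow> left_module R M \<and> left_module R N \<and> (\<forall>x\<in>carrier M. f x \<in> carrier N) \<and>
     (\<forall>x\<in>carrier M. \<forall>y\<in>carrier M. f (x \<oplus>\<^bsub>M\<^esub> y) = f x \<oplus>\<^bsub>N\<^esub> f y) \<and>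
     (\<forall>r\<in>carrier R. \<forall>x\<in>carrier M. f (r \<odot>\<^bsub>M\<^esub> x) = r \<odot>\<^bsub>N\<^esub> f x)"

lemma linI:
  assumes "left_module R M" "left_module R N"
    and "\<And>x. x \<in> carrier M \<Longrightarrow> f x \<in> carrier N"
    and "\<And>x y. x \<in> carrier M \<Longrightarrow> y \<in> carrier M \<Longrightarrow> f (x \<oplus>\<^bsub>M\<^esub> y) = f x \<oplus>\<^bsub>N\<^esub> f y"
    and "\<And>r x. r \<in> carrier R \<Longrightarrow> x \<in> carrier M \<Longrightarrow> f (r \<odot>\<^bsub>M\<^esub> x) = r \<odot>\<^bsub>N\<^esub> f x"
  shows "lin R M N f"
  using assms by (simp add: lin_def)

lemma linD:
  assumes "lin R M N f"
  shows "left_module R M" "left_module R N"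
    and "\<And>x. x \<in> carrier M \<Longrightarrow> f x \<in> carrier N"
    and "\<And>x y. x \<in> carrier M \<Longrightarrow> y \<in> carrier M \<Longrightarrow> f (x \<oplus>\<^bsub>M\<^esub> y) = f x \<oplus>\<^bsub>N\<^esub> f y"
    and "\<And>r x. r \<in> carrier R \<Longrightarrow> x \<in> carrier M \<Longrightarrow> f (r \<odot>\<^bsub>M\<^esub> x) = r \<odot>\<^bsub>N\<^esub> f x"
  using assms by (simp_all add: lin_def)

lemmas lin_closed = linD(3) and lin_add = linD(4) and lin_smult = linD(5)

lemma lin_mod_hom:
  "f \<in> mod_hom R M N \<Longrightarrow> left_module R M \<Longrightarrow> left_module R N \<Longrightarrow> lin R M N f"
  by (intro linI) (auto dest: mod_homD)

lemma restrict_mod_hom: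
  assumes "lin R M N f"
  shows "restrict f (carrier M) \<in> mod_hom R M N"
proof -
  interpret M: left_module R M by (rule linD[OF assms])
  show ?thesis using assms by (intro mod_homI) (auto simp: linD)
qed

lemma lin_cong:
  assumes "lin R M N f" "\<And>x. x \<in> carrier M \<Longrightarrow> f x = g x"
  shows "lin R M N g"
proof -
  interpret M: left_module R M by (rule linD[OF assms(1)])
  show ?thesis using linD[OF assms(1)] by (intro linI) (auto simp: assms(2)[symmetric])
qed

lemma lin_zero:
  assumes "lin R M N f" shows "f \<zero>\<^bsub>M\<^esub> = \<zero>\<^bsub>N\<^esub>"
proof -
  interpret M: left_module R M by (rule linD[OF assms])
  interpret N: left_module R N by (rule linD[OF assms])
  have "f \<zero>\<^bsub>M\<^esub> \<oplus>\<^bsub>N\<^esub> f \<zero>\<^bsub>M\<^esub> = f \<zero>\<^bsub>M\<^esub>"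
    using lin_add[OF assms, of "\<zero>\<^bsub>M\<^esub>" "\<zero>\<^bsub>M\<^esub>"] by simp
  then show ?thesis
    using lin_closed[OF assms, of "\<zero>\<^bsub>M\<^esub>"] by (metis M.M.zero_closed N.M.add.l_cancel_one')
qed

lemma lin_neg:
  assumes "lin R M N f" "x \<in> carrier M" shows "f (\<ominus>\<^bsub>M\<^esub> x) = \<ominus>\<^bsub>N\<^esub> f x"
proof -
  interpret M: left_module R M by (rule linD[OF assms(1)])
  interpret N: left_module R N by (rule linD[OF assms(1)])
  have "f (\<ominus>\<^bsub>M\<^esub> x) \<oplus>\<^bsub>N\<^esub> f x = \<zero>\<^bsub>N\<^esub>"
    using lin_add[OF assms(1), of "\<ominus>\<^bsub>M\<^esub> x" x] assms(2) by (simp add: M.M.l_neg lin_zero[OF assms(1)])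
  then show ?thesis using N.M.minus_equality assms lin_closed[OF assms(1)] by simp
qed

lemma lin_minus:
  assumes "lin R M N f" "x \<in> carrier M" "y \<in> carrier M"
  shows "f (x \<ominus>\<^bsub>M\<^esub> y) = f x \<ominus>\<^bsub>N\<^esub> f y"
proof -
  interpret M: left_module R M by (rule linD[OF assms(1)])
  show ?thesis using assms by (simp add: a_minus_def lin_add[OF assms(1)] lin_neg[OF assms(1)])
qed

lemma lin_finsum:
  assumes h: "lin R M N h" and F: "finite F" and g: "g \<in> F \<rightarrow> carrier M"
  shows "h (\<Oplus>\<^bsub>M\<^esub>x\<in>F. g x) = (\<Oplus>\<^bsub>N\<^esub>x\<in>F. h (g x))"
proof -
  interpret M: left_module R M by (rule linD[OF h])
  interpret N: left_module R N by (rule linD[OF h])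
  show ?thesis using F g
  proof (induction F)
    case (insert x F)
    then have "g \<in> F \<rightarrow> carrier M" "g x \<in> carrier M" by auto
    with insert show ?case
      by (subst M.M.finsum_insert; (subst N.M.finsum_insert)?) (auto simp: linD[OF h] Pi_iff)
  qed (simp add: lin_zero[OF h])
qed

lemma (in left_module) smult_neg:
  assumes "a \<in> carrier R" "x \<in> carrier M" shows "a \<odot>\<^bsub>M\<^esub> (\<ominus>\<^bsub>M\<^esub> x) = \<ominus>\<^bsub>M\<^esub> (a \<odot>\<^bsub>M\<^esub> x)"
proof -
  have "a \<odot>\<^bsub>M\<^esub> (\<ominus>\<^bsub>M\<^esub> x) \<oplus>\<^bsub>M\<^esub> a \<odot>\<^bsub>M\<^esub> x = \<zero>\<^bsub>M\<^esub>"
    using smult_r_distr[of a "\<ominus>\<^bsub>M\<^esub> x" x] assms by (simp add: M.l_neg smult_r_zero)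
  then show ?thesis using assms by (simp add: M.minus_equality)
qed

lemma (in left_module) neg_eq_smult:
  assumes "x \<in> carrier M" shows "\<ominus>\<^bsub>M\<^esub> x = (\<ominus> \<one>) \<odot>\<^bsub>M\<^esub> x"
proof -
  have "(\<ominus> \<one>) \<odot>\<^bsub>M\<^esub> x \<oplus>\<^bsub>M\<^esub> x = \<zero>\<^bsub>M\<^esub>"
    using smult_l_distr[of "\<ominus> \<one>" "\<one>" x] assms by (simp add: R.l_neg smult_l_zero)
  then show ?thesis using assms by (simp add: M.minus_equality)
qed

context abelian_group begin

lemma minus_eq_iff: "\<lbrakk>x \<in> carrier G; y \<in> carrier G; z \<in> carrier G\<rbrakk> \<Longrightarrow> x \<ominus> y = z \<longleftrightarrow> x = z \<oplus> y"
  by (metis a_assoc a_inv_closed l_neg minus_eq r_neg r_zero)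

lemma minus_eq_zero_iff: "\<lbrakk>x \<in> carrier G; y \<in> carrier G\<rbrakk> \<Longrightarrow> x \<ominus> y = \<zero> \<longleftrightarrow> x = y"
  by (simp add: minus_eq_iff)

lemma minus_zero_right: "x \<in> carrier G \<Longrightarrow> x \<ominus> \<zero> = x"
  by (simp add: minus_eq_iff)

lemma add_minus_distrib:
  "\<lbrakk>x \<in> carrier G; y \<in> carrier G; z \<in> carrier G; w \<in> carrier G\<rbrakk> \<Longrightarrow>
    (x \<oplus> y) \<ominus> (z \<oplus> w) = (x \<ominus> z) \<oplus> (y \<ominus> w)"
  by (simp add: minus_eq minus_add a_ac)

lemma minus_minus_cancel: "\<lbrakk>x \<in> carrier G; y \<in> carrier G\<rbrakk> \<Longrightarrow> x \<ominus> (x \<ominus> y) = y"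
  by (metis a_comm minus_closed minus_eq_iff)

end

lemma lin_id: "left_module R M \<Longrightarrow> lin R M M (\<lambda>x. x)"
  by (rule linI) auto

lemma lin_comp: "lin R M N f \<Longrightarrow> lin R N K g \<Longrightarrow> lin R M K (\<lambda>x. g (f x))"
  by (rule linI) (auto simp: linD)

lemma lin_zero_map: "left_module R M \<Longrightarrow> left_module R N \<Longrightarrow> lin R M N (\<lambda>_. \<zero>\<^bsub>N\<^esub>)"
  by (rule linI) (simp_all add: left_module.smult_r_zero abelian_groupE left_module.axioms abelian_group.axioms
    abelian_monoid.zero_closed abelian_monoid.l_zero)

lemma lin_add_map:
  assumes "lin R M N f" "lin R M N g"
  shows "lin R M N (\<lambda>x. f x \<oplus>\<^bsub>N\<^esub> g x)"
proof -
  interpret M: left_module R M by (rule linD[OF assms(1)])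
  interpret N: left_module R N by (rule linD[OF assms(1)])
  show ?thesis
    by (intro linI M.left_module_axioms N.left_module_axioms)
       (simp_all add: linD[OF assms(1)] linD[OF assms(2)] N.smult_r_distr N.M.a_ac)
qed

lemma lin_neg_map:
  assumes "lin R M N f"
  shows "lin R M N (\<lambda>x. \<ominus>\<^bsub>N\<^esub> f x)"
proof -
  interpret M: left_module R M by (rule linD[OF assms(1)])
  interpret N: left_module R N by (rule linD[OF assms(1)])
  show ?thesis
    by (intro linI M.left_module_axioms N.left_module_axioms)
       (simp_all add: linD[OF assms] N.smult_neg N.M.minus_add)
qed

lemma lin_minus_map:
  assumes "lin R M N f" "lin R M N g"
  shows "lin R M N (\<lambda>x. f x \<ominus>\<^bsub>N\<^esub> g x)"
  unfolding a_minus_def by (intro lin_add_map lin_neg_map assms)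

lemma lin_finsum_map:
  assumes "finite I" "\<And>i. i \<in> I \<Longrightarrow> lin R M N (f i)" "left_module R M" "left_module R N"
  shows "lin R M N (\<lambda>x. \<Oplus>\<^bsub>N\<^esub>i\<in>I. f i x)"
  using assms(1,2)
proof (induction I)
  case empty
  interpret N: left_module R N by fact
  show ?case by (simp add: lin_zero_map assms)
next
  case (insert j I)
  interpret N: left_module R N by fact
  have c: "f i x \<in> carrier N" if "i \<in> insert j I" "x \<in> carrier M" for i x
    using that by (intro lin_closed[OF insert.prems])
  show ?case
    by (rule lin_cong[OF lin_add_map[of _ _ _ "f j" "\<lambda>x. \<Oplus>\<^bsub>N\<^esub>i\<in>I. f i x"]])
       (use insert c in \<open>auto intro!: N.M.finsum_insert[symmetric]\<close>)
qed

section \<open>Submodules, images and lifting\<close>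

text \<open>Negatives come from scalars: -x equals (-1) x by \<open>neg_eq_smult\<close>, so closure
  under scalars provides them.\<close>

lemma left_module_submodule:
  fixes M :: "('r, 'm) module"
  assumes "left_module R M" "K \<subseteq> carrier M" "\<zero>\<^bsub>M\<^esub> \<in> K"
    and "\<And>x y. x \<in> K \<Longrightarrow> y \<in> K \<Longrightarrow> x \<oplus>\<^bsub>M\<^esub> y \<in> K"
    and "\<And>r x. r \<in> carrier R \<Longrightarrow> x \<in> K \<Longrightarrow> r \<odot>\<^bsub>M\<^esub> x \<in> K"
  shows "left_module R (M\<lparr>carrier := K\<rparr>)"
proof -
  interpret M: left_module R M by fact
  have K: "x \<in> K \<Longrightarrow> x \<in> carrier M" for x using assms(2) by auto
  have "abelian_group (M\<lparr>carrier := K\<rparr>)"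
  proof (rule abelian_groupI; simp)
    fix x assume x: "x \<in> K"
    then have "\<ominus>\<^bsub>M\<^esub> x \<in> K" using assms(5)[of "\<ominus>\<^bsub>R\<^esub> \<one>\<^bsub>R\<^esub>" x] M.neg_eq_smult[of x] K by simp
    with x K show "\<exists>y\<in>K. y \<oplus>\<^bsub>M\<^esub> x = \<zero>\<^bsub>M\<^esub>" by (auto simp: M.M.l_neg intro!: bexI[of _ "\<ominus>\<^bsub>M\<^esub> x"])
  qed (use K assms in \<open>auto simp: M.M.a_ac\<close>)
  then interpret K: abelian_group "M\<lparr>carrier := K\<rparr>" .
  show ?thesis
    by unfold_locales (use K assms in \<open>auto simp: M.smult_l_distr M.smult_r_distr M.smult_assoc1\<close>)
qed

text \<open>An image stands in for the quotient of \<open>M\<close> by the kernel of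
  \<open>f\<close>. Syzygies and cosyzygies thus are submodules with the type of the ambient term,
  and no quotient modules are formed.\<close>

definition img :: "('r, 'm) module \<Rightarrow> ('r, 'n) module \<Rightarrow> ('m \<Rightarrow> 'n) \<Rightarrow> ('r, 'n) module" where
  "img M N f = N\<lparr>carrier := f ` carrier M\<rparr>"

lemma img_sel [simp]:
  "carrier (img M N f) = f ` carrier M" "\<zero>\<^bsub>img M N f\<^esub> = \<zero>\<^bsub>N\<^esub>"
  "x \<oplus>\<^bsub>img M N f\<^esub> y = x \<oplus>\<^bsub>N\<^esub> y" "r \<odot>\<^bsub>img M N f\<^esub> x = r \<odot>\<^bsub>N\<^esub> x"
  by (simp_all add: img_def)

lemma left_module_img:
  assumes "lin R M N f"
  shows "left_module R (img M N f)"
proof -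
  interpret M: left_module R M by (rule linD[OF assms])
  show ?thesis unfolding img_def
    by (rule left_module_submodule)
       (use linD[OF assms] lin_zero[OF assms] in \<open>auto simp: image_iff\<close>, metis M.M.zero_closed, metis M.M.a_closed, metis M.smult_closed)
qed

lemma lin_to_img: "lin R M N f \<Longrightarrow> lin R M (img M N f) f"
  by (rule linI) (auto simp: linD left_module_img)

lemma lin_from_img: "lin R M N f \<Longrightarrow> lin R (img M N f) N (\<lambda>x. x)"
  by (rule linI) (auto simp: linD left_module_img)

lemma lin_img_cod:
  assumes "lin R M N f" "lin R K N g" "\<And>x. x \<in> carrier K \<Longrightarrow> g x \<in> f ` carrier M"
  shows "lin R K (img M N f) g"
  using assms by (intro linI) (auto simp: linD left_module_img)

text \<open>\<open>C\<close> is the quotient of \<open>B\<close> by the kernel of \<open>p\<close>.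
  The map \<open>g\<close> is \<open>f\<close> after a set-theoretic section \<open>s\<close> of
  \<open>p\<close>; two preimages of the same element differ by an element of the kernel, on which
  \<open>f\<close> vanishes, and this makes the composite linear.\<close>

lemma lin_factor:
  assumes p: "lin R B C p" "p ` carrier B = carrier C" and f: "lin R B N f"
    and k: "\<And>x. x \<in> carrier B \<Longrightarrow> p x = \<zero>\<^bsub>C\<^esub> \<Longrightarrow> f x = \<zero>\<^bsub>N\<^esub>"
  obtains g where "lin R C N g" "\<And>x. x \<in> carrier B \<Longrightarrow> g (p x) = f x"
proof -
  interpret B: left_module R B by (rule linD[OF f])
  interpret N: left_module R N by (rule linD[OF f])
  interpret C: left_module R C by (rule linD[OF p(1)])
  define s where "s y = (SOME x. x \<in> carrier B \<and> p x = y)" for y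
  have s: "s y \<in> carrier B \<and> p (s y) = y" if "y \<in> carrier C" for y
  proof -
    have "y \<in> p ` carrier B" using that p(2) by simp
    then have "\<exists>x. x \<in> carrier B \<and> p x = y" by (metis imageE)
    then show ?thesis unfolding s_def by (rule someI_ex)
  qed
  have eq: "f x = f y" if "x \<in> carrier B" "y \<in> carrier B" "p x = p y" for x y
  proof -
    have "f (x \<ominus>\<^bsub>B\<^esub> y) = \<zero>\<^bsub>N\<^esub>"
      using that k[of "x \<ominus>\<^bsub>B\<^esub> y"] lin_closed[OF p(1)]
      by (simp add: lin_minus[OF p(1)] C.M.minus_eq_zero_iff)
    then show ?thesis using that lin_closed[OF f] by (simp add: lin_minus[OF f] N.M.minus_eq_zero_iff)
  qed
  have "f (s (x \<oplus>\<^bsub>C\<^esub> y)) = f (s x) \<oplus>\<^bsub>N\<^esub> f (s y)" if "x \<in> carrier C" "y \<in> carrier C" for x y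
    using that s eq[of "s (x \<oplus>\<^bsub>C\<^esub> y)" "s x \<oplus>\<^bsub>B\<^esub> s y"] by (simp add: lin_add[OF p(1)] lin_add[OF f])
  moreover have "f (s (r \<odot>\<^bsub>C\<^esub> x)) = r \<odot>\<^bsub>N\<^esub> f (s x)" if "x \<in> carrier C" "r \<in> carrier R" for x r
    using that s eq[of "s (r \<odot>\<^bsub>C\<^esub> x)" "r \<odot>\<^bsub>B\<^esub> s x"] by (simp add: lin_smult[OF p(1)] lin_smult[OF f])
  ultimately have "lin R C N (\<lambda>y. f (s y))"
    using s lin_closed[OF f] by (intro linI C.left_module_axioms N.left_module_axioms) auto
  moreover have "f (s (p x)) = f x" if "x \<in> carrier B" for x
    using that s[of "p x"] lin_closed[OF p(1)] eq by blast
  ultimately show ?thesis using that by blast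
qed

lemma projective_module: "projective R P \<Longrightarrow> left_module R P"
  by (simp add: projective_def)

text \<open>The lifting takes place against the corestriction of \<open>f\<close> to its image, so
  \<open>f\<close> may be a differential; \<open>im\<close> is then supplied by exactness.\<close>

lemma lift_image:
  assumes P: "projective R P" and f: "lin R A B f" and h: "lin R P B h"
    and im: "\<And>x. x \<in> carrier P \<Longrightarrow> \<exists>a\<in>carrier A. f a = h x"
  obtains k where "lin R P A k" "\<And>x. x \<in> carrier P \<Longrightarrow> f (k x) = h x"
proof -
  have A: "left_module R A" using f by (rule linD)
  have "restrict f (carrier A) \<in> mod_hom R A (img A B f)"
    by (rule restrict_mod_hom[OF lin_to_img[OF f]])
  moreover have "lin R P (img A B f) h" by (rule lin_img_cod[OF f h]) (use im in force)
  then have "restrict h (carrier P) \<in> mod_hom R P (img A B f)" by (rule restrict_mod_hom)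
  ultimately obtain k where k: "k \<in> mod_hom R P A"
    "compose (carrier P) (restrict f (carrier A)) k = restrict h (carrier P)"
    using projective_lift[OF P A left_module_img[OF f], of "restrict f (carrier A)" "restrict h (carrier P)"]
    by force
  have "f (k x) = h x" if "x \<in> carrier P" for x
    using fun_cong[OF k(2), of x] that mod_homD(2)[OF k(1)] by (simp add: compose_def)
  then show ?thesis using that lin_mod_hom[OF k(1) projective_module[OF P] A] by blast
qed

text \<open>A lift of h r on \<open>Q\<close>, composed with \<open>s\<close>, lifts h, because r s
  is the identity.\<close>

lemma projectiveI_retract:
  assumes s: "lin R P Q s" and r: "lin R Q P r" and rs: "\<And>x. x \<in> carrier P \<Longrightarrow> r (s x) = x"
    and Q: "projective R Q"
  shows "projective R P"
  unfolding projective_def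
proof (intro conjI allI impI ballI)
  show P: "left_module R P" using s by (rule linD)
  fix A :: "('a, 'b \<Rightarrow> 'a) module" and B :: "('a, 'b) module" and g h
  assume A: "left_module R A" and B: "left_module R B" and g: "g \<in> mod_hom R A B"
    and gs: "g ` carrier A = carrier B" and h: "h \<in> mod_hom R P B"
  have hl: "lin R P B h" by (rule lin_mod_hom[OF h P B])
  have ex: "\<exists>a\<in>carrier A. g a = h (r x)" if "x \<in> carrier Q" for x
    using gs lin_closed[OF hl lin_closed[OF r that]] by (metis imageE)
  obtain k where k: "lin R Q A k" "\<And>x. x \<in> carrier Q \<Longrightarrow> g (k x) = h (r x)"
    by (rule lift_image[OF Q lin_mod_hom[OF g A B] lin_comp[OF r hl]]) (use ex in auto)
  have "compose (carrier P) g (restrict (\<lambda>x. k (s x)) (carrier P)) = h"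
    using mod_homD(1)[OF h] by (intro extensionalityI[of _ "carrier P"])
      (auto simp: compose_def k(2) lin_closed[OF s] rs PiE_def)
  with restrict_mod_hom[OF lin_comp[OF s k(1)]]
  show "\<exists>k\<in>mod_hom R P A. compose (carrier P) g k = h" by blast
qed

section \<open>Direct sums\<close>

definition dsum :: "('r, 'm) module \<Rightarrow> ('r, 'n) module \<Rightarrow> ('r, 'm \<times> 'n) module" where
  "dsum M N = \<lparr>carrier = carrier M \<times> carrier N, monoid.mult = undefined, one = undefined,
     ring.zero = (\<zero>\<^bsub>M\<^esub>, \<zero>\<^bsub>N\<^esub>), ring.add = (\<lambda>x y. (fst x \<oplus>\<^bsub>M\<^esub> fst y, snd x \<oplus>\<^bsub>N\<^esub> snd y)),
     smult = (\<lambda>r x. (r \<odot>\<^bsub>M\<^esub> fst x, r \<odot>\<^bsub>N\<^esub> snd x))\<rparr>"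

lemma dsum_sel [simp]:
  "carrier (dsum M N) = carrier M \<times> carrier N" "\<zero>\<^bsub>dsum M N\<^esub> = (\<zero>\<^bsub>M\<^esub>, \<zero>\<^bsub>N\<^esub>)"
  "x \<oplus>\<^bsub>dsum M N\<^esub> y = (fst x \<oplus>\<^bsub>M\<^esub> fst y, snd x \<oplus>\<^bsub>N\<^esub> snd y)"
  "r \<odot>\<^bsub>dsum M N\<^esub> x = (r \<odot>\<^bsub>M\<^esub> fst x, r \<odot>\<^bsub>N\<^esub> snd x)"
  by (simp_all add: dsum_def)

lemma left_module_dsum:
  assumes "left_module R M" "left_module R N"
  shows "left_module R (dsum M N)"
proof -
  interpret M: left_module R M by fact
  interpret N: left_module R N by fact
  have "abelian_group (dsum M N)"
  proof (rule abelian_groupI)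
    fix x assume "x \<in> carrier (dsum M N)"
    then show "\<exists>y\<in>carrier (dsum M N). y \<oplus>\<^bsub>dsum M N\<^esub> x = \<zero>\<^bsub>dsum M N\<^esub>"
      by (intro bexI[of _ "(\<ominus>\<^bsub>M\<^esub> fst x, \<ominus>\<^bsub>N\<^esub> snd x)"]) (auto simp: M.M.l_neg N.M.l_neg)
  qed (auto simp: M.M.a_ac N.M.a_ac)
  then interpret abelian_group "dsum M N" .
  show ?thesis
    by unfold_locales (auto simp: M.smult_l_distr N.smult_l_distr M.smult_r_distr N.smult_r_distr
      M.smult_assoc1 N.smult_assoc1)
qed

lemma
  assumes "left_module R M" "left_module R N"
  shows lin_fst: "lin R (dsum M N) M fst" and lin_snd: "lin R (dsum M N) N snd"
  using assms by (auto intro!: linI left_module_dsum)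

lemma
  assumes "left_module R M" "left_module R N"
  shows lin_inl: "lin R M (dsum M N) (\<lambda>x. (x, \<zero>\<^bsub>N\<^esub>))"
    and lin_inr: "lin R N (dsum M N) (\<lambda>x. (\<zero>\<^bsub>M\<^esub>, x))"
proof -
  interpret M: left_module R M by fact
  interpret N: left_module R N by fact
  show "lin R M (dsum M N) (\<lambda>x. (x, \<zero>\<^bsub>N\<^esub>))" "lin R N (dsum M N) (\<lambda>x. (\<zero>\<^bsub>M\<^esub>, x))"
    using assms by (auto intro!: linI left_module_dsum simp: M.smult_r_zero N.smult_r_zero)
qed

lemma lin_pair:
  assumes "lin R K M f" "lin R K N g"
  shows "lin R K (dsum M N) (\<lambda>x. (f x, g x))"
  by (rule linI) (auto simp: linD[OF assms(1)] linD[OF assms(2)] left_module_dsum)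

text \<open>Needed for mapping cones, whose terms are direct sums. Lifts on the two summands are
  found separately and added.\<close>

lemma projective_dsum:
  assumes M: "projective R M" and N: "projective R N"
  shows "projective R (dsum M N)"
  unfolding projective_def
proof (intro conjI allI impI ballI)
  have m: "left_module R M" "left_module R N" using M N by (auto simp: projective_def)
  show MN: "left_module R (dsum M N)" by (rule left_module_dsum[OF m])
  interpret M: left_module R M by fact
  interpret N: left_module R N by fact
  fix A :: "('a, 'b \<times> 'c \<Rightarrow> 'a) module" and B :: "('a, 'b \<times> 'c) module" and g h
  assume A: "left_module R A" and B: "left_module R B" and g: "g \<in> mod_hom R A B"
    and gs: "g ` carrier A = carrier B" and h: "h \<in> mod_hom R (dsum M N) B"
  have hl: "lin R (dsum M N) B h" by (rule lin_mod_hom[OF h MN B])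
  have gl: "lin R A B g" by (rule lin_mod_hom[OF g A B])
  have s: "\<exists>a\<in>carrier A. g a = h x" if "x \<in> carrier (dsum M N)" for x
    using gs lin_closed[OF hl that] by (metis imageE)
  obtain k1 where k1: "lin R M A k1" "\<And>x. x \<in> carrier M \<Longrightarrow> g (k1 x) = h (x, \<zero>\<^bsub>N\<^esub>)"
    by (rule lift_image[OF M gl lin_comp[OF lin_inl[OF m] hl]]) (use s in auto)
  obtain k2 where k2: "lin R N A k2" "\<And>x. x \<in> carrier N \<Longrightarrow> g (k2 x) = h (\<zero>\<^bsub>M\<^esub>, x)"
    by (rule lift_image[OF N gl lin_comp[OF lin_inr[OF m] hl]]) (use s in auto)
  let ?k = "\<lambda>x. k1 (fst x) \<oplus>\<^bsub>A\<^esub> k2 (snd x)"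
  have k: "lin R (dsum M N) A ?k"
    by (intro lin_add_map lin_comp[OF lin_fst[OF m] k1(1)] lin_comp[OF lin_snd[OF m] k2(1)])
  have "g (?k x) = h x" if "x \<in> carrier (dsum M N)" for x
    using that lin_add[OF hl, of "(fst x, \<zero>\<^bsub>N\<^esub>)" "(\<zero>\<^bsub>M\<^esub>, snd x)"]
    by (auto simp: lin_add[OF gl] lin_closed[OF k1(1)] lin_closed[OF k2(1)] k1(2) k2(2))
  then have "compose (carrier (dsum M N)) g (restrict ?k (carrier (dsum M N))) = h"
    using mod_homD(1)[OF h] by (intro extensionalityI[of _ "carrier (dsum M N)"])
      (auto simp: compose_def PiE_def)
  with restrict_mod_hom[OF k]
  show "\<exists>k\<in>mod_hom R (dsum M N) A. compose (carrier (dsum M N)) g k = h" by blast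
qed

section \<open>Projective resolutions\<close>

text \<open>\<open>projective_resolution\<close> with \<open>lin\<close> for \<open>mod_hom\<close>
  and with exactness on elements. Differentials may be arbitrary off the carriers, which admits
  those of mapping cones and the maps \<open>precomp\<close>.\<close>

definition resol ::
  "'r ring \<Rightarrow> ('r, 'm) module \<Rightarrow> (nat \<Rightarrow> ('r, 'p) module) \<Rightarrow> (nat \<Rightarrow> 'p \<Rightarrow> 'p) \<Rightarrow> ('p \<Rightarrow> 'm) \<Rightarrow> bool" where
  "resol R X P d e \<longleftrightarrow> (\<forall>n. projective R (P n)) \<and> (\<forall>n. lin R (P (Suc n)) (P n) (d n)) \<and>
     lin R (P 0) X e \<and> e ` carrier (P 0) = carrier X \<and>
     (\<forall>x\<in>carrier (P 0). e x = \<zero>\<^bsub>X\<^esub> \<longleftrightarrow> x \<in> d 0 ` carrier (P (Suc 0))) \<and>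
     (\<forall>n. \<forall>x\<in>carrier (P (Suc n)). d n x = \<zero>\<^bsub>P n\<^esub> \<longleftrightarrow> x \<in> d (Suc n) ` carrier (P (Suc (Suc n))))"

lemma exact_at_add_monoid:
  "exact_at (add_monoid A) f (add_monoid B) g (add_monoid C) \<longleftrightarrow>
    f ` carrier A = {x \<in> carrier B. g x = \<zero>\<^bsub>C\<^esub>}"
  by (simp add: exact_at_def kernel_def)

lemma resolI:
  assumes "projective_resolution R X P d e" "left_module R X"
  shows "resol R X P d e"
  using assms unfolding projective_resolution_def resol_def exact_at_add_monoid
  by (auto simp: lin_mod_hom projective_module)

lemma resolD:
  assumes "resol R X P d e"
  shows "projective R (P n)" "lin R (P (Suc n)) (P n) (d n)" "lin R (P 0) X e"
    "z \<in> carrier X \<Longrightarrow> \<exists>y\<in>carrier (P 0). e y = z"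
    "x \<in> carrier (P (Suc 0)) \<Longrightarrow> e (d 0 x) = \<zero>\<^bsub>X\<^esub>"
    "x \<in> carrier (P (Suc (Suc n))) \<Longrightarrow> d n (d (Suc n) x) = \<zero>\<^bsub>P n\<^esub>"
    "x \<in> carrier (P 0) \<Longrightarrow> e x = \<zero>\<^bsub>X\<^esub> \<Longrightarrow> \<exists>y\<in>carrier (P (Suc 0)). d 0 y = x"
    "x \<in> carrier (P (Suc n)) \<Longrightarrow> d n x = \<zero>\<^bsub>P n\<^esub> \<Longrightarrow> \<exists>y\<in>carrier (P (Suc (Suc n))). d (Suc n) y = x"
proof -
  note r = assms[unfolded resol_def]
  show "projective R (P n)" and 1: "\<And>n. lin R (P (Suc n)) (P n) (d n)" "lin R (P 0) X e" using r by auto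
  show "z \<in> carrier X \<Longrightarrow> \<exists>y\<in>carrier (P 0). e y = z" using r by (metis imageE)
  show "x \<in> carrier (P (Suc 0)) \<Longrightarrow> e (d 0 x) = \<zero>\<^bsub>X\<^esub>"
    using r lin_closed[OF 1(1), of x 0] by simp
  show "x \<in> carrier (P (Suc (Suc n))) \<Longrightarrow> d n (d (Suc n) x) = \<zero>\<^bsub>P n\<^esub>"
    using r lin_closed[OF 1(1), of x "Suc n"] by simp
  show "x \<in> carrier (P 0) \<Longrightarrow> e x = \<zero>\<^bsub>X\<^esub> \<Longrightarrow> \<exists>y\<in>carrier (P (Suc 0)). d 0 y = x" using r by (metis imageE)
  show "x \<in> carrier (P (Suc n)) \<Longrightarrow> d n x = \<zero>\<^bsub>P n\<^esub> \<Longrightarrow> \<exists>y\<in>carrier (P (Suc (Suc n))). d (Suc n) y = x"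
    using r by (metis imageE)
qed

lemma resol_module: "resol R X P d e \<Longrightarrow> left_module R (P n)"
  by (simp add: projective_module resolD)

lemma resol_free_res: "left_module R M \<Longrightarrow> resol R M (free_res R M) (free_res_d R M) (free_res_aug R M)"
  by (intro resolI projective_resolution_free_res)

text \<open>Comparison theorem: the components are built degree by degree, each from projectivity of
  \<open>P n\<close> and exactness of \<open>Q\<close>.\<close>

lemma chain_map_exists:
  assumes P: "resol R X P d e" and Q: "resol R Y Q d' e'" and f: "lin R X Y f"
  obtains \<phi> where "\<And>n. lin R (P n) (Q n) (\<phi> n)"
    "\<And>x. x \<in> carrier (P 0) \<Longrightarrow> e' (\<phi> 0 x) = f (e x)"
    "\<And>n x. x \<in> carrier (P (Suc n)) \<Longrightarrow> d' n (\<phi> (Suc n) x) = \<phi> n (d n x)"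
proof -
  note p = resolD[OF P] and q = resolD[OF Q]
  \<comment> \<open>The last conjunct is what the next degree requires: \<phi> d takes values in the
    image of the next differential of \<open>Q\<close>, so it can be lifted through it.\<close>
  define I where "I n \<phi> \<longleftrightarrow> lin R (P n) (Q n) \<phi> \<and> (n = 0 \<longrightarrow> (\<forall>x\<in>carrier (P 0). e' (\<phi> x) = f (e x))) \<and>
     (\<forall>x\<in>carrier (P (Suc n)). \<exists>y\<in>carrier (Q (Suc n)). d' n y = \<phi> (d n x))" for n \<phi>
  have "\<exists>\<phi>. \<forall>n. I n (\<phi> n) \<and> (\<forall>x\<in>carrier (P (Suc n)). d' n (\<phi> (Suc n) x) = \<phi> n (d n x))"
    (is "\<exists>\<phi>. ?Q \<phi>")
  proof (rule dependent_nat_choice)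
    obtain k where k: "lin R (P 0) (Q 0) k" "\<And>x. x \<in> carrier (P 0) \<Longrightarrow> e' (k x) = f (e x)"
      by (rule lift_image[OF p(1) q(3) lin_comp[OF p(3) f]])
         (use q(4) lin_closed[OF f] lin_closed[OF p(3)] in auto)
    have "\<exists>y\<in>carrier (Q (Suc 0)). d' 0 y = k (d 0 x)" if "x \<in> carrier (P (Suc 0))" for x
      using that k p(5) lin_zero[OF f] lin_closed[OF p(2)] lin_closed[OF k(1)] by (intro q(7)) auto
    with k show "\<exists>\<phi>. I 0 \<phi>" by (auto simp: I_def)
  next
    fix \<phi> n assume I: "I n \<phi>"
    then have \<phi>: "lin R (P n) (Q n) \<phi>" by (simp add: I_def)
    obtain k where k: "lin R (P (Suc n)) (Q (Suc n)) k" "\<And>x. x \<in> carrier (P (Suc n)) \<Longrightarrow> d' n (k x) = \<phi> (d n x)"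
      by (rule lift_image[OF p(1) q(2) lin_comp[OF p(2) \<phi>]]) (use I in \<open>auto simp: I_def\<close>)
    have "\<exists>y\<in>carrier (Q (Suc (Suc n))). d' (Suc n) y = k (d (Suc n) x)" if "x \<in> carrier (P (Suc (Suc n)))" for x
      using that k p(6) lin_zero[OF \<phi>] lin_closed[OF p(2)] lin_closed[OF k(1)] by (intro q(8)) auto
    with k show "\<exists>y. I (Suc n) y \<and> (\<forall>x\<in>carrier (P (Suc n)). d' n (y x) = \<phi> (d n x))" by (auto simp: I_def)
  qed
  then obtain \<phi> where "?Q \<phi>" ..
  then show ?thesis by (intro that[of \<phi>]) (auto simp: I_def)
qed

text \<open>A chain map over the zero map is contracted degree by degree. The homotopy identity is
  recorded in positive degrees, the only ones on which Ext and Tor of positive index depend.\<close>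

lemma null_homotopy_exists:
  assumes P: "resol R X P d e" and Q: "resol R Y Q d' e'" and \<phi>: "\<And>n. lin R (P n) (Q n) (\<phi> n)"
    and \<phi>0: "\<And>x. x \<in> carrier (P 0) \<Longrightarrow> e' (\<phi> 0 x) = \<zero>\<^bsub>Y\<^esub>"
    and \<phi>d: "\<And>n x. x \<in> carrier (P (Suc n)) \<Longrightarrow> d' n (\<phi> (Suc n) x) = \<phi> n (d n x)"
  obtains h where "\<And>n. lin R (P n) (Q (Suc n)) (h n)"
    "\<And>n x. x \<in> carrier (P (Suc n)) \<Longrightarrow> \<phi> (Suc n) x = d' (Suc n) (h (Suc n) x) \<oplus>\<^bsub>Q (Suc n)\<^esub> h n (d n x)"
proof -
  note p = resolD[OF P] and q = resolD[OF Q]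
  \<comment> \<open>The invariant says that \<phi> - h d in degree n + 1 is annihilated by d'.
    Exactness and projectivity then lift it through the next differential, and the lift is the next
    component of h.\<close>
  define I where "I n h \<longleftrightarrow> lin R (P n) (Q (Suc n)) h \<and>
     (\<forall>x\<in>carrier (P (Suc n)). d' n (h (d n x)) = d' n (\<phi> (Suc n) x))" for n h
  have "\<exists>h. \<forall>n. I n (h n) \<and> (\<forall>x\<in>carrier (P (Suc n)).
     \<phi> (Suc n) x = d' (Suc n) (h (Suc n) x) \<oplus>\<^bsub>Q (Suc n)\<^esub> h n (d n x))"
    (is "\<exists>h. ?Q h")
  proof (rule dependent_nat_choice)
    obtain k where k: "lin R (P 0) (Q (Suc 0)) k" "\<And>x. x \<in> carrier (P 0) \<Longrightarrow> d' 0 (k x) = \<phi> 0 x"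
      by (rule lift_image[OF p(1) q(2) \<phi>]) (use q(7) \<phi>0 lin_closed[OF \<phi>] in auto)
    then show "\<exists>h. I 0 h" using \<phi>d lin_closed[OF p(2)] by (auto simp: I_def)
  next
    fix h n assume I: "I n h"
    then have h: "lin R (P n) (Q (Suc n)) h" by (simp add: I_def)
    interpret Q: left_module R "Q (Suc n)" by (rule resol_module[OF Q])
    interpret Qn: left_module R "Q n" by (rule resol_module[OF Q])
    let ?g = "\<lambda>x. \<phi> (Suc n) x \<ominus>\<^bsub>Q (Suc n)\<^esub> h (d n x)"
    have g: "lin R (P (Suc n)) (Q (Suc n)) ?g" by (intro lin_minus_map \<phi> lin_comp[OF p(2) h])
    have "d' n (?g x) = \<zero>\<^bsub>Q n\<^esub>" if "x \<in> carrier (P (Suc n))" for x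
      using that I lin_closed[OF \<phi>] lin_closed[OF h] lin_closed[OF p(2)] lin_closed[OF q(2)]
      by (simp add: I_def lin_minus[OF q(2)] Qn.M.minus_eq_zero_iff)
    then have "\<exists>y\<in>carrier (Q (Suc (Suc n))). d' (Suc n) y = ?g x" if "x \<in> carrier (P (Suc n))" for x
      using that q(8) lin_closed[OF g] by blast
    then obtain k where k: "lin R (P (Suc n)) (Q (Suc (Suc n))) k"
      "\<And>x. x \<in> carrier (P (Suc n)) \<Longrightarrow> d' (Suc n) (k x) = ?g x"
      by (rule lift_image[OF p(1) q(2) g]) auto
    have "d' (Suc n) (k (d (Suc n) x)) = d' (Suc n) (\<phi> (Suc (Suc n)) x)" if x: "x \<in> carrier (P (Suc (Suc n)))" for x
    proof -
      have "d' (Suc n) (k (d (Suc n) x)) = \<phi> (Suc n) (d (Suc n) x) \<ominus>\<^bsub>Q (Suc n)\<^esub> h (d n (d (Suc n) x))"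
        using x lin_closed[OF p(2)] by (simp add: k)
      also have "\<dots> = \<phi> (Suc n) (d (Suc n) x)"
        using x lin_closed[OF \<phi>] lin_closed[OF p(2)] by (simp add: p(6) lin_zero[OF h] Q.M.minus_eq_iff)
      finally show ?thesis using x \<phi>d by simp
    qed
    moreover have "\<phi> (Suc n) x = d' (Suc n) (k x) \<oplus>\<^bsub>Q (Suc n)\<^esub> h (d n x)" if "x \<in> carrier (P (Suc n))" for x
      using that k lin_closed[OF g] lin_closed[OF \<phi>] lin_closed[OF h] lin_closed[OF p(2)]
      by (simp add: Q.M.minus_eq_iff[symmetric])
    ultimately show "\<exists>y. I (Suc n) y \<and> (\<forall>x\<in>carrier (P (Suc n)).
       \<phi> (Suc n) x = d' (Suc n) (y x) \<oplus>\<^bsub>Q (Suc n)\<^esub> h (d n x))"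
      using k(1) by (auto simp: I_def)
  qed
  then obtain h where "?Q h" ..
  then show ?thesis by (intro that[of h]) (auto simp: I_def)
qed


section \<open>Retracts of finite sums\<close>

text \<open>\<open>X\<close> is a direct summand of some \<open>Y\<^sup>n\<close>.\<close>

definition retr :: "'r ring \<Rightarrow> ('r, 'y) module \<Rightarrow> ('r, 'x) module \<Rightarrow> bool" where
  "retr R Y X \<longleftrightarrow> left_module R X \<and> (\<exists>n a b. (\<forall>i<n. lin R X Y (a i) \<and> lin R Y X (b i)) \<and>
     (\<forall>x\<in>carrier X. (\<Oplus>\<^bsub>X\<^esub>i\<in>{..<n::nat}. b i (a i x)) = x))"

lemma retrI:
  assumes a: "lin R X Y a" and b: "lin R Y X b" and ba: "\<And>x. x \<in> carrier X \<Longrightarrow> b (a x) = x"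
  shows "retr R Y X"
proof -
  interpret X: left_module R X by (rule linD[OF a])
  have "(\<Oplus>\<^bsub>X\<^esub>i\<in>{..<Suc 0}. b (a x)) = x" if "x \<in> carrier X" for x
    using that by (simp add: lessThan_Suc ba)
  with a b X.left_module_axioms show ?thesis
    unfolding retr_def by (intro conjI exI[of _ "Suc 0"] exI[of _ "\<lambda>_. a"] exI[of _ "\<lambda>_. b"]) auto
qed

lemma retr_refl: "left_module R X \<Longrightarrow> retr R X X"
  by (rule retrI[OF lin_id lin_id]) auto

lemma retr_trans_retract:
  assumes "retr R Y X" and s: "lin R X' X s" and r: "lin R X X' r"
    and rs: "\<And>x. x \<in> carrier X' \<Longrightarrow> r (s x) = x"
  shows "retr R Y X'"
proof -
  obtain n a b where ab: "\<And>i. i < n \<Longrightarrow> lin R X Y (a i)" "\<And>i. i < n \<Longrightarrow> lin R Y X (b i)"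
    and sum: "\<And>x. x \<in> carrier X \<Longrightarrow> (\<Oplus>\<^bsub>X\<^esub>i\<in>{..<n::nat}. b i (a i x)) = x"
    using assms(1) unfolding retr_def by metis
  have "(\<Oplus>\<^bsub>X'\<^esub>i\<in>{..<n}. r (b i (a i (s x)))) = x" if "x \<in> carrier X'" for x
  proof -
    have "(\<Oplus>\<^bsub>X'\<^esub>i\<in>{..<n}. r (b i (a i (s x)))) = r (\<Oplus>\<^bsub>X\<^esub>i\<in>{..<n}. b i (a i (s x)))"
      by (rule lin_finsum[symmetric, OF r])
         (auto intro: lin_closed[OF ab(2)] lin_closed[OF ab(1)] lin_closed[OF s] that)
    then show ?thesis using that by (simp add: sum lin_closed[OF s] rs)
  qed
  moreover have "lin R X' Y (\<lambda>x. a i (s x))" "lin R Y X' (\<lambda>x. r (b i x))" if "i < n" for i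
    using that by (auto intro: lin_comp[OF s ab(1)] lin_comp[OF ab(2) r])
  ultimately show ?thesis unfolding retr_def using linD(1)[OF s]
    by (intro conjI exI[of _ n] exI[of _ "\<lambda>i x. a i (s x)"] exI[of _ "\<lambda>i x. r (b i x)"]) auto
qed

text \<open>The maps of the retract lift to chain maps \<alpha> i and \<beta> i. The sum of the
  \<beta> i \<alpha> i minus the identity covers zero on \<open>X\<close> and is therefore
  null-homotopic, through h. With \<open>retr_refl\<close> this compares two resolutions of one
  module.\<close>

lemma retr_chain_maps:
  assumes XY: "retr R Y X" and P: "resol R X P d e" and Q: "resol R Y Q d' e'"
  obtains n \<alpha> \<beta> h where
    "\<And>i k. i < n \<Longrightarrow> lin R (P k) (Q k) (\<alpha> i k)" "\<And>i k. i < n \<Longrightarrow> lin R (Q k) (P k) (\<beta> i k)"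
    "\<And>i k x. i < n \<Longrightarrow> x \<in> carrier (P (Suc k)) \<Longrightarrow> d' k (\<alpha> i (Suc k) x) = \<alpha> i k (d k x)"
    "\<And>i k x. i < n \<Longrightarrow> x \<in> carrier (Q (Suc k)) \<Longrightarrow> d k (\<beta> i (Suc k) x) = \<beta> i k (d' k x)"
    "\<And>k. lin R (P k) (P (Suc k)) (h k)"
    "\<And>k x. x \<in> carrier (P (Suc k)) \<Longrightarrow> (\<Oplus>\<^bsub>P (Suc k)\<^esub>i\<in>{..<n::nat}. \<beta> i (Suc k) (\<alpha> i (Suc k) x)) \<ominus>\<^bsub>P (Suc k)\<^esub> x
        = d (Suc k) (h (Suc k) x) \<oplus>\<^bsub>P (Suc k)\<^esub> h k (d k x)"
proof -
  obtain n a b where a: "\<And>i. i < n \<Longrightarrow> lin R X Y (a i)" and b: "\<And>i. i < n \<Longrightarrow> lin R Y X (b i)"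
    and sum: "\<And>x. x \<in> carrier X \<Longrightarrow> (\<Oplus>\<^bsub>X\<^esub>i\<in>{..<n::nat}. b i (a i x)) = x"
    using XY unfolding retr_def by metis
  note p = resolD[OF P] and q = resolD[OF Q]
  have "\<exists>\<phi>. (\<forall>k. lin R (P k) (Q k) (\<phi> k)) \<and> (\<forall>x\<in>carrier (P 0). e' (\<phi> 0 x) = a i (e x)) \<and>
    (\<forall>k. \<forall>x\<in>carrier (P (Suc k)). d' k (\<phi> (Suc k) x) = \<phi> k (d k x))" if i: "i < n" for i
    by (rule chain_map_exists[OF P Q a[OF i]]) blast
  then obtain \<alpha> where \<alpha>: "\<And>i k. i < n \<Longrightarrow> lin R (P k) (Q k) (\<alpha> i k)"
    "\<And>i x. i < n \<Longrightarrow> x \<in> carrier (P 0) \<Longrightarrow> e' (\<alpha> i 0 x) = a i (e x)"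
    "\<And>i k x. i < n \<Longrightarrow> x \<in> carrier (P (Suc k)) \<Longrightarrow> d' k (\<alpha> i (Suc k) x) = \<alpha> i k (d k x)"
    by metis
  have "\<exists>\<phi>. (\<forall>k. lin R (Q k) (P k) (\<phi> k)) \<and> (\<forall>x\<in>carrier (Q 0). e (\<phi> 0 x) = b i (e' x)) \<and>
    (\<forall>k. \<forall>x\<in>carrier (Q (Suc k)). d k (\<phi> (Suc k) x) = \<phi> k (d' k x))" if i: "i < n" for i
    by (rule chain_map_exists[OF Q P b[OF i]]) blast
  then obtain \<beta> where \<beta>: "\<And>i k. i < n \<Longrightarrow> lin R (Q k) (P k) (\<beta> i k)"
    "\<And>i x. i < n \<Longrightarrow> x \<in> carrier (Q 0) \<Longrightarrow> e (\<beta> i 0 x) = b i (e' x)"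
    "\<And>i k x. i < n \<Longrightarrow> x \<in> carrier (Q (Suc k)) \<Longrightarrow> d k (\<beta> i (Suc k) x) = \<beta> i k (d' k x)"
    by metis
  interpret X: left_module R X using p(3) by (rule linD)
  have c: "\<beta> i k (\<alpha> i k x) \<in> carrier (P k)" if "i < n" "x \<in> carrier (P k)" for i k x
    using that by (intro lin_closed[OF \<beta>(1)] lin_closed[OF \<alpha>(1)])
  let ?\<gamma> = "\<lambda>k x. (\<Oplus>\<^bsub>P k\<^esub>i\<in>{..<n}. \<beta> i k (\<alpha> i k x)) \<ominus>\<^bsub>P k\<^esub> x"
  have s: "lin R (P k) (P k) (\<lambda>x. \<Oplus>\<^bsub>P k\<^esub>i\<in>{..<n}. \<beta> i k (\<alpha> i k x))" for k
    using resol_module[OF P] by (intro lin_finsum_map lin_comp[OF \<alpha>(1) \<beta>(1)]) auto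
  have \<gamma>: "lin R (P k) (P k) (?\<gamma> k)" for k
    by (intro lin_minus_map lin_id s resol_module[OF P])
  have \<gamma>0: "e (?\<gamma> 0 x) = \<zero>\<^bsub>X\<^esub>" if x: "x \<in> carrier (P 0)" for x
  proof -
    have "e (\<Oplus>\<^bsub>P 0\<^esub>i\<in>{..<n}. \<beta> i 0 (\<alpha> i 0 x)) = (\<Oplus>\<^bsub>X\<^esub>i\<in>{..<n}. e (\<beta> i 0 (\<alpha> i 0 x)))"
      using x c by (intro lin_finsum[OF p(3)]) auto
    also have "\<dots> = (\<Oplus>\<^bsub>X\<^esub>i\<in>{..<n}. b i (a i (e x)))"
      using x \<alpha>(2) \<beta>(2) lin_closed[OF \<alpha>(1)] lin_closed[OF a] lin_closed[OF b] lin_closed[OF p(3)]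
      by (intro X.M.finsum_cong') auto
    also have "\<dots> = e x" using x lin_closed[OF p(3)] by (intro sum)
    finally show ?thesis
      using x lin_closed[OF s] lin_closed[OF p(3)]
      by (simp add: lin_minus[OF p(3)] X.M.minus_eq_zero_iff)
  qed
  have \<gamma>d: "d k (?\<gamma> (Suc k) x) = ?\<gamma> k (d k x)" if x: "x \<in> carrier (P (Suc k))" for k x
  proof -
    interpret Pk: left_module R "P k" by (rule resol_module[OF P])
    have "d k (\<Oplus>\<^bsub>P (Suc k)\<^esub>i\<in>{..<n}. \<beta> i (Suc k) (\<alpha> i (Suc k) x)) =
        (\<Oplus>\<^bsub>P k\<^esub>i\<in>{..<n}. d k (\<beta> i (Suc k) (\<alpha> i (Suc k) x)))"
      using x c by (intro lin_finsum[OF p(2)]) auto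
    also have "\<dots> = (\<Oplus>\<^bsub>P k\<^esub>i\<in>{..<n}. \<beta> i k (\<alpha> i k (d k x)))"
      using x \<alpha>(3) \<beta>(3) lin_closed[OF \<alpha>(1)] lin_closed[OF \<beta>(1)] lin_closed[OF p(2)]
      by (intro Pk.M.finsum_cong') auto
    finally show ?thesis
      using x lin_closed[OF s] by (simp add: lin_minus[OF p(2)])
  qed
  obtain h where h: "\<And>k. lin R (P k) (P (Suc k)) (h k)"
    "\<And>k x. x \<in> carrier (P (Suc k)) \<Longrightarrow> ?\<gamma> (Suc k) x = d (Suc k) (h (Suc k) x) \<oplus>\<^bsub>P (Suc k)\<^esub> h k (d k x)"
    by (rule null_homotopy_exists[OF P P \<gamma> \<gamma>0 \<gamma>d]) auto
  show ?thesis by (rule that[OF \<alpha>(1) \<beta>(1) \<alpha>(3) \<beta>(3) h])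
qed

section \<open>Vanishing of Ext\<close>

text \<open>For a resolution of X this says that Ext(X,N) vanishes in degree i + 1. The index is
  that of the primitive g, one below the cocycle f, so all i together cover exactly the positive
  degrees.\<close>

definition hom_acyclic_at :: "'r ring \<Rightarrow> (nat \<Rightarrow> ('r, 'p) module) \<Rightarrow> (nat \<Rightarrow> 'p \<Rightarrow> 'p) \<Rightarrow> ('r, 'n) module \<Rightarrow> nat \<Rightarrow> bool" where
  "hom_acyclic_at R P d N i \<longleftrightarrow> (\<forall>f. lin R (P (Suc i)) N f \<longrightarrow>
     (\<forall>x\<in>carrier (P (Suc (Suc i))). f (d (Suc i) x) = \<zero>\<^bsub>N\<^esub>) \<longrightarrow>
     (\<exists>g. lin R (P i) N g \<and> (\<forall>x\<in>carrier (P (Suc i)). g (d i x) = f x)))"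

definition hom_acyclic :: "'r ring \<Rightarrow> (nat \<Rightarrow> ('r, 'p) module) \<Rightarrow> (nat \<Rightarrow> 'p \<Rightarrow> 'p) \<Rightarrow> ('r, 'n) module \<Rightarrow> bool" where
  "hom_acyclic R P d N \<longleftrightarrow> (\<forall>i. hom_acyclic_at R P d N i)"

lemma hom_acyclic_atD:
  assumes "hom_acyclic_at R P d N i" "lin R (P (Suc i)) N f"
    "\<And>x. x \<in> carrier (P (Suc (Suc i))) \<Longrightarrow> f (d (Suc i) x) = \<zero>\<^bsub>N\<^esub>"
  obtains g where "lin R (P i) N g" "\<And>x. x \<in> carrier (P (Suc i)) \<Longrightarrow> g (d i x) = f x"
  using assms unfolding hom_acyclic_at_def by blast

lemma hom_acyclicD:
  assumes "hom_acyclic R P d N" "lin R (P (Suc i)) N f"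
    "\<And>x. x \<in> carrier (P (Suc (Suc i))) \<Longrightarrow> f (d (Suc i) x) = \<zero>\<^bsub>N\<^esub>"
  obtains g where "lin R (P i) N g" "\<And>x. x \<in> carrier (P (Suc i)) \<Longrightarrow> g (d i x) = f x"
  using assms unfolding hom_acyclic_def hom_acyclic_at_def by blast

text \<open>Ext(X,N) is a summand of a power of Ext(Y,N), made explicit on cocycles. For X = Y this
  gives independence of the resolution, which is how canonical and chosen resolutions are
  compared.\<close>

lemma hom_acyclic_at_retr:
  assumes XY: "retr R Y X" and P: "resol R X P d e" and Q: "resol R Y Q d' e'"
    and N: "left_module R N" and ac: "hom_acyclic_at R Q d' N i"
  shows "hom_acyclic_at R P d N i"
  unfolding hom_acyclic_at_def
proof (intro allI impI)
  fix f assume f: "lin R (P (Suc i)) N f" and fd: "\<forall>x\<in>carrier (P (Suc (Suc i))). f (d (Suc i) x) = \<zero>\<^bsub>N\<^esub>"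
  note p = resolD[OF P] and q = resolD[OF Q]
  obtain n \<alpha> \<beta> h where
    \<alpha>: "\<And>i k. i < n \<Longrightarrow> lin R (P k) (Q k) (\<alpha> i k)" and \<beta>: "\<And>i k. i < n \<Longrightarrow> lin R (Q k) (P k) (\<beta> i k)"
    and \<alpha>d: "\<And>i k x. i < n \<Longrightarrow> x \<in> carrier (P (Suc k)) \<Longrightarrow> d' k (\<alpha> i (Suc k) x) = \<alpha> i k (d k x)"
    and \<beta>d: "\<And>i k x. i < n \<Longrightarrow> x \<in> carrier (Q (Suc k)) \<Longrightarrow> d k (\<beta> i (Suc k) x) = \<beta> i k (d' k x)"
    and h: "\<And>k. lin R (P k) (P (Suc k)) (h k)"
    and hd: "\<And>k x. x \<in> carrier (P (Suc k)) \<Longrightarrow>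
      (\<Oplus>\<^bsub>P (Suc k)\<^esub>i\<in>{..<n::nat}. \<beta> i (Suc k) (\<alpha> i (Suc k) x)) \<ominus>\<^bsub>P (Suc k)\<^esub> x
        = d (Suc k) (h (Suc k) x) \<oplus>\<^bsub>P (Suc k)\<^esub> h k (d k x)"
    by (rule retr_chain_maps[OF XY P Q]) blast
  interpret N: left_module R N by fact
  have "\<exists>g. lin R (Q i) N g \<and> (\<forall>y\<in>carrier (Q (Suc i)). g (d' i y) = f (\<beta> k (Suc i) y))" if k: "k < n" for k
    by (rule hom_acyclic_atD[OF ac lin_comp[OF \<beta>[OF k] f]])
       (use k fd lin_closed[OF \<beta>] lin_closed[OF q(2)] in \<open>auto simp flip: \<beta>d\<close>)
  then obtain g where g: "\<And>k. k < n \<Longrightarrow> lin R (Q i) N (g k)"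
    "\<And>k y. k < n \<Longrightarrow> y \<in> carrier (Q (Suc i)) \<Longrightarrow> g k (d' i y) = f (\<beta> k (Suc i) y)"
    by metis
  \<comment> \<open>Since the sum of the \<beta> k \<alpha> k equals 1 + d h + h d and f d = 0, the
    map f is the sum of the f \<beta> k \<alpha> k minus f h d. The cocycles f \<beta> k have
    primitives g k on \<open>Q\<close>, so a factor d splits off on the right of every
    summand.\<close>
  let ?g = "\<lambda>x. (\<Oplus>\<^bsub>N\<^esub>k\<in>{..<n}. g k (\<alpha> k i x)) \<ominus>\<^bsub>N\<^esub> f (h i x)"
  have gl: "lin R (P i) N ?g"
    using resol_module[OF P] N
    by (intro lin_minus_map lin_finsum_map lin_comp[OF \<alpha> g(1)] lin_comp[OF h f]) auto
  moreover have "?g (d i x) = f x" if x: "x \<in> carrier (P (Suc i))" for x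
  proof -
    interpret P: left_module R "P (Suc i)" by (rule resol_module[OF P])
    have c: "\<beta> k (Suc i) (\<alpha> k (Suc i) x) \<in> carrier (P (Suc i))" if "k < n" for k
      using that x by (intro lin_closed[OF \<beta>] lin_closed[OF \<alpha>])
    have *: "(\<Oplus>\<^bsub>P (Suc i)\<^esub>k\<in>{..<n}. \<beta> k (Suc i) (\<alpha> k (Suc i) x)) \<in> carrier (P (Suc i))"
      using c by (intro P.M.finsum_closed) auto
    have "(\<Oplus>\<^bsub>N\<^esub>k\<in>{..<n}. g k (\<alpha> k i (d i x))) = (\<Oplus>\<^bsub>N\<^esub>k\<in>{..<n}. f (\<beta> k (Suc i) (\<alpha> k (Suc i) x)))"
      using x \<alpha>d g(2) c lin_closed[OF \<alpha>] lin_closed[OF f]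
      by (intro N.M.finsum_cong') (auto simp flip: \<alpha>d)
    also have "\<dots> = f (\<Oplus>\<^bsub>P (Suc i)\<^esub>k\<in>{..<n}. \<beta> k (Suc i) (\<alpha> k (Suc i) x))"
      using c by (intro lin_finsum[symmetric, OF f]) auto
    also have "\<dots> = f (h i (d i x)) \<oplus>\<^bsub>N\<^esub> f x"
    proof -
      have dh: "d (Suc i) (h (Suc i) x) \<in> carrier (P (Suc i))" "h i (d i x) \<in> carrier (P (Suc i))"
        using x lin_closed[OF h] lin_closed[OF p(2)] by auto
      have "(\<Oplus>\<^bsub>P (Suc i)\<^esub>k\<in>{..<n}. \<beta> k (Suc i) (\<alpha> k (Suc i) x)) =
          (d (Suc i) (h (Suc i) x) \<oplus>\<^bsub>P (Suc i)\<^esub> h i (d i x)) \<oplus>\<^bsub>P (Suc i)\<^esub> x"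
        using hd[OF x] * x dh by (simp add: P.M.minus_eq_iff)
      then show ?thesis
        using dh x fd lin_closed[OF h] lin_closed[OF f] by (simp add: lin_add[OF f])
    qed
    finally show ?thesis
      using x lin_closed[OF f] lin_closed[OF h] lin_closed[OF p(2)] by (simp add: N.M.minus_eq_iff N.M.a_comm)
  qed
  ultimately show "\<exists>g. lin R (P i) N g \<and> (\<forall>x\<in>carrier (P (Suc i)). g (d i x) = f x)" by blast
qed

lemma hom_acyclic_retr:
  assumes "retr R Y X" "resol R X P d e" "resol R Y Q d' e'" "left_module R N" "hom_acyclic R Q d' N"
  shows "hom_acyclic R P d N"
  using assms hom_acyclic_at_retr unfolding hom_acyclic_def by blast

section \<open>Short exact sequences and mapping cones\<close>

definition ses :: "'r ring \<Rightarrow> ('r, 'a) module \<Rightarrow> ('a \<Rightarrow> 'b) \<Rightarrow> ('r, 'b) module \<Rightarrow> ('b \<Rightarrow> 'c) \<Rightarrow> ('r, 'c) module \<Rightarrow> bool" where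
  "ses R A i B p C \<longleftrightarrow> lin R A B i \<and> lin R B C p \<and> inj_on i (carrier A) \<and> p ` carrier B = carrier C \<and>
     (\<forall>b\<in>carrier B. p b = \<zero>\<^bsub>C\<^esub> \<longleftrightarrow> b \<in> i ` carrier A)"

lemma sesD:
  assumes "ses R A i B p C"
  shows "lin R A B i" "lin R B C p" "\<And>x y. x \<in> carrier A \<Longrightarrow> y \<in> carrier A \<Longrightarrow> i x = i y \<Longrightarrow> x = y"
    "\<And>c. c \<in> carrier C \<Longrightarrow> \<exists>b\<in>carrier B. p b = c"
    "\<And>a. a \<in> carrier A \<Longrightarrow> p (i a) = \<zero>\<^bsub>C\<^esub>"
    "\<And>b. b \<in> carrier B \<Longrightarrow> p b = \<zero>\<^bsub>C\<^esub> \<Longrightarrow> \<exists>a\<in>carrier A. i a = b"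
proof -
  show l: "lin R A B i" "lin R B C p" using assms by (auto simp: ses_def)
  show "\<And>x y. x \<in> carrier A \<Longrightarrow> y \<in> carrier A \<Longrightarrow> i x = i y \<Longrightarrow> x = y"
    using assms by (auto simp: ses_def inj_on_def)
  show "\<exists>b\<in>carrier B. p b = c" if "c \<in> carrier C" for c
    using assms that unfolding ses_def by (metis imageE)
  show "p (i a) = \<zero>\<^bsub>C\<^esub>" if "a \<in> carrier A" for a
    using assms that lin_closed[OF l(1) that] unfolding ses_def by simp
  show "\<exists>a\<in>carrier A. i a = b" if "b \<in> carrier B" "p b = \<zero>\<^bsub>C\<^esub>" for b
    using assms that unfolding ses_def by (metis imageE)
qed

text \<open>The mapping cone of a chain map \<open>\<phi> : P \<rightarrow> Q\<close>.  The zero module in degree \<open>-1\<close> of \<open>P\<close> is a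
  submodule of \<open>P 0\<close>, so that all terms of the cone have the same type.\<close>

definition cone_mod :: "(nat \<Rightarrow> ('r, 'p) module) \<Rightarrow> (nat \<Rightarrow> ('r, 'q) module) \<Rightarrow> nat \<Rightarrow> ('r, 'p \<times> 'q) module" where
  "cone_mod P Q n = (case n of 0 \<Rightarrow> dsum ((P 0)\<lparr>carrier := {\<zero>\<^bsub>P 0\<^esub>}\<rparr>) (Q 0) | Suc m \<Rightarrow> dsum (P m) (Q (Suc m)))"

text \<open>The minus sign sits on the differential of \<open>Q\<close>, so that the square has
  second component \<phi> d - d' \<phi> = 0. In degree 0 the first component lands in the zero
  module.\<close>

definition cone_d :: "(nat \<Rightarrow> ('r, 'p) module) \<Rightarrow> (nat \<Rightarrow> ('r, 'q) module) \<Rightarrow> (nat \<Rightarrow> 'p \<Rightarrow> 'p) \<Rightarrow> (nat \<Rightarrow> 'q \<Rightarrow> 'q) \<Rightarrow>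
    (nat \<Rightarrow> 'p \<Rightarrow> 'q) \<Rightarrow> nat \<Rightarrow> 'p \<times> 'q \<Rightarrow> 'p \<times> 'q" where
  "cone_d P Q d d' \<phi> n = (\<lambda>z. ((case n of 0 \<Rightarrow> \<zero>\<^bsub>P 0\<^esub> | Suc m \<Rightarrow> d m (fst z)),
     \<phi> n (fst z) \<ominus>\<^bsub>Q n\<^esub> d' n (snd z)))"

lemma cone_mod_simps [simp]:
  "cone_mod P Q 0 = dsum ((P 0)\<lparr>carrier := {\<zero>\<^bsub>P 0\<^esub>}\<rparr>) (Q 0)"
  "cone_mod P Q (Suc m) = dsum (P m) (Q (Suc m))"
  by (simp_all add: cone_mod_def)

lemma cone_d_simps [simp]:
  "cone_d P Q d d' \<phi> 0 z = (\<zero>\<^bsub>P 0\<^esub>, \<phi> 0 (fst z) \<ominus>\<^bsub>Q 0\<^esub> d' 0 (snd z))"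
  "cone_d P Q d d' \<phi> (Suc m) z = (d m (fst z), \<phi> (Suc m) (fst z) \<ominus>\<^bsub>Q (Suc m)\<^esub> d' (Suc m) (snd z))"
  by (simp_all add: cone_d_def)

lemma left_module_zero_submodule:
  fixes M :: "('r, 'm) module"
  assumes "left_module R M"
  shows "left_module R (M\<lparr>carrier := {\<zero>\<^bsub>M\<^esub>}\<rparr>)"
proof -
  interpret left_module R M by fact
  show ?thesis by (rule left_module_submodule[OF assms]) (auto simp: smult_r_zero)
qed

lemma projective_zero_submodule:
  assumes "projective R P"
  shows "projective R (P\<lparr>carrier := {\<zero>\<^bsub>P\<^esub>}\<rparr>)"
proof -
  have P: "left_module R P" by (rule projective_module[OF assms])
  interpret left_module R P by fact
  show ?thesis
    by (rule projectiveI_retract[OF _ _ _ assms, where s = "\<lambda>x. x" and r = "\<lambda>_. \<zero>\<^bsub>P\<^esub>"])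
       (auto intro!: linI left_module_zero_submodule[OF P] P simp: smult_r_zero)
qed

text \<open>As \<open>P\<close> and \<open>Q\<close> are exact in positive degrees and i is
  injective, the homology of the cone is concentrated in degree 0, where it is the cokernel of i,
  that is, \<open>C\<close>.\<close>

lemma
  assumes P: "resol R A P d e" and Q: "resol R B Q d' e'" and ABC: "ses R A i B p C"
    and \<phi>: "\<And>n. lin R (P n) (Q n) (\<phi> n)" "\<And>x. x \<in> carrier (P 0) \<Longrightarrow> e' (\<phi> 0 x) = i (e x)"
      "\<And>n x. x \<in> carrier (P (Suc n)) \<Longrightarrow> d' n (\<phi> (Suc n) x) = \<phi> n (d n x)"
  shows lin_cone_d: "lin R (cone_mod P Q (Suc n)) (cone_mod P Q n) (cone_d P Q d d' \<phi> n)" (is ?D)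
    and resol_cone: "resol R C (cone_mod P Q) (cone_d P Q d d' \<phi>) (\<lambda>z. p (e' (snd z)))" (is ?R)
proof -
  note p = resolD[OF P] and q = resolD[OF Q] and s = sesD[OF ABC]
  have mP: "left_module R (P n)" and mQ: "left_module R (Q n)" for n
    by (rule resol_module[OF P] resol_module[OF Q])+
  note cl = lin_closed[OF p(2)] lin_closed[OF p(3)] lin_closed[OF q(2)] lin_closed[OF q(3)]
    lin_closed[OF s(1)] lin_closed[OF s(2)] lin_closed[OF \<phi>(1)]
  note z = lin_zero[OF p(2)] lin_zero[OF p(3)] lin_zero[OF q(2)] lin_zero[OF q(3)]
    lin_zero[OF s(1)] lin_zero[OF s(2)] lin_zero[OF \<phi>(1)]
  interpret P: left_module R "P n" for n by (rule mP)
  interpret Q: left_module R "Q n" for n by (rule mQ)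
  interpret A: left_module R A by (rule linD[OF s(1)])
  interpret B: left_module R B by (rule linD[OF s(1)])
  interpret C: left_module R C by (rule linD[OF s(2)])
  note m0 = left_module_zero_submodule[OF mP[of 0]]
  have D: "lin R (cone_mod P Q (Suc n)) (cone_mod P Q n) (cone_d P Q d d' \<phi> n)" for n
  proof (cases n)
    case 0
    have "lin R (dsum (P 0) (Q (Suc 0))) ((P 0)\<lparr>carrier := {\<zero>\<^bsub>P 0\<^esub>}\<rparr>) (\<lambda>_. \<zero>\<^bsub>P 0\<^esub>)"
      by (rule linI) (auto simp: P.smult_r_zero left_module_dsum mP mQ m0)
    then show ?thesis unfolding 0 cone_mod_simps
      by (simp add: cone_d_def, intro lin_pair lin_minus_map lin_comp[OF lin_fst[OF mP mQ] \<phi>(1)]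
            lin_comp[OF lin_snd[OF mP mQ] q(2)])
  next
    case (Suc m)
    show ?thesis unfolding Suc cone_mod_simps
      by (simp add: cone_d_def, intro lin_pair lin_minus_map lin_comp[OF lin_fst[OF mP mQ] \<phi>(1)]
            lin_comp[OF lin_snd[OF mP mQ] q(2)] lin_comp[OF lin_fst[OF mP mQ] p(2)])
  qed
  then show ?D .
  have "projective R (cone_mod P Q n)" for n
    by (cases n) (auto intro!: projective_dsum p q projective_zero_submodule)
  moreover have e: "lin R (cone_mod P Q 0) C (\<lambda>z. p (e' (snd z)))"
    unfolding cone_mod_simps by (intro lin_comp[OF lin_snd[OF m0 mQ] lin_comp[OF q(3) s(2)]])
  moreover have "(\<lambda>z. p (e' (snd z))) ` carrier (cone_mod P Q 0) = carrier C"
  proof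
    show "carrier C \<subseteq> (\<lambda>z. p (e' (snd z))) ` carrier (cone_mod P Q 0)"
    proof
      fix c assume "c \<in> carrier C"
      then obtain b where "b \<in> carrier B" "p b = c" using s(4) by blast
      then obtain y where "y \<in> carrier (Q 0)" "p (e' y) = c" using q(4) by blast
      then show "c \<in> (\<lambda>z. p (e' (snd z))) ` carrier (cone_mod P Q 0)"
        by (intro image_eqI[of _ _ "(\<zero>\<^bsub>P 0\<^esub>, y)"]) auto
    qed
  qed (use cl in auto)
  moreover have "p (e' (snd z)) = \<zero>\<^bsub>C\<^esub> \<longleftrightarrow> z \<in> cone_d P Q d d' \<phi> 0 ` carrier (cone_mod P Q (Suc 0))"
    if z0: "z \<in> carrier (cone_mod P Q 0)" for z
  proof
    assume a: "p (e' (snd z)) = \<zero>\<^bsub>C\<^esub>"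
    have zc: "fst z = \<zero>\<^bsub>P 0\<^esub>" "snd z \<in> carrier (Q 0)" using z0 by auto
    obtain a where a: "a \<in> carrier A" "i a = e' (snd z)" using s(6)[OF cl(4)[OF zc(2)] a] by blast
    obtain x where x: "x \<in> carrier (P 0)" "e x = a" using p(4)[OF a(1)] by blast
    have "e' (\<phi> 0 x \<ominus>\<^bsub>Q 0\<^esub> snd z) = \<zero>\<^bsub>B\<^esub>"
      using x a zc cl by (simp add: lin_minus[OF q(3)] \<phi>(2) B.M.minus_eq_zero_iff)
    then obtain y where y: "y \<in> carrier (Q (Suc 0))" "d' 0 y = \<phi> 0 x \<ominus>\<^bsub>Q 0\<^esub> snd z"
      using q(7)[OF Q.M.minus_closed[OF cl(7)[OF x(1)] zc(2)]] by blast
    have "cone_d P Q d d' \<phi> 0 (x, y) = z"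
      using x y zc cl by (simp add: Q.M.minus_minus_cancel prod_eq_iff)
    with x y show "z \<in> cone_d P Q d d' \<phi> 0 ` carrier (cone_mod P Q (Suc 0))"
      by (intro image_eqI[of _ _ "(x, y)"]) auto
  next
    assume "z \<in> cone_d P Q d d' \<phi> 0 ` carrier (cone_mod P Q (Suc 0))"
    then obtain x y where "x \<in> carrier (P 0)" "y \<in> carrier (Q (Suc 0))"
      "snd z = \<phi> 0 x \<ominus>\<^bsub>Q 0\<^esub> d' 0 y" by auto
    then show "p (e' (snd z)) = \<zero>\<^bsub>C\<^esub>"
      using cl by (simp add: lin_minus[OF q(3)] lin_minus[OF s(2)] \<phi>(2) q(5) s(5) z C.M.minus_zero_right)
  qed
  moreover have "cone_d P Q d d' \<phi> n z = \<zero>\<^bsub>cone_mod P Q n\<^esub> \<longleftrightarrow>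
      z \<in> cone_d P Q d d' \<phi> (Suc n) ` carrier (cone_mod P Q (Suc (Suc n)))"
    if z': "z \<in> carrier (cone_mod P Q (Suc n))" for n z
  proof
    have zc: "fst z \<in> carrier (P n)" "snd z \<in> carrier (Q (Suc n))" using z' by auto
    assume a: "cone_d P Q d d' \<phi> n z = \<zero>\<^bsub>cone_mod P Q n\<^esub>"
    then have "\<phi> n (fst z) \<ominus>\<^bsub>Q n\<^esub> d' n (snd z) = \<zero>\<^bsub>Q n\<^esub>" by (cases n) auto
    then have \<phi>z: "\<phi> n (fst z) = d' n (snd z)" using zc cl by (simp add: Q.M.minus_eq_zero_iff)
    \<comment> \<open>For n = 0 the first component of the cone differential is zero and says
      nothing about \<open>fst z\<close>. Injectivity of i is used instead: i (e (fst z)) = e' (d'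
      (snd z)) = 0.\<close>
    have "\<exists>x\<in>carrier (P (Suc n)). d n x = fst z"
    proof (cases n)
      case 0
      have "i (e (fst z)) = i \<zero>\<^bsub>A\<^esub>" using zc \<phi>z 0 cl q(5) by (simp flip: \<phi>(2) add: z)
      then have "e (fst z) = \<zero>\<^bsub>A\<^esub>" using zc 0 cl by (intro s(3)) auto
      then show ?thesis using p(7) zc 0 by blast
    next
      case (Suc m)
      then have "d m (fst z) = \<zero>\<^bsub>P m\<^esub>" using a by simp
      then show ?thesis using p(8) zc Suc by blast
    qed
    then obtain x where x: "x \<in> carrier (P (Suc n))" "d n x = fst z" by blast
    have "d' n (\<phi> (Suc n) x \<ominus>\<^bsub>Q (Suc n)\<^esub> snd z) = \<zero>\<^bsub>Q n\<^esub>"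
      using x zc cl \<phi>z by (simp add: lin_minus[OF q(2)] \<phi>(3) Q.M.minus_eq_zero_iff)
    then obtain y where y: "y \<in> carrier (Q (Suc (Suc n)))" "d' (Suc n) y = \<phi> (Suc n) x \<ominus>\<^bsub>Q (Suc n)\<^esub> snd z"
      using q(8)[OF Q.M.minus_closed[OF cl(7)[OF x(1)] zc(2)]] by blast
    have "cone_d P Q d d' \<phi> (Suc n) (x, y) = z"
      using x y zc cl by (simp add: Q.M.minus_minus_cancel prod_eq_iff)
    with x y show "z \<in> cone_d P Q d d' \<phi> (Suc n) ` carrier (cone_mod P Q (Suc (Suc n)))"
      by (intro image_eqI[of _ _ "(x, y)"]) auto
  next
    assume "z \<in> cone_d P Q d d' \<phi> (Suc n) ` carrier (cone_mod P Q (Suc (Suc n)))"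
    then obtain x y where "x \<in> carrier (P (Suc n))" "y \<in> carrier (Q (Suc (Suc n)))"
      "z = (d n x, \<phi> (Suc n) x \<ominus>\<^bsub>Q (Suc n)\<^esub> d' (Suc n) y)" by auto
    then show "cone_d P Q d d' \<phi> n z = \<zero>\<^bsub>cone_mod P Q n\<^esub>"
      using cl by (cases n) (simp_all add: lin_minus[OF q(2)] \<phi>(3) q(6) p(6) Q.M.minus_eq_zero_iff z Q.M.minus_zero_right)
  qed
  ultimately show ?R unfolding resol_def using D by blast
qed

text \<open>This is the part Ext^j(B,N) -> Ext^j(A,N) -> Ext^(j+1)(C,N) of the long exact sequence,
  and for j = 0 the surjectivity of Hom(B,N) -> Hom(A,N). The cone of P -> Q resolves
  \<open>C\<close>, so its cocycles have primitives by comparison with \<open>V\<close>.\<close>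

lemma hom_acyclic_ses:
  assumes ABC: "ses R A i B p C" and P: "resol R A P d e" and Q: "resol R B Q d' e'" and V: "resol R C V dV eV"
    and N: "left_module R N" and acQ: "hom_acyclic R Q d' N" and acV: "hom_acyclic R V dV N"
  shows "hom_acyclic R P d N"
    and "\<And>f. lin R A N f \<Longrightarrow> \<exists>g. lin R B N g \<and> (\<forall>x\<in>carrier A. g (i x) = f x)"
proof -
  note p = resolD[OF P] and q = resolD[OF Q] and s = sesD[OF ABC]
  have mP: "left_module R (P n)" and mQ: "left_module R (Q n)" for n
    by (rule resol_module[OF P] resol_module[OF Q])+
  obtain \<phi> where \<phi>: "\<And>n. lin R (P n) (Q n) (\<phi> n)" "\<And>x. x \<in> carrier (P 0) \<Longrightarrow> e' (\<phi> 0 x) = i (e x)"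
      "\<And>n x. x \<in> carrier (P (Suc n)) \<Longrightarrow> d' n (\<phi> (Suc n) x) = \<phi> n (d n x)"
    by (rule chain_map_exists[OF P Q s(1)]) blast
  interpret N: left_module R N by fact
  interpret P: left_module R "P n" for n by (rule mP)
  interpret Q: left_module R "Q n" for n by (rule mQ)
  note m0 = left_module_zero_submodule[OF mP[of 0]]
  let ?W = "cone_mod P Q" and ?D = "cone_d P Q d d' \<phi>"
  have W: "resol R C ?W ?D (\<lambda>z. p (e' (snd z)))" by (rule resol_cone[OF P Q ABC \<phi>])
  have C: "left_module R C" using s(2) by (rule linD)
  have acW: "hom_acyclic R ?W ?D N" by (rule hom_acyclic_retr[OF retr_refl[OF C] W V N acV])
  note cl = lin_closed[OF p(2)] lin_closed[OF p(3)] lin_closed[OF q(2)] lin_closed[OF q(3)]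
    lin_closed[OF s(1)] lin_closed[OF s(2)] lin_closed[OF \<phi>(1)]
  \<comment> \<open>The connecting map: a cocycle f on \<open>P n\<close> becomes the cocycle f fst
    in degree n + 1 of the cone, and G is a primitive of it. The zero in the first component is
    written as \<open>fst\<close> of the zero of the cone term, which is right for n = 0 and n > 0
    alike.\<close>
  have *: "\<exists>G. lin R (?W n) N G \<and> (\<forall>x\<in>carrier (P n). G (\<zero>\<^bsub>?W n\<^esub>) = \<zero>\<^bsub>N\<^esub> \<and> 
      G (?D n (x, \<zero>\<^bsub>Q (Suc n)\<^esub>)) = f x) \<and> (\<forall>y\<in>carrier (Q (Suc n)). G (fst \<zero>\<^bsub>?W n\<^esub>, d' n y) = \<zero>\<^bsub>N\<^esub>)"
    if f: "lin R (P n) N f" and fd: "\<And>x. x \<in> carrier (P (Suc n)) \<Longrightarrow> f (d n x) = \<zero>\<^bsub>N\<^esub>" for n f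
  proof -
    have l: "lin R (?W (Suc n)) N (\<lambda>z. f (fst z))"
      unfolding cone_mod_simps by (rule lin_comp[OF lin_fst[OF mP mQ] f])
    obtain G where G: "lin R (?W n) N G" "\<And>z. z \<in> carrier (?W (Suc n)) \<Longrightarrow> G (?D n z) = f (fst z)"
      by (rule hom_acyclicD[OF acW l]) (use fd in auto)
    have 1: "G (\<zero>\<^bsub>?W n\<^esub>) = \<zero>\<^bsub>N\<^esub>" by (rule lin_zero[OF G(1)])
    have 2: "G (fst \<zero>\<^bsub>?W n\<^esub>, d' n y) = \<zero>\<^bsub>N\<^esub>" if y: "y \<in> carrier (Q (Suc n))" for y
    proof -
      have "(fst \<zero>\<^bsub>?W n\<^esub>, d' n y) = ?D n (\<zero>\<^bsub>P n\<^esub>, \<ominus>\<^bsub>Q (Suc n)\<^esub> y)"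
        using y cl by (cases n) (simp_all add: lin_zero[OF \<phi>(1)] lin_zero[OF p(2)] lin_neg[OF q(2)] a_minus_def)
      then show ?thesis using G(2)[of "(\<zero>\<^bsub>P n\<^esub>, \<ominus>\<^bsub>Q (Suc n)\<^esub> y)"] y by (simp add: lin_zero[OF f])
    qed
    show ?thesis using G 1 2 by (intro exI[of _ G]) auto
  qed
  show "hom_acyclic R P d N"
    unfolding hom_acyclic_def hom_acyclic_at_def
  proof (intro allI impI)
    fix j f assume f: "lin R (P (Suc j)) N f" and fd: "\<forall>x\<in>carrier (P (Suc (Suc j))). f (d (Suc j) x) = \<zero>\<^bsub>N\<^esub>"
    obtain G where G: "lin R (dsum (P j) (Q (Suc j))) N G"
       "\<And>x. x \<in> carrier (P (Suc j)) \<Longrightarrow> G (d j x, \<phi> (Suc j) x) = f x"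
       "\<And>y. y \<in> carrier (Q (Suc (Suc j))) \<Longrightarrow> G (\<zero>\<^bsub>P j\<^esub>, d' (Suc j) y) = \<zero>\<^bsub>N\<^esub>"
      using *[OF f] fd cl lin_zero[OF q(2)] by (auto simp: Q.M.minus_zero_right)
    \<comment> \<open>The restriction of G to the summand \<open>Q\<close> is itself a cocycle, with
      primitive c. Then f x = G (d x, 0) + G (0, \<phi> x), and the second term is c (d' (\<phi> x))
      = c (\<phi> (d x)), so both terms factor through d.\<close>
    obtain c where c: "lin R (Q j) N c" "\<And>y. y \<in> carrier (Q (Suc j)) \<Longrightarrow> c (d' j y) = G (\<zero>\<^bsub>P j\<^esub>, y)"
      by (rule hom_acyclicD[OF acQ lin_comp[OF lin_inr[OF mP mQ] G(1)]]) (use G(3) in auto)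
    let ?g = "\<lambda>x. G (x, \<zero>\<^bsub>Q (Suc j)\<^esub>) \<oplus>\<^bsub>N\<^esub> c (\<phi> j x)"
    have "lin R (P j) N ?g"
      by (intro lin_add_map lin_comp[OF lin_inl[OF mP mQ] G(1)] lin_comp[OF \<phi>(1) c(1)])
    moreover have "?g (d j x) = f x" if x: "x \<in> carrier (P (Suc j))" for x
    proof -
      have "f x = G (d j x, \<zero>\<^bsub>Q (Suc j)\<^esub>) \<oplus>\<^bsub>N\<^esub> G (\<zero>\<^bsub>P j\<^esub>, \<phi> (Suc j) x)"
        using x cl lin_add[OF G(1), of "(d j x, \<zero>\<^bsub>Q (Suc j)\<^esub>)" "(\<zero>\<^bsub>P j\<^esub>, \<phi> (Suc j) x)"] G(2) by simp
      then show ?thesis using x cl by (simp flip: c(2) \<phi>(3))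
    qed
    ultimately show "\<exists>g. lin R (P j) N g \<and> (\<forall>x\<in>carrier (P (Suc j)). g (d j x) = f x)" by blast
  qed
  fix f assume f: "lin R A N f"
  obtain G where G: "lin R (dsum ((P 0)\<lparr>carrier := {\<zero>\<^bsub>P 0\<^esub>}\<rparr>) (Q 0)) N G"
     "\<And>x. x \<in> carrier (P 0) \<Longrightarrow> G (\<zero>\<^bsub>P 0\<^esub>, \<phi> 0 x) = f (e x)"
     "\<And>y. y \<in> carrier (Q (Suc 0)) \<Longrightarrow> G (\<zero>\<^bsub>P 0\<^esub>, d' 0 y) = \<zero>\<^bsub>N\<^esub>"
    using *[OF lin_comp[OF p(3) f]] cl lin_zero[OF q(2)] p(5) lin_zero[OF f] by (auto simp: Q.M.minus_zero_right)
  \<comment> \<open>In degree 0 the cone term is \<open>Q 0\<close> up to a zero module. G vanishes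
    on the image of d' and therefore descends to \<open>B\<close>, the cokernel of d'.\<close>
  have b: "lin R (Q 0) N (\<lambda>y. G (\<zero>\<^bsub>P 0\<^esub>, y))"
    using lin_comp[OF lin_inr[OF m0 mQ] G(1)] by simp
  have es: "e' ` carrier (Q 0) = carrier B" using Q by (simp add: resol_def)
  obtain g where g: "lin R B N g" "\<And>y. y \<in> carrier (Q 0) \<Longrightarrow> g (e' y) = G (\<zero>\<^bsub>P 0\<^esub>, y)"
    by (rule lin_factor[OF q(3) es b]) (use G(3) q(7) in blast)+
  have "g (i a) = f a" if "a \<in> carrier A" for a
  proof -
    obtain x where x: "x \<in> carrier (P 0)" "e x = a" using p(4)[OF \<open>a \<in> carrier A\<close>] by blast
    then show ?thesis using g(2)[of "\<phi> 0 x"] G(2) cl \<phi>(2) by simp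
  qed
  with g show "\<exists>g. lin R B N g \<and> (\<forall>x\<in>carrier A. g (i x) = f x)" by blast
qed

section \<open>Tensor products via representatives\<close>

definition frags :: "('s, 'a) module \<Rightarrow> ('t, 'm) module \<Rightarrow> ('a \<times> 'm \<Rightarrow>\<^sub>0 int) set" where
  "frags A M = {x. Poly_Mapping.keys x \<subseteq> carrier A \<times> carrier M}"

text \<open>Subgroups in terms of a type class. Formal combinations form such a type, and closure
  under differences matches their induction rule, which has a case for x - y.\<close>

definition diff_closed :: "'g::ab_group_add set \<Rightarrow> bool" where
  "diff_closed K \<longleftrightarrow> 0 \<in> K \<and> (\<forall>x\<in>K. \<forall>y\<in>K. x - y \<in> K)"

lemma diff_closedD:
  assumes "diff_closed K"
  shows "0 \<in> K" "x \<in> K \<Longrightarrow> y \<in> K \<Longrightarrow> x - y \<in> K" "x \<in> K \<Longrightarrow> - x \<in> K" "x \<in> K \<Longrightarrow> y \<in> K \<Longrightarrow> x + y \<in> K"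
proof -
  have d: "\<And>x y. x \<in> K \<Longrightarrow> y \<in> K \<Longrightarrow> x - y \<in> K" and z: "0 \<in> K" using assms by (auto simp: diff_closed_def)
  show "0 \<in> K" "x \<in> K \<Longrightarrow> y \<in> K \<Longrightarrow> x - y \<in> K" using d z by auto
  show n: "x \<in> K \<Longrightarrow> - x \<in> K" for x using d[OF z, of x] by simp
  show "x \<in> K \<Longrightarrow> y \<in> K \<Longrightarrow> x + y \<in> K" using d[OF _ n, of x y] by simp
qed

lemma diff_closed_sum:
  assumes "diff_closed K" "\<And>i. i \<in> I \<Longrightarrow> f i \<in> K"
  shows "sum f I \<in> K"
  using assms(2) by (induction I rule: infinite_finite_induct) (auto intro: diff_closedD[OF assms(1)])

lemma diff_closed_frags: "diff_closed (frags A M)"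
  unfolding diff_closed_def frags_def using keys_diff by fastforce

lemma frag_of_frags [simp]: "frag_of (a, m) \<in> frags A M \<longleftrightarrow> a \<in> carrier A \<and> m \<in> carrier M"
  by (simp add: frags_def)

lemma frags_induct [consumes 1, case_names zero one diff]:
  assumes "x \<in> frags A M" "P 0" "\<And>a m. a \<in> carrier A \<Longrightarrow> m \<in> carrier M \<Longrightarrow> P (frag_of (a, m))"
    and "\<And>x y. x \<in> frags A M \<Longrightarrow> y \<in> frags A M \<Longrightarrow> P x \<Longrightarrow> P y \<Longrightarrow> P (x - y)"
  shows "P x"
proof -
  have "x \<in> frags A M \<and> P x"
    using assms(1)[unfolded frags_def, simplified]
  proof (induction x rule: frag_induction)
    case (diff a b)
    then show ?case using assms(4) diff_closedD(2)[OF diff_closed_frags] by blast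
  qed (use assms diff_closedD[OF diff_closed_frags] in auto)
  then show ?thesis ..
qed

lemma frag_extend_mod:
  assumes x: "x \<in> frags A M" and K: "diff_closed K"
    and "\<And>a m. a \<in> carrier A \<Longrightarrow> m \<in> carrier M \<Longrightarrow> g (a, m) - h (a, m) \<in> K"
  shows "frag_extend g x - frag_extend h x \<in> K"
  using x
proof (induction x rule: frags_induct)
  case (diff x y)
  have "frag_extend g (x - y) - frag_extend h (x - y) =
     (frag_extend g x - frag_extend h x) - (frag_extend g y - frag_extend h y)"
    by (simp add: frag_extend_diff)
  with diff show ?case using diff_closedD[OF K] by metis
qed (use assms diff_closedD[OF K] in auto)

lemma frag_extend_closed:
  assumes "x \<in> frags A M" "diff_closed K" "\<And>a m. a \<in> carrier A \<Longrightarrow> m \<in> carrier M \<Longrightarrow> g (a, m) \<in> K"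
  shows "frag_extend g x \<in> K"
  using frag_extend_mod[OF assms(1,2), of g "\<lambda>_. 0"] assms(3) by (simp add: frag_extend_eq_0)

lemma ring_op_ring:
  assumes "ring S" shows "ring (op_ring S)"
proof -
  interpret ring S by fact
  have "abelian_group (op_ring S)"
    by (rule abelian_groupI) (auto simp: op_ring_def a_ac intro: bexI[of _ "\<ominus>\<^bsub>S\<^esub> x" for x] l_neg)
  moreover have "monoid (op_ring S)"
    by (rule monoidI) (auto simp: op_ring_def m_assoc)
  ultimately show ?thesis
    by (rule ringI) (auto simp: op_ring_def l_distr r_distr)
qed

lemma op_ring_sel [simp]:
  "carrier (op_ring S) = carrier S" "\<one>\<^bsub>op_ring S\<^esub> = \<one>\<^bsub>S\<^esub>" "\<zero>\<^bsub>op_ring S\<^esub> = \<zero>\<^bsub>S\<^esub>"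
  "x \<oplus>\<^bsub>op_ring S\<^esub> y = x \<oplus>\<^bsub>S\<^esub> y" "x \<otimes>\<^bsub>op_ring S\<^esub> y = y \<otimes>\<^bsub>S\<^esub> x"
  by (simp_all add: op_ring_def)

lemma tensor_relations_frags:
  assumes A: "left_module (op_ring S) A" and M: "left_module S M"
  shows "tensor_relations S A M \<subseteq> frags A M"
proof -
  interpret A: left_module "op_ring S" A by fact
  interpret M: left_module S M by fact
  note d = diff_closedD(2)[OF diff_closed_frags]
  show ?thesis unfolding tensor_relations_def
    using A.smult_closed by (auto intro!: d)
qed

lemma diff_closed_subgroup:
  assumes "subgroup K (free_Abelian_group X)" shows "diff_closed K"
proof -
  interpret subgroup K "free_Abelian_group X" by fact
  have "x - y \<in> K" if "x \<in> K" "y \<in> K" for x y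
    using m_closed[OF that(1) m_inv_closed[OF that(2)]] mem_carrier[OF that(2)] by simp
  then show ?thesis using one_closed by (auto simp: diff_closed_def)
qed

lemma
  assumes A: "left_module (op_ring S) A" and M: "left_module S M"
  shows subgroup_tensor_null: "subgroup (tensor_null S A M) (free_Abelian_group (carrier A \<times> carrier M))"
    and diff_closed_tensor_null: "diff_closed (tensor_null S A M)"
    and tensor_null_frags: "tensor_null S A M \<subseteq> frags A M"
proof -
  let ?G = "free_Abelian_group (carrier A \<times> carrier M)"
  interpret G: group ?G by simp
  have "tensor_relations S A M \<subseteq> carrier ?G"
    using tensor_relations_frags[OF assms] by (auto simp: frags_def)
  then show s: "subgroup (tensor_null S A M) ?G"
    unfolding tensor_null_def by (rule G.generate_is_subgroup)
  show "diff_closed (tensor_null S A M)" by (rule diff_closed_subgroup[OF s])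
  show "tensor_null S A M \<subseteq> frags A M" by (rule subsetI, drule subsetD[OF subgroup.subset[OF s]]) (simp add: frags_def)
qed

text \<open>Inverses and products of \<open>generate\<close> are folded into a single case for
  differences. Membership in \<open>frags\<close> is carried along so that maps on representatives
  can be applied.\<close>

lemma tensor_null_induct [consumes 3, case_names zero add_left add_right smult diff]:
  assumes x: "x \<in> tensor_null S A M"
    and AM: "left_module (op_ring S) A" "left_module S M"
    and zero: "P 0"
    and l: "\<And>a b m. a \<in> carrier A \<Longrightarrow> b \<in> carrier A \<Longrightarrow> m \<in> carrier M \<Longrightarrow>
        P (frag_of (a \<oplus>\<^bsub>A\<^esub> b, m) - frag_of (a, m) - frag_of (b, m))"
    and r: "\<And>a m n. a \<in> carrier A \<Longrightarrow> m \<in> carrier M \<Longrightarrow> n \<in> carrier M \<Longrightarrow>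
        P (frag_of (a, m \<oplus>\<^bsub>M\<^esub> n) - frag_of (a, m) - frag_of (a, n))"
    and s: "\<And>s a m. s \<in> carrier S \<Longrightarrow> a \<in> carrier A \<Longrightarrow> m \<in> carrier M \<Longrightarrow>
        P (frag_of (s \<odot>\<^bsub>A\<^esub> a, m) - frag_of (a, s \<odot>\<^bsub>M\<^esub> m))"
    and d: "\<And>x y. x \<in> frags A M \<Longrightarrow> y \<in> frags A M \<Longrightarrow> P x \<Longrightarrow> P y \<Longrightarrow> P (x - y)"
  shows "P x"
proof -
  let ?G = "free_Abelian_group (carrier A \<times> carrier M)"
  let ?Q = "\<lambda>x. x \<in> frags A M \<and> P x"
  note fz = diff_closedD[OF diff_closed_frags[of A M]]
  have d': "?Q (x - y)" if "?Q x" "?Q y" for x y using that fz(2) d by blast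
  have rel: "?Q h" if "h \<in> tensor_relations S A M" for h
  proof
    show "h \<in> frags A M" using that tensor_relations_frags[OF AM] by auto
    show "P h" using that unfolding tensor_relations_def by (auto intro: l r s)
  qed
  have neg: "?Q (- x)" if "?Q x" for x using d'[of 0 x] zero fz(1) that by auto
  have "?Q x" using x unfolding tensor_null_def
  proof (induction x rule: generate.induct)
    case (inv h)
    then show ?case using rel[OF inv] neg[of h] by (simp add: frags_def)
  next
    case (eng h1 h2)
    then show ?case using d'[of h1 "- h2"] neg[of h2] by auto
  qed (use rel zero fz in auto)
  then show ?thesis ..
qed

text \<open>The universal property of the tensor product for a target that is a quotient by
  \<open>K\<close>, known only through representatives: biadditivity and balance are checked modulo
  \<open>K\<close>.\<close>

lemma frag_extend_tensor_null:
  assumes x: "x \<in> tensor_null S A M"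
    and AM: "left_module (op_ring S) A" "left_module S M" and K: "diff_closed K"
    and "\<And>a b m. a \<in> carrier A \<Longrightarrow> b \<in> carrier A \<Longrightarrow> m \<in> carrier M \<Longrightarrow> g (a \<oplus>\<^bsub>A\<^esub> b, m) - g (a, m) - g (b, m) \<in> K"
    and "\<And>a m n. a \<in> carrier A \<Longrightarrow> m \<in> carrier M \<Longrightarrow> n \<in> carrier M \<Longrightarrow> g (a, m \<oplus>\<^bsub>M\<^esub> n) - g (a, m) - g (a, n) \<in> K"
    and "\<And>s a m. s \<in> carrier S \<Longrightarrow> a \<in> carrier A \<Longrightarrow> m \<in> carrier M \<Longrightarrow> g (s \<odot>\<^bsub>A\<^esub> a, m) - g (a, s \<odot>\<^bsub>M\<^esub> m) \<in> K"
  shows "frag_extend g x \<in> K"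
  using x AM by (induction x rule: tensor_null_induct)
    (use assms diff_closedD[OF K] in \<open>auto simp: frag_extend_diff\<close>)

lemma tensor_null_rel:
  shows tensor_null_add_left: "a \<in> carrier A \<Longrightarrow> b \<in> carrier A \<Longrightarrow> m \<in> carrier M \<Longrightarrow>
      frag_of (a \<oplus>\<^bsub>A\<^esub> b, m) - frag_of (a, m) - frag_of (b, m) \<in> tensor_null S A M"
    and tensor_null_add_right: "a \<in> carrier A \<Longrightarrow> m \<in> carrier M \<Longrightarrow> n \<in> carrier M \<Longrightarrow>
      frag_of (a, m \<oplus>\<^bsub>M\<^esub> n) - frag_of (a, m) - frag_of (a, n) \<in> tensor_null S A M"
    and tensor_null_smult: "s \<in> carrier S \<Longrightarrow> a \<in> carrier A \<Longrightarrow> m \<in> carrier M \<Longrightarrow>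
      frag_of (s \<odot>\<^bsub>A\<^esub> a, m) - frag_of (a, s \<odot>\<^bsub>M\<^esub> m) \<in> tensor_null S A M"
  unfolding tensor_null_def tensor_relations_def by (rule generate.incl, blast)+

section \<open>Maps induced on representatives and their evaluation in a module\<close>

definition bimap :: "('a \<Rightarrow> 'b) \<Rightarrow> ('m \<Rightarrow> 'n) \<Rightarrow> ('a \<times> 'm \<Rightarrow>\<^sub>0 int) \<Rightarrow> ('b \<times> 'n \<Rightarrow>\<^sub>0 int)" where
  "bimap f g = frag_extend (\<lambda>(a, m). frag_of (f a, g m))"

lemma bimap_simps [simp]:
  "bimap f g 0 = 0" "bimap f g (frag_of (a, m)) = frag_of (f a, g m)"
  "bimap f g (x - y) = bimap f g x - bimap f g y" "bimap f g (x + y) = bimap f g x + bimap f g y"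
  "bimap f g (- x) = - bimap f g x"
  by (simp_all add: bimap_def frag_extend_diff frag_extend_add frag_extend_minus)

lemma bimap_sum: "finite I \<Longrightarrow> bimap f g (\<Sum>i\<in>I. x i) = (\<Sum>i\<in>I. bimap f g (x i))"
  by (induction I rule: finite_induct) auto

lemma bimap_bimap: "bimap f g (bimap f' g' x) = bimap (\<lambda>a. f (f' a)) (\<lambda>a. g (g' a)) x"
  using subset_UNIV[of "Poly_Mapping.keys x"] by (induction x rule: frag_induction) auto

lemma bimap_cong:
  assumes "x \<in> frags A M" "\<And>a. a \<in> carrier A \<Longrightarrow> f a = f' a" "\<And>m. m \<in> carrier M \<Longrightarrow> g m = g' m"
  shows "bimap f g x = bimap f' g' x"
  using assms(1) by (induction x rule: frags_induct) (auto simp: assms(2,3))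

lemma bimap_id [simp]: "bimap (\<lambda>a. a) (\<lambda>m. m) x = x"
  using subset_UNIV[of "Poly_Mapping.keys x"] by (induction x rule: frag_induction) auto

lemma bimap_ident:
  assumes "x \<in> frags A M" "\<And>a. a \<in> carrier A \<Longrightarrow> f a = a" "\<And>m. m \<in> carrier M \<Longrightarrow> g m = m"
  shows "bimap f g x = x"
  using bimap_cong[OF assms, of "\<lambda>a. a" "\<lambda>m. m"] assms by simp

lemma bimap_frags:
  assumes "x \<in> frags A M" "\<And>a. a \<in> carrier A \<Longrightarrow> f a \<in> carrier B" "\<And>m. m \<in> carrier M \<Longrightarrow> g m \<in> carrier N"
  shows "bimap f g x \<in> frags B N"
  unfolding bimap_def by (rule frag_extend_closed[OF assms(1) diff_closed_frags]) (use assms in auto)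

lemma bimap_null:
  assumes f: "lin (op_ring S) A B f" and g: "lin S M N g" and x: "x \<in> tensor_null S A M"
  shows "bimap f g x \<in> tensor_null S B N"
  unfolding bimap_def
proof (rule frag_extend_tensor_null[OF x])
  show AM: "left_module (op_ring S) A" "left_module S M" and "diff_closed (tensor_null S B N)"
    using linD[OF f] linD[OF g] diff_closed_tensor_null by auto
qed (use linD(3-)[OF f] linD(3-)[OF g] tensor_null_rel[where A = B and M = N] in auto)

text \<open>The values of \<open>frag_extend\<close> are formal combinations, whereas here the
  target is a module. The body is the one occurring in \<open>adj_counit\<close>, so that the counit
  unfolds to it.\<close>

definition frag_ev :: "('r, 'n) module \<Rightarrow> ('p \<Rightarrow> 'n) \<Rightarrow> ('p \<Rightarrow>\<^sub>0 int) \<Rightarrow> 'n" where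
  "frag_ev N g x = (\<Oplus>\<^bsub>N\<^esub>p\<in>Poly_Mapping.keys x. [Poly_Mapping.lookup x p] \<cdot>\<^bsub>N\<^esub> g p)"


lemma frag_ev_zero: "abelian_group N \<Longrightarrow> frag_ev N g 0 = \<zero>\<^bsub>N\<^esub>"
  by (simp add: frag_ev_def abelian_monoid.finsum_empty abelian_group.axioms)

context
  fixes N :: "('r, 'n) module" and A :: "('s, 'a) module" and M :: "('t, 'm) module" and g
  assumes N: "abelian_group N"
    and g: "\<And>p. p \<in> carrier A \<times> carrier M \<Longrightarrow> g p \<in> carrier N"
begin

interpretation N: abelian_group N by (rule N)

lemma add_pow_closed: "y \<in> carrier N \<Longrightarrow> [k] \<cdot>\<^bsub>N\<^esub> y \<in> carrier N" for k :: int
  using group.int_pow_closed[OF N.a_group] by (simp add: add_pow_def)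

lemma frag_ev_superset:
  assumes "finite F" "Poly_Mapping.keys x \<subseteq> F" "F \<subseteq> carrier A \<times> carrier M"
  shows "frag_ev N g x = (\<Oplus>\<^bsub>N\<^esub>p\<in>F. [Poly_Mapping.lookup x p] \<cdot>\<^bsub>N\<^esub> g p)"
  unfolding frag_ev_def
proof (rule N.add.finprod_mono_neutral_cong_left)
  show "[Poly_Mapping.lookup x p] \<cdot>\<^bsub>N\<^esub> g p = \<zero>\<^bsub>N\<^esub>" if "p \<in> F - Poly_Mapping.keys x" for p
    using that by (simp add: in_keys_iff add_pow_def)
qed (use assms g in \<open>auto intro!: add_pow_closed\<close>)

lemma frag_ev_closed: "x \<in> frags A M \<Longrightarrow> frag_ev N g x \<in> carrier N"
  unfolding frag_ev_def frags_def
  by (rule N.finsum_closed) (use g in \<open>auto intro!: add_pow_closed\<close>)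

lemma frag_ev_of: "a \<in> carrier A \<Longrightarrow> m \<in> carrier M \<Longrightarrow> frag_ev N g (frag_of (a, m)) = g (a, m)"
  using g group.int_pow_1[OF N.a_group, of "g (a, m)"] by (simp add: frag_ev_def add_pow_def)

lemma frag_ev_diff:
  assumes x: "x \<in> frags A M" and y: "y \<in> frags A M"
  shows "frag_ev N g (x - y) = frag_ev N g x \<ominus>\<^bsub>N\<^esub> frag_ev N g y"
proof -
  let ?F = "Poly_Mapping.keys x \<union> Poly_Mapping.keys y"
  let ?t = "\<lambda>x p. [Poly_Mapping.lookup x p] \<cdot>\<^bsub>N\<^esub> g p"
  have F: "finite ?F" "?F \<subseteq> carrier A \<times> carrier M" using x y by (auto simp: frags_def)
  have c: "?t z p \<in> carrier N" if "p \<in> ?F" for z :: "_ \<Rightarrow>\<^sub>0 int" and p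
    using that F(2) g by (intro add_pow_closed) blast
  have "frag_ev N g (x - y) \<oplus>\<^bsub>N\<^esub> frag_ev N g y = (\<Oplus>\<^bsub>N\<^esub>p\<in>?F. ?t (x - y) p \<oplus>\<^bsub>N\<^esub> ?t y p)"
    using frag_ev_superset[OF F(1) keys_diff F(2)] frag_ev_superset[OF F(1) _ F(2), of y] c
    by (simp add: N.finsum_addf)
  also have "\<dots> = (\<Oplus>\<^bsub>N\<^esub>p\<in>?F. ?t x p)"
  proof (rule N.finsum_cong')
    fix p assume p: "p \<in> ?F"
    then have "g p \<in> carrier N" using F g by auto
    then show "?t (x - y) p \<oplus>\<^bsub>N\<^esub> ?t y p = ?t x p"
      using group.int_pow_mult[OF N.a_group, of "g p" "Poly_Mapping.lookup (x - y) p" "Poly_Mapping.lookup y p"]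
      by (simp add: add_pow_def lookup_minus)
  qed (use c in auto)
  also have "\<dots> = frag_ev N g x" using frag_ev_superset[OF F(1) _ F(2), of x] by simp
  finally show ?thesis
    using frag_ev_closed[OF x] frag_ev_closed[OF y] frag_ev_closed[OF diff_closedD(2)[OF diff_closed_frags x y]]
    by (metis N.minus_eq_iff)
qed

end

lemma frag_ev_bimap:
  fixes N :: "('r, 'n) module" and A :: "('s, 'a) module" and B :: "('s, 'b) module"
    and M :: "('t, 'm) module" and M' :: "('t, 'k) module"
  assumes N: "abelian_group N" and g: "\<And>p. p \<in> carrier B \<times> carrier M' \<Longrightarrow> g p \<in> carrier N"
    and f: "\<And>a. a \<in> carrier A \<Longrightarrow> f a \<in> carrier B" "\<And>m. m \<in> carrier M \<Longrightarrow> k m \<in> carrier M'"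
    and x: "x \<in> frags A M"
  shows "frag_ev N g (bimap f k x) = frag_ev N (\<lambda>(a, m). g (f a, k m)) x"
proof -
  have g': "(\<lambda>(a, m). g (f a, k m)) p \<in> carrier N" if "p \<in> carrier A \<times> carrier M" for p
    using that f by (auto intro: g)
  show ?thesis using x
  proof (induction x rule: frags_induct)
    case zero then show ?case
      by (simp add: frag_ev_zero[OF N])
  next
    case (one a m) then show ?case using f by (simp add: frag_ev_of[OF N g] frag_ev_of[OF N g'])
  next
    case (diff x y) then show ?case using bimap_frags[where f = f and g = k, OF diff(1) f] bimap_frags[where f = f and g = k, OF diff(2) f]
      by (simp add: frag_ev_diff[OF N g] frag_ev_diff[OF N g'])
  qed
qed

text \<open>The universal property of the tensor product with a module as target: all three kinds of
  relations are killed by a biadditive balanced map.\<close>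

lemma frag_ev_null:
  assumes x: "x \<in> tensor_null S A M" and AM: "left_module (op_ring S) A" "left_module S M"
    and N: "abelian_group N" and g: "\<And>p. p \<in> carrier A \<times> carrier M \<Longrightarrow> g p \<in> carrier N"
    and l: "\<And>a b m. a \<in> carrier A \<Longrightarrow> b \<in> carrier A \<Longrightarrow> m \<in> carrier M \<Longrightarrow> g (a \<oplus>\<^bsub>A\<^esub> b, m) = g (a, m) \<oplus>\<^bsub>N\<^esub> g (b, m)"
    and r: "\<And>a m n. a \<in> carrier A \<Longrightarrow> m \<in> carrier M \<Longrightarrow> n \<in> carrier M \<Longrightarrow> g (a, m \<oplus>\<^bsub>M\<^esub> n) = g (a, m) \<oplus>\<^bsub>N\<^esub> g (a, n)"
    and s: "\<And>s a m. s \<in> carrier S \<Longrightarrow> a \<in> carrier A \<Longrightarrow> m \<in> carrier M \<Longrightarrow> g (s \<odot>\<^bsub>A\<^esub> a, m) = g (a, s \<odot>\<^bsub>M\<^esub> m)"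
  shows "frag_ev N g x = \<zero>\<^bsub>N\<^esub>"
proof -
  interpret A: left_module "op_ring S" A by fact
  interpret M: left_module S M by fact
  interpret N: abelian_group N by fact
  note d = diff_closedD(2)[OF diff_closed_frags[of A M]]
  note ev = frag_ev_diff[OF N g] frag_ev_of[OF N g] frag_ev_zero[OF N]
  have A: "s \<odot>\<^bsub>A\<^esub> a \<in> carrier A" if "s \<in> carrier S" "a \<in> carrier A" for s a
    using A.smult_closed that by simp
  show ?thesis using x AM
  proof (induction x rule: tensor_null_induct)
    case (add_left a b m)
    then show ?case by (simp add: ev d g l N.minus_eq_iff N.a_comm)
  next
    case (add_right a m n)
    then show ?case by (simp add: ev d g r N.minus_eq_iff N.a_comm)
  next
    case (smult t a m)
    then show ?case by (simp add: ev A g s N.minus_eq_iff)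
  next
    case (diff x y)
    then show ?case by (simp add: ev N.minus_eq_iff)
  qed (simp add: ev)
qed

section \<open>The tensor product as a group\<close>

context
  fixes S :: "'s ring" and A :: "('s, 'a) module" and M :: "('s, 'm) module"
  assumes A: "left_module (op_ring S) A" and M: "left_module S M"
begin

interpretation A: left_module "op_ring S" A by (rule A)
interpretation M: left_module S M by (rule M)

lemmas tensor_null_closed = diff_closedD[OF diff_closed_tensor_null[OF A M]]

lemma mem_tensor_class: "y \<in> tensor_class S A M x \<longleftrightarrow> y - x \<in> tensor_null S A M"
proof -
  have "y \<in> tensor_class S A M x \<longleftrightarrow> (\<exists>h\<in>tensor_null S A M. y = h + x)"
    by (simp add: tensor_class_def r_coset_def)
  also have "\<dots> \<longleftrightarrow> y - x \<in> tensor_null S A M"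
    by (metis add_diff_cancel_right' diff_add_cancel)
  finally show ?thesis .
qed

lemma tensor_class_eq_iff: "tensor_class S A M x = tensor_class S A M y \<longleftrightarrow> x - y \<in> tensor_null S A M"
proof
  assume "tensor_class S A M x = tensor_class S A M y"
  then have "x \<in> tensor_class S A M y" using mem_tensor_class[of x x] tensor_null_closed(1) by simp
  then show "x - y \<in> tensor_null S A M" by (simp add: mem_tensor_class)
next
  assume xy: "x - y \<in> tensor_null S A M"
  have "z - x \<in> tensor_null S A M \<longleftrightarrow> z - y \<in> tensor_null S A M" for z
    using tensor_null_closed(4)[OF _ xy, of "z - x"] tensor_null_closed(2)[OF _ xy, of "z - y"] by auto
  then show "tensor_class S A M x = tensor_class S A M y" by (auto simp: mem_tensor_class)
qed

lemma carrier_tensor_group: "carrier (tensor_group S A M) = tensor_class S A M ` frags A M"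
  unfolding tensor_group_def FactGroup_def RCOSETS_def tensor_class_def frags_def by auto

lemma normal_tensor_null: "normal (tensor_null S A M) (free_Abelian_group (carrier A \<times> carrier M))"
  by (intro comm_group.subgroup_imp_normal abelian_free_Abelian_group subgroup_tensor_null A M)

lemma comm_group_tensor_group: "comm_group (tensor_group S A M)"
  unfolding tensor_group_def
  by (intro comm_group.abelian_FactGroup abelian_free_Abelian_group subgroup_tensor_null A M)

lemma tensor_class_mult:
  assumes "x \<in> frags A M" "y \<in> frags A M"
  shows "tensor_class S A M x \<otimes>\<^bsub>tensor_group S A M\<^esub> tensor_class S A M y = tensor_class S A M (x + y)"
proof -
  interpret normal "tensor_null S A M" "free_Abelian_group (carrier A \<times> carrier M)" by (rule normal_tensor_null)
  show ?thesis using rcos_sum[of x y] assms by (simp add: tensor_group_def tensor_class_def FactGroup_def frags_def)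
qed

lemma tensor_group_one: "\<one>\<^bsub>tensor_group S A M\<^esub> = tensor_class S A M 0"
  unfolding tensor_group_def FactGroup_def by (auto simp: mem_tensor_class)

lemma tensor_class_eq_one_iff: "tensor_class S A M x = \<one>\<^bsub>tensor_group S A M\<^esub> \<longleftrightarrow> x \<in> tensor_null S A M"
  by (simp add: tensor_group_one tensor_class_eq_iff)

end

text \<open>\<open>tensor_map\<close> applies \<open>the_elem\<close> to the image of a coset. This
  image is a singleton because \<open>bimap\<close> carries relations to relations; tensor maps can
  henceforth be computed on representatives.\<close>

lemma tensor_map_class:
  assumes f: "lin (op_ring S) A B f" and g: "lin S M N g" and x: "x \<in> frags A M"
  shows "tensor_map S A M B N f g (tensor_class S A M x) = tensor_class S B N (bimap f g x)"
proof -
  note AM = linD(1)[OF f] linD(1)[OF g] and BN = linD(2)[OF f] linD(2)[OF g]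
  have 1: "tensor_class S A M x \<in> carrier (tensor_group S A M)"
    using x by (simp add: carrier_tensor_group[OF AM])
  have eq: "tensor_class S B N (bimap f g y) = tensor_class S B N (bimap f g x)" if "y \<in> tensor_class S A M x" for y
    using that bimap_null[OF f g, of "y - x"] by (simp add: mem_tensor_class[OF AM] tensor_class_eq_iff[OF BN])
  have mem: "x \<in> tensor_class S A M x"
    using diff_closedD(1)[OF diff_closed_tensor_null[OF AM]] by (simp add: mem_tensor_class[OF AM])
  have im: "(\<lambda>y. tensor_class S B N (bimap f g y)) ` tensor_class S A M x = {tensor_class S B N (bimap f g x)}"
    using image_cong[OF refl eq] image_constant[OF mem] by (rule trans)
  have "tensor_map S A M B N f g (tensor_class S A M x) =
      the_elem ((\<lambda>y. tensor_class S B N (bimap f g y)) ` tensor_class S A M x)"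
    unfolding tensor_map_def bimap_def by (rule restrict_apply'[OF 1])
  then show ?thesis by (simp only: im the_elem_eq)
qed

text \<open>Congruences modulo \<open>K\<close> between additive expressions reduce to single
  generators: in applications \<Phi> is the difference of the two sides.\<close>

lemma frags_additive_closed:
  assumes "x \<in> frags A M" "diff_closed K" "\<And>x y. \<Phi> (x - y) = \<Phi> x - \<Phi> y"
    and "\<And>a m. a \<in> carrier A \<Longrightarrow> m \<in> carrier M \<Longrightarrow> \<Phi> (frag_of (a, m)) \<in> K"
  shows "\<Phi> x \<in> K"
  using assms(1)
proof (induction x rule: frags_induct)
  case zero
  have "\<Phi> 0 = 0" using assms(3)[of 0 0] by simp
  then show ?case using diff_closedD(1)[OF assms(2)] by simp
qed (use assms diff_closedD[OF assms(2)] in auto)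

abbreviation tmap :: "('a \<Rightarrow> 'b) \<Rightarrow> ('a \<times> 'm \<Rightarrow>\<^sub>0 int) \<Rightarrow> ('b \<times> 'm \<Rightarrow>\<^sub>0 int)" where
  "tmap f \<equiv> bimap f (\<lambda>m. m)"

section \<open>The functor \<open>- \<otimes> M\<close>\<close>

context
  fixes S :: "'s ring" and M :: "('s, 'm) module"
  assumes M: "left_module S M"
begin

lemma tmap_frags: "lin (op_ring S) A B f \<Longrightarrow> x \<in> frags A M \<Longrightarrow> tmap f x \<in> frags B M"
  by (rule bimap_frags) (auto simp: lin_closed)

lemma tmap_null: "lin (op_ring S) A B f \<Longrightarrow> x \<in> tensor_null S A M \<Longrightarrow> tmap f x \<in> tensor_null S B M"
  by (rule bimap_null[OF _ lin_id[OF M]])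

lemma tmap_null_diff:
  "lin (op_ring S) A B f \<Longrightarrow> x - y \<in> tensor_null S A M \<Longrightarrow> tmap f x - tmap f y \<in> tensor_null S B M"
  using tmap_null[of A B f "x - y"] by simp

lemma tmap_add:
  assumes f: "lin (op_ring S) A B f" and g: "lin (op_ring S) A B g" and x: "x \<in> frags A M"
  shows "tmap (\<lambda>a. f a \<oplus>\<^bsub>B\<^esub> g a) x - (tmap f x + tmap g x) \<in> tensor_null S B M"
  by (rule frags_additive_closed[OF x diff_closed_tensor_null[OF linD(2)[OF f] M]])
     (use tensor_null_add_left[of _ B _ _ M S] in \<open>auto simp: lin_closed[OF f] lin_closed[OF g] diff_diff_eq\<close>)

text \<open>Additivity in the first argument, applied to (f a - g a) + g a = f a.\<close>

lemma tmap_minus: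
  assumes f: "lin (op_ring S) A B f" and g: "lin (op_ring S) A B g" and x: "x \<in> frags A M"
  shows "tmap (\<lambda>a. f a \<ominus>\<^bsub>B\<^esub> g a) x - (tmap f x - tmap g x) \<in> tensor_null S B M"
proof (rule frags_additive_closed[OF x diff_closed_tensor_null[OF linD(2)[OF f] M]])
  interpret B: left_module "op_ring S" B by (rule linD[OF f])
  note K = diff_closedD[OF diff_closed_tensor_null[OF B.left_module_axioms M]]
  fix a m assume a: "a \<in> carrier A" "m \<in> carrier M"
  have c: "f a \<in> carrier B" "g a \<in> carrier B" using a lin_closed[OF f] lin_closed[OF g] by auto
  then have "(f a \<ominus>\<^bsub>B\<^esub> g a) \<oplus>\<^bsub>B\<^esub> g a = f a" using B.M.minus_eq_iff[of "f a" "g a" "f a \<ominus>\<^bsub>B\<^esub> g a"] by simp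
  then have "frag_of (f a, m) - frag_of (f a \<ominus>\<^bsub>B\<^esub> g a, m) - frag_of (g a, m) \<in> tensor_null S B M"
    using tensor_null_add_left[of "f a \<ominus>\<^bsub>B\<^esub> g a" B "g a" m M S] a c by simp
  from K(3)[OF this]
  show "tmap (\<lambda>a. f a \<ominus>\<^bsub>B\<^esub> g a) (frag_of (a, m)) - (tmap f (frag_of (a, m)) - tmap g (frag_of (a, m))) \<in> tensor_null S B M"
    by (simp add: algebra_simps)
qed simp

text \<open>The additivity relation for 0 + 0 = 0 collapses to minus the generator (0, m), which is
  therefore null.\<close>

lemma tmap_zero:
  assumes A: "left_module (op_ring S) A" and B: "left_module (op_ring S) B" and x: "x \<in> frags A M"
  shows "tmap (\<lambda>_. \<zero>\<^bsub>B\<^esub>) x \<in> tensor_null S B M"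
proof (rule frags_additive_closed[OF x diff_closed_tensor_null[OF B M]])
  interpret B: left_module "op_ring S" B by (rule B)
  fix a m assume a: "a \<in> carrier A" "m \<in> carrier M"
  have "- frag_of (\<zero>\<^bsub>B\<^esub>, m) \<in> tensor_null S B M"
    using tensor_null_add_left[of "\<zero>\<^bsub>B\<^esub>" B "\<zero>\<^bsub>B\<^esub>" m M S] a by simp
  then show "tmap (\<lambda>_. \<zero>\<^bsub>B\<^esub>) (frag_of (a, m)) \<in> tensor_null S B M"
    using diff_closedD(3)[OF diff_closed_tensor_null[OF B M]] by force
qed simp

lemma tmap_finsum:
  assumes "finite I" "\<And>i. i \<in> I \<Longrightarrow> lin (op_ring S) A B (f i)" and x: "x \<in> frags A M"
    and A: "left_module (op_ring S) A" and B: "left_module (op_ring S) B"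
  shows "tmap (\<lambda>a. \<Oplus>\<^bsub>B\<^esub>i\<in>I. f i a) x - (\<Sum>i\<in>I. tmap (f i) x) \<in> tensor_null S B M"
  using assms(1,2)
proof (induction I)
  case empty
  interpret B: left_module "op_ring S" B by (rule B)
  show ?case using tmap_zero[OF A B x] by simp
next
  case (insert j I)
  interpret B: left_module "op_ring S" B by (rule B)
  note K = diff_closed_tensor_null[OF B M]
  have c: "f i a \<in> carrier B" if "i \<in> insert j I" "a \<in> carrier A" for i a
    using that by (intro lin_closed[OF insert.prems])
  have "tmap (\<lambda>a. \<Oplus>\<^bsub>B\<^esub>i\<in>insert j I. f i a) x = tmap (\<lambda>a. f j a \<oplus>\<^bsub>B\<^esub> (\<Oplus>\<^bsub>B\<^esub>i\<in>I. f i a)) x"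
    using insert c by (intro bimap_cong[OF x]) (auto intro!: B.M.finsum_insert)
  moreover have "tmap (\<lambda>a. f j a \<oplus>\<^bsub>B\<^esub> (\<Oplus>\<^bsub>B\<^esub>i\<in>I. f i a)) x - (tmap (f j) x + tmap (\<lambda>a. \<Oplus>\<^bsub>B\<^esub>i\<in>I. f i a) x) \<in> tensor_null S B M"
    using insert A B by (intro tmap_add[OF _ _ x] lin_finsum_map) auto
  moreover have "tmap (\<lambda>a. \<Oplus>\<^bsub>B\<^esub>i\<in>I. f i a) x - (\<Sum>i\<in>I. tmap (f i) x) \<in> tensor_null S B M"
    using insert by auto
  ultimately show ?case using insert(1,2) diff_closedD(4)[OF K] by (fastforce simp: algebra_simps)
qed

text \<open>Lifting generator by generator reaches the representative z itself, not only its
  class.\<close>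

lemma tensor_surj:
  assumes "\<And>c. c \<in> carrier C \<Longrightarrow> \<exists>b\<in>carrier B. g b = c" and z: "z \<in> frags C M"
  obtains y where "y \<in> frags B M" "tmap g y = z"
proof -
  have "\<exists>y\<in>frags B M. tmap g y = z" using z
  proof (induction z rule: frags_induct)
    case zero then show ?case using diff_closedD(1)[OF diff_closed_frags] by (intro bexI[of _ 0]) auto
  next
    case (one a m)
    then obtain b where "b \<in> carrier B" "g b = a" using assms(1) by blast
    with one show ?case by (intro bexI[of _ "frag_of (b, m)"]) auto
  next
    case (diff x y)
    then obtain x' y' where "x' \<in> frags B M" "y' \<in> frags B M" "tmap g x' = x" "tmap g y' = y" by blast
    then show ?case using diff_closedD(2)[OF diff_closed_frags] by (intro bexI[of _ "x' - y'"]) auto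
  qed
  with that show ?thesis by blast
qed

text \<open>For a set-theoretic section \<open>s\<close> of \<open>g\<close>, the map \<open>s \<otimes> M\<close> on representatives takes relations of
  \<open>C \<otimes> M\<close> into the image of \<open>A \<otimes> M\<close>, and it inverts \<open>g \<otimes> M\<close> up to this image.\<close>

lemma tensor_right_exact:
  assumes f: "lin (op_ring S) A B f" and g: "lin (op_ring S) B C g"
    and onto: "\<And>c. c \<in> carrier C \<Longrightarrow> \<exists>b\<in>carrier B. g b = c"
    and ex: "\<And>b. b \<in> carrier B \<Longrightarrow> g b = \<zero>\<^bsub>C\<^esub> \<Longrightarrow> \<exists>a\<in>carrier A. f a = b"
    and y: "y \<in> frags B M" and gy: "tmap g y \<in> tensor_null S C M"
  obtains x where "x \<in> frags A M" "y - tmap f x \<in> tensor_null S B M"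
proof -
  interpret A: left_module "op_ring S" A by (rule linD[OF f])
  interpret B: left_module "op_ring S" B by (rule linD[OF f])
  interpret C: left_module "op_ring S" C by (rule linD[OF g])
  interpret M: left_module S M by (rule M)
  note AM = A.left_module_axioms and BM = B.left_module_axioms
  note K = diff_closedD[OF diff_closed_tensor_null[OF BM M]]
  note FA = diff_closedD[OF diff_closed_frags[of A M]]
  \<comment> \<open>The relations of B \<otimes> M together with the image of A \<otimes> M. The
    claim is that y lies in this subgroup.\<close>
  define Q where "Q = {y. \<exists>x\<in>frags A M. y - tmap f x \<in> tensor_null S B M}"
  have KQ: "tensor_null S B M \<subseteq> Q" unfolding Q_def using FA(1) by (auto intro!: bexI[of _ 0])
  have Q: "diff_closed Q"
    unfolding diff_closed_def
  proof (intro conjI ballI)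
    fix u v assume "u \<in> Q" "v \<in> Q"
    then obtain x x' where "x \<in> frags A M" "u - tmap f x \<in> tensor_null S B M"
      "x' \<in> frags A M" "v - tmap f x' \<in> tensor_null S B M" unfolding Q_def by blast
    with FA(2) K(2)[of "u - tmap f x" "v - tmap f x'"] show "u - v \<in> Q"
      unfolding Q_def by (auto intro!: bexI[of _ "x - x'"] simp: algebra_simps)
  qed (use KQ K(1) in auto)
  note q = diff_closedD[OF Q]
  \<comment> \<open>Exactness at \<open>B\<close> enters here: b - b' lies in the kernel of g, hence
    in the image of f.\<close>
  have same: "frag_of (b, m) - frag_of (b', m) \<in> Q"
    if bb: "b \<in> carrier B" "b' \<in> carrier B" "m \<in> carrier M" "g b = g b'" for b b' m
  proof -
    have "g (b \<ominus>\<^bsub>B\<^esub> b') = \<zero>\<^bsub>C\<^esub>" using bb lin_closed[OF g] by (simp add: lin_minus[OF g] C.M.minus_eq_zero_iff)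
    then obtain a where a: "a \<in> carrier A" "f a = b \<ominus>\<^bsub>B\<^esub> b'"
      using ex[OF B.M.minus_closed[OF bb(1,2)]] by blast
    then have "b = f a \<oplus>\<^bsub>B\<^esub> b'" using bb B.M.minus_eq_iff[of b b' "f a"] lin_closed[OF f a(1)] by simp
    then have "frag_of (b, m) - frag_of (f a, m) - frag_of (b', m) \<in> tensor_null S B M"
      using tensor_null_add_left[of "f a" B b' m M S] that a lin_closed[OF f] by simp
    with a bb show ?thesis unfolding Q_def by (auto intro!: bexI[of _ "frag_of (a, m)"] simp: algebra_simps)
  qed
  define s where "s c = (SOME b. b \<in> carrier B \<and> g b = c)" for c
  have s: "s c \<in> carrier B \<and> g (s c) = c" if "c \<in> carrier C" for c
    unfolding s_def by (rule someI_ex) (use onto[OF that] in auto)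
  have sQ: "tmap s z \<in> Q" if "z \<in> tensor_null S C M" for z
    unfolding bimap_def
  proof (rule frag_extend_tensor_null[OF that C.left_module_axioms M Q]; simp)
    fix a b m assume a: "a \<in> carrier C" "b \<in> carrier C" "m \<in> carrier M"
    have "frag_of (s (a \<oplus>\<^bsub>C\<^esub> b), m) - frag_of (s a \<oplus>\<^bsub>B\<^esub> s b, m) \<in> Q"
      using a s by (intro same) (auto simp: lin_add[OF g])
    moreover have "frag_of (s a \<oplus>\<^bsub>B\<^esub> s b, m) - frag_of (s a, m) - frag_of (s b, m) \<in> Q"
      using a s by (intro subsetD[OF KQ] tensor_null_add_left) auto
    ultimately show "frag_of (s (a \<oplus>\<^bsub>C\<^esub> b), m) - frag_of (s a, m) - frag_of (s b, m) \<in> Q"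
      using q(4) by (fastforce simp: algebra_simps)
  next
    fix a m n assume "a \<in> carrier C" "m \<in> carrier M" "n \<in> carrier M"
    then show "frag_of (s a, m \<oplus>\<^bsub>M\<^esub> n) - frag_of (s a, m) - frag_of (s a, n) \<in> Q"
      using s by (intro subsetD[OF KQ] tensor_null_add_right) auto
  next
    fix t a m assume a: "t \<in> carrier S" "a \<in> carrier C" "m \<in> carrier M"
    have tB: "t \<odot>\<^bsub>B\<^esub> b \<in> carrier B" if "b \<in> carrier B" for b using that a B.smult_closed by simp
    have "frag_of (s (t \<odot>\<^bsub>C\<^esub> a), m) - frag_of (t \<odot>\<^bsub>B\<^esub> s a, m) \<in> Q"
      using a s tB C.smult_closed by (intro same) (auto simp: lin_smult[OF g])
    moreover have "frag_of (t \<odot>\<^bsub>B\<^esub> s a, m) - frag_of (s a, t \<odot>\<^bsub>M\<^esub> m) \<in> Q"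
      using a s by (intro subsetD[OF KQ] tensor_null_smult) auto
    ultimately show "frag_of (s (t \<odot>\<^bsub>C\<^esub> a), m) - frag_of (s a, t \<odot>\<^bsub>M\<^esub> m) \<in> Q"
      using q(4) by (fastforce simp: algebra_simps)
  qed
  have "y - tmap s (tmap g y) \<in> Q"
    by (rule frags_additive_closed[OF y Q]) (use same s lin_closed[OF g] in auto)
  with q(4)[OF this sQ[OF gy]] have "y \<in> Q" by simp
  with that show ?thesis unfolding Q_def by blast
qed

text \<open>For a resolution of A this is the vanishing of Tor(A,M) in the degrees i + 1, that is,
  in all positive degrees: cycles modulo relations are boundaries modulo relations.\<close>

definition tensor_acyclic :: "(nat \<Rightarrow> ('s, 'p) module) \<Rightarrow> (nat \<Rightarrow> 'p \<Rightarrow> 'p) \<Rightarrow> bool" where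
  "tensor_acyclic P d \<longleftrightarrow> (\<forall>i. \<forall>x\<in>frags (P (Suc i)) M. tmap (d i) x \<in> tensor_null S (P i) M \<longrightarrow>
     (\<exists>y\<in>frags (P (Suc (Suc i))) M. x - tmap (d (Suc i)) y \<in> tensor_null S (P (Suc i)) M))"

lemma tensor_acyclicD:
  assumes "tensor_acyclic P d" "x \<in> frags (P (Suc i)) M" "tmap (d i) x \<in> tensor_null S (P i) M"
  obtains y where "y \<in> frags (P (Suc (Suc i))) M" "x - tmap (d (Suc i)) y \<in> tensor_null S (P (Suc i)) M"
  using assms unfolding tensor_acyclic_def by blast

text \<open>The counterpart of \<open>hom_acyclic_at_retr\<close>: Tor(X,M) is a summand of a power
  of Tor(Y,M). Sums of maps turn into sums of representatives only up to relations, so each step is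
  a membership in \<open>?K\<close>.\<close>

lemma tensor_acyclic_retr:
  assumes XY: "retr (op_ring S) Y X" and P: "resol (op_ring S) X P d e" and Q: "resol (op_ring S) Y Q d' e'"
    and ac: "tensor_acyclic Q d'"
  shows "tensor_acyclic P d"
  unfolding tensor_acyclic_def
proof (intro allI ballI impI)
  fix i z assume z: "z \<in> frags (P (Suc i)) M" and dz: "tmap (d i) z \<in> tensor_null S (P i) M"
  note p = resolD[OF P] and q = resolD[OF Q]
  obtain n \<alpha> \<beta> h where
    \<alpha>: "\<And>i k. i < n \<Longrightarrow> lin (op_ring S) (P k) (Q k) (\<alpha> i k)" and \<beta>: "\<And>i k. i < n \<Longrightarrow> lin (op_ring S) (Q k) (P k) (\<beta> i k)"
    and \<alpha>d: "\<And>i k x. i < n \<Longrightarrow> x \<in> carrier (P (Suc k)) \<Longrightarrow> d' k (\<alpha> i (Suc k) x) = \<alpha> i k (d k x)"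
    and \<beta>d: "\<And>i k x. i < n \<Longrightarrow> x \<in> carrier (Q (Suc k)) \<Longrightarrow> d k (\<beta> i (Suc k) x) = \<beta> i k (d' k x)"
    and h: "\<And>k. lin (op_ring S) (P k) (P (Suc k)) (h k)"
    and hd: "\<And>k x. x \<in> carrier (P (Suc k)) \<Longrightarrow>
      (\<Oplus>\<^bsub>P (Suc k)\<^esub>i\<in>{..<n::nat}. \<beta> i (Suc k) (\<alpha> i (Suc k) x)) \<ominus>\<^bsub>P (Suc k)\<^esub> x
        = d (Suc k) (h (Suc k) x) \<oplus>\<^bsub>P (Suc k)\<^esub> h k (d k x)"
    by (rule retr_chain_maps[OF XY P Q]) blast
  have mP: "left_module (op_ring S) (P k)" for k by (rule resol_module[OF P])
  let ?K = "tensor_null S (P (Suc i)) M"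
  note dK = diff_closed_tensor_null[OF mP[of "Suc i"] M]
  note K = diff_closedD[OF dK]
  have "\<exists>w\<in>frags (Q (Suc (Suc i))) M. tmap (\<alpha> k (Suc i)) z - tmap (d' (Suc i)) w \<in> tensor_null S (Q (Suc i)) M"
    if k: "k < n" for k
  proof -
    have "tmap (d' i) (tmap (\<alpha> k (Suc i)) z) = tmap (\<alpha> k i) (tmap (d i) z)"
      unfolding bimap_bimap by (rule bimap_cong[OF z]) (use \<alpha>d k in auto)
    then have "tmap (d' i) (tmap (\<alpha> k (Suc i)) z) \<in> tensor_null S (Q i) M"
      using tmap_null[OF \<alpha>[OF k] dz] by simp
    from tensor_acyclicD[OF ac tmap_frags[OF \<alpha>[OF k] z] this] show ?thesis by blast
  qed
  then obtain w where w: "\<And>k. k < n \<Longrightarrow> w k \<in> frags (Q (Suc (Suc i))) M"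
    "\<And>k. k < n \<Longrightarrow> tmap (\<alpha> k (Suc i)) z - tmap (d' (Suc i)) (w k) \<in> tensor_null S (Q (Suc i)) M" by metis
  \<comment> \<open>The identity is \<Sum> \<beta> \<alpha> - d h - h d. On z the last term is null,
    and \<alpha> z is the boundary of w on \<open>Q\<close>, so z is the boundary of \<Sum> \<beta>
    w - h z.\<close>
  let ?y = "(\<Sum>k<n. tmap (\<beta> k (Suc (Suc i))) (w k)) - tmap (h (Suc i)) z"
  have y: "?y \<in> frags (P (Suc (Suc i))) M"
    by (intro diff_closedD(2)[OF diff_closed_frags] diff_closed_sum[OF diff_closed_frags])
       (use tmap_frags[OF \<beta> w(1)] tmap_frags[OF h z] in auto)
  have s: "lin (op_ring S) (P (Suc i)) (P (Suc i)) (\<lambda>x. \<Oplus>\<^bsub>P (Suc i)\<^esub>k\<in>{..<n}. \<beta> k (Suc i) (\<alpha> k (Suc i) x))"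
    using mP by (intro lin_finsum_map lin_comp[OF \<alpha> \<beta>]) auto
  let ?\<gamma> = "tmap (\<lambda>x. (\<Oplus>\<^bsub>P (Suc i)\<^esub>k\<in>{..<n}. \<beta> k (Suc i) (\<alpha> k (Suc i) x)) \<ominus>\<^bsub>P (Suc i)\<^esub> x) z"
  have 1: "?\<gamma> - (tmap (\<lambda>x. \<Oplus>\<^bsub>P (Suc i)\<^esub>k\<in>{..<n}. \<beta> k (Suc i) (\<alpha> k (Suc i) x)) z - z) \<in> ?K"
    using tmap_minus[OF s lin_id[OF mP] z] by simp
  have 2: "tmap (\<lambda>x. \<Oplus>\<^bsub>P (Suc i)\<^esub>k\<in>{..<n}. \<beta> k (Suc i) (\<alpha> k (Suc i) x)) z
      - (\<Sum>k<n. tmap (\<lambda>x. \<beta> k (Suc i) (\<alpha> k (Suc i) x)) z) \<in> ?K"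
    using mP by (intro tmap_finsum[OF _ _ z] lin_comp[OF \<alpha> \<beta>]) auto
  have 3: "(\<Sum>k<n. tmap (\<lambda>x. \<beta> k (Suc i) (\<alpha> k (Suc i) x)) z) - (\<Sum>k<n. tmap (d (Suc i)) (tmap (\<beta> k (Suc (Suc i))) (w k))) \<in> ?K"
    unfolding sum_subtractf[symmetric]
  proof (rule diff_closed_sum[OF dK])
    fix k assume "k \<in> {..<n}" then have k: "k < n" by simp
    have "tmap (d (Suc i)) (tmap (\<beta> k (Suc (Suc i))) (w k)) = tmap (\<beta> k (Suc i)) (tmap (d' (Suc i)) (w k))"
      unfolding bimap_bimap by (rule bimap_cong[OF w(1)[OF k]]) (use \<beta>d k in auto)
    then show "tmap (\<lambda>x. \<beta> k (Suc i) (\<alpha> k (Suc i) x)) z - tmap (d (Suc i)) (tmap (\<beta> k (Suc (Suc i))) (w k)) \<in> ?K"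
      using tmap_null_diff[OF \<beta>[OF k] w(2)[OF k]] by (simp add: bimap_bimap)
  qed
  have "?\<gamma> = tmap (\<lambda>x. d (Suc i) (h (Suc i) x) \<oplus>\<^bsub>P (Suc i)\<^esub> h i (d i x)) z"
    by (rule bimap_cong[OF z]) (use hd in auto)
  then have 4: "?\<gamma> - (tmap (d (Suc i)) (tmap (h (Suc i)) z) + tmap (h i) (tmap (d i) z)) \<in> ?K"
    using tmap_add[OF lin_comp[OF h p(2)] lin_comp[OF p(2) h] z] by (simp add: bimap_bimap)
  have 5: "tmap (h i) (tmap (d i) z) \<in> ?K" by (rule tmap_null[OF h dz])
  \<comment> \<open>The right side is 1 - 4 + 2 + 3 - 5 in terms of the memberships established
    before; everything else cancels.\<close>
  have "z - tmap (d (Suc i)) ?y = (?\<gamma> - (tmap (\<lambda>x. \<Oplus>\<^bsub>P (Suc i)\<^esub>k\<in>{..<n}. \<beta> k (Suc i) (\<alpha> k (Suc i) x)) z - z))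
     - (?\<gamma> - (tmap (d (Suc i)) (tmap (h (Suc i)) z) + tmap (h i) (tmap (d i) z)))
     + (tmap (\<lambda>x. \<Oplus>\<^bsub>P (Suc i)\<^esub>k\<in>{..<n}. \<beta> k (Suc i) (\<alpha> k (Suc i) x)) z
      - (\<Sum>k<n. tmap (\<lambda>x. \<beta> k (Suc i) (\<alpha> k (Suc i) x)) z)) +
     ((\<Sum>k<n. tmap (\<lambda>x. \<beta> k (Suc i) (\<alpha> k (Suc i) x)) z) - (\<Sum>k<n. tmap (d (Suc i)) (tmap (\<beta> k (Suc (Suc i))) (w k))))
     - tmap (h i) (tmap (d i) z)" (is "_ = ?rhs")
    by (simp add: bimap_sum algebra_simps)
  moreover have "?rhs \<in> ?K" by (intro K(2)[OF _ 5] K(4) K(2)[OF 1 4] 2 3)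
  ultimately have "z - tmap (d (Suc i)) ?y \<in> ?K" by (simp only:)
  with y show "\<exists>y\<in>frags (P (Suc (Suc i))) M. z - tmap (d (Suc i)) y \<in> ?K" by blast
qed

text \<open>This is the part Tor_(j+1)(C,M) -> Tor_j(A,M) -> Tor_j(B,M) of the long exact sequence,
  read for j > 0 in the first claim and for j = 0 in the second. A cycle z of \<open>P\<close>
  together with some w bounding its image in \<open>Q\<close> is a cycle of the cone, which resolves
  \<open>C\<close>.\<close>

lemma tensor_acyclic_ses:
  assumes ABC: "ses (op_ring S) A i B p C" and P: "resol (op_ring S) A P d e"
    and Q: "resol (op_ring S) B Q d' e'" and V: "resol (op_ring S) C V dV eV"
    and acQ: "tensor_acyclic Q d'" and acV: "tensor_acyclic V dV"
  shows "tensor_acyclic P d"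
    and "\<And>x. x \<in> frags A M \<Longrightarrow> tmap i x \<in> tensor_null S B M \<Longrightarrow> x \<in> tensor_null S A M"
proof -
  let ?R = "op_ring S"
  note p = resolD[OF P] and q = resolD[OF Q] and s = sesD[OF ABC]
  have mP: "left_module ?R (P n)" and mQ: "left_module ?R (Q n)" for n
    by (rule resol_module[OF P] resol_module[OF Q])+
  have mA: "left_module ?R A" and mB: "left_module ?R B" and mC: "left_module ?R C"
    using s(1,2) by (auto dest: linD)
  obtain \<phi> where \<phi>: "\<And>n. lin ?R (P n) (Q n) (\<phi> n)" "\<And>x. x \<in> carrier (P 0) \<Longrightarrow> e' (\<phi> 0 x) = i (e x)"
      "\<And>n x. x \<in> carrier (P (Suc n)) \<Longrightarrow> d' n (\<phi> (Suc n) x) = \<phi> n (d n x)"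
    by (rule chain_map_exists[OF P Q s(1)]) blast
  interpret P: left_module ?R "P n" for n by (rule mP)
  interpret Q: left_module ?R "Q n" for n by (rule mQ)
  note m0 = left_module_zero_submodule[OF mP[of 0]]
  let ?W = "cone_mod P Q" and ?D = "cone_d P Q d d' \<phi>"
  have W: "resol ?R C ?W ?D (\<lambda>z. p (e' (snd z)))" by (rule resol_cone[OF P Q ABC \<phi>])
  have mW: "left_module ?R (?W n)" for n by (rule resol_module[OF W])
  have acW: "tensor_acyclic ?W ?D" by (rule tensor_acyclic_retr[OF retr_refl[OF mC] W V acV])
  note cl = lin_closed[OF p(2)] lin_closed[OF q(2)] lin_closed[OF \<phi>(1)]
  have F: "x \<in> frags N M \<Longrightarrow> y \<in> frags N M \<Longrightarrow> x - y \<in> frags N M" for x y and N :: "('s, 'z) module"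
    by (rule diff_closedD(2)[OF diff_closed_frags])
  \<comment> \<open>For k = 0 the cycle condition \<open>dz\<close> is void, as there is no
    differential below \<open>P 0\<close>. This case serves the injectivity claim, the cases k > 0
    the acyclicity.\<close>
  have *: "\<exists>y\<in>frags (P (Suc k)) M. z - tmap (d k) y \<in> tensor_null S (P k) M"
    if z: "z \<in> frags (P k) M" and w: "w \<in> frags (Q (Suc k)) M"
      and zw: "tmap (\<phi> k) z - tmap (d' k) w \<in> tensor_null S (Q k) M"
      and dz: "\<And>j. k = Suc j \<Longrightarrow> tmap (d j) z \<in> tensor_null S (P j) M" for k z w
  proof -
    let ?v = "tmap (\<lambda>x. (x, \<zero>\<^bsub>Q (Suc k)\<^esub>)) z + tmap (\<lambda>y. (\<zero>\<^bsub>P k\<^esub>, y)) w"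
    let ?J = "\<lambda>y. (fst \<zero>\<^bsub>?W k\<^esub>, y)"
    note KW = diff_closedD[OF diff_closed_tensor_null[OF mW[of k] M]]
    interpret W: left_module ?R "?W k" by (rule mW)
    have J: "lin ?R (Q k) (?W k) ?J"
    proof (cases k)
      case 0 then show ?thesis using lin_inr[OF m0 mQ[of 0]] by simp
    next
      case (Suc j) then show ?thesis using lin_inr[OF mP[of j] mQ[of k]] by simp
    qed
    have v: "?v \<in> frags (?W (Suc k)) M"
      using tmap_frags[OF lin_inl[OF mP mQ] z] tmap_frags[OF lin_inr[OF mP mQ] w]
      by (auto intro: diff_closedD(4)[OF diff_closed_frags])
    \<comment> \<open>On (z, 0) the cone differential gives (d z, \<phi> z), where d z is null; on
      (0, w) it gives -d' w in the second component. Together they leave \<phi> z - d' w, which is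
      null by assumption.\<close>
    have a: "tmap (?D k) (tmap (\<lambda>x. (x, \<zero>\<^bsub>Q (Suc k)\<^esub>)) z) - tmap ?J (tmap (\<phi> k) z) \<in> tensor_null S (?W k) M"
    proof (cases k)
      case 0
      have "tmap (?D k) (tmap (\<lambda>x. (x, \<zero>\<^bsub>Q (Suc k)\<^esub>)) z) = tmap ?J (tmap (\<phi> k) z)"
        unfolding bimap_bimap using z
        by (rule bimap_cong) (use 0 cl in \<open>simp_all add: lin_zero[OF q(2)] Q.M.minus_zero_right\<close>)
      then show ?thesis using KW(1) by simp
    next
      case (Suc j)
      let ?I = "\<lambda>x. (x, \<zero>\<^bsub>Q k\<^esub>)"
      have I: "lin ?R (P j) (?W k) ?I" using lin_inl[OF mP[of j] mQ[of k]] Suc by simp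
      have dj: "lin ?R (P k) (P j) (d j)" using p(2) Suc by simp
      have "tmap (?D k) (tmap (\<lambda>x. (x, \<zero>\<^bsub>Q (Suc k)\<^esub>)) z) = tmap (\<lambda>x. ?I (d j x) \<oplus>\<^bsub>?W k\<^esub> ?J (\<phi> k x)) z"
        unfolding bimap_bimap using z
        by (rule bimap_cong) (use Suc cl in \<open>simp_all add: lin_zero[OF q(2)] Q.M.minus_zero_right\<close>)
      moreover have "tmap (\<lambda>x. ?I (d j x) \<oplus>\<^bsub>?W k\<^esub> ?J (\<phi> k x)) z - (tmap (\<lambda>x. ?I (d j x)) z + tmap (\<lambda>x. ?J (\<phi> k x)) z) \<in> tensor_null S (?W k) M"
        by (rule tmap_add[OF lin_comp[OF dj I] lin_comp[OF \<phi>(1) J] z])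
      moreover have "tmap (\<lambda>x. ?I (d j x)) z \<in> tensor_null S (?W k) M"
        using tmap_null[OF I dz[OF Suc]] by (simp add: bimap_bimap)
      ultimately show ?thesis using KW(4) by (fastforce simp: bimap_bimap algebra_simps)
    qed
    have b: "tmap (?D k) (tmap (\<lambda>y. (\<zero>\<^bsub>P k\<^esub>, y)) w) + tmap ?J (tmap (d' k) w) \<in> tensor_null S (?W k) M"
    proof -
      have zl: "lin ?R (Q (Suc k)) (?W k) (\<lambda>_. \<zero>\<^bsub>?W k\<^esub>)" by (rule lin_zero_map[OF mQ mW])
      have "?D k (\<zero>\<^bsub>P k\<^esub>, y) = \<zero>\<^bsub>?W k\<^esub> \<ominus>\<^bsub>?W k\<^esub> ?J (d' k y)" if y: "y \<in> carrier (Q (Suc k))" for y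
      proof -
        have "?D k (\<zero>\<^bsub>P k\<^esub>, y) \<oplus>\<^bsub>?W k\<^esub> ?J (d' k y) = \<zero>\<^bsub>?W k\<^esub>"
          using y cl by (cases k) (simp_all add: lin_zero[OF \<phi>(1)] lin_zero[OF p(2)] a_minus_def Q.M.l_neg)
        moreover have "?D k (\<zero>\<^bsub>P k\<^esub>, y) \<in> carrier (?W k)"
          using y lin_closed[OF lin_cone_d[OF P Q ABC \<phi>], of "(\<zero>\<^bsub>P k\<^esub>, y)" k] by simp
        ultimately show ?thesis using y cl lin_closed[OF J] W.M.minus_eq_iff by (metis W.M.zero_closed)
      qed
      then have "tmap (?D k) (tmap (\<lambda>y. (\<zero>\<^bsub>P k\<^esub>, y)) w) = tmap (\<lambda>y. \<zero>\<^bsub>?W k\<^esub> \<ominus>\<^bsub>?W k\<^esub> ?J (d' k y)) w"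
        unfolding bimap_bimap using w by (intro bimap_cong) auto
      moreover have "tmap (\<lambda>y. \<zero>\<^bsub>?W k\<^esub> \<ominus>\<^bsub>?W k\<^esub> ?J (d' k y)) w - (tmap (\<lambda>_. \<zero>\<^bsub>?W k\<^esub>) w - tmap (\<lambda>y. ?J (d' k y)) w)
          \<in> tensor_null S (?W k) M"
        by (rule tmap_minus[OF zl lin_comp[OF q(2) J] w])
      moreover have "tmap (\<lambda>_. \<zero>\<^bsub>?W k\<^esub>) w \<in> tensor_null S (?W k) M" by (rule tmap_zero[OF mQ mW w])
      ultimately show ?thesis using KW(4) by (fastforce simp: bimap_bimap algebra_simps)
    qed
    have "tmap (?D k) ?v = (tmap (?D k) (tmap (\<lambda>x. (x, \<zero>\<^bsub>Q (Suc k)\<^esub>)) z) - tmap ?J (tmap (\<phi> k) z)) +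
       (tmap (?D k) (tmap (\<lambda>y. (\<zero>\<^bsub>P k\<^esub>, y)) w) + tmap ?J (tmap (d' k) w)) +
       (tmap ?J (tmap (\<phi> k) z) - tmap ?J (tmap (d' k) w))" (is "_ = ?rhs")
      by (simp add: algebra_simps)
    moreover have "?rhs \<in> tensor_null S (?W k) M"
      by (intro KW(4) a b tmap_null_diff[OF J zw])
    ultimately have "tmap (?D k) ?v \<in> tensor_null S (?W k) M" by simp
    then obtain y where y: "y \<in> frags (?W (Suc (Suc k))) M" "?v - tmap (?D (Suc k)) y \<in> tensor_null S (?W (Suc k)) M"
      by (rule tensor_acyclicD[OF acW v])
    note KP = diff_closedD[OF diff_closed_tensor_null[OF mP[of k] M]]
    have f1: "lin ?R (?W (Suc k)) (P k) fst" using lin_fst[OF mP mQ] by simp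
    have f2: "lin ?R (?W (Suc (Suc k))) (P (Suc k)) fst" using lin_fst[OF mP mQ] by simp
    have "tmap fst ?v - tmap fst (tmap (?D (Suc k)) y) \<in> tensor_null S (P k) M"
      by (rule tmap_null_diff[OF f1 y(2)])
    moreover have "tmap fst (tmap (\<lambda>x. (x, \<zero>\<^bsub>Q (Suc k)\<^esub>)) z) = z" by (simp add: bimap_bimap)
    moreover have "tmap fst (tmap (\<lambda>y. (\<zero>\<^bsub>P k\<^esub>, y)) w) \<in> tensor_null S (P k) M"
      using tmap_zero[OF mQ mP w] by (simp add: bimap_bimap)
    moreover have "tmap fst (tmap (?D (Suc k)) y) = tmap (d k) (tmap fst y)"
      unfolding bimap_bimap by simp
    ultimately have "z - tmap (d k) (tmap fst y) \<in> tensor_null S (P k) M"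
      using KP(2)[of "tmap fst ?v - tmap fst (tmap (?D (Suc k)) y)" "tmap fst (tmap (\<lambda>y. (\<zero>\<^bsub>P k\<^esub>, y)) w)"]
      by (simp add: algebra_simps)
    then show ?thesis using tmap_frags[OF f2 y(1)] by blast
  qed
  show "tensor_acyclic P d"
    unfolding tensor_acyclic_def
  proof (intro allI ballI impI)
    fix j z assume z: "z \<in> frags (P (Suc j)) M" and dz: "tmap (d j) z \<in> tensor_null S (P j) M"
    have "tmap (d' j) (tmap (\<phi> (Suc j)) z) = tmap (\<phi> j) (tmap (d j) z)"
      unfolding bimap_bimap by (rule bimap_cong[OF z]) (use \<phi> in auto)
    then have "tmap (d' j) (tmap (\<phi> (Suc j)) z) \<in> tensor_null S (Q j) M"
      using tmap_null[OF \<phi>(1) dz] by simp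
    then obtain w where "w \<in> frags (Q (Suc (Suc j))) M"
      "tmap (\<phi> (Suc j)) z - tmap (d' (Suc j)) w \<in> tensor_null S (Q (Suc j)) M"
      by (rule tensor_acyclicD[OF acQ tmap_frags[OF \<phi>(1) z]])
    from *[OF z this] dz
    show "\<exists>y\<in>frags (P (Suc (Suc j))) M. z - tmap (d (Suc j)) y \<in> tensor_null S (P (Suc j)) M" by simp
  qed
  fix x assume x: "x \<in> frags A M" and ix: "tmap i x \<in> tensor_null S B M"
  obtain z where z: "z \<in> frags (P 0) M" "tmap e z = x" by (rule tensor_surj[OF p(4) x])
  have "tmap e' (tmap (\<phi> 0) z) = tmap i (tmap e z)"
    unfolding bimap_bimap by (rule bimap_cong[OF z(1)]) (use \<phi> in auto)
  then have "tmap e' (tmap (\<phi> 0) z) \<in> tensor_null S B M" using ix z by simp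
  \<comment> \<open>The image of the lift z vanishes in B \<otimes> M, so right exactness along Q 1
    -> Q 0 -> B makes \<phi> z a boundary up to relations.\<close>
  then obtain w where "w \<in> frags (Q (Suc 0)) M" "tmap (\<phi> 0) z - tmap (d' 0) w \<in> tensor_null S (Q 0) M"
    using tensor_right_exact[OF q(2) q(3) q(4) q(7) tmap_frags[OF \<phi>(1) z(1)]] by blast
  from *[OF z(1) this] obtain y where y: "y \<in> frags (P (Suc 0)) M" "z - tmap (d 0) y \<in> tensor_null S (P 0) M"
    by auto
  have "tmap e (tmap (d 0) y) = tmap (\<lambda>_. \<zero>\<^bsub>A\<^esub>) y"
    unfolding bimap_bimap by (rule bimap_cong[OF y(1)]) (use p(5) in auto)
  then have "tmap e (tmap (d 0) y) \<in> tensor_null S A M" using tmap_zero[OF mP mA y(1)] by simp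
  with tmap_null_diff[OF p(3) y(2)] z(2) show "x \<in> tensor_null S A M"
    using diff_closedD(4)[OF diff_closed_tensor_null[OF mA M]] by fastforce
qed

end

section \<open>Tor and Ext\<close>

lemma all_pos_iff_all_Suc: "(\<forall>i>0. Q i) \<longleftrightarrow> (\<forall>j. Q (Suc j))"
  by (metis Suc_pred zero_less_Suc)

lemma trivial_quotient_iff:
  assumes G: "comm_group G" and K: "subgroup K G" and H: "subgroup H G" and HK: "H \<subseteq> K"
  shows "trivial_group (G\<lparr>carrier := K\<rparr> Mod H) \<longleftrightarrow> K \<subseteq> H"
proof -
  interpret G: comm_group G by fact
  interpret K: comm_group "G\<lparr>carrier := K\<rparr>" 
    by (rule group.group_comm_groupI[OF subgroup.subgroup_is_group[OF K G.group_axioms]])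
       (use subgroup.mem_carrier[OF K] in \<open>auto simp: G.m_comm\<close>)
  have HK': "subgroup H (G\<lparr>carrier := K\<rparr>)" by (rule G.subgroup_incl[OF H K HK])
  interpret H: normal H "G\<lparr>carrier := K\<rparr>" by (rule K.subgroup_imp_normal[OF HK'])
  have "carrier (G\<lparr>carrier := K\<rparr> Mod H) = {H} \<longleftrightarrow> K \<subseteq> H"
  proof
    assume a: "carrier (G\<lparr>carrier := K\<rparr> Mod H) = {H}"
    show "K \<subseteq> H"
    proof
      fix x assume x: "x \<in> K"
      then have "H #>\<^bsub>G\<lparr>carrier := K\<rparr>\<^esub> x \<in> carrier (G\<lparr>carrier := K\<rparr> Mod H)"
        by (auto simp: FactGroup_def RCOSETS_def)
      with a x show "x \<in> H" using K.rcos_self[OF _ HK', of x] by auto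
    qed
  next
    assume "K \<subseteq> H"
    then have "H #>\<^bsub>G\<lparr>carrier := K\<rparr>\<^esub> x = H" if "x \<in> K" for x
      using that K.coset_join2[OF _ HK', of x] by auto
    then show "carrier (G\<lparr>carrier := K\<rparr> Mod H) = {H}"
      using subgroup.one_closed[OF K] by (auto simp: FactGroup_def RCOSETS_def)
  qed
  then show ?thesis using H.factorgroup_is_group by (simp add: trivial_group_def FactGroup_def)
qed

lemma tensor_map_hom:
  assumes f: "lin (op_ring S) A B f" and g: "lin S M N g"
  shows "tensor_map S A M B N f g \<in> hom (tensor_group S A M) (tensor_group S B N)"
proof (rule homI)
  note AM = linD(1)[OF f] linD(1)[OF g] and BN = linD(2)[OF f] linD(2)[OF g]
  have c: "bimap f g x \<in> frags B N" if "x \<in> frags A M" for x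
    by (rule bimap_frags[OF that]) (auto simp: lin_closed[OF f] lin_closed[OF g])
  show "tensor_map S A M B N f g x \<in> carrier (tensor_group S B N)" if "x \<in> carrier (tensor_group S A M)" for x
    using that c by (auto simp: carrier_tensor_group[OF AM] carrier_tensor_group[OF BN] tensor_map_class[OF f g])
  fix x y assume "x \<in> carrier (tensor_group S A M)" "y \<in> carrier (tensor_group S A M)"
  then obtain u v where "u \<in> frags A M" "v \<in> frags A M" "x = tensor_class S A M u" "y = tensor_class S A M v"
    by (auto simp: carrier_tensor_group[OF AM])
  then show "tensor_map S A M B N f g (x \<otimes>\<^bsub>tensor_group S A M\<^esub> y) =
      tensor_map S A M B N f g x \<otimes>\<^bsub>tensor_group S B N\<^esub> tensor_map S A M B N f g y"
    using diff_closedD(4)[OF diff_closed_frags, of u A M v] c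
    by (simp add: tensor_class_mult[OF AM] tensor_class_mult[OF BN] tensor_map_class[OF f g])
qed

text \<open>Kernels and images in the complex of tensor groups consist of the classes of cycles and
  boundaries among representatives, so triviality of the quotient can be read on
  representatives.\<close>

lemma trivial_Tor_iff:
  assumes A: "left_module (op_ring S) A" and M: "left_module S M"
  shows "(\<forall>i>0. trivial_group (Tor S A M i)) \<longleftrightarrow>
    tensor_acyclic S M (free_res (op_ring S) A) (free_res_d (op_ring S) A)"
proof -
  define P where "P = free_res (op_ring S) A"
  define d where "d = free_res_d (op_ring S) A"
  have res: "resol (op_ring S) A P d (free_res_aug (op_ring S) A)"
    unfolding P_def d_def by (rule resol_free_res[OF A])
  note p = resolD[OF res] and mP = resol_module[OF res]
  define C where "C n = tensor_group S (P n) M" for n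
  define bd where "bd n = tensor_map S (P (Suc n)) M (P n) M (d n) (id_hom M)" for n
  have id: "lin S M M (id_hom M)" by (rule lin_cong[OF lin_id[OF M]]) (simp add: id_hom_def)
  have C: "comm_group (C n)" for n unfolding C_def by (rule comm_group_tensor_group[OF mP M])
  have bd: "group_hom (C (Suc n)) (C n) (bd n)" for n
    unfolding group_hom_def group_hom_axioms_def
    using C tensor_map_hom[OF p(2) id] by (simp add: comm_group_def C_def bd_def)
  have tc: "bd n (tensor_class S (P (Suc n)) M x) = tensor_class S (P n) M (tmap (d n) x)"
    if "x \<in> frags (P (Suc n)) M" for n x
    unfolding bd_def tensor_map_class[OF p(2) id that]
    using bimap_cong[OF that, of "d n" "d n" "id_hom M" "\<lambda>m. m"] by (simp add: id_hom_def)
  have cC: "carrier (C n) = tensor_class S (P n) M ` frags (P n) M" for n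
    unfolding C_def by (rule carrier_tensor_group[OF mP M])
  have dd: "tmap (d n) (tmap (d (Suc n)) x) \<in> tensor_null S (P n) M" if x: "x \<in> frags (P (Suc (Suc n))) M" for n x
  proof -
    have "tmap (d n) (tmap (d (Suc n)) x) = tmap (\<lambda>_. \<zero>\<^bsub>P n\<^esub>) x"
      unfolding bimap_bimap by (rule bimap_cong[OF x]) (use p(6) in auto)
    then show ?thesis using tmap_zero[OF M mP mP x] by simp
  qed
  have one: "tensor_class S (P n) M x = \<one>\<^bsub>C n\<^esub> \<longleftrightarrow> x \<in> tensor_null S (P n) M" for n x
    unfolding C_def by (rule tensor_class_eq_one_iff[OF mP M])
  have eq: "tensor_class S (P n) M x = tensor_class S (P n) M y \<longleftrightarrow> x - y \<in> tensor_null S (P n) M" for n x y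
    by (rule tensor_class_eq_iff[OF mP M])
  have fr: "tmap (d n) x \<in> frags (P n) M" if "x \<in> frags (P (Suc n)) M" for n x
    by (rule tmap_frags[OF M p(2) that])
  have T: "trivial_group (Tor S A M (Suc j)) \<longleftrightarrow> kernel (C (Suc j)) (C j) (bd j) \<subseteq> bd (Suc j) ` carrier (C (Suc (Suc j)))" for j
  proof -
    have "Tor S A M (Suc j) = (C (Suc j))\<lparr>carrier := kernel (C (Suc j)) (C j) (bd j)\<rparr> Mod (bd (Suc j) ` carrier (C (Suc (Suc j))))"
      unfolding Tor_def P_def C_def bd_def d_def by (simp add: Let_def)
    moreover have "bd (Suc j) ` carrier (C (Suc (Suc j))) \<subseteq> kernel (C (Suc j)) (C j) (bd j)"
    proof
      fix c assume "c \<in> bd (Suc j) ` carrier (C (Suc (Suc j)))"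
      then obtain x where x: "x \<in> frags (P (Suc (Suc j))) M" "c = tensor_class S (P (Suc j)) M (tmap (d (Suc j)) x)"
        by (auto simp: cC tc)
      then have "bd j c = \<one>\<^bsub>C j\<^esub>" using dd[OF x(1)] by (simp only: x(2) tc[OF fr[OF x(1)]] one)
      then show "c \<in> kernel (C (Suc j)) (C j) (bd j)" using x fr by (simp add: kernel_def cC)
    qed
    ultimately show ?thesis
      using trivial_quotient_iff[OF C group_hom.subgroup_kernel[OF bd] group_hom.img_is_subgroup[OF bd]] by simp
  qed
  have k: "kernel (C (Suc j)) (C j) (bd j) = tensor_class S (P (Suc j)) M ` {x \<in> frags (P (Suc j)) M. tmap (d j) x \<in> tensor_null S (P j) M}" for j
  proof -
    have "bd j (tensor_class S (P (Suc j)) M x) = \<one>\<^bsub>C j\<^esub> \<longleftrightarrow> tmap (d j) x \<in> tensor_null S (P j) M"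
      if "x \<in> frags (P (Suc j)) M" for x
      by (simp only: tc[OF that] one)
    then show ?thesis unfolding kernel_def cC by blast
  qed
  have i: "bd (Suc j) ` carrier (C (Suc (Suc j))) = (\<lambda>y. tensor_class S (P (Suc j)) M (tmap (d (Suc j)) y)) ` frags (P (Suc (Suc j))) M" for j
    by (auto simp: cC tc image_iff)
  have "trivial_group (Tor S A M (Suc j)) \<longleftrightarrow> (\<forall>x\<in>frags (P (Suc j)) M. tmap (d j) x \<in> tensor_null S (P j) M \<longrightarrow>
     (\<exists>y\<in>frags (P (Suc (Suc j))) M. x - tmap (d (Suc j)) y \<in> tensor_null S (P (Suc j)) M))" for j
    unfolding T k i by (auto simp: image_subset_iff image_iff eq)
  then show ?thesis
    unfolding tensor_acyclic_def[OF M] P_def[symmetric] d_def[symmetric]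
    by (simp add: all_pos_iff_all_Suc)
qed

lemma comm_group_hom_group:
  fixes M :: "('r, 'm) module" and N :: "('r, 'n) module"
  assumes M: "left_module R M" and N: "left_module R N"
  shows "comm_group (hom_group R M N)"
proof -
  interpret M: left_module R M by fact
  interpret N: left_module R N by fact
  have cl: "(\<lambda>x\<in>carrier M. f x \<oplus>\<^bsub>N\<^esub> g x) \<in> mod_hom R M N" if "f \<in> mod_hom R M N" "g \<in> mod_hom R M N" for f g
    by (intro restrict_mod_hom lin_add_map lin_mod_hom that M N)
  show ?thesis
  proof (rule comm_groupI)
    fix f g assume "f \<in> carrier (hom_group R M N)" "g \<in> carrier (hom_group R M N)"
    then have f: "f \<in> mod_hom R M N" and g: "g \<in> mod_hom R M N" by (simp_all add: hom_group_def)
    show "f \<otimes>\<^bsub>hom_group R M N\<^esub> g \<in> carrier (hom_group R M N)"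
      using cl[OF f g] by (simp add: hom_group_def)
    show "f \<otimes>\<^bsub>hom_group R M N\<^esub> g = g \<otimes>\<^bsub>hom_group R M N\<^esub> f"
      using mod_homD(2)[OF f] mod_homD(2)[OF g] by (auto intro!: restrict_ext simp: N.M.a_comm hom_group_def)
    fix h assume "h \<in> carrier (hom_group R M N)"
    then have h: "h \<in> mod_hom R M N" by (simp add: hom_group_def)
    show "f \<otimes>\<^bsub>hom_group R M N\<^esub> g \<otimes>\<^bsub>hom_group R M N\<^esub> h = f \<otimes>\<^bsub>hom_group R M N\<^esub> (g \<otimes>\<^bsub>hom_group R M N\<^esub> h)"
      using mod_homD(2)[OF f] mod_homD(2)[OF g] mod_homD(2)[OF h]
      by (auto intro!: restrict_ext simp: N.M.a_assoc hom_group_def)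
  next
    show "\<one>\<^bsub>hom_group R M N\<^esub> \<in> carrier (hom_group R M N)"
      using restrict_mod_hom[OF lin_zero_map[OF M N]] by (simp add: hom_group_def)
  next
    fix f assume "f \<in> carrier (hom_group R M N)"
    then have f: "f \<in> mod_hom R M N" by (simp add: hom_group_def)
    show "\<one>\<^bsub>hom_group R M N\<^esub> \<otimes>\<^bsub>hom_group R M N\<^esub> f = f"
      using mod_homD(1,2)[OF f] by (intro extensionalityI[of _ "carrier M"]) (auto simp: PiE_def hom_group_def)
    have "(\<lambda>x\<in>carrier M. \<ominus>\<^bsub>N\<^esub> f x) \<in> mod_hom R M N"
      by (intro restrict_mod_hom lin_neg_map lin_mod_hom f M N)
    then show "\<exists>g\<in>carrier (hom_group R M N). g \<otimes>\<^bsub>hom_group R M N\<^esub> f = \<one>\<^bsub>hom_group R M N\<^esub>"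
      using mod_homD(2)[OF f] by (intro bexI[of _ "\<lambda>x\<in>carrier M. \<ominus>\<^bsub>N\<^esub> f x"])
        (auto simp: N.M.l_neg hom_group_def intro!: restrict_ext)
  qed
qed

lemma precomp_hom:
  assumes f: "lin R M M' f" and N: "left_module R N"
  shows "precomp M f \<in> hom (hom_group R M' N) (hom_group R M N)"
proof (rule homI)
  have M': "left_module R M'" using f by (rule linD)
  show "precomp M f g \<in> carrier (hom_group R M N)" if "g \<in> carrier (hom_group R M' N)" for g
    using restrict_mod_hom[OF lin_comp[OF f lin_mod_hom[OF _ M' N]]] that
    by (simp add: hom_group_def precomp_def compose_def)
  show "precomp M f (g \<otimes>\<^bsub>hom_group R M' N\<^esub> h) = precomp M f g \<otimes>\<^bsub>hom_group R M N\<^esub> precomp M f h" for g h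
    using lin_closed[OF f] by (auto simp: hom_group_def precomp_def compose_def intro!: restrict_ext)
qed

text \<open>Besides unfolding the quotient this passes from extensional homomorphisms to
  \<open>lin\<close>: cocycles are restricted to the carrier in one direction, primitives in the
  other.\<close>

lemma trivial_Ext_iff:
  fixes M :: "('r, 'm) module" and N :: "('r, 'n) module"
  assumes M: "left_module R M" and N: "left_module R N"
  shows "(\<forall>i>0. trivial_group (Ext R M N i)) \<longleftrightarrow> hom_acyclic R (free_res R M) (free_res_d R M) N"
proof -
  define P where "P = free_res R M"
  define d where "d = free_res_d R M"
  have res: "resol R M P d (free_res_aug R M)"
    unfolding P_def d_def by (rule resol_free_res[OF M])
  note p = resolD[OF res] and mP = resol_module[OF res]
  interpret N: left_module R N by fact
  define C where "C n = hom_group R (P n) N" for n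
  define \<delta> :: "nat \<Rightarrow> ((('r, 'm) cell \<Rightarrow> 'r) \<Rightarrow> 'n) \<Rightarrow> (('r, 'm) cell \<Rightarrow> 'r) \<Rightarrow> 'n"
    where "\<delta> n = precomp (P (Suc n)) (d n)" for n
  have C: "comm_group (C n)" for n unfolding C_def by (rule comm_group_hom_group[OF mP N])
  have \<delta>: "group_hom (C n) (C (Suc n)) (\<delta> n)" for n
    unfolding group_hom_def group_hom_axioms_def
    using C precomp_hom[OF p(2) N] by (simp add: comm_group_def C_def \<delta>_def)
  have ker: "f \<in> kernel (C (Suc j)) (C (Suc (Suc j))) (\<delta> (Suc j)) \<longleftrightarrow> f \<in> mod_hom R (P (Suc j)) N \<and>
     (\<forall>x\<in>carrier (P (Suc (Suc j))). f (d (Suc j) x) = \<zero>\<^bsub>N\<^esub>)" for f j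
    by (auto simp: kernel_def C_def hom_group_def \<delta>_def precomp_def compose_def fun_eq_iff restrict_def split: if_splits)
  have "trivial_group (Ext R M N (Suc j)) \<longleftrightarrow> kernel (C (Suc j)) (C (Suc (Suc j))) (\<delta> (Suc j)) \<subseteq> \<delta> j ` carrier (C j)" for j
  proof -
    have "Ext R M N (Suc j) = (C (Suc j))\<lparr>carrier := kernel (C (Suc j)) (C (Suc (Suc j))) (\<delta> (Suc j))\<rparr> Mod (\<delta> j ` carrier (C j))"
      unfolding Ext_def P_def C_def \<delta>_def d_def by (simp add: Let_def)
    moreover have "\<delta> j ` carrier (C j) \<subseteq> kernel (C (Suc j)) (C (Suc (Suc j))) (\<delta> (Suc j))"
    proof (rule image_subsetI, unfold ker, intro conjI ballI)
      fix f assume f: "f \<in> carrier (C j)"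
      then show "\<delta> j f \<in> mod_hom R (P (Suc j)) N"
        using group_hom.hom_closed[OF \<delta> f] by (simp add: C_def hom_group_def)
      fix x assume "x \<in> carrier (P (Suc (Suc j)))"
      then show "\<delta> j f (d (Suc j) x) = \<zero>\<^bsub>N\<^esub>"
        using p(6) lin_closed[OF p(2)] f lin_zero[OF lin_mod_hom[OF _ mP N]]
        by (simp add: \<delta>_def precomp_def compose_def C_def hom_group_def)
    qed
    ultimately show ?thesis
      using trivial_quotient_iff[OF C group_hom.subgroup_kernel[OF \<delta>] group_hom.img_is_subgroup[OF \<delta>]] by simp
  qed
  moreover have "kernel (C (Suc j)) (C (Suc (Suc j))) (\<delta> (Suc j)) \<subseteq> \<delta> j ` carrier (C j) \<longleftrightarrow>
    (\<forall>f. lin R (P (Suc j)) N f \<longrightarrow> (\<forall>x\<in>carrier (P (Suc (Suc j))). f (d (Suc j) x) = \<zero>\<^bsub>N\<^esub>) \<longrightarrow>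
     (\<exists>g. lin R (P j) N g \<and> (\<forall>x\<in>carrier (P (Suc j)). g (d j x) = f x)))" (is "?L \<longleftrightarrow> ?R") for j
  proof
    assume L: ?L
    show ?R
    proof (intro allI impI)
      fix f assume f: "lin R (P (Suc j)) N f" "\<forall>x\<in>carrier (P (Suc (Suc j))). f (d (Suc j) x) = \<zero>\<^bsub>N\<^esub>"
      have "restrict f (carrier (P (Suc j))) \<in> kernel (C (Suc j)) (C (Suc (Suc j))) (\<delta> (Suc j))"
        unfolding ker using f restrict_mod_hom[OF f(1)] lin_closed[OF p(2)] by simp
      then obtain g where g: "g \<in> mod_hom R (P j) N" "restrict f (carrier (P (Suc j))) = \<delta> j g"
        using L by (auto simp: C_def hom_group_def)
      have "g (d j x) = f x" if "x \<in> carrier (P (Suc j))" for x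
        using fun_cong[OF g(2), of x] that by (simp add: \<delta>_def precomp_def compose_def)
      with g show "\<exists>g. lin R (P j) N g \<and> (\<forall>x\<in>carrier (P (Suc j)). g (d j x) = f x)"
        using lin_mod_hom[OF g(1) mP N] by blast
    qed
  next
    assume R: ?R
    show ?L
    proof
      fix f assume "f \<in> kernel (C (Suc j)) (C (Suc (Suc j))) (\<delta> (Suc j))"
      then have f: "f \<in> mod_hom R (P (Suc j)) N" "\<forall>x\<in>carrier (P (Suc (Suc j))). f (d (Suc j) x) = \<zero>\<^bsub>N\<^esub>"
        by (auto simp: ker)
      then obtain g where g: "lin R (P j) N g" "\<forall>x\<in>carrier (P (Suc j)). g (d j x) = f x"
        using R lin_mod_hom[OF f(1) mP N] by blast
      have "f = \<delta> j (restrict g (carrier (P j)))"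
        using mod_homD(1)[OF f(1)] g(2) lin_closed[OF p(2)]
        by (intro extensionalityI[of _ "carrier (P (Suc j))"]) (auto simp: \<delta>_def precomp_def compose_def PiE_def)
      then show "f \<in> \<delta> j ` carrier (C j)" using restrict_mod_hom[OF g(1)] by (auto simp: C_def hom_group_def)
    qed
  qed
  ultimately show ?thesis
    unfolding hom_acyclic_def hom_acyclic_at_def P_def[symmetric] d_def[symmetric]
    by (simp add: all_pos_iff_all_Suc)
qed

section \<open>Duals with respect to \<open>T\<close>\<close>

lemma mod_hom_eqI:
  assumes "f \<in> mod_hom R M N" "g \<in> mod_hom R M N" "\<And>x. x \<in> carrier M \<Longrightarrow> f x = g x"
  shows "f = g"
  using assms mod_homD(1)[OF assms(1)] mod_homD(1)[OF assms(2)]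
  by (intro extensionalityI[of _ "carrier M"]) (auto simp: PiE_def)

text \<open>Hom groups and tensor groups are multiplicative records while modules use the additive
  fields; the group axioms are carried over here.\<close>

lemma abelian_group_of_comm_group:
  assumes "comm_group H" and eq: "carrier G = carrier H" "ring.add G = monoid.mult H" "ring.zero G = one H"
  shows "abelian_group G"
proof -
  interpret H: comm_group H by fact
  show ?thesis
  proof (rule abelian_groupI; (unfold eq)?)
    show "\<exists>y\<in>carrier H. y \<otimes>\<^bsub>H\<^esub> x = \<one>\<^bsub>H\<^esub>" if "x \<in> carrier H" for x
      using that by (intro bexI[of _ "inv\<^bsub>H\<^esub> x"]) auto
  qed (auto simp: H.m_ac)
qed

text \<open>S acts on the values, (\<phi> s)(x) = s (\<phi> x), hence by composition on the left.
  Special cases, as right S-modules: the dual of R is T and the dual of T is S.\<close>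

definition dual_mod :: "'r ring \<Rightarrow> ('r, 't) module \<Rightarrow> ('r, 'x) module \<Rightarrow> ('t \<Rightarrow> 't, 'x \<Rightarrow> 't) module" where
  "dual_mod R T X = \<lparr>carrier = mod_hom R X T, monoid.mult = undefined, one = undefined,
     ring.zero = \<one>\<^bsub>hom_group R X T\<^esub>, ring.add = monoid.mult (hom_group R X T),
     smult = (\<lambda>s \<phi>. compose (carrier X) s \<phi>)\<rparr>"

lemma dual_mod_sel [simp]:
  "carrier (dual_mod R T X) = mod_hom R X T" "\<zero>\<^bsub>dual_mod R T X\<^esub> = (\<lambda>x\<in>carrier X. \<zero>\<^bsub>T\<^esub>)"
  "\<phi> \<oplus>\<^bsub>dual_mod R T X\<^esub> \<psi> = (\<lambda>x\<in>carrier X. \<phi> x \<oplus>\<^bsub>T\<^esub> \<psi> x)" "s \<odot>\<^bsub>dual_mod R T X\<^esub> \<phi> = compose (carrier X) s \<phi>"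
  by (simp_all add: dual_mod_def hom_group_def)

lemma hom_obj_sel [simp]:
  "carrier (hom_obj R T N) = mod_hom R T N" "\<zero>\<^bsub>hom_obj R T N\<^esub> = (\<lambda>x\<in>carrier T. \<zero>\<^bsub>N\<^esub>)"
  "f \<oplus>\<^bsub>hom_obj R T N\<^esub> g = (\<lambda>x\<in>carrier T. f x \<oplus>\<^bsub>N\<^esub> g x)" "s \<odot>\<^bsub>hom_obj R T N\<^esub> f = compose (carrier T) f s"
  by (simp_all add: hom_obj_def hom_group_def)

lemma End_ring_sel [simp]:
  "carrier (End_ring R T) = mod_hom R T T" "\<zero>\<^bsub>End_ring R T\<^esub> = (\<lambda>x\<in>carrier T. \<zero>\<^bsub>T\<^esub>)"
  "f \<oplus>\<^bsub>End_ring R T\<^esub> g = (\<lambda>x\<in>carrier T. f x \<oplus>\<^bsub>T\<^esub> g x)" "f \<otimes>\<^bsub>End_ring R T\<^esub> g = compose (carrier T) g f"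
  "\<one>\<^bsub>End_ring R T\<^esub> = id_hom T"
  by (simp_all add: End_ring_def hom_group_def)

lemma right_End_module_sel [simp]:
  "carrier (right_End_module T) = carrier T" "\<zero>\<^bsub>right_End_module T\<^esub> = \<zero>\<^bsub>T\<^esub>"
  "x \<oplus>\<^bsub>right_End_module T\<^esub> y = x \<oplus>\<^bsub>T\<^esub> y" "s \<odot>\<^bsub>right_End_module T\<^esub> x = s x"
  by (simp_all add: right_End_module_def)

lemma regular_module_sel [simp]:
  "carrier (regular_module R) = carrier R" "\<zero>\<^bsub>regular_module R\<^esub> = \<zero>\<^bsub>R\<^esub>"
  "x \<oplus>\<^bsub>regular_module R\<^esub> y = x \<oplus>\<^bsub>R\<^esub> y" "s \<odot>\<^bsub>regular_module R\<^esub> x = s \<otimes>\<^bsub>R\<^esub> x"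
  by (simp_all add: regular_module_def)

lemma left_module_regular:
  assumes "ring R" shows "left_module R (regular_module R)"
proof -
  interpret R: ring R by fact
  have "abelian_group (regular_module R)"
    by (rule abelian_groupI) (auto simp: R.a_ac intro: bexI[of _ "\<ominus>\<^bsub>R\<^esub> x" for x] R.l_neg)
  then interpret abelian_group "regular_module R" .
  show ?thesis by unfold_locales (auto simp: R.l_distr R.r_distr R.m_assoc)
qed

lemma id_hom_mod_hom: "left_module R M \<Longrightarrow> id_hom M \<in> mod_hom R M M"
  using restrict_mod_hom[OF lin_id] by (simp add: id_hom_def)

lemma ring_End_ring:
  assumes T: "left_module R T"
  shows "ring (End_ring R T)"
proof -
  interpret T: left_module R T by fact
  have "abelian_group (End_ring R T)"
    by (rule abelian_group_of_comm_group[OF comm_group_hom_group[OF T T]]) (simp_all add: End_ring_def hom_group_def)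
  moreover have "monoid (End_ring R T)"
  proof (rule monoidI)
    fix f g assume fg: "f \<in> carrier (End_ring R T)" "g \<in> carrier (End_ring R T)"
    then show "f \<otimes>\<^bsub>End_ring R T\<^esub> g \<in> carrier (End_ring R T)"
      using mod_hom_compose[of f R T T g T] T by simp
    fix h assume "h \<in> carrier (End_ring R T)"
    with fg show "f \<otimes>\<^bsub>End_ring R T\<^esub> g \<otimes>\<^bsub>End_ring R T\<^esub> h = f \<otimes>\<^bsub>End_ring R T\<^esub> (g \<otimes>\<^bsub>End_ring R T\<^esub> h)"
      by (auto simp: compose_def mod_homD(2) intro!: restrict_ext)
  next
    fix f assume "f \<in> carrier (End_ring R T)"
    then have f: "f \<in> mod_hom R T T" by simp
    show "\<one>\<^bsub>End_ring R T\<^esub> \<otimes>\<^bsub>End_ring R T\<^esub> f = f" "f \<otimes>\<^bsub>End_ring R T\<^esub> \<one>\<^bsub>End_ring R T\<^esub> = f"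
      using mod_homD(1)[OF f] by (auto simp: id_hom_def PiE_def compose_Id compose_def intro!: extensionalityI[of _ "carrier T"])
  qed (use id_hom_mod_hom[OF T] in simp)
  ultimately show ?thesis
    by (rule ringI) (auto simp: compose_def mod_homD(2,3) intro!: restrict_ext)
qed

locale End_module =
  fixes R :: "'r ring" and T :: "('r, 't) module"
  assumes T: "left_module R T"
begin

sublocale T: left_module R T by (rule T)

abbreviation "S \<equiv> End_ring R T"
abbreviation "TS \<equiv> right_End_module T"
abbreviation "dual \<equiv> dual_mod R T"

lemma ring_S: "ring S"
  by (rule ring_End_ring[OF T])

lemma ring_op_S: "ring (op_ring S)"
  by (rule ring_op_ring[OF ring_S])

lemma left_module_TS: "left_module (op_ring S) TS"
proof -
  interpret ring "op_ring S" by (rule ring_op_S)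
  have "abelian_group TS"
    by (rule abelian_groupI) (auto simp: T.M.a_ac intro: bexI[of _ "\<ominus>\<^bsub>T\<^esub> x" for x] T.M.l_neg)
  then interpret abelian_group TS .
  show ?thesis
    by unfold_locales (auto simp: mod_homD(2,3) compose_def id_hom_def)
qed

lemma left_module_dual:
  assumes X: "left_module R X"
  shows "left_module (op_ring S) (dual X)"
proof -
  interpret X: left_module R X by fact
  interpret ring "op_ring S" by (rule ring_op_S)
  have "abelian_group (dual X)"
    by (rule abelian_group_of_comm_group[OF comm_group_hom_group[OF X T]]) (simp_all add: dual_mod_def hom_group_def)
  then interpret abelian_group "dual X" .
  show ?thesis
  proof unfold_locales
    fix \<phi> assume "\<phi> \<in> carrier (dual X)"
    then have \<phi>: "\<phi> \<in> mod_hom R X T" by simp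
    show "\<one>\<^bsub>op_ring S\<^esub> \<odot>\<^bsub>dual X\<^esub> \<phi> = \<phi>"
      using mod_homD(1,2)[OF \<phi>] by (auto intro!: extensionalityI[of _ "carrier X"] simp: compose_def id_hom_def PiE_def)
    fix a assume "a \<in> carrier (op_ring S)"
    then show "a \<odot>\<^bsub>dual X\<^esub> \<phi> \<in> carrier (dual X)"
      using mod_hom_compose[OF \<phi> _ X] by simp
  qed (auto simp: compose_def mod_homD(2,3) intro!: restrict_ext)
qed

lemma left_module_hom_obj:
  assumes N: "left_module R N"
  shows "left_module S (hom_obj R T N)"
proof -
  interpret N: left_module R N by fact
  interpret ring S by (rule ring_S)
  have "abelian_group (hom_obj R T N)"
    by (rule abelian_group_of_comm_group[OF comm_group_hom_group[OF T N]]) (simp_all add: hom_obj_def hom_group_def)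
  then interpret abelian_group "hom_obj R T N" .
  show ?thesis
  proof unfold_locales
    fix f assume "f \<in> carrier (hom_obj R T N)"
    then have f: "f \<in> mod_hom R T N" by simp
    show "\<one>\<^bsub>S\<^esub> \<odot>\<^bsub>hom_obj R T N\<^esub> f = f"
      using mod_homD(1,2)[OF f] by (auto intro!: extensionalityI[of _ "carrier T"] simp: compose_def id_hom_def PiE_def)
    fix a assume "a \<in> carrier S"
    then show "a \<odot>\<^bsub>hom_obj R T N\<^esub> f \<in> carrier (hom_obj R T N)"
      using mod_hom_compose[OF _ f T] by simp
  qed (auto simp: compose_def mod_homD(2,3) intro!: restrict_ext)
qed

lemma lin_precomp:
  assumes f: "lin R X Y f"
  shows "lin (op_ring S) (dual Y) (dual X) (precomp X f)"
proof (rule linI)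
  have X: "left_module R X" and Y: "left_module R Y" using f by (auto dest: linD)
  show "left_module (op_ring S) (dual Y)" "left_module (op_ring S) (dual X)"
    by (rule left_module_dual X Y)+
  note fc = lin_closed[OF f]
  interpret X: left_module R X by fact
  fix \<phi> assume "\<phi> \<in> carrier (dual Y)"
  then have \<phi>: "\<phi> \<in> mod_hom R Y T" by simp
  show "precomp X f \<phi> \<in> carrier (dual X)"
    using restrict_mod_hom[OF lin_comp[OF f lin_mod_hom[OF \<phi> Y T]]] by (simp add: precomp_def compose_def)
  show "precomp X f (\<phi> \<oplus>\<^bsub>dual Y\<^esub> \<psi>) = precomp X f \<phi> \<oplus>\<^bsub>dual X\<^esub> precomp X f \<psi>" for \<psi>
    using fc by (auto simp: precomp_def compose_def intro!: restrict_ext)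
  show "precomp X f (s \<odot>\<^bsub>dual Y\<^esub> \<phi>) = s \<odot>\<^bsub>dual X\<^esub> precomp X f \<phi>" for s
    using fc by (auto simp: precomp_def compose_def intro!: restrict_ext)
qed

lemma precomp_apply: "x \<in> carrier X \<Longrightarrow> precomp X f \<phi> x = \<phi> (f x)"
  by (simp add: precomp_def compose_def)

lemma precomp_mod_hom: "lin R X Y f \<Longrightarrow> \<phi> \<in> mod_hom R Y T \<Longrightarrow> precomp X f \<phi> \<in> mod_hom R X T"
  using lin_closed[OF lin_precomp[of X Y f]] by simp

text \<open>Linearity of evaluation lets finite sums in \<open>dual X\<close> be computed pointwise;
  it also provides the augmentation of the dualized coresolution.\<close>

lemma lin_eval:
  assumes X: "left_module R X" and x: "x \<in> carrier X"
  shows "lin (op_ring S) (dual X) TS (\<lambda>\<phi>. \<phi> x)"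
  using x by (intro linI left_module_dual X left_module_TS) (auto simp: mod_homD(2) compose_def)

lemma finsum_TS: "finsum TS f I = finsum T f I"
  by (simp add: finsum_def right_End_module_def finprod_def)

lemma finsum_dual_apply:
  assumes "left_module R X" "x \<in> carrier X" "finite I" "\<And>i. i \<in> I \<Longrightarrow> f i \<in> mod_hom R X T"
  shows "(\<Oplus>\<^bsub>dual X\<^esub>i\<in>I. f i) x = (\<Oplus>\<^bsub>T\<^esub>i\<in>I. f i x)"
  using lin_finsum[OF lin_eval[OF assms(1,2)] assms(3), of f] assms(4) by (auto simp: finsum_TS)

lemma dual_retract_sum:
  assumes X: "left_module R X" and a: "\<And>i. i < n \<Longrightarrow> lin R X Y (a i)" and b: "\<And>i. i < n \<Longrightarrow> lin R Y X (b i)"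
    and sum: "\<And>x. x \<in> carrier X \<Longrightarrow> (\<Oplus>\<^bsub>X\<^esub>i\<in>{..<n::nat}. b i (a i x)) = x"
    and \<phi>: "\<phi> \<in> mod_hom R X T"
  shows "(\<Oplus>\<^bsub>dual X\<^esub>i\<in>{..<n}. precomp X (a i) (precomp Y (b i) \<phi>)) = \<phi>"
proof -
  interpret D: left_module "op_ring S" "dual X" by (rule left_module_dual[OF X])
  have c: "precomp X (a i) (precomp Y (b i) \<phi>) \<in> mod_hom R X T" if "i < n" for i
    by (rule precomp_mod_hom[OF a[OF that] precomp_mod_hom[OF b[OF that] \<phi>]])
  show ?thesis
  proof (rule mod_hom_eqI)
    show "(\<Oplus>\<^bsub>dual X\<^esub>i\<in>{..<n}. precomp X (a i) (precomp Y (b i) \<phi>)) \<in> mod_hom R X T"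
      using D.M.finsum_closed[of "\<lambda>i. precomp X (a i) (precomp Y (b i) \<phi>)" "{..<n}"] c by auto
    fix x assume x: "x \<in> carrier X"
    have "(\<Oplus>\<^bsub>dual X\<^esub>i\<in>{..<n}. precomp X (a i) (precomp Y (b i) \<phi>)) x =
        (\<Oplus>\<^bsub>T\<^esub>i\<in>{..<n}. precomp X (a i) (precomp Y (b i) \<phi>) x)"
      using X x c by (intro finsum_dual_apply) auto
    also have "\<dots> = (\<Oplus>\<^bsub>T\<^esub>i\<in>{..<n}. \<phi> (b i (a i x)))"
      using x lin_closed[OF a] lin_closed[OF b] mod_homD(2)[OF \<phi>]
      by (intro T.M.finsum_cong') (auto simp: precomp_apply)
    also have "\<dots> = \<phi> (\<Oplus>\<^bsub>X\<^esub>i\<in>{..<n}. b i (a i x))"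
      using x lin_closed[OF a] lin_closed[OF b]
      by (intro lin_finsum[symmetric, OF lin_mod_hom[OF \<phi> X T]]) auto
    finally show "(\<Oplus>\<^bsub>dual X\<^esub>i\<in>{..<n}. precomp X (a i) (precomp Y (b i) \<phi>)) x = \<phi> x" using sum[OF x] by simp
  qed (rule \<phi>)
qed

text \<open>Dualizing retraction data exchanges the roles of the maps a i and b i.\<close>

lemma retr_dual:
  assumes "retr R Y X"
  shows "retr (op_ring S) (dual Y) (dual X)"
proof -
  obtain n a b where X: "left_module R X" and a: "\<And>i. i < n \<Longrightarrow> lin R X Y (a i)" and b: "\<And>i. i < n \<Longrightarrow> lin R Y X (b i)"
    and sum: "\<And>x. x \<in> carrier X \<Longrightarrow> (\<Oplus>\<^bsub>X\<^esub>i\<in>{..<n::nat}. b i (a i x)) = x"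
    using assms unfolding retr_def by metis
  show ?thesis unfolding retr_def
    using lin_precomp[OF a] lin_precomp[OF b] dual_retract_sum[OF X a b sum] left_module_dual[OF X]
    by (intro conjI exI[of _ n] exI[of _ "\<lambda>i. precomp Y (b i)"] exI[of _ "\<lambda>i. precomp X (a i)"]) auto
qed

text \<open>Hom(-,T) is left exact, and \<open>ext\<close> supplies surjectivity at the end. In the
  applications \<open>ext\<close> comes from Ext(T,T) = 0 for the syzygies of T and from exactness
  of the dualized coresolution for the cosyzygies of R.\<close>

lemma ses_dual:
  assumes ABC: "ses R A i B p C" and ext: "\<And>f. lin R A T f \<Longrightarrow> \<exists>g. lin R B T g \<and> (\<forall>a\<in>carrier A. g (i a) = f a)"
  shows "ses (op_ring S) (dual C) (precomp B p) (dual B) (precomp A i) (dual A)"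
proof -
  note s = sesD[OF ABC]
  have m: "left_module R A" "left_module R B" "left_module R C" using s(1,2) by (auto dest: linD)
  have ps: "p ` carrier B = carrier C" using ABC by (simp add: ses_def)
  show ?thesis
    unfolding ses_def
  proof (intro conjI lin_precomp s(1,2) ballI)
    show "inj_on (precomp B p) (carrier (dual C))"
    proof (rule inj_onI, simp)
      fix \<phi> \<psi> assume *: "\<phi> \<in> mod_hom R C T" "\<psi> \<in> mod_hom R C T" "precomp B p \<phi> = precomp B p \<psi>"
      show "\<phi> = \<psi>"
      proof (rule mod_hom_eqI[OF *(1,2)])
        fix c assume "c \<in> carrier C"
        then obtain b where "b \<in> carrier B" "p b = c" using s(4) by blast
        then show "\<phi> c = \<psi> c" using fun_cong[OF *(3), of b] by (simp add: precomp_apply)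
      qed
    qed
    show "precomp A i ` carrier (dual B) = carrier (dual A)"
    proof
      show "carrier (dual A) \<subseteq> precomp A i ` carrier (dual B)"
      proof
        fix f assume "f \<in> carrier (dual A)"
        then have f: "f \<in> mod_hom R A T" by simp
        obtain g where g: "lin R B T g" "\<forall>a\<in>carrier A. g (i a) = f a"
          using ext[OF lin_mod_hom[OF f m(1) T]] by blast
        have g': "restrict g (carrier B) \<in> mod_hom R B T" by (rule restrict_mod_hom[OF g(1)])
        have "f = precomp A i (restrict g (carrier B))"
          by (rule mod_hom_eqI[OF f precomp_mod_hom[OF s(1) g']])
             (use g(2) lin_closed[OF s(1)] in \<open>simp add: precomp_apply\<close>)
        then show "f \<in> precomp A i ` carrier (dual B)" using g' by auto
      qed
    qed (use precomp_mod_hom[OF s(1)] in auto)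
    fix b assume "b \<in> carrier (dual B)"
    then have b: "b \<in> mod_hom R B T" by simp
    show "precomp A i b = \<zero>\<^bsub>dual A\<^esub> \<longleftrightarrow> b \<in> precomp B p ` carrier (dual C)"
    proof
      assume z: "precomp A i b = \<zero>\<^bsub>dual A\<^esub>"
      have "b x = \<zero>\<^bsub>T\<^esub>" if x: "x \<in> carrier B" "p x = \<zero>\<^bsub>C\<^esub>" for x
      proof -
        obtain a where a: "a \<in> carrier A" "i a = x" using s(6)[OF x] by blast
        then show ?thesis using fun_cong[OF z, of a] by (simp add: precomp_apply)
      qed
      then obtain g where g: "lin R C T g" "\<And>x. x \<in> carrier B \<Longrightarrow> g (p x) = b x"
        by (rule lin_factor[OF s(2) ps lin_mod_hom[OF b m(2) T]]) auto
      have g': "restrict g (carrier C) \<in> mod_hom R C T" by (rule restrict_mod_hom[OF g(1)])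
      have "b = precomp B p (restrict g (carrier C))"
        by (rule mod_hom_eqI[OF b precomp_mod_hom[OF s(2) g']])
           (use g(2) lin_closed[OF s(2)] in \<open>simp add: precomp_apply\<close>)
      then show "b \<in> precomp B p ` carrier (dual C)" using g' by auto
    next
      assume "b \<in> precomp B p ` carrier (dual C)"
      then obtain \<phi> where \<phi>: "\<phi> \<in> mod_hom R C T" "b = precomp B p \<phi>" by auto
      then show "precomp A i b = \<zero>\<^bsub>dual A\<^esub>"
        using s(5) lin_closed[OF s(1)] lin_zero[OF lin_mod_hom[OF \<phi>(1) m(3) T]]
        by (auto simp: precomp_def compose_def intro!: restrict_ext)
    qed
  qed
qed

end

text \<open>\<open>\<mu>\<close> encodes an \<open>R\<close>-linear map \<open>T \<otimes>\<^sub>S U \<rightarrow> N\<close>.\<close>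

locale pairing = End_module R T for R :: "'r ring" and T :: "('r, 't) module" +
  fixes U :: "('t \<Rightarrow> 't, 'u) module" and N :: "('r, 'n) module" and \<mu> :: "'t \<Rightarrow> 'u \<Rightarrow> 'n"
  assumes U: "left_module (End_ring R T) U" and N: "left_module R N"
    and \<mu>_closed: "t \<in> carrier T \<Longrightarrow> u \<in> carrier U \<Longrightarrow> \<mu> t u \<in> carrier N"
    and \<mu>_add_left: "t \<in> carrier T \<Longrightarrow> t' \<in> carrier T \<Longrightarrow> u \<in> carrier U \<Longrightarrow> \<mu> (t \<oplus>\<^bsub>T\<^esub> t') u = \<mu> t u \<oplus>\<^bsub>N\<^esub> \<mu> t' u"
    and \<mu>_add_right: "t \<in> carrier T \<Longrightarrow> u \<in> carrier U \<Longrightarrow> u' \<in> carrier U \<Longrightarrow> \<mu> t (u \<oplus>\<^bsub>U\<^esub> u') = \<mu> t u \<oplus>\<^bsub>N\<^esub> \<mu> t u'"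
    and \<mu>_smult: "r \<in> carrier R \<Longrightarrow> t \<in> carrier T \<Longrightarrow> u \<in> carrier U \<Longrightarrow> \<mu> (r \<odot>\<^bsub>T\<^esub> t) u = r \<odot>\<^bsub>N\<^esub> \<mu> t u"
    and \<mu>_balanced: "s \<in> mod_hom R T T \<Longrightarrow> t \<in> carrier T \<Longrightarrow> u \<in> carrier U \<Longrightarrow> \<mu> (s t) u = \<mu> t (s \<odot>\<^bsub>U\<^esub> u)"
begin

sublocale U: left_module "End_ring R T" U by (rule U)
sublocale N: left_module R N by (rule N)

abbreviation null :: "('t \<Rightarrow> 't, 'a) module \<Rightarrow> ('a \<times> 'u \<Rightarrow>\<^sub>0 int) set" where
  "null A \<equiv> tensor_null S A U"

text \<open>On a generator (\<phi>, u) this is the map t -> \<mu> (\<phi> t) u. The module X is no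
  argument, since only values at points of X matter.\<close>

definition \<theta> :: "(('x \<Rightarrow> 't) \<times> 'u \<Rightarrow>\<^sub>0 int) \<Rightarrow> 'x \<Rightarrow> 'n" where
  "\<theta> x t = frag_ev N (\<lambda>p. \<mu> (fst p t) (snd p)) x"

lemma \<theta>_closed0:
  "t \<in> carrier X \<Longrightarrow> p \<in> carrier (dual X) \<times> carrier U \<Longrightarrow> \<mu> (fst p t) (snd p) \<in> carrier N"
  by (clarsimp, rule \<mu>_closed, erule mod_homD(2))

lemma \<theta>_zero: "\<theta> 0 t = \<zero>\<^bsub>N\<^esub>"
  unfolding \<theta>_def by (rule frag_ev_zero[OF N.M.abelian_group_axioms])

lemma \<theta>_of:
  assumes "t \<in> carrier X" "\<phi> \<in> mod_hom R X T" "u \<in> carrier U"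
  shows "\<theta> (frag_of (\<phi>, u)) t = \<mu> (\<phi> t) u"
  unfolding \<theta>_def using assms
  by (subst frag_ev_of[where A = "dual X" and M = U, OF N.M.abelian_group_axioms \<theta>_closed0[where X = X]]) auto

lemma \<theta>_diff:
  assumes "x \<in> frags (dual X) U" "y \<in> frags (dual X) U" "t \<in> carrier X"
  shows "\<theta> (x - y) t = \<theta> x t \<ominus>\<^bsub>N\<^esub> \<theta> y t"
  unfolding \<theta>_def using assms
  by (intro frag_ev_diff[where A = "dual X" and M = U, OF N.M.abelian_group_axioms \<theta>_closed0[where X = X]]) auto

lemma \<theta>_lin:
  assumes X: "left_module R X" and x: "x \<in> frags (dual X) U"
  shows "lin R X N (\<theta> x)"
  using x
proof (induction x rule: frags_induct)
  case zero
  show ?case by (rule lin_cong[OF lin_zero_map[OF X N]]) (simp add: \<theta>_zero)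
next
  case (one \<phi> u)
  have "lin R X N (\<lambda>t. \<mu> (\<phi> t) u)"
    using one mod_homD[of \<phi> R X T]
    by (intro linI X N) (auto simp: \<mu>_closed \<mu>_add_left \<mu>_smult)
  then show ?case by (rule lin_cong) (use one in \<open>simp add: \<theta>_of[where X = X]\<close>)
next
  case (diff x y)
  show ?case
    by (rule lin_cong[OF lin_minus_map[OF diff(3,4)]]) (use diff in \<open>simp add: \<theta>_diff[where X = X]\<close>)
qed

lemma \<theta>_null:
  assumes X: "left_module R X" and x: "x \<in> null (dual X)" and t: "t \<in> carrier X"
  shows "\<theta> x t = \<zero>\<^bsub>N\<^esub>"
  unfolding \<theta>_def
  by (rule frag_ev_null[OF x left_module_dual[OF X] U N.M.abelian_group_axioms \<theta>_closed0[OF t]])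
     (use t in \<open>auto simp: mod_homD(2) compose_def \<mu>_add_left \<mu>_add_right \<mu>_balanced\<close>)

lemma \<theta>_cong_null:
  assumes X: "left_module R X" and "x \<in> frags (dual X) U" "y \<in> frags (dual X) U" "x - y \<in> null (dual X)" "t \<in> carrier X"
  shows "\<theta> x t = \<theta> y t"
  using \<theta>_diff[OF assms(2,3,5)] \<theta>_null[OF X assms(4,5)] lin_closed[OF \<theta>_lin[OF X assms(2)] assms(5)]
    lin_closed[OF \<theta>_lin[OF X assms(3)] assms(5)] by (metis N.M.minus_eq_zero_iff)

lemma \<theta>_sum:
  assumes X: "left_module R X" and t: "t \<in> carrier X" and I: "finite I" "\<And>i. i \<in> I \<Longrightarrow> x i \<in> frags (dual X) U"
  shows "\<theta> (\<Sum>i\<in>I. x i) t = (\<Oplus>\<^bsub>N\<^esub>i\<in>I. \<theta> (x i) t)"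
  using I
proof (induction I)
  case empty then show ?case by (simp add: \<theta>_zero)
next
  case (insert j I)
  have c: "\<theta> (x i) t \<in> carrier N" if "i \<in> insert j I" for i
    by (rule lin_closed[OF \<theta>_lin[OF X] t]) (use that insert in auto)
  have s: "(\<Sum>i\<in>I. x i) \<in> frags (dual X) U" by (rule diff_closed_sum[OF diff_closed_frags]) (use insert in auto)
  have s': "(\<Sum>i\<in>insert j I. x i) \<in> frags (dual X) U" by (rule diff_closed_sum[OF diff_closed_frags]) (use insert in auto)
  have "\<theta> (x j) t = \<theta> (\<Sum>i\<in>insert j I. x i) t \<ominus>\<^bsub>N\<^esub> \<theta> (\<Sum>i\<in>I. x i) t"
    using \<theta>_diff[OF s' s t] insert(1,2) by simp
  moreover have "\<theta> (\<Sum>i\<in>insert j I. x i) t \<in> carrier N" "\<theta> (\<Sum>i\<in>I. x i) t \<in> carrier N"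
    by (rule lin_closed[OF \<theta>_lin[OF X s'] t] lin_closed[OF \<theta>_lin[OF X s] t])+
  ultimately have "\<theta> (\<Sum>i\<in>insert j I. x i) t = \<theta> (x j) t \<oplus>\<^bsub>N\<^esub> \<theta> (\<Sum>i\<in>I. x i) t"
    using N.M.minus_eq_iff c by (metis insertI1)
  also have "\<dots> = (\<Oplus>\<^bsub>N\<^esub>i\<in>insert j I. \<theta> (x i) t)"
    using insert c N.M.finsum_insert[of I j "\<lambda>i. \<theta> (x i) t"] by auto
  finally show ?case .
qed

lemma \<theta>_natural:
  assumes f: "lin R X Y f" and x: "x \<in> frags (dual Y) U" and t: "t \<in> carrier X"
  shows "\<theta> (tmap (precomp X f) x) t = \<theta> x (f t)"
proof -
  have X: "left_module R X" using f by (rule linD)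
  have "\<theta> (tmap (precomp X f) x) t = frag_ev N (\<lambda>(\<phi>, u). \<mu> (fst (precomp X f \<phi>, u) t) (snd (precomp X f \<phi>, u))) x"
    unfolding \<theta>_def
    by (rule frag_ev_bimap[where f = "precomp X f" and k = "\<lambda>m. m" and B = "dual X" and M' = U,
        OF N.M.abelian_group_axioms \<theta>_closed0[OF t] _ _ x]) (use precomp_mod_hom[OF f] in auto)
  then show ?thesis using t by (simp add: \<theta>_def precomp_apply case_prod_unfold)
qed

section \<open>Bijectivity of \<theta> in terms of representatives\<close>

definition \<theta>_inj :: "('r, 'x) module \<Rightarrow> bool" where
  "\<theta>_inj X \<longleftrightarrow> (\<forall>x\<in>frags (dual X) U. (\<forall>t\<in>carrier X. \<theta> x t = \<zero>\<^bsub>N\<^esub>) \<longrightarrow> x \<in> null (dual X))"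

definition \<theta>_surj :: "('r, 'x) module \<Rightarrow> bool" where
  "\<theta>_surj X \<longleftrightarrow> (\<forall>f. lin R X N f \<longrightarrow> (\<exists>x\<in>frags (dual X) U. \<forall>t\<in>carrier X. \<theta> x t = f t))"

definition \<theta>_iso :: "('r, 'x) module \<Rightarrow> bool" where
  "\<theta>_iso X \<longleftrightarrow> left_module R X \<and> \<theta>_inj X \<and> \<theta>_surj X"

lemma \<theta>_isoD:
  assumes "\<theta>_iso X"
  shows "left_module R X"
    and "x \<in> frags (dual X) U \<Longrightarrow> (\<And>t. t \<in> carrier X \<Longrightarrow> \<theta> x t = \<zero>\<^bsub>N\<^esub>) \<Longrightarrow> x \<in> null (dual X)"
    and "lin R X N f \<Longrightarrow> \<exists>x\<in>frags (dual X) U. \<forall>t\<in>carrier X. \<theta> x t = f t"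
  using assms by (auto simp: \<theta>_iso_def \<theta>_inj_def \<theta>_surj_def)

text \<open>Both sides of \<theta> are additive in X, so bijectivity passes to powers of
  \<open>Y\<close> and their summands: elements are moved to \<open>Y\<close> by the b i, treated
  there, and brought back by the a i.\<close>

lemma \<theta>_iso_retr:
  assumes YX: "retr R Y X" and Y: "\<theta>_iso Y"
  shows "\<theta>_iso X"
proof -
  obtain n a b where X: "left_module R X" and a: "\<And>i. i < n \<Longrightarrow> lin R X Y (a i)" and b: "\<And>i. i < n \<Longrightarrow> lin R Y X (b i)"
    and sum: "\<And>x. x \<in> carrier X \<Longrightarrow> (\<Oplus>\<^bsub>X\<^esub>i\<in>{..<n::nat}. b i (a i x)) = x"
    using YX unfolding retr_def by metis
  interpret D: left_module "op_ring S" "dual X" by (rule left_module_dual[OF X])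
  note DX = D.left_module_axioms
  note K = diff_closed_tensor_null[OF DX U]
  have "x \<in> null (dual X)" if x: "x \<in> frags (dual X) U" and z: "\<forall>t\<in>carrier X. \<theta> x t = \<zero>\<^bsub>N\<^esub>" for x
  proof -
    have 1: "tmap (precomp X (a i)) (tmap (precomp Y (b i)) x) \<in> null (dual X)" if i: "i < n" for i
    proof (rule tmap_null[OF U lin_precomp[OF a[OF i]]], rule \<theta>_isoD(2)[OF Y])
      show "tmap (precomp Y (b i)) x \<in> frags (dual Y) U" by (rule tmap_frags[OF U lin_precomp[OF b[OF i]] x])
      show "\<theta> (tmap (precomp Y (b i)) x) t = \<zero>\<^bsub>N\<^esub>" if "t \<in> carrier Y" for t
        using \<theta>_natural[OF b[OF i] x that] z lin_closed[OF b[OF i] that] by simp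
    qed
    have "tmap (\<lambda>\<phi>. \<Oplus>\<^bsub>dual X\<^esub>i\<in>{..<n}. precomp X (a i) (precomp Y (b i) \<phi>)) x - 
        (\<Sum>i<n. tmap (\<lambda>\<phi>. precomp X (a i) (precomp Y (b i) \<phi>)) x) \<in> null (dual X)"
      by (rule tmap_finsum[OF U _ _ x DX DX]) (auto intro!: lin_comp[OF lin_precomp lin_precomp] a b)
    moreover have "(\<Sum>i<n. tmap (\<lambda>\<phi>. precomp X (a i) (precomp Y (b i) \<phi>)) x) \<in> null (dual X)"
      using 1 by (intro diff_closed_sum[OF K]) (simp add: bimap_bimap)
    moreover have "tmap (\<lambda>\<phi>. \<Oplus>\<^bsub>dual X\<^esub>i\<in>{..<n}. precomp X (a i) (precomp Y (b i) \<phi>)) x = x"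
      using dual_retract_sum[OF X a b sum] by (intro bimap_ident[OF x]) auto
    ultimately show ?thesis using diff_closedD(4)[OF K] by fastforce
  qed
  moreover have "\<exists>x\<in>frags (dual X) U. \<forall>t\<in>carrier X. \<theta> x t = f t" if f: "lin R X N f" for f
  proof -
    have "\<exists>y\<in>frags (dual Y) U. \<forall>t\<in>carrier Y. \<theta> y t = f (b i t)" if "i < n" for i
      by (rule \<theta>_isoD(3)[OF Y lin_comp[OF b[OF that] f]])
    then obtain y where y: "\<And>i. i < n \<Longrightarrow> y i \<in> frags (dual Y) U" "\<And>i t. i < n \<Longrightarrow> t \<in> carrier Y \<Longrightarrow> \<theta> (y i) t = f (b i t)"
      by metis
    let ?x = "\<Sum>i<n. tmap (precomp X (a i)) (y i)"
    have c: "tmap (precomp X (a i)) (y i) \<in> frags (dual X) U" if "i < n" for i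
      by (rule tmap_frags[OF U lin_precomp[OF a[OF that]] y(1)[OF that]])
    have "\<theta> ?x t = f t" if t: "t \<in> carrier X" for t
    proof -
      have "\<theta> ?x t = (\<Oplus>\<^bsub>N\<^esub>i\<in>{..<n}. \<theta> (tmap (precomp X (a i)) (y i)) t)"
        by (rule \<theta>_sum[OF X t]) (use c in auto)
      also have "\<dots> = (\<Oplus>\<^bsub>N\<^esub>i\<in>{..<n}. f (b i (a i t)))"
        using t lin_closed[OF f] lin_closed[OF a] lin_closed[OF b]
        by (intro N.M.finsum_cong') (auto simp: \<theta>_natural[OF a y(1)] y(2))
      also have "\<dots> = f (\<Oplus>\<^bsub>X\<^esub>i\<in>{..<n}. b i (a i t))"
        using t lin_closed[OF a] lin_closed[OF b] by (intro lin_finsum[symmetric, OF f]) auto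
      finally show ?thesis using sum[OF t] by simp
    qed
    moreover have "?x \<in> frags (dual X) U" by (rule diff_closed_sum[OF diff_closed_frags]) (use c in auto)
    ultimately show ?thesis by blast
  qed
  ultimately show ?thesis using X by (simp add: \<theta>_iso_def \<theta>_inj_def \<theta>_surj_def)
qed

end

section \<open>The map \<theta> along short exact sequences\<close>

context pairing begin

text \<open>A chase in a diagram with exact rows. The upper row is dual C \<otimes> U -> dual B
  \<otimes> U -> dual A \<otimes> U -> 0, with injective first map by \<open>inj\<close>; the lower
  row is 0 -> Hom(C,N) -> Hom(B,N) -> Hom(A,N). Its last map is onto because the last map above is
  onto and \<theta> is onto at \<open>A\<close>.\<close>

lemma \<theta>_iso_cokernel:
  assumes ABC: "ses R A i B p C" and ext: "\<And>f. lin R A T f \<Longrightarrow> \<exists>g. lin R B T g \<and> (\<forall>a\<in>carrier A. g (i a) = f a)"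
    and A: "\<theta>_iso A" and B: "\<theta>_iso B"
    and inj: "\<And>x. x \<in> frags (dual C) U \<Longrightarrow> tmap (precomp B p) x \<in> null (dual B) \<Longrightarrow> x \<in> null (dual C)"
  shows "\<theta>_iso C"
    and "\<And>f. lin R A N f \<Longrightarrow> \<exists>g. lin R B N g \<and> (\<forall>a\<in>carrier A. g (i a) = f a)"
proof -
  note s = sesD[OF ABC] and D = sesD[OF ses_dual[OF ABC ext]]
  have mA: "left_module R A" and mB: "left_module R B" and mC: "left_module R C" using s(1,2) by (auto dest: linD)
  show ext_N: "\<exists>g. lin R B N g \<and> (\<forall>a\<in>carrier A. g (i a) = f a)" if f: "lin R A N f" for f
  proof -
    obtain x where x: "x \<in> frags (dual A) U" "\<forall>t\<in>carrier A. \<theta> x t = f t" using \<theta>_isoD(3)[OF A f] by blast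
    obtain y where y: "y \<in> frags (dual B) U" "tmap (precomp A i) y = x"
      by (rule tensor_surj[OF U D(4) x(1)])
    have "\<theta> y (i a) = f a" if "a \<in> carrier A" for a
      using \<theta>_natural[OF s(1) y(1) that] x(2) y(2) that by simp
    with \<theta>_lin[OF mB y(1)] show ?thesis by blast
  qed
  have "x \<in> null (dual C)" if x: "x \<in> frags (dual C) U" and z: "\<forall>t\<in>carrier C. \<theta> x t = \<zero>\<^bsub>N\<^esub>" for x
  proof (rule inj[OF x], rule \<theta>_isoD(2)[OF B tmap_frags[OF U D(1) x]])
    show "\<theta> (tmap (precomp B p) x) t = \<zero>\<^bsub>N\<^esub>" if "t \<in> carrier B" for t
      using \<theta>_natural[OF s(2) x that] z lin_closed[OF s(2) that] by simp
  qed
  moreover have "\<exists>x\<in>frags (dual C) U. \<forall>t\<in>carrier C. \<theta> x t = f t" if f: "lin R C N f" for f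
  proof -
    obtain y where y: "y \<in> frags (dual B) U" "\<forall>t\<in>carrier B. \<theta> y t = f (p t)"
      using \<theta>_isoD(3)[OF B lin_comp[OF s(2) f]] by blast
    have "tmap (precomp A i) y \<in> null (dual A)"
    proof (rule \<theta>_isoD(2)[OF A tmap_frags[OF U D(2) y(1)]])
      show "\<theta> (tmap (precomp A i) y) t = \<zero>\<^bsub>N\<^esub>" if "t \<in> carrier A" for t
        using \<theta>_natural[OF s(1) y(1) that] y(2) lin_closed[OF s(1) that] s(5)[OF that] lin_zero[OF f] by simp
    qed
    then obtain x where x: "x \<in> frags (dual C) U" "y - tmap (precomp B p) x \<in> null (dual B)"
      using tensor_right_exact[OF U D(1) D(2) D(4) D(6) y(1)] by blast
    have "\<theta> x c = f c" if c: "c \<in> carrier C" for c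
    proof -
      obtain b where b: "b \<in> carrier B" "p b = c" using s(4)[OF c] by blast
      have "\<theta> x c = \<theta> (tmap (precomp B p) x) b" using \<theta>_natural[OF s(2) x(1) b(1)] b(2) by simp
      also have "\<dots> = \<theta> y b"
        by (rule \<theta>_cong_null[OF mB y(1) tmap_frags[OF U D(1) x(1)] x(2) b(1), symmetric])
      finally show ?thesis using y(2) b by simp
    qed
    with x show ?thesis by blast
  qed
  ultimately show "\<theta>_iso C" using mC by (simp add: \<theta>_iso_def \<theta>_inj_def \<theta>_surj_def)
qed

text \<open>The same diagram chased from the other side. Surjectivity of the last lower map is now
  the hypothesis \<open>ext_N\<close>. Injectivity of the first upper map comes out: followed by
  \<theta> at \<open>B\<close> it equals \<theta> at \<open>C\<close> followed by the inclusion of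
  Hom(C,N) in Hom(B,N).\<close>

lemma \<theta>_iso_kernel:
  assumes ABC: "ses R A i B p C" and ext: "\<And>f. lin R A T f \<Longrightarrow> \<exists>g. lin R B T g \<and> (\<forall>a\<in>carrier A. g (i a) = f a)"
    and B: "\<theta>_iso B" and C: "\<theta>_iso C"
    and ext_N: "\<And>f. lin R A N f \<Longrightarrow> \<exists>g. lin R B N g \<and> (\<forall>a\<in>carrier A. g (i a) = f a)"
  shows "\<theta>_iso A"
    and "\<And>x. x \<in> frags (dual C) U \<Longrightarrow> tmap (precomp B p) x \<in> null (dual B) \<Longrightarrow> x \<in> null (dual C)"
proof -
  note s = sesD[OF ABC] and D = sesD[OF ses_dual[OF ABC ext]]
  have mA: "left_module R A" and mB: "left_module R B" and mC: "left_module R C" using s(1,2) by (auto dest: linD)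
  have ps: "p ` carrier B = carrier C" using ABC by (simp add: ses_def)
  note KA = diff_closedD[OF diff_closed_tensor_null[OF left_module_dual[OF mA] U]]
  show "x \<in> null (dual C)" if x: "x \<in> frags (dual C) U" and px: "tmap (precomp B p) x \<in> null (dual B)" for x
  proof (rule \<theta>_isoD(2)[OF C x])
    fix c assume "c \<in> carrier C"
    then obtain b where b: "b \<in> carrier B" "p b = c" using s(4) by blast
    show "\<theta> x c = \<zero>\<^bsub>N\<^esub>" using \<theta>_natural[OF s(2) x b(1)] \<theta>_null[OF mB px b(1)] b(2) by simp
  qed
  have "x \<in> null (dual A)" if x: "x \<in> frags (dual A) U" and z: "\<forall>t\<in>carrier A. \<theta> x t = \<zero>\<^bsub>N\<^esub>" for x
  proof -
    obtain y where y: "y \<in> frags (dual B) U" "tmap (precomp A i) y = x"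
      by (rule tensor_surj[OF U D(4) x])
    have "\<theta> y b = \<zero>\<^bsub>N\<^esub>" if b: "b \<in> carrier B" "p b = \<zero>\<^bsub>C\<^esub>" for b
    proof -
      obtain a where a: "a \<in> carrier A" "i a = b" using s(6)[OF b] by blast
      show ?thesis using \<theta>_natural[OF s(1) y(1) a(1)] z y(2) a by simp
    qed
    then obtain f where f: "lin R C N f" "\<And>b. b \<in> carrier B \<Longrightarrow> f (p b) = \<theta> y b"
      by (rule lin_factor[OF s(2) ps \<theta>_lin[OF mB y(1)]]) auto
    obtain w where w: "w \<in> frags (dual C) U" "\<forall>t\<in>carrier C. \<theta> w t = f t" using \<theta>_isoD(3)[OF C f(1)] by blast
    have pw: "tmap (precomp B p) w \<in> frags (dual B) U" by (rule tmap_frags[OF U D(1) w(1)])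
    have "y - tmap (precomp B p) w \<in> null (dual B)"
    proof (rule \<theta>_isoD(2)[OF B diff_closedD(2)[OF diff_closed_frags y(1) pw]])
      fix t assume t: "t \<in> carrier B"
      have "\<theta> (tmap (precomp B p) w) t = \<theta> y t"
        using \<theta>_natural[OF s(2) w(1) t] w(2) lin_closed[OF s(2) t] f(2)[OF t] by simp
      then show "\<theta> (y - tmap (precomp B p) w) t = \<zero>\<^bsub>N\<^esub>"
        using \<theta>_diff[OF y(1) pw t] lin_closed[OF \<theta>_lin[OF mB y(1)] t] by (simp add: N.M.minus_eq_zero_iff)
    qed
    then have "x - tmap (precomp A i) (tmap (precomp B p) w) \<in> null (dual A)"
      using tmap_null_diff[OF U D(2)] y(2) by blast
    moreover have "tmap (precomp A i) (tmap (precomp B p) w) = tmap (\<lambda>_. \<zero>\<^bsub>dual A\<^esub>) w"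
      unfolding bimap_bimap by (rule bimap_cong[OF w(1)]) (use D(5) in auto)
    moreover have "tmap (\<lambda>_. \<zero>\<^bsub>dual A\<^esub>) w \<in> null (dual A)"
      by (rule tmap_zero[OF U left_module_dual[OF mC] left_module_dual[OF mA] w(1)])
    ultimately show ?thesis using KA(4) by fastforce
  qed
  moreover have "\<exists>x\<in>frags (dual A) U. \<forall>t\<in>carrier A. \<theta> x t = f t" if f: "lin R A N f" for f
  proof -
    obtain g where g: "lin R B N g" "\<forall>a\<in>carrier A. g (i a) = f a" using ext_N[OF f] by blast
    obtain y where y: "y \<in> frags (dual B) U" "\<forall>t\<in>carrier B. \<theta> y t = g t" using \<theta>_isoD(3)[OF B g(1)] by blast
    have "\<theta> (tmap (precomp A i) y) t = f t" if "t \<in> carrier A" for t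
      using \<theta>_natural[OF s(1) y(1) that] y(2) g(2) lin_closed[OF s(1) that] that by simp
    with tmap_frags[OF U D(2) y(1)] show ?thesis by blast
  qed
  ultimately show "\<theta>_iso A" using mA by (simp add: \<theta>_iso_def \<theta>_inj_def \<theta>_surj_def)
qed

end

section \<open>Syzygies\<close>

text \<open>Indices are shifted: this is the (k + 1)-st syzygy of the resolved module, a submodule
  of \<open>P k\<close>.\<close>

abbreviation syzygy :: "(nat \<Rightarrow> ('r, 'p) module) \<Rightarrow> (nat \<Rightarrow> 'p \<Rightarrow> 'p) \<Rightarrow> nat \<Rightarrow> ('r, 'p) module" where
  "syzygy P d k \<equiv> img (P (Suc k)) (P k) (d k)"

lemma ses_syzygy_0:
  assumes P: "resol R X P d e"
  shows "ses R (syzygy P d 0) (\<lambda>x. x) (P 0) e X"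
  unfolding ses_def
proof (intro conjI)
  note p = resolD[OF P]
  show "lin R (syzygy P d 0) (P 0) (\<lambda>x. x)" by (rule lin_from_img[OF p(2)])
  show "e ` carrier (P 0) = carrier X" using P by (simp add: resol_def)
qed (use P resolD[OF P] in \<open>auto simp: resol_def\<close>)

lemma ses_syzygy_Suc:
  assumes P: "resol R X P d e"
  shows "ses R (syzygy P d (Suc k)) (\<lambda>x. x) (P (Suc k)) (d k) (syzygy P d k)"
  unfolding ses_def
proof (intro conjI)
  note p = resolD[OF P]
  show "lin R (syzygy P d (Suc k)) (P (Suc k)) (\<lambda>x. x)" by (rule lin_from_img[OF p(2)])
  show "lin R (P (Suc k)) (syzygy P d k) (d k)" by (rule lin_to_img[OF p(2)])
qed (use P in \<open>auto simp: resol_def\<close>)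

text \<open>By exactness, cocycles on \<open>P (Suc k)\<close> are maps on its image in
  \<open>P k\<close>. Ext in degree k + 1 is thus the obstruction to extending maps from the syzygy
  to \<open>P k\<close>, which is the form that the descent along short exact sequences
  delivers.\<close>

lemma hom_acyclic_iff_extend:
  assumes P: "resol R X P d e" and N: "left_module R N"
  shows "hom_acyclic_at R P d N k \<longleftrightarrow>
    (\<forall>f. lin R (syzygy P d k) N f \<longrightarrow> (\<exists>g. lin R (P k) N g \<and> (\<forall>a\<in>carrier (syzygy P d k). g a = f a)))"
    (is "?L \<longleftrightarrow> ?R")
proof
  note p = resolD[OF P]
  assume L: ?L
  show ?R
  proof (intro allI impI)
    fix f assume f: "lin R (syzygy P d k) N f"
    have fd: "lin R (P (Suc k)) N (\<lambda>x. f (d k x))" by (rule lin_comp[OF lin_to_img[OF p(2)] f])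
    obtain g where "lin R (P k) N g" "\<And>x. x \<in> carrier (P (Suc k)) \<Longrightarrow> g (d k x) = f (d k x)"
      by (rule hom_acyclic_atD[OF L fd]) (use p(6) lin_zero[OF f] in auto)
    then show "\<exists>g. lin R (P k) N g \<and> (\<forall>a\<in>carrier (syzygy P d k). g a = f a)" by auto
  qed
next
  note p = resolD[OF P]
  assume R: ?R
  show ?L
    unfolding hom_acyclic_at_def
  proof (intro allI impI)
    fix f assume f: "lin R (P (Suc k)) N f" and fd: "\<forall>x\<in>carrier (P (Suc (Suc k))). f (d (Suc k) x) = \<zero>\<^bsub>N\<^esub>"
    have k0: "f x = \<zero>\<^bsub>N\<^esub>" if x: "x \<in> carrier (P (Suc k))" "d k x = \<zero>\<^bsub>syzygy P d k\<^esub>" for x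
      using p(8)[OF x(1)] x(2) fd by auto
    obtain f' where f': "lin R (syzygy P d k) N f'" "\<And>x. x \<in> carrier (P (Suc k)) \<Longrightarrow> f' (d k x) = f x"
      by (rule lin_factor[OF lin_to_img[OF p(2)] _ f k0]) auto
    with R obtain g where "lin R (P k) N g" "\<forall>a\<in>carrier (syzygy P d k). g a = f' a" by blast
    with f' show "\<exists>g. lin R (P k) N g \<and> (\<forall>x\<in>carrier (P (Suc k)). g (d k x) = f x)" by auto
  qed
qed

text \<open>If \<open>X\<close> has a projective resolution of length \<open>n\<close>, then \<open>Ext\<^sup>k\<^sup>+\<^sup>1(X,-)\<close> vanishes for \<open>k \<ge> n\<close>;
  applied to the cocycle \<open>P (k+1) \<rightarrow> syzygy P d k\<close> this splits off the syzygy.\<close>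

lemma syzygy_retract:
  assumes P: "resol R X P d e" and P': "resol R X P' d' e'" and fin: "\<And>k. k > n \<Longrightarrow> carrier (P' k) = {\<zero>\<^bsub>P' k\<^esub>}"
    and k: "k \<ge> n"
  obtains g where "lin R (P k) (syzygy P d k) g" "\<And>x. x \<in> carrier (syzygy P d k) \<Longrightarrow> g x = x"
proof -
  note p = resolD[OF P]
  have X: "left_module R X" using p(3) by (rule linD)
  have N: "left_module R (syzygy P d k)" by (rule left_module_img[OF p(2)])
  \<comment> \<open>Since k + 1 > n, the module \<open>P' (Suc k)\<close> is zero, so every cocycle
    in this degree is zero.\<close>
  have "hom_acyclic_at R P' d' (syzygy P d k) k"
    unfolding hom_acyclic_at_def
  proof (intro allI impI)
    fix f assume f: "lin R (P' (Suc k)) (syzygy P d k) f"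
    have "\<zero>\<^bsub>syzygy P d k\<^esub> = f x" if "x \<in> carrier (P' (Suc k))" for x
      using that fin[of "Suc k"] k lin_zero[OF f] by simp
    with lin_zero_map[OF resol_module[OF P'] N]
    show "\<exists>g. lin R (P' k) (syzygy P d k) g \<and> (\<forall>x\<in>carrier (P' (Suc k)). g (d' k x) = f x)" by blast
  qed
  then have "hom_acyclic_at R P d (syzygy P d k) k" by (rule hom_acyclic_at_retr[OF retr_refl[OF X] P P' N])
  then have "\<exists>g. lin R (P k) (syzygy P d k) g \<and> (\<forall>a\<in>carrier (syzygy P d k). g a = a)"
    unfolding hom_acyclic_iff_extend[OF P N] using lin_id[OF N] by blast
  with that show ?thesis by blast
qed

section \<open>The two descending inductions\<close>

context pairing begin

text \<open>Fixing the canonical resolution makes the vanishing of Tor a condition on the module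
  alone, and likewise for Ext below; chosen resolutions are compared with it through
  \<open>tensor_acyclic_retr\<close> and \<open>hom_acyclic_retr\<close>.\<close>

definition tor_acyclic :: "('t \<Rightarrow> 't, 'a) module \<Rightarrow> bool" where
  "tor_acyclic A \<longleftrightarrow> left_module (op_ring S) A \<and> tensor_acyclic S U (free_res (op_ring S) A) (free_res_d (op_ring S) A)"

definition ext_acyclic :: "('r, 'x) module \<Rightarrow> bool" where
  "ext_acyclic X \<longleftrightarrow> left_module R X \<and> hom_acyclic R (free_res R X) (free_res_d R X) N"

lemma tor_acyclic_retr:
  assumes YX: "retr (op_ring S) Y X" and Y: "tor_acyclic Y"
  shows "tor_acyclic X"
proof -
  have X: "left_module (op_ring S) X" using YX by (simp add: retr_def)
  show ?thesis
    using tensor_acyclic_retr[OF U YX resol_free_res[OF X] resol_free_res] Y X by (simp add: tor_acyclic_def)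
qed

lemma ext_acyclic_retr:
  assumes YX: "retr R Y X" and Y: "ext_acyclic Y"
  shows "ext_acyclic X"
proof -
  have X: "left_module R X" using YX by (simp add: retr_def)
  show ?thesis
    using hom_acyclic_retr[OF YX resol_free_res[OF X] resol_free_res N] Y X by (simp add: ext_acyclic_def)
qed

lemma tor_acyclic_ses:
  assumes ABC: "ses (op_ring S) A i B p C" and B: "tor_acyclic B" and C: "tor_acyclic C"
  shows "tor_acyclic A"
    and "\<And>x. x \<in> frags A U \<Longrightarrow> tmap i x \<in> null B \<Longrightarrow> x \<in> null A"
proof -
  have A: "left_module (op_ring S) A" using sesD(1)[OF ABC] by (rule linD)
  note BC = B[unfolded tor_acyclic_def] C[unfolded tor_acyclic_def]
  note r = resol_free_res[OF A] resol_free_res[OF conjunct1[OF BC(1)]] resol_free_res[OF conjunct1[OF BC(2)]]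
  show "tor_acyclic A" using tensor_acyclic_ses(1)[OF U ABC r conjunct2[OF BC(1)] conjunct2[OF BC(2)]] A
    by (simp add: tor_acyclic_def)
  show "\<And>x. x \<in> frags A U \<Longrightarrow> tmap i x \<in> null B \<Longrightarrow> x \<in> null A"
    by (rule tensor_acyclic_ses(2)[OF U ABC r conjunct2[OF BC(1)] conjunct2[OF BC(2)]])
qed

lemma ext_acyclic_ses:
  assumes ABC: "ses R A i B p C" and B: "ext_acyclic B" and C: "ext_acyclic C"
  shows "ext_acyclic A"
    and "\<And>f. lin R A N f \<Longrightarrow> \<exists>g. lin R B N g \<and> (\<forall>a\<in>carrier A. g (i a) = f a)"
proof -
  have A: "left_module R A" using sesD(1)[OF ABC] by (rule linD)
  note BC = B[unfolded ext_acyclic_def] C[unfolded ext_acyclic_def]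
  note r = resol_free_res[OF A] resol_free_res[OF conjunct1[OF BC(1)]] resol_free_res[OF conjunct1[OF BC(2)]]
  show "ext_acyclic A" using hom_acyclic_ses(1)[OF ABC r N conjunct2[OF BC(1)] conjunct2[OF BC(2)]] A
    by (simp add: ext_acyclic_def)
  show "\<And>f. lin R A N f \<Longrightarrow> \<exists>g. lin R B N g \<and> (\<forall>a\<in>carrier A. g (i a) = f a)"
    by (rule hom_acyclic_ses(2)[OF ABC r N conjunct2[OF BC(1)] conjunct2[OF BC(2)]])
qed

text \<open>One step down, \<open>\<theta>_iso_cokernel\<close> asks that the dual sequence stay
  injective on the left after tensoring with \<open>U\<close>. The obstruction is Tor in degree 1 of
  the dual of the higher syzygy, so the induction carries the vanishing of Tor on duals along with
  bijectivity.\<close>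

lemma descend_resolution:
  assumes P: "resol R T P d e" and addR: "\<And>k. retr R (regular_module R) (P k)"
    and syz: "\<And>k. k \<ge> n \<Longrightarrow> retr R (regular_module R) (syzygy P d k)"
    and acT: "hom_acyclic R P d T"
    and tor: "tor_acyclic (dual (regular_module R))" and iso: "\<theta>_iso (regular_module R)"
  shows "\<theta>_iso T" and "hom_acyclic R P d N"
proof -
  have ext: "\<exists>g. lin R (P k) T g \<and> (\<forall>a\<in>carrier (syzygy P d k). g a = f a)" if "lin R (syzygy P d k) T f" for f k
    using acT that unfolding hom_acyclic_def hom_acyclic_iff_extend[OF P T] by blast
  have add: "\<theta>_iso X \<and> tor_acyclic (dual X)" if "retr R (regular_module R) X" for X :: "('r, 'x) module"
    using \<theta>_iso_retr[OF that iso] tor_acyclic_retr[OF retr_dual[OF that] tor] by blast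
  have syz_ok: "\<theta>_iso (syzygy P d k) \<and> tor_acyclic (dual (syzygy P d k))" for k
  proof -
    \<comment> \<open>The induction descends to k from max k n, where \<open>syz\<close>
      applies.\<close>
    have "k \<le> max k n" by simp
    then show ?thesis
    proof (induction k rule: inc_induct)
      case base show ?case by (rule add[OF syz]) simp
    next
      case (step j)
      note s = ses_syzygy_Suc[OF P, of j]
      note tr = tor_acyclic_ses[OF ses_dual[OF s ext] conjunct2[OF add[OF addR]] conjunct2[OF step.IH]]
      have "\<theta>_iso (syzygy P d j)"
        by (rule \<theta>_iso_cokernel(1)[OF s ext conjunct1[OF step.IH] conjunct1[OF add[OF addR]] tr(2)])
      with tr(1) show ?case by blast
    qed
  qed
  note s0 = ses_syzygy_0[OF P]
  note t0 = tor_acyclic_ses(2)[OF ses_dual[OF s0 ext] conjunct2[OF add[OF addR]] conjunct2[OF syz_ok]]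
  note c0 = \<theta>_iso_cokernel[OF s0 ext conjunct1[OF syz_ok] conjunct1[OF add[OF addR]] t0]
  show "\<theta>_iso T" by (rule c0(1))
  \<comment> \<open>Maps into \<open>N\<close> extend from each syzygy by the second part of
    \<open>\<theta>_iso_cokernel\<close>; through \<open>hom_acyclic_iff_extend\<close> this is
    Ext(T,N) = 0 in degree k + 1.\<close>
  have "hom_acyclic_at R P d N k" for k
  proof (cases k)
    case 0
    then show ?thesis using c0(2) by (simp add: hom_acyclic_iff_extend[OF P N])
  next
    case (Suc j)
    note s = ses_syzygy_Suc[OF P, of j]
    note tr = tor_acyclic_ses(2)[OF ses_dual[OF s ext] conjunct2[OF add[OF addR]] conjunct2[OF syz_ok]]
    have "\<exists>g. lin R (P k) N g \<and> (\<forall>a\<in>carrier (syzygy P d k). g a = f a)" if "lin R (syzygy P d k) N f" for f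
      using \<theta>_iso_cokernel(2)[OF s ext conjunct1[OF syz_ok] conjunct1[OF add[OF addR]] tr] that Suc by blast
    then show ?thesis unfolding hom_acyclic_iff_extend[OF P N] by blast
  qed
  then show "hom_acyclic R P d N" by (simp add: hom_acyclic_def)
qed

text \<open>\<open>K k\<close> is the (k + 1)-st cosyzygy of R. The vanishing of Ext(-,N) is carried
  along, as it provides the extension property required by \<open>\<theta>_iso_kernel\<close>. The
  injectivity statements obtained for the short exact pieces are spliced to acyclicity of the dual
  complex tensored with \<open>U\<close>, which in the application computes Tor(T,U).\<close>

lemma descend_coresolution:
  fixes X :: "nat \<Rightarrow> ('r, 'x) module" and d :: "nat \<Rightarrow> 'x \<Rightarrow> 'x" and u :: "'r \<Rightarrow> 'x"
  defines "K \<equiv> \<lambda>k. img (X k) (X (Suc k)) (d k)"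
  assumes s0: "ses R (regular_module R) u (X 0) (d 0) (K 0)"
    and s: "\<And>k. ses R (K k) (\<lambda>x. x) (X (Suc k)) (d (Suc k)) (K (Suc k))"
    and ext0: "\<And>f. lin R (regular_module R) T f \<Longrightarrow> \<exists>g. lin R (X 0) T g \<and> (\<forall>a\<in>carrier (regular_module R). g (u a) = f a)"
    and ext: "\<And>k f. lin R (K k) T f \<Longrightarrow> \<exists>g. lin R (X (Suc k)) T g \<and> (\<forall>a\<in>carrier (K k). g a = f a)"
    and addT: "\<And>k. retr R T (X k)" and cosyz: "\<And>k. k \<ge> n \<Longrightarrow> retr R T (K k)"
    and acT: "ext_acyclic T" and iso: "\<theta>_iso T"
  shows "\<theta>_iso (regular_module R)" and "tensor_acyclic S U (\<lambda>k. dual (X k)) (\<lambda>k. precomp (X k) (d k))"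
proof -
  have add: "\<theta>_iso Y \<and> ext_acyclic Y" if "retr R T Y" for Y :: "('r, 'y) module"
    using \<theta>_iso_retr[OF that iso] ext_acyclic_retr[OF that acT] by blast
  have K: "\<theta>_iso (K k) \<and> ext_acyclic (K k)" for k
  proof -
    have "k \<le> max k n" by simp
    then show ?thesis
    proof (induction k rule: inc_induct)
      case base show ?case by (rule add[OF cosyz]) simp
    next
      case (step j)
      note e = ext_acyclic_ses[OF s conjunct2[OF add[OF addT]] conjunct2[OF step.IH]]
      show ?case
        using \<theta>_iso_kernel(1)[OF s ext conjunct1[OF add[OF addT]] conjunct1[OF step.IH] e(2)] e(1) by blast
    qed
  qed
  note e0 = ext_acyclic_ses(2)[OF s0 conjunct2[OF add[OF addT]] conjunct2[OF K]]
  note k0 = \<theta>_iso_kernel[OF s0 ext0 conjunct1[OF add[OF addT]] conjunct1[OF K] e0]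
  show "\<theta>_iso (regular_module R)" by (rule k0(1))
  have inj: "x \<in> null (dual (K k))"
    if x: "x \<in> frags (dual (K k)) U" "tmap (precomp (X k) (d k)) x \<in> null (dual (X k))" for k x
  proof (cases k)
    case 0
    then show ?thesis using k0(2) x by simp
  next
    case (Suc j)
    note e = ext_acyclic_ses(2)[OF s conjunct2[OF add[OF addT]] conjunct2[OF K]]
    show ?thesis
      using \<theta>_iso_kernel(2)[OF s[of j] ext conjunct1[OF add[OF addT]] conjunct1[OF K] e, of x] x Suc by simp
  qed
  show "tensor_acyclic S U (\<lambda>k. dual (X k)) (\<lambda>k. precomp (X k) (d k))"
    unfolding tensor_acyclic_def[OF U]
  proof (intro allI ballI impI)
    fix j z assume z: "z \<in> frags (dual (X (Suc j))) U" and dz: "tmap (precomp (X j) (d j)) z \<in> null (dual (X j))"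
    \<comment> \<open>Restriction of functionals from X (k + 1) to the submodule \<open>K k\<close>.
      The dual differential is this surjection followed by the injection of dual K k into dual X k,
      and the latter stays injective after tensoring, by \<open>inj\<close>.\<close>
    let ?r = "\<lambda>k. precomp (K k) (\<lambda>x. x)"
    note D = sesD[OF ses_dual[OF s ext]]
    have Xl: "lin R (X k) (K k) (d k)" for k by (cases k) (use sesD(2)[OF s0] sesD(2)[OF s] in auto)
    have dK: "precomp (X k) (d k) (?r k \<phi>) = precomp (X k) (d k) \<phi>" for k \<phi>
      using lin_closed[OF Xl[of k]] by (auto simp: precomp_def compose_def intro!: restrict_ext)
    have rz: "tmap (?r j) z \<in> frags (dual (K j)) U" by (rule tmap_frags[OF U D(2) z])
    have "tmap (precomp (X j) (d j)) (tmap (?r j) z) = tmap (precomp (X j) (d j)) z"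
      by (simp add: bimap_bimap dK)
    then have "tmap (?r j) z \<in> null (dual (K j))" using inj[OF rz] dz by simp
    then obtain y where y: "y \<in> frags (dual (K (Suc j))) U" "z - tmap (precomp (X (Suc j)) (d (Suc j))) y \<in> null (dual (X (Suc j)))"
      using tensor_right_exact[OF U D(1) D(2) D(4) D(6) z] by blast
    obtain w where w: "w \<in> frags (dual (X (Suc (Suc j)))) U" "tmap (?r (Suc j)) w = y"
      by (rule tensor_surj[OF U D(4) y(1)])
    have "tmap (precomp (X (Suc j)) (d (Suc j))) y = tmap (precomp (X (Suc j)) (d (Suc j))) w"
      by (simp add: bimap_bimap dK flip: w(2))
    with y w show "\<exists>y\<in>frags (dual (X (Suc (Suc j)))) U. z - tmap (precomp (X (Suc j)) (d (Suc j))) y \<in> null (dual (X (Suc j)))"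
      by auto
  qed
qed

end

section \<open>Summands of finite powers\<close>

text \<open>The dual basis lemma: a section of the free module on a finite generating set writes
  every x as a combination of generators with coefficients linear in x. These coefficients are the
  maps to R, and multiplication of the generators by scalars gives the maps back.\<close>

lemma retr_fg_projective:
  assumes P: "projective R P" and fg: "fin_gen R P"
  shows "retr R (regular_module R) P"
proof -
  have mP: "left_module R P" by (rule projective_module[OF P])
  interpret P: left_module R P by fact
  have ring: "ring R" by unfold_locales
  obtain B where B: "finite B" "B \<subseteq> carrier P"
    and gen: "\<And>x. x \<in> carrier P \<Longrightarrow> \<exists>c\<in>B \<rightarrow> carrier R. x = (\<Oplus>\<^bsub>P\<^esub>b\<in>B. c b \<odot>\<^bsub>P\<^esub> b)"
    using fg unfolding fin_gen_def by blast
  let ?F = "free_module R B"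
  have mF: "left_module R ?F" by (rule left_module_free[OF ring])
  have gB: "(\<lambda>x. x) \<in> B \<rightarrow> carrier P" using B by auto
  define \<pi> where "\<pi> = free_ext R B P (\<lambda>x. x)"
  have \<pi>: "lin R ?F P \<pi>" unfolding \<pi>_def by (rule lin_mod_hom[OF free_ext_hom[OF mP gB] mF mP])
  have \<pi>_eq: "\<pi> f = (\<Oplus>\<^bsub>P\<^esub>b\<in>B. f b \<odot>\<^bsub>P\<^esub> b)" if f: "f \<in> carrier ?F" for f
    unfolding \<pi>_def by (rule free_ext_eq[OF mP gB f B(1)]) (use f in \<open>auto simp: free_module_sel\<close>)
  have onto: "\<exists>f\<in>carrier ?F. \<pi> f = x" if x: "x \<in> carrier P" for x
  proof -
    obtain c where c: "c \<in> B \<rightarrow> carrier R" "x = (\<Oplus>\<^bsub>P\<^esub>b\<in>B. c b \<odot>\<^bsub>P\<^esub> b)" using gen[OF x] by blast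
    let ?f = "\<lambda>b. if b \<in> B then c b else \<zero>\<^bsub>R\<^esub>"
    have f: "?f \<in> carrier ?F" using c B by (auto simp: free_module_sel intro: finite_subset[OF _ B(1)])
    have "\<pi> ?f = x" unfolding \<pi>_eq[OF f] c(2) using c B by (intro P.M.finsum_cong') auto
    with f show ?thesis by blast
  qed
  obtain s where s: "lin R P ?F s" "\<And>x. x \<in> carrier P \<Longrightarrow> \<pi> (s x) = x"
    by (rule lift_image[OF P \<pi> lin_id[OF mP]]) (use onto in auto)
  \<comment> \<open>An enumeration of the generators, as \<open>retr\<close> indexes its maps by an
    initial segment of the naturals.\<close>
  obtain h where h: "bij_betw h {..<card B} B" using ex_bij_betw_nat_finite[OF B(1)] by (auto simp: atLeast0LessThan)
  have hB: "h i \<in> B" "h i \<in> carrier P" if "i < card B" for i using h that B by (auto dest: bij_betwE)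
  have a: "lin R P (regular_module R) (\<lambda>x. s x (h i))" for i
  proof -
    have "lin R ?F (regular_module R) (\<lambda>f. f (h i))"
      by (intro linI mF left_module_regular ring) (auto simp: free_module_sel)
    from lin_comp[OF s(1) this] show ?thesis .
  qed
  have b: "lin R (regular_module R) P (\<lambda>r. r \<odot>\<^bsub>P\<^esub> h i)" if "i < card B" for i
    using hB[OF that] by (intro linI mP left_module_regular ring) (auto simp: P.smult_l_distr P.smult_assoc1)
  have "(\<Oplus>\<^bsub>P\<^esub>i\<in>{..<card B}. s x (h i) \<odot>\<^bsub>P\<^esub> h i) = x" if x: "x \<in> carrier P" for x
  proof -
    have sx: "s x b \<in> carrier R" for b using lin_closed[OF s(1) x] by (simp add: free_module_sel)
    have "(\<Oplus>\<^bsub>P\<^esub>b\<in>h ` {..<card B}. s x b \<odot>\<^bsub>P\<^esub> b) = (\<Oplus>\<^bsub>P\<^esub>i\<in>{..<card B}. s x (h i) \<odot>\<^bsub>P\<^esub> h i)"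
      using h sx subsetD[OF B(2)] by (intro P.M.finsum_reindex) (auto simp: bij_betw_def)
    moreover have "h ` {..<card B} = B" using h by (simp add: bij_betw_def)
    ultimately show ?thesis using \<pi>_eq[OF lin_closed[OF s(1) x]] s(2)[OF x] by simp
  qed
  with a b mP show ?thesis unfolding retr_def
    by (intro conjI exI[of _ "card B"] exI[of _ "\<lambda>i x. s x (h i)"] exI[of _ "\<lambda>i r. r \<odot>\<^bsub>P\<^esub> h i"]) auto
qed

text \<open>Lifts of h b i on \<open>Y\<close>, composed with the a i, add up to a lift of
  h.\<close>

lemma projective_retr:
  assumes YX: "retr R Y X" and Y: "projective R Y"
  shows "projective R X"
  unfolding projective_def
proof (intro conjI allI impI ballI)
  show X: "left_module R X" using YX by (simp add: retr_def)
  obtain n a b where a: "\<And>i. i < n \<Longrightarrow> lin R X Y (a i)" and b: "\<And>i. i < n \<Longrightarrow> lin R Y X (b i)"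
    and sum: "\<And>x. x \<in> carrier X \<Longrightarrow> (\<Oplus>\<^bsub>X\<^esub>i\<in>{..<n::nat}. b i (a i x)) = x"
    using YX unfolding retr_def by metis
  fix A :: "('a, 'c \<Rightarrow> 'a) module" and B :: "('a, 'c) module" and g h
  assume A: "left_module R A" and B: "left_module R B" and g: "g \<in> mod_hom R A B"
    and gs: "g ` carrier A = carrier B" and h: "h \<in> mod_hom R X B"
  interpret A: left_module R A by (rule A)
  interpret B: left_module R B by (rule B)
  have hl: "lin R X B h" by (rule lin_mod_hom[OF h X B])
  have gl: "lin R A B g" by (rule lin_mod_hom[OF g A B])
  have "\<exists>k. lin R Y A k \<and> (\<forall>y\<in>carrier Y. g (k y) = h (b i y))" if i: "i < n" for i
  proof -
    have ex: "\<exists>a\<in>carrier A. g a = h (b i y)" if "y \<in> carrier Y" for y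
      using gs lin_closed[OF hl lin_closed[OF b[OF i] that]] by (metis imageE)
    obtain k where "lin R Y A k" "\<And>y. y \<in> carrier Y \<Longrightarrow> g (k y) = h (b i y)"
      by (rule lift_image[OF Y gl lin_comp[OF b[OF i] hl]]) (use ex in auto)
    then show ?thesis by blast
  qed
  then obtain k where k: "\<And>i. i < n \<Longrightarrow> lin R Y A (k i)" "\<And>i y. i < n \<Longrightarrow> y \<in> carrier Y \<Longrightarrow> g (k i y) = h (b i y)"
    by metis
  let ?k = "\<lambda>x. \<Oplus>\<^bsub>A\<^esub>i\<in>{..<n}. k i (a i x)"
  have kl: "lin R X A ?k" using X A by (intro lin_finsum_map lin_comp[OF a k(1)]) auto
  have "g (?k x) = h x" if x: "x \<in> carrier X" for x
  proof -
    have "g (?k x) = (\<Oplus>\<^bsub>B\<^esub>i\<in>{..<n}. g (k i (a i x)))"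
      using x lin_closed[OF k(1)] lin_closed[OF a] by (intro lin_finsum[OF gl]) auto
    also have "\<dots> = (\<Oplus>\<^bsub>B\<^esub>i\<in>{..<n}. h (b i (a i x)))"
      using x k(2) lin_closed[OF a] lin_closed[OF b] lin_closed[OF hl] by (intro B.M.finsum_cong') auto
    also have "\<dots> = h (\<Oplus>\<^bsub>X\<^esub>i\<in>{..<n}. b i (a i x))"
      using x lin_closed[OF a] lin_closed[OF b] by (intro lin_finsum[symmetric, OF hl]) auto
    finally show ?thesis using sum[OF x] by simp
  qed
  then have "compose (carrier X) g (restrict ?k (carrier X)) = h"
    using mod_homD(1)[OF h] by (intro extensionalityI[of _ "carrier X"]) (auto simp: compose_def PiE_def)
  with restrict_mod_hom[OF kl] show "\<exists>k\<in>mod_hom R X A. compose (carrier X) g k = h" by blast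
qed

lemma mod_power_sel [simp]:
  "carrier (mod_power T n) = {..<n} \<rightarrow>\<^sub>E carrier T" "\<zero>\<^bsub>mod_power T n\<^esub> = (\<lambda>i\<in>{..<n}. \<zero>\<^bsub>T\<^esub>)"
  "x \<oplus>\<^bsub>mod_power T n\<^esub> y = (\<lambda>i\<in>{..<n}. x i \<oplus>\<^bsub>T\<^esub> y i)" "r \<odot>\<^bsub>mod_power T n\<^esub> x = (\<lambda>i\<in>{..<n}. r \<odot>\<^bsub>T\<^esub> x i)"
  by (simp_all add: mod_power_def)

lemma left_module_mod_power:
  assumes T: "left_module R T"
  shows "left_module R (mod_power T n)"
proof -
  interpret T: left_module R T by fact
  have m: "x i \<in> carrier T" if "x \<in> {..<n} \<rightarrow>\<^sub>E carrier T" "i < n" for x i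
    using PiE_mem[OF that(1)] that(2) by simp
  have "abelian_group (mod_power T n)"
  proof (rule abelian_groupI)
    fix x assume "x \<in> carrier (mod_power T n)"
    then have x: "x \<in> {..<n} \<rightarrow>\<^sub>E carrier T" by simp
    show "\<zero>\<^bsub>mod_power T n\<^esub> \<oplus>\<^bsub>mod_power T n\<^esub> x = x"
      using m[OF x] x by (intro extensionalityI[of _ "{..<n}"]) (auto simp: PiE_def)
    have "(\<lambda>i\<in>{..<n}. \<ominus>\<^bsub>T\<^esub> x i) \<in> carrier (mod_power T n)" using m[OF x] by auto
    moreover have "(\<lambda>i\<in>{..<n}. \<ominus>\<^bsub>T\<^esub> x i) \<oplus>\<^bsub>mod_power T n\<^esub> x = \<zero>\<^bsub>mod_power T n\<^esub>"
      using m[OF x] by (auto simp: T.M.l_neg intro!: restrict_ext)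
    ultimately show "\<exists>y\<in>carrier (mod_power T n). y \<oplus>\<^bsub>mod_power T n\<^esub> x = \<zero>\<^bsub>mod_power T n\<^esub>" by blast
    fix y assume "y \<in> carrier (mod_power T n)"
    then have y: "y \<in> {..<n} \<rightarrow>\<^sub>E carrier T" by simp
    show "x \<oplus>\<^bsub>mod_power T n\<^esub> y \<in> carrier (mod_power T n)" using m[OF x] m[OF y] by auto
    show "x \<oplus>\<^bsub>mod_power T n\<^esub> y = y \<oplus>\<^bsub>mod_power T n\<^esub> x"
      using m[OF x] m[OF y] by (auto intro!: restrict_ext T.M.a_comm)
    fix z assume "z \<in> carrier (mod_power T n)"
    then have z: "z \<in> {..<n} \<rightarrow>\<^sub>E carrier T" by simp
    show "x \<oplus>\<^bsub>mod_power T n\<^esub> y \<oplus>\<^bsub>mod_power T n\<^esub> z = x \<oplus>\<^bsub>mod_power T n\<^esub> (y \<oplus>\<^bsub>mod_power T n\<^esub> z)"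
      using m[OF x] m[OF y] m[OF z] by (auto intro!: restrict_ext T.M.a_assoc)
  qed simp
  then interpret abelian_group "mod_power T n" .
  show ?thesis
  proof unfold_locales
    fix x assume "x \<in> carrier (mod_power T n)"
    then have x: "x \<in> {..<n} \<rightarrow>\<^sub>E carrier T" by simp
    show "\<one>\<^bsub>R\<^esub> \<odot>\<^bsub>mod_power T n\<^esub> x = x"
      using m[OF x] x by (auto intro!: extensionalityI[of _ "{..<n}"] simp: PiE_def)
    fix a assume a: "a \<in> carrier R"
    show "a \<odot>\<^bsub>mod_power T n\<^esub> x \<in> carrier (mod_power T n)" using a m[OF x] by auto
    fix b assume b: "b \<in> carrier R"
    show "(a \<oplus>\<^bsub>R\<^esub> b) \<odot>\<^bsub>mod_power T n\<^esub> x = a \<odot>\<^bsub>mod_power T n\<^esub> x \<oplus>\<^bsub>mod_power T n\<^esub> b \<odot>\<^bsub>mod_power T n\<^esub> x"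
      using a b m[OF x] by (auto simp: T.smult_l_distr intro!: restrict_ext)
    show "(a \<otimes>\<^bsub>R\<^esub> b) \<odot>\<^bsub>mod_power T n\<^esub> x = a \<odot>\<^bsub>mod_power T n\<^esub> (b \<odot>\<^bsub>mod_power T n\<^esub> x)"
      using a b m[OF x] by (auto simp: T.smult_assoc1 intro!: restrict_ext)
  next
    fix a x y assume a: "a \<in> carrier R" and "x \<in> carrier (mod_power T n)" "y \<in> carrier (mod_power T n)"
    then have x: "x \<in> {..<n} \<rightarrow>\<^sub>E carrier T" and y: "y \<in> {..<n} \<rightarrow>\<^sub>E carrier T" by auto
    show "a \<odot>\<^bsub>mod_power T n\<^esub> (x \<oplus>\<^bsub>mod_power T n\<^esub> y) = a \<odot>\<^bsub>mod_power T n\<^esub> x \<oplus>\<^bsub>mod_power T n\<^esub> a \<odot>\<^bsub>mod_power T n\<^esub> y"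
      using a m[OF x] m[OF y] by (auto simp: T.smult_r_distr intro!: restrict_ext)
  qed
qed

lemma retr_mod_power:
  assumes T: "left_module R T"
  shows "retr R T (mod_power T n)"
proof -
  interpret T: left_module R T by fact
  let ?M = "mod_power T n"
  note M = left_module_mod_power[OF T, of n]
  interpret M: left_module R ?M by (rule M)
  let ?e = "\<lambda>i t. \<lambda>j\<in>{..<n}. if i = j then t else \<zero>\<^bsub>T\<^esub>"
  have a: "lin R ?M T (\<lambda>x. x i)" if "i < n" for i
    using that by (intro linI M T) auto
  have b: "lin R T ?M (?e i)" for i
    by (intro linI M T) (auto simp: T.smult_r_zero intro!: restrict_ext)
  have "(\<Oplus>\<^bsub>?M\<^esub>i\<in>{..<n}. ?e i (x i)) = x" if x: "x \<in> carrier ?M" for x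
  proof (rule extensionalityI[of _ "{..<n}"])
    have c: "x i \<in> carrier T" if "i < n" for i using lin_closed[OF a[OF that] x] .
    have e: "(\<lambda>i. ?e i (x i)) \<in> {..<n} \<rightarrow> carrier ?M" using lin_closed[OF b c] by blast
    show "(\<Oplus>\<^bsub>?M\<^esub>i\<in>{..<n}. ?e i (x i)) \<in> extensional {..<n}" "x \<in> extensional {..<n}"
      using M.M.finsum_closed[OF e] x by (auto simp: PiE_def)
    fix j assume "j \<in> {..<n}"
    then have j: "j < n" by simp
    have "(\<Oplus>\<^bsub>?M\<^esub>i\<in>{..<n}. ?e i (x i)) j = (\<Oplus>\<^bsub>T\<^esub>i\<in>{..<n}. ?e i (x i) j)"
      by (rule lin_finsum[OF a[OF j] _ e]) simp
    also have "\<dots> = (\<Oplus>\<^bsub>T\<^esub>i\<in>{..<n}. if j = i then x i else \<zero>\<^bsub>T\<^esub>)"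
      using j c by (intro T.M.finsum_cong') auto
    also have "\<dots> = x j" using j c by (intro T.M.finsum_singleton) auto
    finally show "(\<Oplus>\<^bsub>?M\<^esub>i\<in>{..<n}. ?e i (x i)) j = x j" .
  qed
  with a b M show ?thesis unfolding retr_def
    by (intro conjI exI[of _ n] exI[of _ "\<lambda>i x. x i"] exI[of _ ?e]) auto
qed

text \<open>The projection \<pi> onto \<open>U\<close> along \<open>V\<close> is chosen element by
  element and is linear because the decomposition u + v is unique. Followed by the inverse of
  \<iota> it retracts the power of T onto \<open>X\<close>.\<close>

lemma retr_add_class:
  assumes T: "left_module R T" and X: "X \<in> add_class R T"
  shows "retr R T X"
proof -
  obtain n U V \<iota> where mX: "left_module R X" and U: "is_submodule R U (mod_power T n)" and V: "is_submodule R V (mod_power T n)"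
    and UV: "U \<inter> V = {\<zero>\<^bsub>mod_power T n\<^esub>}" "U <+>\<^bsub>mod_power T n\<^esub> V = carrier (mod_power T n)"
    and \<iota>: "\<iota> \<in> mod_iso R X (mod_power T n\<lparr>carrier := U\<rparr>)"
    using X unfolding add_class_def is_direct_summand_def by blast
  define M where "M = mod_power T n"
  have M: "left_module R M" unfolding M_def by (rule left_module_mod_power[OF T])
  interpret M: left_module R M by fact
  interpret U: left_module R "M\<lparr>carrier := U\<rparr>" using U by (simp add: is_submodule_def M_def)
  interpret V: left_module R "M\<lparr>carrier := V\<rparr>" using V by (simp add: is_submodule_def M_def)
  have UM: "U \<subseteq> carrier M" "V \<subseteq> carrier M" using U V by (auto simp: is_submodule_def M_def)
  have Ua: "u \<oplus>\<^bsub>M\<^esub> u' \<in> U" if "u \<in> U" "u' \<in> U" for u u'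
    using U.M.a_closed[of u u'] that by auto
  have Us: "r \<odot>\<^bsub>M\<^esub> u \<in> U" if "r \<in> carrier R" "u \<in> U" for u r
    using U.smult_closed[of r u] that by auto
  have Va: "u \<oplus>\<^bsub>M\<^esub> u' \<in> V" if "u \<in> V" "u' \<in> V" for u u'
    using V.M.a_closed[of u u'] that by auto
  have Vs: "r \<odot>\<^bsub>M\<^esub> u \<in> V" if "r \<in> carrier R" "u \<in> V" for u r
    using V.smult_closed[of r u] that by auto
  have U0: "\<zero>\<^bsub>M\<^esub> \<in> U" "\<zero>\<^bsub>M\<^esub> \<in> V" using U.M.zero_closed V.M.zero_closed by auto
  have negU: "\<ominus>\<^bsub>M\<^esub> u \<in> U" if "u \<in> U" for u
    using Us[OF _ that, of "\<ominus>\<^bsub>R\<^esub> \<one>\<^bsub>R\<^esub>"] M.neg_eq_smult[of u] UM that by auto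
  have negV: "\<ominus>\<^bsub>M\<^esub> u \<in> V" if "u \<in> V" for u
    using Vs[OF _ that, of "\<ominus>\<^bsub>R\<^esub> \<one>\<^bsub>R\<^esub>"] M.neg_eq_smult[of u] UM that by auto
  have dec: "\<exists>u\<in>U. \<exists>v\<in>V. y = u \<oplus>\<^bsub>M\<^esub> v" if "y \<in> carrier M" for y
  proof -
    have "y \<in> U <+>\<^bsub>M\<^esub> V" using UV(2) that by (simp only: M_def)
    then show ?thesis unfolding set_add_def set_mult_def by auto
  qed
  have uniq: "u = u'" if uv: "u \<in> U" "v \<in> V" "u' \<in> U" "v' \<in> V" "u \<oplus>\<^bsub>M\<^esub> v = u' \<oplus>\<^bsub>M\<^esub> v'" for u v u' v'
  proof -
    have c: "u \<in> carrier M" "v \<in> carrier M" "u' \<in> carrier M" "v' \<in> carrier M" using uv UM by auto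
    have "u \<ominus>\<^bsub>M\<^esub> u' = v' \<ominus>\<^bsub>M\<^esub> v"
    proof -
      have "(u \<ominus>\<^bsub>M\<^esub> u') \<oplus>\<^bsub>M\<^esub> (v \<ominus>\<^bsub>M\<^esub> v') = \<zero>\<^bsub>M\<^esub>"
        using c uv(5) M.M.minus_eq_zero_iff[of "u' \<oplus>\<^bsub>M\<^esub> v'" "u' \<oplus>\<^bsub>M\<^esub> v'"] by (simp flip: M.M.add_minus_distrib)
      then have "u \<ominus>\<^bsub>M\<^esub> u' = \<ominus>\<^bsub>M\<^esub> (v \<ominus>\<^bsub>M\<^esub> v')" using c by (simp add: M.M.minus_equality)
      then show ?thesis using c by (simp add: a_minus_def M.M.minus_add M.M.a_comm)
    qed
    moreover have "u \<ominus>\<^bsub>M\<^esub> u' \<in> U" "v' \<ominus>\<^bsub>M\<^esub> v \<in> V"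
      using uv Ua[of u "\<ominus>\<^bsub>M\<^esub> u'"] Va[of v' "\<ominus>\<^bsub>M\<^esub> v"] negU negV by (auto simp: a_minus_def)
    ultimately have "u \<ominus>\<^bsub>M\<^esub> u' = \<zero>\<^bsub>M\<^esub>" using UV(1) by (auto simp: M_def)
    then show ?thesis using c by (simp add: M.M.minus_eq_zero_iff)
  qed
  define \<pi> where "\<pi> y = (SOME u. u \<in> U \<and> (\<exists>v\<in>V. y = u \<oplus>\<^bsub>M\<^esub> v))" for y
  have \<pi>: "\<pi> y \<in> U \<and> (\<exists>v\<in>V. y = \<pi> y \<oplus>\<^bsub>M\<^esub> v)" if "y \<in> carrier M" for y
  proof -
    have "\<exists>u. u \<in> U \<and> (\<exists>v\<in>V. y = u \<oplus>\<^bsub>M\<^esub> v)" using dec[OF that] by blast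
    then show ?thesis unfolding \<pi>_def by (rule someI_ex)
  qed
  have \<pi>_eq: "\<pi> (u \<oplus>\<^bsub>M\<^esub> v) = u" if "u \<in> U" "v \<in> V" for u v
  proof -
    have "u \<oplus>\<^bsub>M\<^esub> v \<in> carrier M" using that UM by auto
    then obtain v' where "v' \<in> V" "\<pi> (u \<oplus>\<^bsub>M\<^esub> v) \<in> U" "u \<oplus>\<^bsub>M\<^esub> v = \<pi> (u \<oplus>\<^bsub>M\<^esub> v) \<oplus>\<^bsub>M\<^esub> v'" using \<pi> by blast
    then show ?thesis using uniq that by metis
  qed
  have \<pi>_lin: "lin R M (M\<lparr>carrier := U\<rparr>) \<pi>"
  proof (rule linI[OF M U.left_module_axioms]; simp)
    show "\<pi> x \<in> U" if "x \<in> carrier M" for x using \<pi>[OF that] by blast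
    fix x assume x: "x \<in> carrier M"
    then obtain v where v: "v \<in> V" "\<pi> x \<in> U" "x = \<pi> x \<oplus>\<^bsub>M\<^esub> v" using \<pi> by blast
    have c: "\<pi> x \<in> carrier M" "v \<in> carrier M" using v UM by auto
    show "\<pi> (x \<oplus>\<^bsub>M\<^esub> y) = \<pi> x \<oplus>\<^bsub>M\<^esub> \<pi> y" if y: "y \<in> carrier M" for y
    proof -
      obtain w where w: "w \<in> V" "\<pi> y \<in> U" "y = \<pi> y \<oplus>\<^bsub>M\<^esub> w" using \<pi>[OF y] by blast
      have c': "\<pi> y \<in> carrier M" "w \<in> carrier M" using w UM by auto
      have "x \<oplus>\<^bsub>M\<^esub> y = (\<pi> x \<oplus>\<^bsub>M\<^esub> v) \<oplus>\<^bsub>M\<^esub> (\<pi> y \<oplus>\<^bsub>M\<^esub> w)" using v(3) w(3) by simp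
      also have "\<dots> = (\<pi> x \<oplus>\<^bsub>M\<^esub> \<pi> y) \<oplus>\<^bsub>M\<^esub> (v \<oplus>\<^bsub>M\<^esub> w)" using c c' by (simp add: M.M.a_ac)
      finally show ?thesis using \<pi>_eq[OF Ua[OF v(2) w(2)] Va[OF v(1) w(1)]] by simp
    qed
    show "\<pi> (r \<odot>\<^bsub>M\<^esub> x) = r \<odot>\<^bsub>M\<^esub> \<pi> x" if r: "r \<in> carrier R" for r
    proof -
      have "r \<odot>\<^bsub>M\<^esub> x = r \<odot>\<^bsub>M\<^esub> \<pi> x \<oplus>\<^bsub>M\<^esub> r \<odot>\<^bsub>M\<^esub> v"
        using M.smult_r_distr[OF r c] v(3) by simp
      then show ?thesis using \<pi>_eq[OF Us[OF r v(2)] Vs[OF r v(1)]] by simp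
    qed
  qed
  have \<iota>': "\<iota> \<in> mod_hom R X (M\<lparr>carrier := U\<rparr>)" "bij_betw \<iota> (carrier X) U"
    using \<iota> by (auto simp: mod_iso_def M_def)
  have \<iota>l: "lin R X (M\<lparr>carrier := U\<rparr>) \<iota>" by (rule lin_mod_hom[OF \<iota>'(1) mX U.left_module_axioms])
  define \<kappa> where "\<kappa> = inv_into (carrier X) \<iota>"
  have \<kappa>: "\<kappa> u \<in> carrier X" "\<iota> (\<kappa> u) = u" if "u \<in> U" for u
    using that \<iota>'(2) unfolding \<kappa>_def bij_betw_def by (auto intro: inv_into_into f_inv_into_f)
  have \<kappa>\<iota>: "\<kappa> (\<iota> x) = x" if "x \<in> carrier X" for x
    using that \<iota>'(2) unfolding \<kappa>_def bij_betw_def by auto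
  interpret X: left_module R X by (rule mX)
  have \<kappa>l: "lin R (M\<lparr>carrier := U\<rparr>) X \<kappa>"
  proof (rule linI[OF U.left_module_axioms mX]; simp)
    show "\<kappa> x \<in> carrier X" if "x \<in> U" for x by (rule \<kappa>(1)[OF that])
    show "\<kappa> (x \<oplus>\<^bsub>M\<^esub> y) = \<kappa> x \<oplus>\<^bsub>X\<^esub> \<kappa> y" if "x \<in> U" "y \<in> U" for x y
      using \<kappa>\<iota>[of "\<kappa> x \<oplus>\<^bsub>X\<^esub> \<kappa> y"] lin_add[OF \<iota>l, of "\<kappa> x" "\<kappa> y"] \<kappa> that by simp
    show "\<kappa> (r \<odot>\<^bsub>M\<^esub> x) = r \<odot>\<^bsub>X\<^esub> \<kappa> x" if "r \<in> carrier R" "x \<in> U" for x r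
      using \<kappa>\<iota>[of "r \<odot>\<^bsub>X\<^esub> \<kappa> x"] lin_smult[OF \<iota>l, of r "\<kappa> x"] \<kappa> that by simp
  qed
  have incl: "lin R (M\<lparr>carrier := U\<rparr>) M (\<lambda>x. x)" by (rule linI[OF U.left_module_axioms M]) (use UM in auto)
  have "\<pi> u = u" if "u \<in> U" for u using \<pi>_eq[OF that U0(2)] that UM by auto
  then have "\<kappa> (\<pi> (\<iota> x)) = x" if "x \<in> carrier X" for x
    using that \<kappa>\<iota> lin_closed[OF \<iota>l that] by simp
  then show ?thesis
    using retr_trans_retract[OF retr_mod_power[OF T, of n, folded M_def] lin_comp[OF \<iota>l incl] lin_comp[OF \<pi>_lin \<kappa>l]] by blast
qed

context End_module begin

lemma smult_id_hom: "s \<in> mod_hom R T T \<Longrightarrow> compose (carrier T) s (id_hom T) = s"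
  using mod_homD(1)[of s R T T]
  by (auto simp: id_hom_def compose_def PiE_def intro!: extensionalityI[of _ "carrier T"])

text \<open>\<open>dual T\<close> is \<open>op_ring S\<close> as a module over itself, free on
  \<open>id_hom T\<close>, so a lift is obtained from a preimage of the image of the
  identity.\<close>

lemma projective_dual_T: "projective (op_ring S) (dual T)"
  unfolding projective_def
proof (intro conjI allI impI ballI)
  show D: "left_module (op_ring S) (dual T)" by (rule left_module_dual[OF T])
  fix A :: "('t \<Rightarrow> 't, ('t \<Rightarrow> 't) \<Rightarrow> 't \<Rightarrow> 't) module" and B :: "('t \<Rightarrow> 't, 't \<Rightarrow> 't) module" and g h
  assume A: "left_module (op_ring S) A" and B: "left_module (op_ring S) B" and g: "g \<in> mod_hom (op_ring S) A B"
    and gs: "g ` carrier A = carrier B" and h: "h \<in> mod_hom (op_ring S) (dual T) B"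
  interpret A: left_module "op_ring S" A by (rule A)
  have id: "id_hom T \<in> mod_hom R T T" by (rule id_hom_mod_hom[OF T])
  have "h (id_hom T) \<in> carrier B" using mod_homD(2)[OF h] id by simp
  then obtain a where a: "a \<in> carrier A" "g a = h (id_hom T)" using gs by (metis imageE)
  let ?k = "\<lambda>\<phi>. \<phi> \<odot>\<^bsub>A\<^esub> a"
  have k: "lin (op_ring S) (dual T) A ?k"
  proof (rule linI[OF D A])
    fix \<phi> assume \<phi>: "\<phi> \<in> carrier (dual T)"
    show "?k \<phi> \<in> carrier A" using A.smult_closed[OF _ a(1)] \<phi> by simp
    show "?k (\<phi> \<oplus>\<^bsub>dual T\<^esub> \<psi>) = ?k \<phi> \<oplus>\<^bsub>A\<^esub> ?k \<psi>" if "\<psi> \<in> carrier (dual T)" for \<psi>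
      using A.smult_l_distr[of \<phi> \<psi> a] \<phi> that a by simp
    show "?k (s \<odot>\<^bsub>dual T\<^esub> \<phi>) = s \<odot>\<^bsub>A\<^esub> ?k \<phi>" if "s \<in> carrier (op_ring S)" for s
      using A.smult_assoc1[of s \<phi> a] \<phi> that a by simp
  qed
  have "g (?k \<phi>) = h \<phi>" if "\<phi> \<in> mod_hom R T T" for \<phi>
    using mod_homD(4)[OF g, of \<phi> a] mod_homD(4)[OF h, of \<phi> "id_hom T"] a that id by (simp add: smult_id_hom)
  then have "compose (carrier (dual T)) g (restrict ?k (carrier (dual T))) = h"
    using mod_homD(1)[OF h] by (intro extensionalityI[of _ "carrier (dual T)"]) (auto simp: compose_def PiE_def)
  with restrict_mod_hom[OF k]
  show "\<exists>k\<in>mod_hom (op_ring S) (dual T) A. compose (carrier (dual T)) g k = h" by blast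
qed

abbreviation "R0 \<equiv> regular_module R"

lemma left_module_R0: "left_module R R0"
  by (rule left_module_regular) unfold_locales

text \<open>Inverse to evaluation at 1; together they form the isomorphism of right S-modules
  between T and the dual of R.\<close>

definition from_one :: "'t \<Rightarrow> 'r \<Rightarrow> 't" where
  "from_one t = (\<lambda>r\<in>carrier R. r \<odot>\<^bsub>T\<^esub> t)"

lemma from_one_mod_hom: "t \<in> carrier T \<Longrightarrow> from_one t \<in> mod_hom R R0 T"
  unfolding from_one_def
  by (rule mod_homI) (auto simp: T.smult_l_distr T.smult_assoc1)

lemma lin_from_one: "lin (op_ring S) TS (dual R0) from_one"
  by (intro linI left_module_TS left_module_dual left_module_R0)
     (auto simp: from_one_mod_hom, auto simp: from_one_def T.smult_r_distr compose_def mod_homD(4) intro!: restrict_ext)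

lemma lin_at_one: "lin (op_ring S) (dual R0) TS (\<lambda>\<phi>. \<phi> \<one>\<^bsub>R\<^esub>)"
  by (rule lin_eval[OF left_module_R0]) simp

lemma from_one_at_one: "\<phi> \<in> mod_hom R R0 T \<Longrightarrow> from_one (\<phi> \<one>\<^bsub>R\<^esub>) = \<phi>"
  using mod_homD(2,4)[of \<phi> R R0 T]
  by (intro mod_hom_eqI[of _ R R0 T] from_one_mod_hom) (auto simp: from_one_def simp flip: mod_homD(4))

lemma at_one_from_one: "t \<in> carrier T \<Longrightarrow> from_one t \<one>\<^bsub>R\<^esub> = t"
  by (simp add: from_one_def)

lemma retr_dual_R0: "retr (op_ring S) TS (dual R0)"
  by (rule retrI[OF lin_at_one lin_from_one]) (simp add: from_one_at_one)

end

section \<open>The coresolution of \<open>R\<close> and its dual\<close>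

text \<open>\<open>has_add_coresolution\<close> in terms of elements, with \<open>retr\<close> for
  \<open>add_class\<close>. The three \<open>dual\<close> assumptions are exactness after Hom(-,T),
  phrased as solvability of equations for functionals.\<close>

locale add_coresolution = End_module R T for R :: "'r ring" and T :: "('r, 't) module" +
  fixes X :: "nat \<Rightarrow> ('r, 'x) module" and d :: "nat \<Rightarrow> 'x \<Rightarrow> 'x" and u :: "'r \<Rightarrow> 'x"
  assumes addT: "\<And>k. retr R T (X k)"
    and lin_u: "lin R (regular_module R) (X 0) u"
    and lin_d: "\<And>k. lin R (X k) (X (Suc k)) (d k)"
    and inj_u: "inj_on u (carrier R)"
    and ex0: "\<And>x. x \<in> carrier (X 0) \<Longrightarrow> d 0 x = \<zero>\<^bsub>X (Suc 0)\<^esub> \<longleftrightarrow> x \<in> u ` carrier R"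
    and exS: "\<And>k x. x \<in> carrier (X (Suc k)) \<Longrightarrow> d (Suc k) x = \<zero>\<^bsub>X (Suc (Suc k))\<^esub> \<longleftrightarrow> x \<in> d k ` carrier (X k)"
    and dual_onto: "\<And>\<phi>. \<phi> \<in> mod_hom R (regular_module R) T \<Longrightarrow>
        \<exists>\<psi>\<in>mod_hom R (X 0) T. \<forall>r\<in>carrier R. \<psi> (u r) = \<phi> r"
    and dual_ex0: "\<And>\<phi>. \<phi> \<in> mod_hom R (X 0) T \<Longrightarrow> (\<And>r. r \<in> carrier R \<Longrightarrow> \<phi> (u r) = \<zero>\<^bsub>T\<^esub>) \<Longrightarrow>
        \<exists>\<psi>\<in>mod_hom R (X (Suc 0)) T. \<forall>x\<in>carrier (X 0). \<psi> (d 0 x) = \<phi> x"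
    and dual_exS: "\<And>k \<phi>. \<phi> \<in> mod_hom R (X (Suc k)) T \<Longrightarrow> (\<And>x. x \<in> carrier (X k) \<Longrightarrow> \<phi> (d k x) = \<zero>\<^bsub>T\<^esub>) \<Longrightarrow>
        \<exists>\<psi>\<in>mod_hom R (X (Suc (Suc k))) T. \<forall>x\<in>carrier (X (Suc k)). \<psi> (d (Suc k) x) = \<phi> x"
begin

abbreviation "K k \<equiv> img (X k) (X (Suc k)) (d k)"
abbreviation "L k \<equiv> dual (X k)"
abbreviation "dL k \<equiv> precomp (X k) (d k)"

lemma mX: "left_module R (X k)"
  by (rule linD[OF lin_d])

lemma du: "r \<in> carrier R \<Longrightarrow> d 0 (u r) = \<zero>\<^bsub>X (Suc 0)\<^esub>"
  using ex0 lin_closed[OF lin_u, of r] by simp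

lemma dd: "x \<in> carrier (X k) \<Longrightarrow> d (Suc k) (d k x) = \<zero>\<^bsub>X (Suc (Suc k))\<^esub>"
  using exS lin_closed[OF lin_d, of x k] by simp

lemma ses_0: "ses R R0 u (X 0) (d 0) (K 0)"
  unfolding ses_def using lin_u lin_to_img[OF lin_d] inj_u ex0 by auto

lemma ses_Suc: "ses R (K k) (\<lambda>x. x) (X (Suc k)) (d (Suc k)) (K (Suc k))"
  unfolding ses_def using lin_from_img[OF lin_d] lin_to_img[OF lin_d] exS by auto

lemma ext_0:
  assumes "lin R R0 T f"
  shows "\<exists>g. lin R (X 0) T g \<and> (\<forall>a\<in>carrier R0. g (u a) = f a)"
proof -
  obtain \<psi> where "\<psi> \<in> mod_hom R (X 0) T" "\<forall>r\<in>carrier R. \<psi> (u r) = f r"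
    using dual_onto[OF restrict_mod_hom[OF assms]] by auto
  then show ?thesis using lin_mod_hom[OF _ mX T] by auto
qed

text \<open>Pulled back along \<open>d k\<close>, the functional f becomes a cocycle of the dual
  complex, and exactness there yields the extension.\<close>

lemma ext_Suc:
  assumes f: "lin R (K k) T f"
  shows "\<exists>g. lin R (X (Suc k)) T g \<and> (\<forall>a\<in>carrier (K k). g a = f a)"
proof -
  let ?\<phi> = "\<lambda>x\<in>carrier (X k). f (d k x)"
  have \<phi>: "?\<phi> \<in> mod_hom R (X k) T" by (rule restrict_mod_hom[OF lin_comp[OF lin_to_img[OF lin_d] f]])
  have "\<exists>\<psi>\<in>mod_hom R (X (Suc k)) T. \<forall>x\<in>carrier (X k). \<psi> (d k x) = ?\<phi> x"
  proof (cases k)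
    case 0
    have "?\<phi> (u r) = \<zero>\<^bsub>T\<^esub>" if "r \<in> carrier R" for r
      using that 0 lin_closed[OF lin_u, of r] du[OF that] lin_zero[OF f] by simp
    then show ?thesis using dual_ex0[of ?\<phi>] \<phi> 0 by simp
  next
    case (Suc j)
    have "?\<phi> (d j x) = \<zero>\<^bsub>T\<^esub>" if "x \<in> carrier (X j)" for x
      using that Suc lin_closed[OF lin_d, of x j] dd[OF that] lin_zero[OF f] by simp
    then show ?thesis using dual_exS[of ?\<phi> j] \<phi> Suc by simp
  qed
  then show ?thesis using lin_mod_hom[OF _ mX T] by auto
qed

text \<open>Duals of summands of powers of T are summands of powers of S, hence projective. The
  augmentation is the dual of u followed by the identification of the dual of R with T, that is,
  evaluation at u 1.\<close>

lemma resol_dual: "resol (op_ring S) TS L dL (\<lambda>\<phi>. \<phi> (u \<one>\<^bsub>R\<^esub>))"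
  unfolding resol_def
proof (intro conjI allI)
  have u1: "u \<one>\<^bsub>R\<^esub> \<in> carrier (X 0)" using lin_closed[OF lin_u] by simp
  have ur: "\<phi> (u r) = r \<odot>\<^bsub>T\<^esub> \<phi> (u \<one>\<^bsub>R\<^esub>)" if "r \<in> carrier R" "\<phi> \<in> mod_hom R (X 0) T" for r \<phi>
    using lin_smult[OF lin_u, of r "\<one>\<^bsub>R\<^esub>"] mod_homD(4)[OF that(2,1) u1] that(1) by simp
  show "projective (op_ring S) (L n)" for n by (rule projective_retr[OF retr_dual[OF addT] projective_dual_T])
  show "lin (op_ring S) (L (Suc n)) (L n) (dL n)" for n by (rule lin_precomp[OF lin_d])
  show e: "lin (op_ring S) (L 0) TS (\<lambda>\<phi>. \<phi> (u \<one>\<^bsub>R\<^esub>))" by (rule lin_eval[OF mX u1])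
  show "(\<lambda>\<phi>. \<phi> (u \<one>\<^bsub>R\<^esub>)) ` carrier (L 0) = carrier TS"
  proof
    show "carrier TS \<subseteq> (\<lambda>\<phi>. \<phi> (u \<one>\<^bsub>R\<^esub>)) ` carrier (L 0)"
    proof
      fix t assume "t \<in> carrier TS"
      then have t: "t \<in> carrier T" by simp
      obtain \<psi> where "\<psi> \<in> mod_hom R (X 0) T" "\<forall>r\<in>carrier R. \<psi> (u r) = from_one t r"
        using dual_onto[OF from_one_mod_hom[OF t]] by blast
      then show "t \<in> (\<lambda>\<phi>. \<phi> (u \<one>\<^bsub>R\<^esub>)) ` carrier (L 0)"
        using at_one_from_one[OF t] by (intro image_eqI[of _ _ \<psi>]) auto
    qed
  qed (use lin_closed[OF e] in auto)
  show "\<forall>\<phi>\<in>carrier (L 0). \<phi> (u \<one>\<^bsub>R\<^esub>) = \<zero>\<^bsub>TS\<^esub> \<longleftrightarrow> \<phi> \<in> dL 0 ` carrier (L (Suc 0))"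
  proof
    fix \<phi> assume "\<phi> \<in> carrier (L 0)"
    then have \<phi>: "\<phi> \<in> mod_hom R (X 0) T" by simp
    show "\<phi> (u \<one>\<^bsub>R\<^esub>) = \<zero>\<^bsub>TS\<^esub> \<longleftrightarrow> \<phi> \<in> dL 0 ` carrier (L (Suc 0))"
    proof
      assume "\<phi> (u \<one>\<^bsub>R\<^esub>) = \<zero>\<^bsub>TS\<^esub>"
      then have "\<phi> (u r) = \<zero>\<^bsub>T\<^esub>" if "r \<in> carrier R" for r
        using ur[OF that \<phi>] that by (simp add: T.smult_r_zero)
      then obtain \<psi> where \<psi>: "\<psi> \<in> mod_hom R (X (Suc 0)) T" "\<forall>x\<in>carrier (X 0). \<psi> (d 0 x) = \<phi> x"
        using dual_ex0[OF \<phi>] by blast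
      have "\<phi> = dL 0 \<psi>"
        by (rule mod_hom_eqI[OF \<phi> precomp_mod_hom[OF lin_d \<psi>(1)]]) (simp add: precomp_apply \<psi>(2))
      then show "\<phi> \<in> dL 0 ` carrier (L (Suc 0))" using \<psi> by auto
    next
      assume "\<phi> \<in> dL 0 ` carrier (L (Suc 0))"
      then obtain \<psi> where \<psi>: "\<psi> \<in> mod_hom R (X (Suc 0)) T" "\<phi> = dL 0 \<psi>" by auto
      then show "\<phi> (u \<one>\<^bsub>R\<^esub>) = \<zero>\<^bsub>TS\<^esub>"
        using u1 du[of "\<one>\<^bsub>R\<^esub>"] lin_zero[OF lin_mod_hom[OF \<psi>(1) mX T]] by (simp add: precomp_apply)
    qed
  qed
  show "\<forall>\<phi>\<in>carrier (L (Suc n)). dL n \<phi> = \<zero>\<^bsub>L n\<^esub> \<longleftrightarrow> \<phi> \<in> dL (Suc n) ` carrier (L (Suc (Suc n)))" for n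
  proof
    fix \<phi> assume "\<phi> \<in> carrier (L (Suc n))"
    then have \<phi>: "\<phi> \<in> mod_hom R (X (Suc n)) T" by simp
    show "dL n \<phi> = \<zero>\<^bsub>L n\<^esub> \<longleftrightarrow> \<phi> \<in> dL (Suc n) ` carrier (L (Suc (Suc n)))"
    proof
      assume z: "dL n \<phi> = \<zero>\<^bsub>L n\<^esub>"
      have "\<phi> (d n x) = \<zero>\<^bsub>T\<^esub>" if "x \<in> carrier (X n)" for x
        using fun_cong[OF z, of x] that by (simp add: precomp_apply)
      then obtain \<psi> where \<psi>: "\<psi> \<in> mod_hom R (X (Suc (Suc n))) T" "\<forall>x\<in>carrier (X (Suc n)). \<psi> (d (Suc n) x) = \<phi> x"
        using dual_exS[OF \<phi>] by blast
      have "\<phi> = dL (Suc n) \<psi>"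
        by (rule mod_hom_eqI[OF \<phi> precomp_mod_hom[OF lin_d \<psi>(1)]]) (simp add: precomp_apply \<psi>(2))
      then show "\<phi> \<in> dL (Suc n) ` carrier (L (Suc (Suc n)))" using \<psi> by auto
    next
      assume "\<phi> \<in> dL (Suc n) ` carrier (L (Suc (Suc n)))"
      then obtain \<psi> where \<psi>: "\<psi> \<in> mod_hom R (X (Suc (Suc n))) T" "\<phi> = dL (Suc n) \<psi>" by auto
      have "dL n \<phi> \<in> mod_hom R (X n) T" by (rule precomp_mod_hom[OF lin_d \<phi>])
      moreover have "\<zero>\<^bsub>L n\<^esub> \<in> mod_hom R (X n) T" using restrict_mod_hom[OF lin_zero_map[OF mX T]] by simp
      ultimately show "dL n \<phi> = \<zero>\<^bsub>L n\<^esub>"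
        using lin_closed[OF lin_d] dd lin_zero[OF lin_mod_hom[OF \<psi>(1) mX T]] \<psi>(2)
        by (intro mod_hom_eqI[of _ R "X n" T]) (auto simp: precomp_apply)
    qed
  qed
qed

text \<open>A retraction of \<open>X\<^sup>* \<close> onto the syzygy of \<open>T\<^sub>S\<close> is precomposition with an endomorphism \<open>p\<close> of
  \<open>X k\<close>, since \<open>X k\<close> is a summand of a power of \<open>T\<close>.  This \<open>p\<close> induces a section of \<open>X k \<rightarrow> K k\<close>,
  because \<open>T\<close> cogenerates the modules involved.\<close>

lemma cosyzygy_retract:
  assumes g: "lin (op_ring S) (L k) (syzygy L dL k) g" and gid: "\<And>\<phi>. \<phi> \<in> carrier (syzygy L dL k) \<Longrightarrow> g \<phi> = \<phi>"
  shows "retr R T (K k)"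
proof -
  interpret X: left_module R "X k" by (rule mX)
  interpret X': left_module R "X (Suc k)" by (rule mX)
  obtain n a b where a: "\<And>i. i < n \<Longrightarrow> lin R (X k) T (a i)" and b: "\<And>i. i < n \<Longrightarrow> lin R T (X k) (b i)"
    and sum: "\<And>x. x \<in> carrier (X k) \<Longrightarrow> (\<Oplus>\<^bsub>X k\<^esub>i\<in>{..<n::nat}. b i (a i x)) = x"
    using addT[of k] unfolding retr_def by metis
  obtain n' a' b' where a': "\<And>i. i < n' \<Longrightarrow> lin R (X (Suc k)) T (a' i)" and b': "\<And>i. i < n' \<Longrightarrow> lin R T (X (Suc k)) (b' i)"
    and sum': "\<And>x. x \<in> carrier (X (Suc k)) \<Longrightarrow> (\<Oplus>\<^bsub>X (Suc k)\<^esub>i\<in>{..<n'::nat}. b' i (a' i x)) = x"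
    using addT[of "Suc k"] unfolding retr_def by metis
  let ?a = "\<lambda>i. restrict (a i) (carrier (X k))"
  have am: "?a i \<in> mod_hom R (X k) T" if "i < n" for i by (rule restrict_mod_hom[OF a[OF that]])
  have gcl: "\<exists>\<psi>\<in>mod_hom R (X (Suc k)) T. g \<phi> = dL k \<psi>" if "\<phi> \<in> mod_hom R (X k) T" for \<phi>
    using lin_closed[OF g, of \<phi>] that by auto
  have gm: "g \<phi> \<in> mod_hom R (X k) T" if "\<phi> \<in> mod_hom R (X k) T" for \<phi>
    using gcl[OF that] precomp_mod_hom[OF lin_d] by auto
  have gl: "lin (op_ring S) (L k) (L k) g"
    by (rule lin_comp[OF g lin_from_img[OF lin_precomp[OF lin_d]]])
  \<comment> \<open>The endomorphism with g \<phi> = \<phi> p. Expanding \<phi> as the sum of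
    (\<phi> b i) a i, with coefficients \<phi> b i in S, the S-linearity of g leaves only the
    functionals g (a i) to be known.\<close>
  define p where "p x = (\<Oplus>\<^bsub>X k\<^esub>i\<in>{..<n}. b i (g (?a i) x))" for x
  have gal: "lin R (X k) T (g (?a i))" if "i < n" for i by (rule lin_mod_hom[OF gm[OF am[OF that]] mX T])
  have p: "lin R (X k) (X k) p"
    unfolding p_def using mX by (intro lin_finsum_map lin_comp[OF gal b]) auto
  have gp: "g \<phi> x = \<phi> (p x)" if \<phi>: "\<phi> \<in> mod_hom R (X k) T" and x: "x \<in> carrier (X k)" for \<phi> x
  proof -
    have \<phi>l: "lin R (X k) T \<phi>" by (rule lin_mod_hom[OF \<phi> mX T])
    let ?s = "\<lambda>i. \<lambda>t\<in>carrier T. \<phi> (b i t)"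
    have s: "?s i \<in> mod_hom R T T" if "i < n" for i by (rule restrict_mod_hom[OF lin_comp[OF b[OF that] \<phi>l]])
    have "\<phi> = (\<Oplus>\<^bsub>L k\<^esub>i\<in>{..<n}. ?s i \<odot>\<^bsub>L k\<^esub> ?a i)"
    proof -
      interpret D: left_module "op_ring S" "L k" by (rule left_module_dual[OF mX])
      have "?s i \<odot>\<^bsub>L k\<^esub> ?a i = precomp (X k) (a i) (precomp T (b i) \<phi>)" if "i < n" for i
        using lin_closed[OF a[OF that]] by (auto simp: precomp_def compose_def intro!: restrict_ext)
      moreover have "precomp (X k) (a i) (precomp T (b i) \<phi>) \<in> carrier (L k)" if "i < n" for i
        using precomp_mod_hom[OF a[OF that] precomp_mod_hom[OF b[OF that] \<phi>]] by simp
      ultimately have "(\<Oplus>\<^bsub>L k\<^esub>i\<in>{..<n}. ?s i \<odot>\<^bsub>L k\<^esub> ?a i) = (\<Oplus>\<^bsub>L k\<^esub>i\<in>{..<n}. precomp (X k) (a i) (precomp T (b i) \<phi>))"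
        by (intro D.M.finsum_cong') auto
      then show ?thesis using dual_retract_sum[OF mX a b sum \<phi>] by simp
    qed
    then have "g \<phi> = g (\<Oplus>\<^bsub>L k\<^esub>i\<in>{..<n}. ?s i \<odot>\<^bsub>L k\<^esub> ?a i)" by simp
    also have "\<dots> = (\<Oplus>\<^bsub>L k\<^esub>i\<in>{..<n}. g (?s i \<odot>\<^bsub>L k\<^esub> ?a i))"
    proof (rule lin_finsum[OF gl])
      interpret D: left_module "op_ring S" "L k" by (rule left_module_dual[OF mX])
      show "(\<lambda>i. ?s i \<odot>\<^bsub>L k\<^esub> ?a i) \<in> {..<n} \<rightarrow> carrier (L k)"
        using D.smult_closed[OF _ _, of "?s i" "?a i" for i] s am by simp
    qed simp
    finally have "g \<phi> x = (\<Oplus>\<^bsub>L k\<^esub>i\<in>{..<n}. g (?s i \<odot>\<^bsub>L k\<^esub> ?a i)) x" by (rule fun_cong)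
    also have "\<dots> = (\<Oplus>\<^bsub>T\<^esub>i\<in>{..<n}. g (?s i \<odot>\<^bsub>L k\<^esub> ?a i) x)"
    proof (rule finsum_dual_apply[OF mX x])
      interpret D: left_module "op_ring S" "L k" by (rule left_module_dual[OF mX])
      show "g (?s i \<odot>\<^bsub>L k\<^esub> ?a i) \<in> mod_hom R (X k) T" if "i \<in> {..<n}" for i
        using gm D.smult_closed[of "?s i" "?a i"] s am that by simp
    qed simp
    also have "\<dots> = (\<Oplus>\<^bsub>T\<^esub>i\<in>{..<n}. \<phi> (b i (g (?a i) x)))"
    proof (rule T.M.finsum_cong')
      show "g (?s i \<odot>\<^bsub>L k\<^esub> ?a i) x = \<phi> (b i (g (?a i) x))" if "i \<in> {..<n}" for i
      proof -
        have "g (?s i \<odot>\<^bsub>L k\<^esub> ?a i) = ?s i \<odot>\<^bsub>L k\<^esub> g (?a i)"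
          using that s am by (intro lin_smult[OF gl]) auto
        then show ?thesis using x lin_closed[OF gal, of i x] that by (simp add: compose_def)
      qed
      show "(\<lambda>i. \<phi> (b i (g (?a i) x))) \<in> {..<n} \<rightarrow> carrier T"
        using lin_closed[OF \<phi>l lin_closed[OF b lin_closed[OF gal x]]] by auto
    qed simp
    also have "\<dots> = \<phi> (p x)"
      unfolding p_def using lin_closed[OF b lin_closed[OF gal x]] by (intro lin_finsum[symmetric, OF \<phi>l]) auto
    finally show ?thesis .
  qed
  \<comment> \<open>Values of g have the form \<psi> d k, so they vanish on the kernel of
    \<open>d k\<close>; hence p factors through \<open>K k\<close>.\<close>
  have "p x = \<zero>\<^bsub>X k\<^esub>" if x: "x \<in> carrier (X k)" "d k x = \<zero>\<^bsub>K k\<^esub>" for x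
  proof -
    have "b i (g (?a i) x) = \<zero>\<^bsub>X k\<^esub>" if i: "i < n" for i
    proof -
      obtain \<psi> where "\<psi> \<in> mod_hom R (X (Suc k)) T" "g (?a i) = dL k \<psi>" using gcl[OF am[OF i]] by blast
      then have "g (?a i) x = \<zero>\<^bsub>T\<^esub>" using x lin_zero[OF lin_mod_hom[OF _ mX T]] by (simp add: precomp_apply)
      then show ?thesis using lin_zero[OF b[OF i]] by simp
    qed
    then have "p x = (\<Oplus>\<^bsub>X k\<^esub>i\<in>{..<n}. \<zero>\<^bsub>X k\<^esub>)" unfolding p_def by (intro X.M.finsum_cong') auto
    then show ?thesis by simp
  qed
  then obtain \<sigma> where \<sigma>: "lin R (K k) (X k) \<sigma>" "\<And>x. x \<in> carrier (X k) \<Longrightarrow> \<sigma> (d k x) = p x"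
    by (rule lin_factor[OF lin_to_img[OF lin_d] _ p, rotated]) auto
  \<comment> \<open>The functionals a' i d k lie in the image of the dual differential and are fixed
    by g, so a' i d k p = a' i d k. The a' i separate the points of X (k + 1).\<close>
  have dp: "d k (p x) = d k x" if x: "x \<in> carrier (X k)" for x
  proof -
    have px: "p x \<in> carrier (X k)" by (rule lin_closed[OF p x])
    have "a' i (d k (p x)) = a' i (d k x)" if i: "i < n'" for i
    proof -
      let ?\<psi> = "restrict (a' i) (carrier (X (Suc k)))"
      have \<psi>: "?\<psi> \<in> mod_hom R (X (Suc k)) T" by (rule restrict_mod_hom[OF a'[OF i]])
      then have "g (dL k ?\<psi>) = dL k ?\<psi>" by (intro gid) simp
      then show ?thesis
        using gp[OF precomp_mod_hom[OF lin_d \<psi>] x] x px lin_closed[OF lin_d] by (simp add: precomp_apply)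
    qed
    then have "(\<Oplus>\<^bsub>X (Suc k)\<^esub>i\<in>{..<n'}. b' i (a' i (d k (p x)))) = (\<Oplus>\<^bsub>X (Suc k)\<^esub>i\<in>{..<n'}. b' i (a' i (d k x)))"
      using lin_closed[OF b' lin_closed[OF a' lin_closed[OF lin_d x]]] by (intro X'.M.finsum_cong') auto
    then show ?thesis using sum' lin_closed[OF lin_d] x px by simp
  qed
  show ?thesis
    by (rule retr_trans_retract[OF addT \<sigma>(1) lin_to_img[OF lin_d]]) (use \<sigma>(2) dp in auto)
qed

end

section \<open>The pairing at \<open>X = R\<close> and \<open>X = T\<close>\<close>

context pairing begin

text \<open>The map T \<otimes> U -> N induced by \<mu>. It becomes the class map for N = T
  \<otimes> M and the counit for U = Hom(T,N).\<close>

definition total :: "('t \<times> 'u \<Rightarrow>\<^sub>0 int) \<Rightarrow> 'n" where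
  "total y = frag_ev N (\<lambda>p. \<mu> (fst p) (snd p)) y"

lemma \<mu>_pair_closed: "p \<in> carrier TS \<times> carrier U \<Longrightarrow> \<mu> (fst p) (snd p) \<in> carrier N"
  by (auto intro: \<mu>_closed)

text \<open>Identifying the dual of R with T and Hom(R,N) with N turns \<theta> at R into
  \<open>total\<close>.\<close>

lemma \<theta>_R0:
  assumes x: "x \<in> frags (dual R0) U" and r: "r \<in> carrier R"
  shows "\<theta> x r = r \<odot>\<^bsub>N\<^esub> total (tmap (\<lambda>\<phi>. \<phi> \<one>\<^bsub>R\<^esub>) x)"
proof -
  have "total (tmap (\<lambda>\<phi>. \<phi> \<one>\<^bsub>R\<^esub>) x) = frag_ev N (\<lambda>(\<phi>, u). \<mu> (fst (\<phi> \<one>\<^bsub>R\<^esub>, u)) (snd (\<phi> \<one>\<^bsub>R\<^esub>, u))) x"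
    unfolding total_def
    by (rule frag_ev_bimap[where f = "\<lambda>\<phi>. \<phi> \<one>\<^bsub>R\<^esub>" and k = "\<lambda>m. m" and B = TS and M' = U,
        OF N.M.abelian_group_axioms \<mu>_pair_closed _ _ x]) (use lin_closed[OF lin_at_one] in auto)
  then have "total (tmap (\<lambda>\<phi>. \<phi> \<one>\<^bsub>R\<^esub>) x) = \<theta> x \<one>\<^bsub>R\<^esub>" by (simp add: \<theta>_def case_prod_unfold)
  then show ?thesis using lin_smult[OF \<theta>_lin[OF left_module_R0 x], of r "\<one>\<^bsub>R\<^esub>"] r by simp
qed

lemma total_closed: "y \<in> frags TS U \<Longrightarrow> total y \<in> carrier N"
  unfolding total_def by (rule frag_ev_closed[OF N.M.abelian_group_axioms \<mu>_pair_closed])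

lemma total_zero: "total 0 = \<zero>\<^bsub>N\<^esub>"
  unfolding total_def by (rule frag_ev_zero[OF N.M.abelian_group_axioms])

lemma total_of: "t \<in> carrier T \<Longrightarrow> u \<in> carrier U \<Longrightarrow> total (frag_of (t, u)) = \<mu> t u"
  unfolding total_def
  by (subst frag_ev_of[where A = TS and M = U, OF N.M.abelian_group_axioms \<mu>_pair_closed]) auto

lemma total_diff: "x \<in> frags TS U \<Longrightarrow> y \<in> frags TS U \<Longrightarrow> total (x - y) = total x \<ominus>\<^bsub>N\<^esub> total y"
  unfolding total_def
  by (rule frag_ev_diff[where A = TS and M = U, OF N.M.abelian_group_axioms \<mu>_pair_closed])

lemma total_add:
  assumes x: "x \<in> frags TS U" and y: "y \<in> frags TS U"
  shows "total (x + y) = total x \<oplus>\<^bsub>N\<^esub> total y"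
proof -
  have s: "x + y \<in> frags TS U" using x y by (rule diff_closedD(4)[OF diff_closed_frags])
  have "total x = total (x + y) \<ominus>\<^bsub>N\<^esub> total y" using total_diff[OF s y] by simp
  then show ?thesis using total_closed[OF x] total_closed[OF y] total_closed[OF s] by (metis N.M.minus_eq_iff)
qed

lemma tmap_at_one_from_one: "y \<in> frags TS U \<Longrightarrow> tmap (\<lambda>\<phi>. \<phi> \<one>\<^bsub>R\<^esub>) (tmap from_one y) = y"
  unfolding bimap_bimap by (rule bimap_ident) (auto simp: at_one_from_one)

lemma tmap_from_one_at_one: "x \<in> frags (dual R0) U \<Longrightarrow> tmap from_one (tmap (\<lambda>\<phi>. \<phi> \<one>\<^bsub>R\<^esub>) x) = x"
  unfolding bimap_bimap by (rule bimap_ident) (auto simp: from_one_at_one)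

lemma \<theta>_iso_R0I:
  assumes inj: "\<And>y. y \<in> frags TS U \<Longrightarrow> total y = \<zero>\<^bsub>N\<^esub> \<Longrightarrow> y \<in> null TS"
    and surj: "\<And>n. n \<in> carrier N \<Longrightarrow> \<exists>y\<in>frags TS U. total y = n"
  shows "\<theta>_iso R0"
proof -
  have "x \<in> null (dual R0)" if x: "x \<in> frags (dual R0) U" and z: "\<forall>t\<in>carrier R0. \<theta> x t = \<zero>\<^bsub>N\<^esub>" for x
  proof -
    let ?y = "tmap (\<lambda>\<phi>. \<phi> \<one>\<^bsub>R\<^esub>) x"
    have y: "?y \<in> frags TS U" by (rule tmap_frags[OF U lin_at_one x])
    have "total ?y = \<zero>\<^bsub>N\<^esub>" using z \<theta>_R0[OF x, of "\<one>\<^bsub>R\<^esub>"] total_closed[OF y] by simp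
    then have "tmap from_one ?y \<in> null (dual R0)" by (intro tmap_null[OF U lin_from_one] inj[OF y])
    then show ?thesis by (simp add: tmap_from_one_at_one[OF x])
  qed
  moreover have "\<exists>x\<in>frags (dual R0) U. \<forall>t\<in>carrier R0. \<theta> x t = f t" if f: "lin R R0 N f" for f
  proof -
    obtain y where y: "y \<in> frags TS U" "total y = f \<one>\<^bsub>R\<^esub>"
      using surj lin_closed[OF f, of "\<one>\<^bsub>R\<^esub>"] by auto
    have x: "tmap from_one y \<in> frags (dual R0) U" by (rule tmap_frags[OF U lin_from_one y(1)])
    have "\<theta> (tmap from_one y) r = f r" if "r \<in> carrier R" for r
      using \<theta>_R0[OF x that] lin_smult[OF f that, of "\<one>\<^bsub>R\<^esub>"] that by (simp add: tmap_at_one_from_one y)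
    with x show ?thesis by auto
  qed
  ultimately show ?thesis using left_module_R0 by (simp add: \<theta>_iso_def \<theta>_inj_def \<theta>_surj_def)
qed

lemma \<theta>_iso_R0D:
  assumes iso: "\<theta>_iso R0"
  shows "y \<in> frags TS U \<Longrightarrow> total y = \<zero>\<^bsub>N\<^esub> \<Longrightarrow> y \<in> null TS"
    and "n \<in> carrier N \<Longrightarrow> \<exists>y\<in>frags TS U. total y = n"
proof -
  assume y: "y \<in> frags TS U" "total y = \<zero>\<^bsub>N\<^esub>"
  have x: "tmap from_one y \<in> frags (dual R0) U" by (rule tmap_frags[OF U lin_from_one y(1)])
  have "tmap from_one y \<in> null (dual R0)"
    by (rule \<theta>_isoD(2)[OF iso x]) (use \<theta>_R0[OF x] y in \<open>auto simp: tmap_at_one_from_one N.smult_r_zero\<close>)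
  from tmap_null[OF U lin_at_one this] show "y \<in> null TS" by (simp add: tmap_at_one_from_one y)
next
  assume n: "n \<in> carrier N"
  have "lin R R0 N (\<lambda>r. r \<odot>\<^bsub>N\<^esub> n)"
    using n by (intro linI left_module_R0 N) (auto simp: N.smult_l_distr N.smult_assoc1)
  then obtain x where x: "x \<in> frags (dual R0) U" "\<forall>r\<in>carrier R0. \<theta> x r = r \<odot>\<^bsub>N\<^esub> n"
    using \<theta>_isoD(3)[OF iso] by blast
  let ?y = "tmap (\<lambda>\<phi>. \<phi> \<one>\<^bsub>R\<^esub>) x"
  have y: "?y \<in> frags TS U" by (rule tmap_frags[OF U lin_at_one x(1)])
  have "total ?y = n" using \<theta>_R0[OF x(1), of "\<one>\<^bsub>R\<^esub>"] x(2) total_closed[OF y] n by simp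
  with y show "\<exists>y\<in>frags TS U. total y = n" by blast
qed

text \<open>\<open>T\<^sup>* \<otimes>\<^sub>S U = S \<otimes>\<^sub>S U = U\<close>\<close>

lemma dual_T_reduce:
  assumes x: "x \<in> frags (dual T) U"
  shows "\<exists>u\<in>carrier U. x - frag_of (id_hom T, u) \<in> null (dual T)"
  using x
proof (induction x rule: frags_induct)
  have id: "id_hom T \<in> carrier (dual T)" using id_hom_mod_hom[OF T] by simp
  note K = diff_closedD[OF diff_closed_tensor_null[OF left_module_dual[OF T] U]]
  case zero
  have "- frag_of (id_hom T, \<zero>\<^bsub>U\<^esub>) \<in> null (dual T)"
    using tensor_null_add_right[OF id U.M.zero_closed U.M.zero_closed] by simp
  then show ?case using U.M.zero_closed by (intro bexI[of _ "\<zero>\<^bsub>U\<^esub>"]) simp_all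
next
  case (one s u)
  have "frag_of (s, u) - frag_of (id_hom T, s \<odot>\<^bsub>U\<^esub> u) \<in> null (dual T)"
    using tensor_null_smult[of s S "id_hom T" "dual T" u U] one id_hom_mod_hom[OF T] by (simp add: smult_id_hom)
  then show ?case using U.smult_closed[of s u] one by (intro bexI[of _ "s \<odot>\<^bsub>U\<^esub> u"]) auto
next
  case (diff x y)
  have id: "id_hom T \<in> carrier (dual T)" using id_hom_mod_hom[OF T] by simp
  note K = diff_closedD[OF diff_closed_tensor_null[OF left_module_dual[OF T] U]]
  obtain u v where u: "u \<in> carrier U" "x - frag_of (id_hom T, u) \<in> null (dual T)"
    and v: "v \<in> carrier U" "y - frag_of (id_hom T, v) \<in> null (dual T)" using diff by blast
  have "(u \<ominus>\<^bsub>U\<^esub> v) \<oplus>\<^bsub>U\<^esub> v = u" using U.M.minus_eq_iff[of u v "u \<ominus>\<^bsub>U\<^esub> v"] u v by simp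
  then have w: "frag_of (id_hom T, u) - frag_of (id_hom T, u \<ominus>\<^bsub>U\<^esub> v) - frag_of (id_hom T, v) \<in> null (dual T)"
    using tensor_null_add_right[OF id, of "u \<ominus>\<^bsub>U\<^esub> v" U v S] u v by simp
  have "x - y - frag_of (id_hom T, u \<ominus>\<^bsub>U\<^esub> v) = (x - frag_of (id_hom T, u)) - (y - frag_of (id_hom T, v)) +
      (frag_of (id_hom T, u) - frag_of (id_hom T, u \<ominus>\<^bsub>U\<^esub> v) - frag_of (id_hom T, v))" by simp
  moreover have "\<dots> \<in> null (dual T)" by (intro K(4) K(2) u v w)
  ultimately show ?case using u v by (intro bexI[of _ "u \<ominus>\<^bsub>U\<^esub> v"]) auto
qed

lemma \<theta>_id_hom: "t \<in> carrier T \<Longrightarrow> u \<in> carrier U \<Longrightarrow> \<theta> (frag_of (id_hom T, u)) t = \<mu> t u"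
  using \<theta>_of[of t T "id_hom T" u] id_hom_mod_hom[OF T] by (simp add: id_hom_def)

text \<open>Identifying dual T \<otimes> U with U turns \<theta> at T into the map that sends u to
  \<mu>(-,u).\<close>

lemma \<theta>_iso_TD:
  assumes iso: "\<theta>_iso T"
  shows "u \<in> carrier U \<Longrightarrow> (\<And>t. t \<in> carrier T \<Longrightarrow> \<mu> t u = \<zero>\<^bsub>N\<^esub>) \<Longrightarrow> u = \<zero>\<^bsub>U\<^esub>"
    and "lin R T N f \<Longrightarrow> \<exists>u\<in>carrier U. \<forall>t\<in>carrier T. \<mu> t u = f t"
proof -
  have id: "id_hom T \<in> carrier (dual T)" using id_hom_mod_hom[OF T] by simp
  show "u = \<zero>\<^bsub>U\<^esub>" if u: "u \<in> carrier U" and z: "\<And>t. t \<in> carrier T \<Longrightarrow> \<mu> t u = \<zero>\<^bsub>N\<^esub>"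
  proof -
    have "frag_of (id_hom T, u) \<in> null (dual T)"
      by (rule \<theta>_isoD(2)[OF iso]) (use u id z in \<open>auto simp: \<theta>_id_hom\<close>)
    \<comment> \<open>The action map from S \<otimes> U to U respects the relations and sends the
      pair (id, u) to u.\<close>
    then have "frag_ev U (\<lambda>p. fst p \<odot>\<^bsub>U\<^esub> snd p) (frag_of (id_hom T, u)) = \<zero>\<^bsub>U\<^esub>"
    proof (rule frag_ev_null[OF _ left_module_dual[OF T] U U.M.abelian_group_axioms])
      show "fst p \<odot>\<^bsub>U\<^esub> snd p \<in> carrier U" if "p \<in> carrier (dual T) \<times> carrier U" for p
        using that U.smult_closed by auto
      show "fst (\<phi> \<oplus>\<^bsub>dual T\<^esub> \<psi>, m) \<odot>\<^bsub>U\<^esub> snd (\<phi> \<oplus>\<^bsub>dual T\<^esub> \<psi>, m) = fst (\<phi>, m) \<odot>\<^bsub>U\<^esub> snd (\<phi>, m) \<oplus>\<^bsub>U\<^esub> fst (\<psi>, m) \<odot>\<^bsub>U\<^esub> snd (\<psi>, m)"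
        if "\<phi> \<in> carrier (dual T)" "\<psi> \<in> carrier (dual T)" "m \<in> carrier U" for \<phi> \<psi> m
        using that U.smult_l_distr[of \<phi> \<psi> m] by simp
      show "fst (\<phi>, m \<oplus>\<^bsub>U\<^esub> n) \<odot>\<^bsub>U\<^esub> snd (\<phi>, m \<oplus>\<^bsub>U\<^esub> n) = fst (\<phi>, m) \<odot>\<^bsub>U\<^esub> snd (\<phi>, m) \<oplus>\<^bsub>U\<^esub> fst (\<phi>, n) \<odot>\<^bsub>U\<^esub> snd (\<phi>, n)"
        if "\<phi> \<in> carrier (dual T)" "m \<in> carrier U" "n \<in> carrier U" for \<phi> m n
        using that U.smult_r_distr[of \<phi> m n] by simp
      show "fst (s \<odot>\<^bsub>dual T\<^esub> \<phi>, m) \<odot>\<^bsub>U\<^esub> snd (s \<odot>\<^bsub>dual T\<^esub> \<phi>, m) = fst (\<phi>, s \<odot>\<^bsub>U\<^esub> m) \<odot>\<^bsub>U\<^esub> snd (\<phi>, s \<odot>\<^bsub>U\<^esub> m)"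
        if "s \<in> carrier S" "\<phi> \<in> carrier (dual T)" "m \<in> carrier U" for s \<phi> m
        using that U.smult_assoc1[of \<phi> s m] by simp
    qed
    moreover have "frag_ev U (\<lambda>p. fst p \<odot>\<^bsub>U\<^esub> snd p) (frag_of (id_hom T, u)) = id_hom T \<odot>\<^bsub>U\<^esub> u"
      by (subst frag_ev_of[where A = "dual T" and M = U, OF U.M.abelian_group_axioms])
         (use id u U.smult_closed in auto)
    ultimately show ?thesis using U.smult_one[OF u] by simp
  qed
  show "\<exists>u\<in>carrier U. \<forall>t\<in>carrier T. \<mu> t u = f t" if f: "lin R T N f"
  proof -
    obtain x where x: "x \<in> frags (dual T) U" "\<forall>t\<in>carrier T. \<theta> x t = f t" using \<theta>_isoD(3)[OF iso f] by blast
    obtain u where u: "u \<in> carrier U" "x - frag_of (id_hom T, u) \<in> null (dual T)" using dual_T_reduce[OF x(1)] by blast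
    have "\<mu> t u = f t" if t: "t \<in> carrier T" for t
      using \<theta>_cong_null[OF T x(1) _ u(2) t] \<theta>_id_hom[OF t u(1)] x(2) t id u(1) by simp
    with u show ?thesis by blast
  qed
qed

lemma \<theta>_iso_TI:
  assumes inj: "\<And>u. u \<in> carrier U \<Longrightarrow> (\<And>t. t \<in> carrier T \<Longrightarrow> \<mu> t u = \<zero>\<^bsub>N\<^esub>) \<Longrightarrow> u = \<zero>\<^bsub>U\<^esub>"
    and surj: "\<And>f. lin R T N f \<Longrightarrow> \<exists>u\<in>carrier U. \<forall>t\<in>carrier T. \<mu> t u = f t"
  shows "\<theta>_iso T"
proof -
  have id: "id_hom T \<in> carrier (dual T)" using id_hom_mod_hom[OF T] by simp
  note K = diff_closedD[OF diff_closed_tensor_null[OF left_module_dual[OF T] U]]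
  have "x \<in> null (dual T)" if x: "x \<in> frags (dual T) U" and z: "\<forall>t\<in>carrier T. \<theta> x t = \<zero>\<^bsub>N\<^esub>" for x
  proof -
    obtain u where u: "u \<in> carrier U" "x - frag_of (id_hom T, u) \<in> null (dual T)" using dual_T_reduce[OF x] by blast
    have "\<mu> t u = \<zero>\<^bsub>N\<^esub>" if t: "t \<in> carrier T" for t
      using \<theta>_cong_null[OF T x _ u(2) t] \<theta>_id_hom[OF t u(1)] z t id u(1) by simp
    then have "u = \<zero>\<^bsub>U\<^esub>" by (rule inj[OF u(1)])
    then have "frag_of (id_hom T, u) \<in> null (dual T)"
      using K(3)[OF tensor_null_add_right[OF id U.M.zero_closed U.M.zero_closed]] by simp
    from K(4)[OF u(2) this] show ?thesis by simp
  qed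
  moreover have "\<exists>x\<in>frags (dual T) U. \<forall>t\<in>carrier T. \<theta> x t = f t" if f: "lin R T N f" for f
  proof -
    obtain u where "u \<in> carrier U" "\<forall>t\<in>carrier T. \<mu> t u = f t" using surj[OF f] by blast
    then show ?thesis using id by (intro bexI[of _ "frag_of (id_hom T, u)"]) (auto simp: \<theta>_id_hom)
  qed
  ultimately show ?thesis using T by (simp add: \<theta>_iso_def \<theta>_inj_def \<theta>_surj_def)
qed

end

section \<open>Unit and counit\<close>

context End_module begin

lemma lin_scalar: "r \<in> carrier R \<Longrightarrow> lin (op_ring S) TS TS (\<lambda>t. r \<odot>\<^bsub>T\<^esub> t)"
  by (intro linI left_module_TS) (auto simp: T.smult_r_distr mod_homD(4))

lemma lin_id_hom: "left_module Q M \<Longrightarrow> lin Q M M (id_hom M)"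
  by (rule lin_cong[OF lin_id]) (simp_all add: id_hom_def)

section \<open>The R-module T \<otimes> M and the unit\<close>

context
  fixes M :: "('t \<Rightarrow> 't, 'm) module"
  assumes M: "left_module S M"
begin

abbreviation "tc \<equiv> tensor_class S TS M"
abbreviation "TM \<equiv> tensor_obj R T M"

lemmas tc_eq_iff = tensor_class_eq_iff[OF left_module_TS M]

lemma carrier_TM: "carrier TM = tc ` frags TS M"
  using carrier_tensor_group[OF left_module_TS M] by (simp add: tensor_obj_def Let_def)

lemma tc_closed: "x \<in> frags TS M \<Longrightarrow> tc x \<in> carrier TM"
  by (simp add: carrier_TM)

lemma zero_TM: "\<zero>\<^bsub>TM\<^esub> = tc 0"
  using tensor_group_one[OF left_module_TS M] by (simp add: tensor_obj_def Let_def)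

lemma tc_eq_zero_iff: "tc x = \<zero>\<^bsub>TM\<^esub> \<longleftrightarrow> x \<in> tensor_null S TS M"
  by (simp add: zero_TM tc_eq_iff)

lemma add_TM: "x \<in> frags TS M \<Longrightarrow> y \<in> frags TS M \<Longrightarrow> tc x \<oplus>\<^bsub>TM\<^esub> tc y = tc (x + y)"
  using tensor_class_mult[OF left_module_TS M] by (simp add: tensor_obj_def Let_def)

lemma smult_TM:
  assumes r: "r \<in> carrier R" and x: "x \<in> frags TS M"
  shows "r \<odot>\<^bsub>TM\<^esub> tc x = tc (tmap (\<lambda>t. r \<odot>\<^bsub>T\<^esub> t) x)"
proof -
  have "r \<odot>\<^bsub>TM\<^esub> tc x = tc (bimap (\<lambda>t. r \<odot>\<^bsub>T\<^esub> t) (id_hom M) x)"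
    using tensor_map_class[OF lin_scalar[OF r] lin_id_hom[OF M] x] by (simp add: tensor_obj_def Let_def)
  also have "bimap (\<lambda>t. r \<odot>\<^bsub>T\<^esub> t) (id_hom M) x = tmap (\<lambda>t. r \<odot>\<^bsub>T\<^esub> t) x"
    by (rule bimap_cong[OF x]) (auto simp: id_hom_def)
  finally show ?thesis .
qed

text \<open>Distributivity over sums in R is where relations enter; associativity, the unit law and
  additivity come from identities between representatives.\<close>

lemma left_module_TM: "left_module R TM"
proof -
  have "abelian_group TM"
    by (rule abelian_group_of_comm_group[OF comm_group_tensor_group[OF left_module_TS M]])
       (simp_all add: tensor_obj_def Let_def)
  then interpret abelian_group TM .
  note fr = tmap_frags[OF M lin_scalar]
  have F: "x + y \<in> frags TS M" if "x \<in> frags TS M" "y \<in> frags TS M" for x y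
    using that by (rule diff_closedD(4)[OF diff_closed_frags])
  show ?thesis
  proof unfold_locales
    fix a c assume a: "a \<in> carrier R" and "c \<in> carrier TM"
    then obtain x where x: "x \<in> frags TS M" "c = tc x" by (auto simp: carrier_TM)
    show "a \<odot>\<^bsub>TM\<^esub> c \<in> carrier TM" using a x fr by (simp add: smult_TM tc_closed)
    show "(a \<oplus>\<^bsub>R\<^esub> b) \<odot>\<^bsub>TM\<^esub> c = a \<odot>\<^bsub>TM\<^esub> c \<oplus>\<^bsub>TM\<^esub> b \<odot>\<^bsub>TM\<^esub> c" if b: "b \<in> carrier R" for b
    proof -
      have "tmap (\<lambda>t. (a \<oplus>\<^bsub>R\<^esub> b) \<odot>\<^bsub>T\<^esub> t) x = tmap (\<lambda>t. a \<odot>\<^bsub>T\<^esub> t \<oplus>\<^bsub>TS\<^esub> b \<odot>\<^bsub>T\<^esub> t) x"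
        using x(1) by (rule bimap_cong) (use a b in \<open>auto simp: T.smult_l_distr\<close>)
      then show ?thesis using a b x fr tmap_add[OF M lin_scalar[OF a] lin_scalar[OF b] x(1)]
        by (simp add: smult_TM add_TM tc_eq_iff)
    qed
    show "(a \<otimes>\<^bsub>R\<^esub> b) \<odot>\<^bsub>TM\<^esub> c = a \<odot>\<^bsub>TM\<^esub> (b \<odot>\<^bsub>TM\<^esub> c)" if b: "b \<in> carrier R" for b
    proof -
      have "tmap (\<lambda>t. (a \<otimes>\<^bsub>R\<^esub> b) \<odot>\<^bsub>T\<^esub> t) x = tmap (\<lambda>t. a \<odot>\<^bsub>T\<^esub> t) (tmap (\<lambda>t. b \<odot>\<^bsub>T\<^esub> t) x)"
        unfolding bimap_bimap using x(1) by (rule bimap_cong) (use a b in \<open>auto simp: T.smult_assoc1\<close>)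
      then show ?thesis using a b x fr by (simp add: smult_TM)
    qed
    show "a \<odot>\<^bsub>TM\<^esub> (c \<oplus>\<^bsub>TM\<^esub> c') = a \<odot>\<^bsub>TM\<^esub> c \<oplus>\<^bsub>TM\<^esub> a \<odot>\<^bsub>TM\<^esub> c'" if c': "c' \<in> carrier TM" for c'
    proof -
      obtain y where "y \<in> frags TS M" "c' = tc y" using c' by (auto simp: carrier_TM)
      then show ?thesis using a x fr F by (simp add: smult_TM add_TM)
    qed
  next
    fix c assume "c \<in> carrier TM"
    then obtain x where x: "x \<in> frags TS M" "c = tc x" by (auto simp: carrier_TM)
    have "tmap (\<lambda>t. \<one>\<^bsub>R\<^esub> \<odot>\<^bsub>T\<^esub> t) x = x" using x(1) by (rule bimap_ident) auto
    then show "\<one>\<^bsub>R\<^esub> \<odot>\<^bsub>TM\<^esub> c = c" using x by (simp add: smult_TM)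
  qed
qed

lemma pairing_tensor: "pairing R T M TM (tensor_elem S TS M)"
proof (intro pairing.intro pairing_axioms.intro End_module_axioms M left_module_TM)
  show "tensor_elem S TS M t u \<in> carrier TM" if "t \<in> carrier T" "u \<in> carrier M" for t u
    using that by (simp add: tensor_elem_def tc_closed)
  show "tensor_elem S TS M (t \<oplus>\<^bsub>T\<^esub> t') u = tensor_elem S TS M t u \<oplus>\<^bsub>TM\<^esub> tensor_elem S TS M t' u"
    if "t \<in> carrier T" "t' \<in> carrier T" "u \<in> carrier M" for t t' u
    using that tensor_null_add_left[of t TS t' u M S] by (simp add: tensor_elem_def add_TM tc_eq_iff diff_diff_eq)
  show "tensor_elem S TS M t (u \<oplus>\<^bsub>M\<^esub> u') = tensor_elem S TS M t u \<oplus>\<^bsub>TM\<^esub> tensor_elem S TS M t u'"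
    if "t \<in> carrier T" "u \<in> carrier M" "u' \<in> carrier M" for t u u'
    using that tensor_null_add_right[of t TS u M u' S] by (simp add: tensor_elem_def add_TM tc_eq_iff diff_diff_eq)
  show "tensor_elem S TS M (r \<odot>\<^bsub>T\<^esub> t) u = r \<odot>\<^bsub>TM\<^esub> tensor_elem S TS M t u"
    if "r \<in> carrier R" "t \<in> carrier T" "u \<in> carrier M" for r t u
    using that by (simp add: tensor_elem_def smult_TM)
  show "tensor_elem S TS M (s t) u = tensor_elem S TS M t (s \<odot>\<^bsub>M\<^esub> u)"
    if "s \<in> mod_hom R T T" "t \<in> carrier T" "u \<in> carrier M" for s t u
    using that tensor_null_smult[of s S t TS u M] by (simp add: tensor_elem_def tc_eq_iff)
qed

text \<open>Hence \<open>total\<close> is bijective on classes by construction, so \<theta> is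
  bijective at R, the base of the first descent.\<close>

lemma total_TM:
  assumes "x \<in> frags TS M"
  shows "pairing.total TM (tensor_elem S TS M) x = tc x"
proof -
  interpret pairing R T M TM "tensor_elem S TS M" by (rule pairing_tensor)
  show ?thesis using assms
  proof (induction x rule: frags_induct)
    case zero then show ?case by (simp add: total_zero zero_TM)
  next
    case (one a m) then show ?case by (subst total_of) (simp_all add: tensor_elem_def)
  next
    case (diff x y)
    have d: "x - y \<in> frags TS M" using diff(1,2) by (rule diff_closedD(2)[OF diff_closed_frags])
    have "total (x - y) = tc x \<ominus>\<^bsub>TM\<^esub> tc y" using diff by (simp add: total_diff)
    also have "\<dots> = tc (x - y)" using diff d by (simp add: N.M.minus_eq_iff tc_closed add_TM)
    finally show ?case .
  qed
qed

lemma adj_unit_apply: "m \<in> carrier M \<Longrightarrow> t \<in> carrier T \<Longrightarrow> adj_unit R T M m t = tensor_elem S TS M t m"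
  by (simp add: adj_unit_def)

lemma adj_unit_hom: "adj_unit R T M \<in> mod_hom S M (hom_obj R T TM)"
proof -
  interpret pairing R T M TM "tensor_elem S TS M" by (rule pairing_tensor)
  show ?thesis
  proof (rule mod_homI)
    have "lin R T TM (\<lambda>t. tensor_elem S TS M t m)" if "m \<in> carrier M" for m
      using that by (intro linI T N) (simp_all add: \<mu>_closed \<mu>_add_left \<mu>_smult)
    then show "adj_unit R T M \<in> carrier M \<rightarrow>\<^sub>E carrier (hom_obj R T TM)"
      using restrict_mod_hom[of R T TM "\<lambda>t. tensor_elem S TS M t m" for m] by (auto simp: adj_unit_def)
    show "adj_unit R T M (m \<oplus>\<^bsub>M\<^esub> n) = adj_unit R T M m \<oplus>\<^bsub>hom_obj R T TM\<^esub> adj_unit R T M n"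
      if "m \<in> carrier M" "n \<in> carrier M" for m n
      using that by (simp add: adj_unit_def \<mu>_add_right cong: restrict_cong)
    show "adj_unit R T M (s \<odot>\<^bsub>M\<^esub> m) = s \<odot>\<^bsub>hom_obj R T TM\<^esub> adj_unit R T M m"
      if "s \<in> carrier S" "m \<in> carrier M" for s m
      using that U.smult_closed[of s m] mod_homD(2)[of s R T T]
      by (simp add: adj_unit_def compose_def \<mu>_balanced cong: restrict_cong)
  qed
qed

end

text \<open>For evaluation as the pairing, \<theta> at T is the identity of Hom(T,N) after
  identifying dual T \<otimes> U with U; this is the base of the second descent.\<close>

lemma pairing_hom:
  assumes N: "left_module R N"
  shows "pairing R T (hom_obj R T N) N (\<lambda>t f. f t)"
proof (intro pairing.intro pairing_axioms.intro End_module_axioms left_module_hom_obj N)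
  fix t u assume t: "t \<in> carrier T" and "u \<in> carrier (hom_obj R T N)"
  then have u: "u \<in> mod_hom R T N" by simp
  show "u t \<in> carrier N" by (rule mod_homD(2)[OF u t])
  show "u (t \<oplus>\<^bsub>T\<^esub> t') = u t \<oplus>\<^bsub>N\<^esub> u t'" if "t' \<in> carrier T" for t' by (rule mod_homD(3)[OF u t that])
  show "(u \<oplus>\<^bsub>hom_obj R T N\<^esub> u') t = u t \<oplus>\<^bsub>N\<^esub> u' t" for u' using t by simp
  show "u (r \<odot>\<^bsub>T\<^esub> t) = r \<odot>\<^bsub>N\<^esub> u t" if "r \<in> carrier R" for r by (rule mod_homD(4)[OF u that t])
  show "u (s t) = (s \<odot>\<^bsub>hom_obj R T N\<^esub> u) t" for s using t by (simp add: compose_def)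
qed

section \<open>The S-module Hom(T,N) and the counit\<close>

context
  fixes N :: "('r, 'n) module"
  assumes N: "left_module R N"
begin

abbreviation "H \<equiv> hom_obj R T N"

lemma left_module_H: "left_module S H"
  by (rule left_module_hom_obj[OF N])

interpretation pairing R T H N "\<lambda>t f. f t" by (rule pairing_hom[OF N])

text \<open>As for \<open>tensor_map\<close>, the argument of \<open>the_elem\<close> is a
  singleton: evaluation is biadditive and balanced, so \<open>total\<close> is constant on
  cosets.\<close>

lemma adj_counit_class:
  assumes x: "x \<in> frags TS H"
  shows "adj_counit R T N (tensor_class S TS H x) = total x"
proof -
  have eq: "total y = total x" if "y \<in> tensor_class S TS H x" for y
  proof -
    have yx: "y - x \<in> null TS" using that by (simp add: mem_tensor_class[OF left_module_TS left_module_H])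
    then have "y - x \<in> frags TS H" using tensor_null_frags[OF left_module_TS left_module_H] by blast
    then have y: "y \<in> frags TS H" using diff_closedD(4)[OF diff_closed_frags, of "y - x" TS H x] x by simp
    have "total (y - x) = \<zero>\<^bsub>N\<^esub>"
      unfolding total_def
      by (rule frag_ev_null[OF yx left_module_TS left_module_H N.M.abelian_group_axioms \<mu>_pair_closed])
         (auto simp: mod_homD(3) compose_def)
    then have "total y \<ominus>\<^bsub>N\<^esub> total x = \<zero>\<^bsub>N\<^esub>"
      using total_diff[OF y x] by simp
    then show ?thesis using total_closed[OF x] total_closed[OF y] by (simp add: N.M.minus_eq_zero_iff)
  qed
  have mem: "x \<in> tensor_class S TS H x"
    using diff_closedD(1)[OF diff_closed_tensor_null[OF left_module_TS left_module_H]]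
    by (simp add: mem_tensor_class[OF left_module_TS left_module_H])
  have im: "total ` tensor_class S TS H x = {total x}"
    using image_cong[OF refl eq] image_constant[OF mem] by (rule trans)
  have "adj_counit R T N (tensor_class S TS H x) = the_elem (total ` tensor_class S TS H x)"
    unfolding adj_counit_def total_def frag_ev_def
    by (rule restrict_apply'[OF tc_closed[OF left_module_H x]])
  then show ?thesis by (simp only: im the_elem_eq)
qed

lemma total_smult:
  assumes r: "r \<in> carrier R" and x: "x \<in> frags TS H"
  shows "total (tmap (\<lambda>t. r \<odot>\<^bsub>T\<^esub> t) x) = r \<odot>\<^bsub>N\<^esub> total x"
  using x
proof (induction x rule: frags_induct)
  case zero then show ?case using r by (simp add: total_zero N.smult_r_zero)
next
  case (one t f)
  then show ?case using r mod_homD(4)[of f R T N r t] by (simp add: total_of)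
next
  case (diff x y)
  then show ?case
    using r tmap_frags[OF left_module_H lin_scalar[OF r] diff(1)] tmap_frags[OF left_module_H lin_scalar[OF r] diff(2)]
      total_closed[OF diff(1)] total_closed[OF diff(2)]
    by (simp add: total_diff a_minus_def N.smult_r_distr N.smult_neg)
qed

lemma adj_counit_hom: "adj_counit R T N \<in> mod_hom R (tensor_obj R T H) N"
proof (rule mod_homI)
  note cT = carrier_TM[OF left_module_H] and F = diff_closedD(4)[OF diff_closed_frags[of TS H]]
  note fr = tmap_frags[OF left_module_H lin_scalar]
  show "adj_counit R T N \<in> carrier (tensor_obj R T H) \<rightarrow>\<^sub>E carrier N"
  proof (rule PiE_I)
    show "adj_counit R T N c \<in> carrier N" if "c \<in> carrier (tensor_obj R T H)" for c
      using that total_closed by (auto simp: cT adj_counit_class)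
  qed (simp add: adj_counit_def)
  fix c assume "c \<in> carrier (tensor_obj R T H)"
  then obtain x where x: "x \<in> frags TS H" "c = tensor_class S TS H x" by (auto simp: cT)
  show "adj_counit R T N (c \<oplus>\<^bsub>tensor_obj R T H\<^esub> c') = adj_counit R T N c \<oplus>\<^bsub>N\<^esub> adj_counit R T N c'"
    if "c' \<in> carrier (tensor_obj R T H)" for c'
  proof -
    obtain y where "y \<in> frags TS H" "c' = tensor_class S TS H y" using \<open>c' \<in> _\<close> by (auto simp: cT)
    with x F show ?thesis by (simp add: add_TM[OF left_module_H] adj_counit_class total_add)
  qed
  show "adj_counit R T N (r \<odot>\<^bsub>tensor_obj R T H\<^esub> c) = r \<odot>\<^bsub>N\<^esub> adj_counit R T N c" if "r \<in> carrier R" for r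
    using x fr[OF that] that by (simp add: smult_TM[OF left_module_H] adj_counit_class total_smult)
qed

end

end

section \<open>The two classes\<close>

lemma exact_at_hom_group:
  "exact_at (hom_group R A T) (precomp B f) (hom_group R B T) (precomp C g) (hom_group R C T) \<longleftrightarrow>
    precomp B f ` mod_hom R A T = {\<phi> \<in> mod_hom R B T. precomp C g \<phi> = (\<lambda>x\<in>carrier C. \<zero>\<^bsub>T\<^esub>)}"
  by (simp add: exact_at_def kernel_def hom_group_def)

text \<open>Summands of powers of T become retracts by \<open>retr_add_class\<close>, and exactness
  of the Hom groups is read on single functionals.\<close>

lemma add_coresolution_exists:
  fixes R :: "'r ring" and T :: "('r, 't) module"
  assumes T: "left_module R T" and c: "has_add_coresolution R T"
  obtains X :: "nat \<Rightarrow> ('r, nat \<Rightarrow> 't) module" and d u where "add_coresolution R T X d u"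
proof -
  interpret End_module R T by (rule End_module.intro[OF T])
  obtain X :: "nat \<Rightarrow> ('r, nat \<Rightarrow> 't) module" and d u where
    X: "\<And>n. X n \<in> add_class R T" and u: "u \<in> mod_hom R R0 (X 0)" and d: "\<And>n. d n \<in> mod_hom R (X n) (X (Suc n))"
    and inj: "inj_on u (carrier R0)"
    and e0: "exact_at (add_monoid R0) u (add_monoid (X 0)) (d 0) (add_monoid (X 1))"
    and eS: "\<And>n. exact_at (add_monoid (X n)) (d n) (add_monoid (X (Suc n))) (d (Suc n)) (add_monoid (X (Suc (Suc n))))"
    and h: "precomp R0 u ` carrier (hom_group R (X 0) T) = carrier (hom_group R R0 T)"
    and h0: "exact_at (hom_group R (X 1) T) (precomp (X 0) (d 0)) (hom_group R (X 0) T) (precomp R0 u) (hom_group R R0 T)"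
    and hS: "\<And>n. exact_at (hom_group R (X (Suc (Suc n))) T) (precomp (X (Suc n)) (d (Suc n)))
                 (hom_group R (X (Suc n)) T) (precomp (X n) (d n)) (hom_group R (X n) T)"
    using c unfolding has_add_coresolution_def Let_def by blast
  have mX: "left_module R (X n)" for n using X by (simp add: add_class_def)
  have ext: "precomp B f \<psi> = \<phi> \<Longrightarrow> x \<in> carrier B \<Longrightarrow> \<psi> (f x) = \<phi> x" for B :: "('r, 'b) module" and f \<psi> \<phi> x
    by (auto simp: precomp_apply)
  have "add_coresolution R T X d u"
  proof unfold_locales
    show "retr R T (X k)" for k by (rule retr_add_class[OF T X])
    show "lin R R0 (X 0) u" by (rule lin_mod_hom[OF u left_module_R0 mX])
    show "lin R (X k) (X (Suc k)) (d k)" for k by (rule lin_mod_hom[OF d mX mX])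
    show "inj_on u (carrier R)" using inj by simp
    show "d 0 x = \<zero>\<^bsub>X (Suc 0)\<^esub> \<longleftrightarrow> x \<in> u ` carrier R" if "x \<in> carrier (X 0)" for x
      using e0[unfolded exact_at_add_monoid] that by auto
    show "d (Suc k) x = \<zero>\<^bsub>X (Suc (Suc k))\<^esub> \<longleftrightarrow> x \<in> d k ` carrier (X k)" if "x \<in> carrier (X (Suc k))" for k x
      using eS[of k, unfolded exact_at_add_monoid] that by auto
    show "\<exists>\<psi>\<in>mod_hom R (X 0) T. \<forall>r\<in>carrier R. \<psi> (u r) = \<phi> r" if \<phi>: "\<phi> \<in> mod_hom R R0 T" for \<phi>
    proof -
      have "\<phi> \<in> precomp R0 u ` mod_hom R (X 0) T" using h \<phi> by (simp add: hom_group_def)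
      then obtain \<psi> where "\<psi> \<in> mod_hom R (X 0) T" "precomp R0 u \<psi> = \<phi>" by blast
      then show ?thesis using ext[of R0 u \<psi> \<phi>] by auto
    qed
    show "\<exists>\<psi>\<in>mod_hom R (X (Suc 0)) T. \<forall>x\<in>carrier (X 0). \<psi> (d 0 x) = \<phi> x"
      if \<phi>: "\<phi> \<in> mod_hom R (X 0) T" and z: "\<And>r. r \<in> carrier R \<Longrightarrow> \<phi> (u r) = \<zero>\<^bsub>T\<^esub>" for \<phi>
    proof -
      have "precomp R0 u \<phi> = (\<lambda>x\<in>carrier R0. \<zero>\<^bsub>T\<^esub>)" using z by (auto simp: precomp_def compose_def intro!: restrict_ext)
      then have "\<phi> \<in> precomp (X 0) (d 0) ` mod_hom R (X 1) T" using h0 \<phi> by (simp add: exact_at_hom_group)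
      then show ?thesis using ext by (auto simp: precomp_apply)
    qed
    show "\<exists>\<psi>\<in>mod_hom R (X (Suc (Suc k))) T. \<forall>x\<in>carrier (X (Suc k)). \<psi> (d (Suc k) x) = \<phi> x"
      if \<phi>: "\<phi> \<in> mod_hom R (X (Suc k)) T" and z: "\<And>x. x \<in> carrier (X k) \<Longrightarrow> \<phi> (d k x) = \<zero>\<^bsub>T\<^esub>" for k \<phi>
    proof -
      have "precomp (X k) (d k) \<phi> = (\<lambda>x\<in>carrier (X k). \<zero>\<^bsub>T\<^esub>)" using z by (auto simp: precomp_def compose_def intro!: restrict_ext)
      then have "\<phi> \<in> precomp (X (Suc k)) (d (Suc k)) ` mod_hom R (X (Suc (Suc k))) T"
        using hS[of k] \<phi> by (simp add: exact_at_hom_group)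
      then show ?thesis by (auto simp: precomp_apply)
    qed
  qed
  then show ?thesis by (rule that)
qed

section \<open>Wakamatsu tilting modules of finite projective dimension on both sides\<close>

locale wakamatsu_finite = End_module R T for R :: "'r ring" and T :: "('r, 't) module" +
  assumes W: "wakamatsu_tilting R T"
    and pd_left: "finite_projective_dimension R T"
    and pd_right: "finite_projective_dimension (op_ring (End_ring R T)) (right_End_module T)"
begin

text \<open>Up to the identification of dual T \<otimes> M with M the unit is \<theta> at T.
  Bijectivity there and the vanishing of Ext(T, T \<otimes> M) are the two outcomes of
  \<open>descend_resolution\<close>; comparison moves the vanishing of Ext between the canonical
  resolution and the finitely generated one.\<close>

lemma tensor_KT:
  assumes M: "M \<in> KT S TS"
  shows "\<forall>i>0. trivial_group (Ext R T (tensor_obj R T M) i)"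
    and "adj_unit R T M \<in> mod_iso S M (hom_obj R T (tensor_obj R T M))"
proof -
  have mM: "left_module S M" using M by (simp add: KT_def)
  interpret pairing R T M "tensor_obj R T M" "tensor_elem S TS M" by (rule pairing_tensor[OF mM])
  obtain P :: "nat \<Rightarrow> ('r, nat \<Rightarrow> 'r) module" and d e where pr: "projective_resolution R T P d e" and fg: "\<And>n. fin_gen R (P n)"
    using W unfolding wakamatsu_tilting_def has_fg_projective_resolution_def by blast
  have P: "resol R T P d e" by (rule resolI[OF pr T])
  have addR: "retr R R0 (P k)" for k by (rule retr_fg_projective[OF resolD(1)[OF P] fg])
  obtain P' :: "nat \<Rightarrow> ('r, ('r, 't) cell \<Rightarrow> 'r) module" and d' e' n where
    pr': "projective_resolution R T P' d' e'" and fin: "\<And>k. k > n \<Longrightarrow> carrier (P' k) = {\<zero>\<^bsub>P' k\<^esub>}"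
    using pd_left unfolding finite_projective_dimension_def by blast
  have P': "resol R T P' d' e'" by (rule resolI[OF pr' T])
  \<comment> \<open>The number n bounds the length of \<open>P'\<close>, while the syzygies are
    those of \<open>P\<close>, whose terms are finitely generated but may be nonzero in all degrees.
    Comparing both resolutions splits the syzygy off \<open>P k\<close>.\<close>
  have syz: "retr R R0 (syzygy P d k)" if kn: "k \<ge> n" for k
  proof -
    obtain g where "lin R (P k) (syzygy P d k) g" "\<And>x. x \<in> carrier (syzygy P d k) \<Longrightarrow> g x = x"
      by (rule syzygy_retract[OF P P' fin kn]) auto
    then show ?thesis by (intro retr_trans_retract[OF addR lin_from_img[OF resolD(2)[OF P]]])
  qed
  have "hom_acyclic R (free_res R T) (free_res_d R T) T"
    using W trivial_Ext_iff[OF T T] by (simp add: wakamatsu_tilting_def)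
  then have acT: "hom_acyclic R P d T" by (rule hom_acyclic_retr[OF retr_refl[OF T] P resol_free_res[OF T] T])
  have "tor_acyclic TS"
    using M trivial_Tor_iff[OF left_module_TS mM] by (simp add: tor_acyclic_def KT_def left_module_TS)
  then have tor: "tor_acyclic (dual R0)" by (rule tor_acyclic_retr[OF retr_dual_R0])
  have total: "total y = tensor_class S TS M y" if "y \<in> frags TS M" for y
    by (rule total_TM[OF mM that])
  have iso: "\<theta>_iso R0"
    by (rule \<theta>_iso_R0I) (auto simp: total tc_eq_zero_iff[OF mM] carrier_TM[OF mM])
  note res = descend_resolution[OF P addR syz acT tor iso]
  have "hom_acyclic R (free_res R T) (free_res_d R T) (tensor_obj R T M)"
    by (rule hom_acyclic_retr[OF retr_refl[OF T] resol_free_res[OF T] P N res(2)])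
  then show "\<forall>i>0. trivial_group (Ext R T (tensor_obj R T M) i)" by (simp add: trivial_Ext_iff[OF T N])
  note u = adj_unit_hom[OF mM]
  have ul: "lin S M (hom_obj R T (tensor_obj R T M)) (adj_unit R T M)"
    by (rule lin_mod_hom[OF u mM left_module_hom_obj[OF N]])
  have "inj_on (adj_unit R T M) (carrier M)"
  proof (rule inj_onI)
    fix x y assume xy: "x \<in> carrier M" "y \<in> carrier M" "adj_unit R T M x = adj_unit R T M y"
    interpret HH: left_module S "hom_obj R T (tensor_obj R T M)" by (rule left_module_hom_obj[OF N])
    have "adj_unit R T M (x \<ominus>\<^bsub>M\<^esub> y) = \<zero>\<^bsub>hom_obj R T (tensor_obj R T M)\<^esub>"
      using xy lin_closed[OF ul] HH.M.minus_eq_zero_iff by (metis lin_minus[OF ul])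
    then have "tensor_elem S TS M t (x \<ominus>\<^bsub>M\<^esub> y) = \<zero>\<^bsub>tensor_obj R T M\<^esub>" if "t \<in> carrier T" for t
      using xy that fun_cong[of "adj_unit R T M (x \<ominus>\<^bsub>M\<^esub> y)" _ t] adj_unit_apply[OF mM _ that, of "x \<ominus>\<^bsub>M\<^esub> y"] by simp
    then have "x \<ominus>\<^bsub>M\<^esub> y = \<zero>\<^bsub>M\<^esub>" using xy by (intro \<theta>_iso_TD(1)[OF res(1)]) auto
    then show "x = y" using xy by (simp add: U.M.minus_eq_zero_iff)
  qed
  moreover have "adj_unit R T M ` carrier M = mod_hom R T (tensor_obj R T M)"
  proof
    show "mod_hom R T (tensor_obj R T M) \<subseteq> adj_unit R T M ` carrier M"
    proof
      fix f assume f: "f \<in> mod_hom R T (tensor_obj R T M)"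
      obtain m where m: "m \<in> carrier M" "\<forall>t\<in>carrier T. tensor_elem S TS M t m = f t"
        using \<theta>_iso_TD(2)[OF res(1) lin_mod_hom[OF f T N]] by blast
      have "f = adj_unit R T M m"
        by (rule mod_hom_eqI[OF f]) (use mod_homD(2)[OF u m(1)] m in \<open>simp_all add: adj_unit_apply[OF mM]\<close>)
      with m show "f \<in> adj_unit R T M ` carrier M" by blast
    qed
  qed (use mod_homD(2)[OF u] in auto)
  ultimately show "adj_unit R T M \<in> mod_iso S M (hom_obj R T (tensor_obj R T M))"
    using u by (simp add: mod_iso_def bij_betw_def)
qed

text \<open>With the dual of R identified with T, \<theta> at R is the counit. Its bijectivity and
  the vanishing of Tor(T, Hom(T,N)) are the two outcomes of
  \<open>descend_coresolution\<close>.\<close>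

lemma hom_KE:
  assumes NK: "N \<in> KE R T"
  shows "\<forall>i>0. trivial_group (Tor S TS (hom_obj R T N) i)"
    and "adj_counit R T N \<in> mod_iso R (tensor_obj R T (hom_obj R T N)) N"
proof -
  have mN: "left_module R N" using NK by (simp add: KE_def)
  let ?H = "hom_obj R T N"
  have mH: "left_module S ?H" by (rule left_module_hom_obj[OF mN])
  interpret pairing R T ?H N "\<lambda>t f. f t" by (rule pairing_hom[OF mN])
  obtain X :: "nat \<Rightarrow> ('r, nat \<Rightarrow> 't) module" and d u where "add_coresolution R T X d u"
    using add_coresolution_exists[OF T] W unfolding wakamatsu_tilting_def by blast
  then interpret C: add_coresolution R T X d u .
  obtain P' :: "nat \<Rightarrow> ('t \<Rightarrow> 't, ('t \<Rightarrow> 't, 't) cell \<Rightarrow> 't \<Rightarrow> 't) module" and d' e' n where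
    pr': "projective_resolution (op_ring S) TS P' d' e'" and fin: "\<And>k. k > n \<Longrightarrow> carrier (P' k) = {\<zero>\<^bsub>P' k\<^esub>}"
    using pd_right unfolding finite_projective_dimension_def by blast
  have P': "resol (op_ring S) TS P' d' e'" by (rule resolI[OF pr' left_module_TS])
  have cosyz: "retr R T (img (X k) (X (Suc k)) (d k))" if kn: "k \<ge> n" for k
  proof -
    obtain g where "lin (op_ring S) (C.L k) (syzygy C.L C.dL k) g" "\<And>x. x \<in> carrier (syzygy C.L C.dL k) \<Longrightarrow> g x = x"
      by (rule syzygy_retract[OF C.resol_dual P' fin kn]) auto
    then show ?thesis by (rule C.cosyzygy_retract)
  qed
  have "\<forall>i>0. trivial_group (Ext R T N i)" using NK by (simp add: KE_def)
  then have acT: "ext_acyclic T" unfolding trivial_Ext_iff[OF T mN] using T by (simp add: ext_acyclic_def)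
  have iso: "\<theta>_iso T"
  proof (rule \<theta>_iso_TI)
    fix f assume f: "f \<in> carrier ?H" and z: "\<And>t. t \<in> carrier T \<Longrightarrow> f t = \<zero>\<^bsub>N\<^esub>"
    have "\<zero>\<^bsub>?H\<^esub> \<in> mod_hom R T N" using U.M.zero_closed by simp
    with f z show "f = \<zero>\<^bsub>?H\<^esub>" by (intro mod_hom_eqI[of _ R T N]) auto
  next
    fix f assume "lin R T N f"
    from restrict_mod_hom[OF this] show "\<exists>g\<in>carrier ?H. \<forall>t\<in>carrier T. g t = f t"
      by (intro bexI[of _ "restrict f (carrier T)"]) auto
  qed
  note res = descend_coresolution[OF C.ses_0 C.ses_Suc C.ext_0 C.ext_Suc C.addT cosyz acT iso]
  \<comment> \<open>The dualized coresolution is one projective resolution of T over S; comparison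
    with the canonical one reaches Tor as defined.\<close>
  have "tensor_acyclic S ?H (free_res (op_ring S) TS) (free_res_d (op_ring S) TS)"
    by (rule tensor_acyclic_retr[OF mH retr_refl[OF left_module_TS] resol_free_res[OF left_module_TS] C.resol_dual res(2)])
  then show "\<forall>i>0. trivial_group (Tor S TS ?H i)" by (simp add: trivial_Tor_iff[OF left_module_TS mH])
  note R0D = \<theta>_iso_R0D[OF res(1)]
  note c = adj_counit_hom[OF mN] and cc = adj_counit_class[OF mN]
  let ?TH = "tensor_obj R T ?H"
  have mTH: "left_module R ?TH" by (rule left_module_TM[OF mH])
  interpret TH: left_module R ?TH by (rule mTH)
  have cl: "lin R ?TH N (adj_counit R T N)" by (rule lin_mod_hom[OF c mTH mN])
  have z: "x = \<zero>\<^bsub>?TH\<^esub>" if x: "x \<in> carrier ?TH" and x0: "adj_counit R T N x = \<zero>\<^bsub>N\<^esub>" for x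
  proof -
    obtain y where y: "y \<in> frags TS ?H" "x = tensor_class S TS ?H y" using x by (auto simp: carrier_TM[OF mH])
    then have "y \<in> null TS" using x0 cc by (intro R0D(1)) auto
    then show ?thesis using y by (simp add: tc_eq_zero_iff[OF mH])
  qed
  have "inj_on (adj_counit R T N) (carrier ?TH)"
  proof (rule inj_onI)
    fix x y assume xy: "x \<in> carrier ?TH" "y \<in> carrier ?TH" "adj_counit R T N x = adj_counit R T N y"
    have "adj_counit R T N (x \<ominus>\<^bsub>?TH\<^esub> y) = \<zero>\<^bsub>N\<^esub>"
      using xy lin_closed[OF cl] by (simp add: lin_minus[OF cl] N.M.minus_eq_zero_iff)
    then have "x \<ominus>\<^bsub>?TH\<^esub> y = \<zero>\<^bsub>?TH\<^esub>" using xy by (intro z) auto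
    then show "x = y" using xy by (simp add: TH.M.minus_eq_zero_iff)
  qed
  moreover have "adj_counit R T N ` carrier ?TH = carrier N"
  proof
    show "carrier N \<subseteq> adj_counit R T N ` carrier ?TH"
    proof
      fix n assume "n \<in> carrier N"
      then obtain y where y: "y \<in> frags TS ?H" "total y = n" using R0D(2) by blast
      then show "n \<in> adj_counit R T N ` carrier ?TH"
        using cc tc_closed[OF mH y(1)] by (intro image_eqI[of _ _ "tensor_class S TS ?H y"]) auto
    qed
  qed (use mod_homD(2)[OF c] in auto)
  ultimately show "adj_counit R T N \<in> mod_iso R ?TH N" using c by (simp add: mod_iso_def bij_betw_def)
qed

end

section \<open>The equivalence\<close>

context End_module begin

context
  fixes X :: "('t \<Rightarrow> 't, 'm) module" and Y :: "('t \<Rightarrow> 't, 'k) module"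
  assumes X: "left_module S X" and Y: "left_module S Y"
begin

lemma tensor_arr_class:
  assumes f: "f \<in> mod_hom S X Y" and x: "x \<in> frags TS X"
  shows "tensor_arr R T X Y f (tensor_class S TS X x) = tensor_class S TS Y (bimap (\<lambda>t. t) f x)"
proof -
  have b: "bimap (id_hom T) f x = bimap (\<lambda>t. t) f x" using x by (rule bimap_cong) (auto simp: id_hom_def)
  have l: "lin (op_ring S) TS TS (id_hom T)"
    by (rule lin_cong[OF lin_id[OF left_module_TS]]) (simp add: id_hom_def)
  show ?thesis
    unfolding tensor_arr_def using tensor_map_class[OF l lin_mod_hom[OF f X Y] x] by (simp only: b)
qed

lemma tensor_arr_hom:
  assumes f: "f \<in> mod_hom S X Y"
  shows "tensor_arr R T X Y f \<in> mod_hom R (tensor_obj R T X) (tensor_obj R T Y)"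
proof (rule mod_homI)
  note cX = carrier_TM[OF X] and fc = mod_homD(2)[OF f]
  have b: "bimap (\<lambda>t. t) f x \<in> frags TS Y" if "x \<in> frags TS X" for x
    using that by (rule bimap_frags) (auto simp: fc)
  show "tensor_arr R T X Y f \<in> carrier (tensor_obj R T X) \<rightarrow>\<^sub>E carrier (tensor_obj R T Y)"
  proof (rule PiE_I)
    show "tensor_arr R T X Y f c \<in> carrier (tensor_obj R T Y)" if "c \<in> carrier (tensor_obj R T X)" for c
      using that b by (auto simp: cX tensor_arr_class[OF f] tc_closed[OF Y])
  qed (simp add: tensor_arr_def tensor_map_def tensor_obj_def Let_def)
  fix c assume "c \<in> carrier (tensor_obj R T X)"
  then obtain x where x: "x \<in> frags TS X" "c = tensor_class S TS X x" by (auto simp: cX)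
  show "tensor_arr R T X Y f (c \<oplus>\<^bsub>tensor_obj R T X\<^esub> c') = tensor_arr R T X Y f c \<oplus>\<^bsub>tensor_obj R T Y\<^esub> tensor_arr R T X Y f c'"
    if c': "c' \<in> carrier (tensor_obj R T X)" for c'
  proof -
    obtain y where y: "y \<in> frags TS X" "c' = tensor_class S TS X y" using c' by (auto simp: cX)
    have "x + y \<in> frags TS X" using x(1) y(1) by (rule diff_closedD(4)[OF diff_closed_frags])
    with x y b show ?thesis by (simp add: add_TM[OF X] add_TM[OF Y] tensor_arr_class[OF f])
  qed
  show "tensor_arr R T X Y f (r \<odot>\<^bsub>tensor_obj R T X\<^esub> c) = r \<odot>\<^bsub>tensor_obj R T Y\<^esub> tensor_arr R T X Y f c"
    if r: "r \<in> carrier R" for r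
    using x b r tmap_frags[OF X lin_scalar[OF r] x(1)]
    by (simp add: smult_TM[OF X] smult_TM[OF Y] tensor_arr_class[OF f] bimap_bimap)
qed

lemma adj_unit_natural:
  assumes f: "f \<in> mod_hom S X Y"
  shows "compose (carrier X) (adj_unit R T Y) f =
    compose (carrier X) (hom_arr R T (tensor_obj R T X) (tensor_obj R T Y) (tensor_arr R T X Y f)) (adj_unit R T X)"
proof -
  have "adj_unit R T Y (f x) = hom_arr R T (tensor_obj R T X) (tensor_obj R T Y) (tensor_arr R T X Y f) (adj_unit R T X x)"
    if x: "x \<in> carrier X" for x
  proof -
    have u: "adj_unit R T X x \<in> mod_hom R T (tensor_obj R T X)" using mod_homD(2)[OF adj_unit_hom[OF X] x] by simp
    have "adj_unit R T Y (f x) = (\<lambda>t\<in>carrier T. tensor_arr R T X Y f (tensor_elem S TS X t x))"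
      using x mod_homD(2)[OF f x] by (auto simp: adj_unit_def tensor_elem_def tensor_arr_class[OF f] intro!: restrict_ext)
    also have "\<dots> = compose (carrier T) (tensor_arr R T X Y f) (adj_unit R T X x)"
      using x by (auto simp: compose_def adj_unit_apply[OF X] intro!: restrict_ext)
    finally show ?thesis using u by (simp add: hom_arr_def)
  qed
  then show ?thesis by (auto simp: compose_def intro!: restrict_ext)
qed

end

lemma tensor_arr_id:
  assumes X: "left_module S X"
  shows "tensor_arr R T X X (id_hom X) = id_hom (tensor_obj R T X)"
proof (rule mod_hom_eqI[OF tensor_arr_hom[OF X X id_hom_mod_hom[OF X]] id_hom_mod_hom[OF left_module_TM[OF X]]])
  fix c assume c: "c \<in> carrier (tensor_obj R T X)"
  then obtain x where x: "x \<in> frags TS X" "c = tensor_class S TS X x" by (auto simp: carrier_TM[OF X])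
  have "bimap (\<lambda>t. t) (id_hom X) x = x" using x(1) by (rule bimap_ident) (auto simp: id_hom_def)
  then show "tensor_arr R T X X (id_hom X) c = id_hom (tensor_obj R T X) c"
    using x c tensor_arr_class[OF X X id_hom_mod_hom[OF X] x(1)] by (simp add: id_hom_def)
qed

lemma tensor_arr_compose:
  assumes X: "left_module S X" and Y: "left_module S Y" and Z: "left_module S Z"
    and f: "f \<in> mod_hom S X Y" and g: "g \<in> mod_hom S Y Z"
  shows "tensor_arr R T X Z (compose (carrier X) g f) =
    compose (carrier (tensor_obj R T X)) (tensor_arr R T Y Z g) (tensor_arr R T X Y f)"
proof -
  note gf = mod_hom_compose[OF f g X]
  show ?thesis
  proof (rule mod_hom_eqI[OF tensor_arr_hom[OF X Z gf]
        mod_hom_compose[OF tensor_arr_hom[OF X Y f] tensor_arr_hom[OF Y Z g] left_module_TM[OF X]]])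
    fix c assume c: "c \<in> carrier (tensor_obj R T X)"
    then obtain x where x: "x \<in> frags TS X" "c = tensor_class S TS X x" by (auto simp: carrier_TM[OF X])
    have fx: "bimap (\<lambda>t. t) f x \<in> frags TS Y" using x(1) by (rule bimap_frags) (auto simp: mod_homD(2)[OF f])
    have "bimap (\<lambda>t. t) (compose (carrier X) g f) x = bimap (\<lambda>t. t) g (bimap (\<lambda>t. t) f x)"
      unfolding bimap_bimap using x(1) by (rule bimap_cong) (auto simp: compose_def)
    then show "tensor_arr R T X Z (compose (carrier X) g f) c =
        compose (carrier (tensor_obj R T X)) (tensor_arr R T Y Z g) (tensor_arr R T X Y f) c"
      using c x tensor_arr_class[OF X Z gf x(1)] tensor_arr_class[OF X Y f x(1)] tensor_arr_class[OF Y Z g fx]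
      by (simp add: compose_def)
  qed
qed

lemma hom_arr_hom:
  assumes X: "left_module R X" and Y: "left_module R Y" and g: "g \<in> mod_hom R X Y"
  shows "hom_arr R T X Y g \<in> mod_hom S (hom_obj R T X) (hom_obj R T Y)"
proof (rule mod_homI)
  interpret HX: left_module S "hom_obj R T X" by (rule left_module_hom_obj[OF X])
  have cl: "compose (carrier T) g f \<in> mod_hom R T Y" if "f \<in> mod_hom R T X" for f
    by (rule mod_hom_compose[OF that g T])
  show "hom_arr R T X Y g \<in> carrier (hom_obj R T X) \<rightarrow>\<^sub>E carrier (hom_obj R T Y)"
    using cl by (auto simp: hom_arr_def)
  fix f assume f: "f \<in> carrier (hom_obj R T X)"
  show "hom_arr R T X Y g (f \<oplus>\<^bsub>hom_obj R T X\<^esub> f') = hom_arr R T X Y g f \<oplus>\<^bsub>hom_obj R T Y\<^esub> hom_arr R T X Y g f'"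
    if f': "f' \<in> carrier (hom_obj R T X)" for f'
    using f f' HX.M.a_closed[OF f f'] mod_homD(2)[of f R T X] mod_homD(2)[of f' R T X]
    by (simp add: hom_arr_def compose_def mod_homD(3)[OF g] cong: restrict_cong)
  show "hom_arr R T X Y g (s \<odot>\<^bsub>hom_obj R T X\<^esub> f) = s \<odot>\<^bsub>hom_obj R T Y\<^esub> hom_arr R T X Y g f"
    if s: "s \<in> carrier S" for s
    using f s HX.smult_closed[OF s f] mod_homD(2)[of s R T T]
    by (simp add: hom_arr_def compose_def cong: restrict_cong)
qed

lemma hom_arr_id:
  assumes X: "left_module R X"
  shows "hom_arr R T X X (id_hom X) = id_hom (hom_obj R T X)"
proof -
  have "compose (carrier T) (id_hom X) f = f" if f: "f \<in> mod_hom R T X" for f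
    by (rule mod_hom_eqI[OF mod_hom_compose[OF f id_hom_mod_hom[OF X] T] f])
       (simp add: compose_def id_hom_def mod_homD(2)[OF f])
  then show ?thesis by (auto simp: hom_arr_def id_hom_def intro!: restrict_ext)
qed

lemma hom_arr_compose:
  assumes f: "f \<in> mod_hom R X Y" and g: "g \<in> mod_hom R Y Z"
  shows "hom_arr R T X Z (compose (carrier X) g f) = compose (carrier (hom_obj R T X)) (hom_arr R T Y Z g) (hom_arr R T X Y f)"
proof -
  have "compose (carrier T) (compose (carrier X) g f) h = hom_arr R T Y Z g (compose (carrier T) f h)"
    if h: "h \<in> mod_hom R T X" for h
    using mod_hom_compose[OF h f T] mod_homD(2)[OF h] by (auto simp: hom_arr_def compose_def intro!: restrict_ext)
  then show ?thesis
    by (intro ext) (simp add: hom_arr_def[of R T X] compose_def[of "mod_hom R T X"] restrict_def)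
qed

lemma bimap_snd_frags:
  assumes "x \<in> frags TS A" "f \<in> mod_hom Q A B"
  shows "bimap (\<lambda>t. t) f x \<in> frags TS B"
  using assms(1) by (rule bimap_frags) (auto simp: mod_homD(2)[OF assms(2)])

text \<open>On classes the counit is \<open>total\<close>, which is additive, so naturality reduces
  to single pairs (t, h).\<close>

lemma adj_counit_natural:
  assumes X: "left_module R X" and Y: "left_module R Y" and f: "f \<in> mod_hom R X Y"
  shows "compose (carrier (tensor_obj R T (hom_obj R T X))) (adj_counit R T Y)
      (tensor_arr R T (hom_obj R T X) (hom_obj R T Y) (hom_arr R T X Y f)) =
    compose (carrier (tensor_obj R T (hom_obj R T X))) f (adj_counit R T X)"
proof -
  note HX = left_module_hom_obj[OF X] and HY = left_module_hom_obj[OF Y]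
  note hf = hom_arr_hom[OF X Y f]
  interpret PX: pairing R T "hom_obj R T X" X "\<lambda>t f. f t" by (rule pairing_hom[OF X])
  interpret PY: pairing R T "hom_obj R T Y" Y "\<lambda>t f. f t" by (rule pairing_hom[OF Y])
  have total: "PY.total (bimap (\<lambda>t. t) (hom_arr R T X Y f) x) = f (PX.total x)"
    if "x \<in> frags TS (hom_obj R T X)" for x
    using that
  proof (induction x rule: frags_induct)
    case zero then show ?case using lin_zero[OF lin_mod_hom[OF f X Y]] by (simp add: PX.total_zero PY.total_zero)
  next
    case (one t h)
    then have "hom_arr R T X Y f h \<in> carrier (hom_obj R T Y)" using mod_homD(2)[OF hf] by blast
    then have "PY.total (frag_of (t, hom_arr R T X Y f h)) = hom_arr R T X Y f h t"
      using one by (intro PY.total_of) auto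
    also have "\<dots> = f (h t)" using one by (simp add: hom_arr_def compose_def)
    finally show ?case using one PX.total_of[of t h] by simp
  next
    case (diff x y)
    then show ?case
      using bimap_snd_frags[OF diff(1) hf] bimap_snd_frags[OF diff(2) hf] PX.total_closed
      by (simp add: PX.total_diff PY.total_diff lin_minus[OF lin_mod_hom[OF f X Y]])
  qed
  have "adj_counit R T Y (tensor_arr R T (hom_obj R T X) (hom_obj R T Y) (hom_arr R T X Y f) c) = f (adj_counit R T X c)"
    if c: "c \<in> carrier (tensor_obj R T (hom_obj R T X))" for c
  proof -
    obtain x where x: "x \<in> frags TS (hom_obj R T X)" "c = tensor_class S TS (hom_obj R T X) x"
      using c by (auto simp: carrier_TM[OF HX])
    then show ?thesis
      using tensor_arr_class[OF HX HY hf x(1)] adj_counit_class[OF Y bimap_snd_frags[OF x(1) hf]]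
        adj_counit_class[OF X x(1)] total[OF x(1)] by simp
  qed
  then show ?thesis by (auto simp: compose_def intro!: restrict_ext)
qed

lemma triangle_tensor:
  assumes X: "left_module S X"
  shows "compose (carrier (tensor_obj R T X)) (adj_counit R T (tensor_obj R T X))
      (tensor_arr R T X (hom_obj R T (tensor_obj R T X)) (adj_unit R T X)) = id_hom (tensor_obj R T X)"
proof -
  let ?TX = "tensor_obj R T X"
  note mTX = left_module_TM[OF X]
  note H = left_module_hom_obj[OF mTX] and u = adj_unit_hom[OF X]
  interpret PX: pairing R T X ?TX "tensor_elem S TS X" by (rule pairing_tensor[OF X])
  interpret PH: pairing R T "hom_obj R T ?TX" ?TX "\<lambda>t f. f t" by (rule pairing_hom[OF mTX])
  have total: "PH.total (bimap (\<lambda>t. t) (adj_unit R T X) x) = PX.total x" if "x \<in> frags TS X" for x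
    using that
  proof (induction x rule: frags_induct)
    case zero then show ?case by (simp add: PX.total_zero PH.total_zero)
  next
    case (one t m)
    then have "PH.total (frag_of (t, adj_unit R T X m)) = adj_unit R T X m t"
      using mod_homD(2)[OF u] by (intro PH.total_of) auto
    then show ?case using one PX.total_of[of t m] by (simp add: adj_unit_apply[OF X])
  next
    case (diff x y)
    then show ?case
      using bimap_snd_frags[OF diff(1) u] bimap_snd_frags[OF diff(2) u]
      by (simp add: PX.total_diff PH.total_diff)
  qed
  have "adj_counit R T ?TX (tensor_arr R T X (hom_obj R T ?TX) (adj_unit R T X) c) = c" if c: "c \<in> carrier ?TX" for c
  proof -
    obtain x where x: "x \<in> frags TS X" "c = tensor_class S TS X x" using c by (auto simp: carrier_TM[OF X])
    show ?thesis
      using tensor_arr_class[OF X H u x(1)] adj_counit_class[OF mTX bimap_snd_frags[OF x(1) u]]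
        total[OF x(1)] total_TM[OF X x(1)] x(2) by simp
  qed
  then show ?thesis by (auto simp: compose_def id_hom_def intro!: restrict_ext)
qed

lemma triangle_hom:
  assumes X: "left_module R X"
  shows "compose (carrier (hom_obj R T X)) (hom_arr R T (tensor_obj R T (hom_obj R T X)) X (adj_counit R T X))
      (adj_unit R T (hom_obj R T X)) = id_hom (hom_obj R T X)"
proof -
  let ?H = "hom_obj R T X"
  note H = left_module_hom_obj[OF X]
  note u = adj_unit_hom[OF H] and c = adj_counit_hom[OF X]
  interpret PX: pairing R T ?H X "\<lambda>t f. f t" by (rule pairing_hom[OF X])
  have "hom_arr R T (tensor_obj R T ?H) X (adj_counit R T X) (adj_unit R T ?H f) = f" if f: "f \<in> mod_hom R T X" for f
  proof -
    have uf: "adj_unit R T ?H f \<in> mod_hom R T (tensor_obj R T ?H)" using mod_homD(2)[OF u, of f] f by simp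
    have "compose (carrier T) (adj_counit R T X) (adj_unit R T ?H f) = f"
    proof (rule mod_hom_eqI[OF mod_hom_compose[OF uf c T] f])
      fix t assume t: "t \<in> carrier T"
      have "adj_counit R T X (tensor_elem S TS ?H t f) = PX.total (frag_of (t, f))"
        unfolding tensor_elem_def using t f by (intro adj_counit_class[OF X]) auto
      also have "\<dots> = f t" using t f by (intro PX.total_of) auto
      finally show "compose (carrier T) (adj_counit R T X) (adj_unit R T ?H f) t = f t"
        using t f by (simp add: compose_def adj_unit_apply[OF H])
    qed
    then show ?thesis using uf by (simp add: hom_arr_def)
  qed
  then show ?thesis by (auto simp: compose_def id_hom_def intro!: restrict_ext)
qed

end

text \<open>The conditions that cut \<open>auslander_class\<close> and \<open>bass_class\<close> out
  of \<open>KT\<close> and \<open>KE\<close> are those which \<open>tensor_KT\<close> and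
  \<open>hom_KE\<close> establish for every object. The same lemmas place the values of the functors
  in the right subcategories and make unit and counit isomorphisms; naturality and the triangle
  identities are formal.\<close>

theorem proposition4p2:
  fixes R :: "'r ring" and T :: "('r, 't) module"
  assumes "wakamatsu_tilting R T"
    and "finite_projective_dimension R T"
    and "finite_projective_dimension (op_ring (End_ring R T)) (right_End_module T)"
  shows "tensor_hom_equivalence TYPE('m) TYPE('n) R T \<and>
    (auslander_class R T :: ('t \<Rightarrow> 't, 'm) module set) = KT (End_ring R T) (right_End_module T) \<and>
    (bass_class R T :: ('r, 'n) module set) = KE R T"
proof -
  have T: "left_module R T" using assms(1) by (simp add: wakamatsu_tilting_def)
  interpret wakamatsu_finite R T
    by (intro wakamatsu_finite.intro wakamatsu_finite_axioms.intro End_module.intro T assms)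
  define C where "C = (KT S TS :: ('t \<Rightarrow> 't, 'm) module set)"
  define D where "D = (KE R T :: ('r, 'n) module set)"
  have mC: "left_module S X" if "X \<in> C" for X using that by (simp add: C_def KT_def)
  have mD: "left_module R X" if "X \<in> D" for X using that by (simp add: D_def KE_def)
  have tC: "tensor_obj R T X \<in> KE R T" if "X \<in> C" for X
    using tensor_KT(1) that left_module_TM[OF mC[OF that]] by (simp add: KE_def C_def)
  have hD: "hom_obj R T X \<in> KT S TS" if "X \<in> D" for X
    using hom_KE(1) that left_module_hom_obj[OF mD[OF that]] by (simp add: KT_def D_def)
  have unit: "adj_unit R T X \<in> mod_iso S X (hom_obj R T (tensor_obj R T X))" if "X \<in> C" for X
    using tensor_KT(2) that by (simp add: C_def)
  have counit: "adj_counit R T X \<in> mod_iso R (tensor_obj R T (hom_obj R T X)) X" if "X \<in> D" for X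
    using hom_KE(2) that by (simp add: D_def)
  have "tensor_hom_equivalence TYPE('m) TYPE('n) R T"
    unfolding tensor_hom_equivalence_def Let_def C_def[symmetric] D_def[symmetric]
  proof (intro conjI)
    show "module_functor S C R (KE R T) (tensor_obj R T) (tensor_arr R T)"
      unfolding module_functor_def
      by (intro conjI ballI tC tensor_arr_hom tensor_arr_id tensor_arr_compose mC)
    show "module_functor R D S (KT S TS) (hom_obj R T) (hom_arr R T)"
      unfolding module_functor_def
      by (intro conjI ballI hD hom_arr_hom hom_arr_id hom_arr_compose mD)
    show "natural_isomorphism S C S (\<lambda>X. X) (\<lambda>X Y f. f) (\<lambda>X. hom_obj R T (tensor_obj R T X))
         (\<lambda>X Y f. hom_arr R T (tensor_obj R T X) (tensor_obj R T Y) (tensor_arr R T X Y f)) (adj_unit R T)"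
      unfolding natural_isomorphism_def by (intro conjI ballI unit adj_unit_natural mC)
    show "natural_isomorphism R D R (\<lambda>X. tensor_obj R T (hom_obj R T X))
         (\<lambda>X Y f. tensor_arr R T (hom_obj R T X) (hom_obj R T Y) (hom_arr R T X Y f)) (\<lambda>X. X) (\<lambda>X Y f. f) (adj_counit R T)"
      unfolding natural_isomorphism_def by (intro conjI ballI counit adj_counit_natural mD)
  qed (intro ballI triangle_tensor triangle_hom mC mD, assumption)+
  moreover have "(auslander_class R T :: ('t \<Rightarrow> 't, 'm) module set) = C"
  proof
    show "(auslander_class R T :: ('t \<Rightarrow> 't, 'm) module set) \<subseteq> C" by (auto simp: auslander_class_def C_def KT_def)
    show "C \<subseteq> auslander_class R T" using tC unit by (auto simp: auslander_class_def C_def KT_def KE_def)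
  qed
  moreover have "(bass_class R T :: ('r, 'n) module set) = D"
  proof
    show "(bass_class R T :: ('r, 'n) module set) \<subseteq> D" by (auto simp: bass_class_def D_def KE_def)
    show "D \<subseteq> bass_class R T" using hD counit by (auto simp: bass_class_def D_def KT_def KE_def)
  qed
  ultimately show ?thesis by (simp add: C_def D_def)
qed

end
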